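(* Let $(X,d_X,\mu)$ be a complete metric measure space, $\Omega\subset X$ a bounded domain, $\mathcal H$ a $\sigma$-finite Borel regular measure on $\partial\Omega$, $Y$ a complete metric space, and $Y_\omega$ an ultra-completion of $Y$. Suppose $\Omega$ is $(p,\theta)$-admissible. If $\{u_k\}\subset N^{1,p}(\Omega,Y)$ is a bounded sequence for some $p>1$, then after possibly passing to a subsequence, the map $\phi(z):=[(u_k(z))]$ belongs to $N^{1,p}(\Omega,Y_\omega)$ and satisfies $E^p(\phi)\le\liminf_{k\to\infty}E^p(u_k)$. Moreover, if $Tu_k$ converges $\mathcal H$-almost everywhere on $\partial\Omega$ to some map $\rho\in L^p(\partial\Omega,Y)$, then $T\phi=\iota\circ\rho$.
   Context: $\Omega$ is $(p,\theta)$-admissible ($1<p<\infty$, $0<\theta<p$) if: $\mu$ is doubling on $\Omega$ ($0<\mu(B(x,2r)\cap\Omega)\le C_d\mu(B(x,r)\cap\Omega)<\infty$ for $x\in\overline\Omega,r>0$); $\mathcal H(B(x,r)\cap\partial\Omega)\le C\mu(B(x,r)\cap\Omega)r^{-\theta}$ for $x\in\partial\Omega,r>0$; $\Omega$ supports a local $p$-Poincaré inequality (there are $C>0,\lambda\ge1$ with $\frac{1}{\mu(B(x,r)\cap\Omega)}\int_{B(x,r)\cap\Omega}|u-u_{B(x,r)\cap\Omega}|\,d\mu\le Cr\big(\frac{1}{\mu(B(x,\lambda r)\cap\Omega)}\int_{B(x,\lambda r)\cap\Omega}g^p\,d\mu\big)^{1/p}$ for all $x\in\Omega,r>0$, $u\in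 L^1_{loc}(\Omega)$, upper gradients $g$ of $u$); and for every $p'\ge p$, $\|w\|_{L^{p'}(\Omega)}\le C(\Omega)\|g_w\|_{L^{p'}(\Omega)}$ for all $w\in N^{1,p'}(\Omega)$ with zero trace. Upper gradient of $u:\Omega\to Z$: Borel $g\ge0$ with $d_Z(u(\gamma(b)),u(\gamma(a)))\le\int_\gamma g\,ds$ for all rectifiable $\gamma$ ($p$-weak: $p$-a.e. curve); $g_u$ minimal $p$-weak upper gradient; $N^{1,p}(\Omega,Z)$: $u\in L^p(\Omega,Z)$ with $g_u\in L^p(\Omega)$; $E^p(u)=\int_\Omega g_u^p\,d\mu$. A sequence $\{u_k\}$ is bounded in $N^{1,p}(\Omega,Y)$ if $\sup_k\int_\Omega d_Y^p(u_k(x),y_0)\,d\mu(x)+E^p(u_k)<\infty$ for some $y_0\in Y$. Trace: $Tu(x)$ with $\lim_{r\to0^+}\frac{1}{\mu(B(x,r)\cap\Omega)}\int_{B(x,r)\cap\Omega}d(u,Tu(x))\,d\mu=0$ for $\mathcal H$-a.e. $x\in\partial\Omega$. Ultra-completion: for a non-principal ultrafilter $\omega$ on $\mathbb N$ (finitely additive $\{0,1\}$-valued probability measure on all subsets of $\mathbb N$ vanishing on finite sets, with associated limit $\lim_\omega$), $Y_\omega$ is the set of bounded sequences $(y_m)$ in $Y$ modulo $\lim_\omega d(y_m,y'_m)=0$, with metric $d_\omega([(y_m)],[(y'_m)])=\lim_\omega d(y_m,y'_m)$; $\iota:Y\to Y_\omega$, $\iota(y)=[(y)]$.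
   Formalization: The sequence (u_k(z)) can be unbounded at some points, so φ(z)=[(u_k(z))] is asserted only for μ-almost every z in Ω, and it is a map φ equal to [(u_k(z))] almost everywhere that belongs to N^{1,p}(Ω,Y_ω). *)

theory Defs
  imports "HOL-Analysis.Analysis"
begin

definition enn_powr :: "ennreal \<Rightarrow> real \<Rightarrow> ennreal" where
  "enn_powr x q = (if x = top then top else ennreal (enn2real x powr q))"

text \<open>A non-principal ultrafilter on the naturals, viewed as a filter:
  a {0,1}-valued finitely additive probability on all subsets of nat vanishing on finite sets.\<close>
definition nonprincipal_ultrafilter :: "nat filter \<Rightarrow> bool" where
  "nonprincipal_ultrafilter F \<longleftrightarrow>
     F \<noteq> bot \<and>
     (\<forall>A. eventually (\<lambda>n. n \<in> A) F \<or> eventually (\<lambda>n. n \<notin> A) F) \<and>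
     (\<forall>A. finite A \<longrightarrow> eventually (\<lambda>n. n \<notin> A) F)"

text \<open>Points of the ultra-completion are represented by bounded sequences; two sequences
  represent the same point iff their ultra-distance is 0.\<close>
definition ultra_carrier :: "(nat \<Rightarrow> 'y::metric_space) set" where
  "ultra_carrier = {y. bounded (range y)}"

definition ultra_dist :: "nat filter \<Rightarrow> (nat \<Rightarrow> 'y::metric_space) \<Rightarrow> (nat \<Rightarrow> 'y) \<Rightarrow> real" where
  "ultra_dist F a b = Lim F (\<lambda>m. dist (a m) (b m))"

definition ultra_embed :: "'y \<Rightarrow> (nat \<Rightarrow> 'y)" where
  "ultra_embed y = (\<lambda>_. y)"

definition curve_length :: "(real \<Rightarrow> 'a::metric_space) \<Rightarrow> real \<Rightarrow> real \<Rightarrow> ereal" where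
  "curve_length \<gamma> a b =
     (SUP ts \<in> {ts. sorted ts \<and> set ts \<subseteq> {a..b}}.
        ereal (\<Sum>i < length ts - 1. dist (\<gamma> (ts ! i)) (\<gamma> (ts ! Suc i))))"

text \<open>Arc-length parametrised (hence rectifiable, compact) curves in \<Omega>, given as a pair
  (\<gamma>, L) with \<gamma> : [0,L] \<rightarrow> \<Omega>. Every rectifiable curve has such a parametrisation, and the
  line integral is defined through it.\<close>
definition arclength_curve :: "'a::metric_space set \<Rightarrow> (real \<Rightarrow> 'a) \<times> real \<Rightarrow> bool" where
  "arclength_curve \<Omega> c \<longleftrightarrow>
     0 \<le> snd c \<and> fst c ` {0..snd c} \<subseteq> \<Omega> \<and> continuous_on {0..snd c} (fst c) \<and>
     (\<forall>s t. 0 \<le> s \<and> s \<le> t \<and> t \<le> snd c \<longrightarrow> curve_length (fst c) s t = ereal (t - s))"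

definition line_integral :: "('a \<Rightarrow> ennreal) \<Rightarrow> (real \<Rightarrow> 'a) \<times> real \<Rightarrow> ennreal" where
  "line_integral g c = (\<integral>\<^sup>+ t \<in> {0..snd c}. g (fst c t) \<partial>lborel)"

definition p_modulus :: "'a::metric_space measure \<Rightarrow> 'a set \<Rightarrow> real \<Rightarrow> ((real \<Rightarrow> 'a) \<times> real) set \<Rightarrow> ennreal" where
  "p_modulus \<mu> \<Omega> p \<Gamma> =
     (INF \<rho> \<in> {\<rho>. \<rho> \<in> borel_measurable borel \<and> (\<forall>c\<in>\<Gamma>. 1 \<le> line_integral \<rho> c)}.
        \<integral>\<^sup>+ x \<in> \<Omega>. enn_powr (\<rho> x) p \<partial>\<mu>)"

definition upper_gradient :: "'a::metric_space set \<Rightarrow> ('z \<Rightarrow> 'z \<Rightarrow> real) \<Rightarrow> ('a \<Rightarrow> 'z) \<Rightarrow> ('a \<Rightarrow> ennreal) \<Rightarrow> bool" where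
  "upper_gradient \<Omega> d u g \<longleftrightarrow>
     g \<in> borel_measurable borel \<and>
     (\<forall>c. arclength_curve \<Omega> c \<longrightarrow>
        ennreal (d (u (fst c (snd c))) (u (fst c 0))) \<le> line_integral g c)"

definition p_weak_upper_gradient :: "'a::metric_space measure \<Rightarrow> 'a set \<Rightarrow> real \<Rightarrow> ('z \<Rightarrow> 'z \<Rightarrow> real) \<Rightarrow> ('a \<Rightarrow> 'z) \<Rightarrow> ('a \<Rightarrow> ennreal) \<Rightarrow> bool" where
  "p_weak_upper_gradient \<mu> \<Omega> p d u g \<longleftrightarrow>
     g \<in> borel_measurable borel \<and>
     p_modulus \<mu> \<Omega> p {c. arclength_curve \<Omega> c \<and>
        \<not> ennreal (d (u (fst c (snd c))) (u (fst c 0))) \<le> line_integral g c} = 0"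

definition minimal_p_weak_upper_gradient :: "'a::metric_space measure \<Rightarrow> 'a set \<Rightarrow> real \<Rightarrow> ('z \<Rightarrow> 'z \<Rightarrow> real) \<Rightarrow> ('a \<Rightarrow> 'z) \<Rightarrow> ('a \<Rightarrow> ennreal) \<Rightarrow> bool" where
  "minimal_p_weak_upper_gradient \<mu> \<Omega> p d u g \<longleftrightarrow>
     p_weak_upper_gradient \<mu> \<Omega> p d u g \<and> (\<integral>\<^sup>+ x \<in> \<Omega>. enn_powr (g x) p \<partial>\<mu>) < top \<and>
     (\<forall>h. p_weak_upper_gradient \<mu> \<Omega> p d u h \<and> (\<integral>\<^sup>+ x \<in> \<Omega>. enn_powr (h x) p \<partial>\<mu>) < top
          \<longrightarrow> (AE x in \<mu>. x \<in> \<Omega> \<longrightarrow> g x \<le> h x))"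

definition p_energy :: "'a::metric_space measure \<Rightarrow> 'a set \<Rightarrow> real \<Rightarrow> ('z \<Rightarrow> 'z \<Rightarrow> real) \<Rightarrow> ('a \<Rightarrow> 'z) \<Rightarrow> ennreal" where
  "p_energy \<mu> \<Omega> p d u =
     (if \<exists>g. minimal_p_weak_upper_gradient \<mu> \<Omega> p d u g
      then \<integral>\<^sup>+ x \<in> \<Omega>. enn_powr ((SOME g. minimal_p_weak_upper_gradient \<mu> \<Omega> p d u g) x) p \<partial>\<mu>
      else top)"

definition Lp_map :: "'a::metric_space measure \<Rightarrow> 'a set \<Rightarrow> real \<Rightarrow> 'z set \<Rightarrow> ('z \<Rightarrow> 'z \<Rightarrow> real) \<Rightarrow> ('a \<Rightarrow> 'z) \<Rightarrow> bool" where
  "Lp_map \<mu> \<Omega> p S d u \<longleftrightarrow>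
     (\<forall>x\<in>\<Omega>. u x \<in> S) \<and>
     (\<forall>z\<in>S. (\<lambda>x. d (u x) z) \<in> borel_measurable (restrict_space \<mu> \<Omega>)) \<and>
     (\<exists>D. countable D \<and> D \<subseteq> S \<and> (AE x in \<mu>. x \<in> \<Omega> \<longrightarrow> (\<forall>e>0. \<exists>z\<in>D. d (u x) z < e))) \<and>
     (\<exists>z\<in>S. (\<integral>\<^sup>+ x \<in> \<Omega>. ennreal (d (u x) z powr p) \<partial>\<mu>) < top)"

definition newtonian :: "'a::metric_space measure \<Rightarrow> 'a set \<Rightarrow> real \<Rightarrow> 'z set \<Rightarrow> ('z \<Rightarrow> 'z \<Rightarrow> real) \<Rightarrow> ('a \<Rightarrow> 'z) \<Rightarrow> bool" where
  "newtonian \<mu> \<Omega> p S d u \<longleftrightarrow>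
     Lp_map \<mu> \<Omega> p S d u \<and> (\<exists>g. minimal_p_weak_upper_gradient \<mu> \<Omega> p d u g)"

definition bounded_newtonian_seq :: "'a::metric_space measure \<Rightarrow> 'a set \<Rightarrow> real \<Rightarrow> (nat \<Rightarrow> 'a \<Rightarrow> 'y::metric_space) \<Rightarrow> bool" where
  "bounded_newtonian_seq \<mu> \<Omega> p u \<longleftrightarrow>
     (\<forall>k. newtonian \<mu> \<Omega> p UNIV dist (u k)) \<and>
     (\<exists>y0 B. \<forall>k. (\<integral>\<^sup>+ x \<in> \<Omega>. ennreal (dist (u k x) y0 powr p) \<partial>\<mu>) + p_energy \<mu> \<Omega> p dist (u k)
                    \<le> ennreal B)"

definition is_trace :: "'a::metric_space measure \<Rightarrow> 'a measure \<Rightarrow> 'a set \<Rightarrow> 'z set \<Rightarrow> ('z \<Rightarrow> 'z \<Rightarrow> real) \<Rightarrow> ('a \<Rightarrow> 'z) \<Rightarrow> ('a \<Rightarrow> 'z) \<Rightarrow> bool" where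
  "is_trace \<mu> H \<Omega> S d u T \<longleftrightarrow>
     (\<forall>x\<in>frontier \<Omega>. T x \<in> S) \<and>
     (AE x in H. ((\<lambda>r. (\<integral>\<^sup>+ y \<in> ball x r \<inter> \<Omega>. ennreal (d (u y) (T x)) \<partial>\<mu>)
                        / emeasure \<mu> (ball x r \<inter> \<Omega>)) \<longlongrightarrow> 0) (at_right 0))"

definition L1_loc :: "'a::metric_space measure \<Rightarrow> 'a set \<Rightarrow> ('a \<Rightarrow> real) \<Rightarrow> bool" where
  "L1_loc \<mu> \<Omega> u \<longleftrightarrow> u \<in> borel_measurable (restrict_space \<mu> \<Omega>) \<and>
     (\<forall>K. compact K \<and> K \<subseteq> \<Omega> \<longrightarrow> set_integrable \<mu> K u)"

definition admissible :: "'a::metric_space measure \<Rightarrow> 'a measure \<Rightarrow> 'a set \<Rightarrow> real \<Rightarrow> real \<Rightarrow> bool" where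
  "admissible \<mu> H \<Omega> p \<theta> \<longleftrightarrow>
     1 < p \<and> 0 < \<theta> \<and> \<theta> < p \<and>
     \<comment> \<open>doubling on \<Omega>\<close>
     (\<exists>Cd. \<forall>x\<in>closure \<Omega>. \<forall>r>0.
        0 < emeasure \<mu> (ball x (2*r) \<inter> \<Omega>) \<and>
        emeasure \<mu> (ball x (2*r) \<inter> \<Omega>) \<le> ennreal Cd * emeasure \<mu> (ball x r \<inter> \<Omega>) \<and>
        emeasure \<mu> (ball x r \<inter> \<Omega>) < top) \<and>
     \<comment> \<open>codimension-\<theta> upper bound for H\<close>
     (\<exists>C. \<forall>x\<in>frontier \<Omega>. \<forall>r>0.
        emeasure H (ball x r \<inter> frontier \<Omega>) \<le> ennreal (C * r powr (-\<theta>)) * emeasure \<mu> (ball x r \<inter> \<Omega>)) \<and>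
     \<comment> \<open>local p-Poincare inequality\<close>
     (\<exists>C>0. \<exists>lam\<ge>1. \<forall>x\<in>\<Omega>. \<forall>r>0. \<forall>u g.
        L1_loc \<mu> \<Omega> u \<and> set_integrable \<mu> (ball x r \<inter> \<Omega>) u \<and> upper_gradient \<Omega> dist u g \<longrightarrow>
        (\<integral>\<^sup>+ y \<in> ball x r \<inter> \<Omega>.
            ennreal \<bar>u y - (\<integral>z \<in> ball x r \<inter> \<Omega>. u z \<partial>\<mu>) / measure \<mu> (ball x r \<inter> \<Omega>)\<bar> \<partial>\<mu>)
          / emeasure \<mu> (ball x r \<inter> \<Omega>)
        \<le> ennreal (C * r) *
           enn_powr ((\<integral>\<^sup>+ y \<in> ball x (lam*r) \<inter> \<Omega>. enn_powr (g y) p \<partial>\<mu>)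
                      / emeasure \<mu> (ball x (lam*r) \<inter> \<Omega>)) (1/p)) \<and>
     \<comment> \<open>Poincare inequality for zero-trace functions, all exponents p' \<ge> p\<close>
     (\<exists>C. \<forall>p'\<ge>p. \<forall>w::'a \<Rightarrow> real.
        newtonian \<mu> \<Omega> p' UNIV dist w \<and> is_trace \<mu> H \<Omega> UNIV dist w (\<lambda>_. 0) \<longrightarrow>
        enn_powr (\<integral>\<^sup>+ x \<in> \<Omega>. ennreal (\<bar>w x\<bar> powr p') \<partial>\<mu>) (1/p')
          \<le> ennreal C * enn_powr (p_energy \<mu> \<Omega> p' dist w) (1/p'))"

end

theory Submission
  imports Defs "HOL-Library.Diagonal_Subsequence"
begin

text \<open>Cover the domain at every level m by finitely many balls of radius comparable to 2^(-m). Chaining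
  the real Poincare inequality for the functions d(u k, y) along nested balls gives, with a bound that does
  not depend on y, one value of u k per ball that approximates u k in mean. Only finitely many values occur
  at each level, so along a diagonal subsequence all their mutual distances converge, with a rate. The
  sequences of values are then essentially dense in the image of the ultralimit, and for almost every z all
  distances from u k (z) to them converge as ordinary limits; this yields measurability and essential
  separability.

  For the energy, take almost energy minimising midpoint combinations of upper gradients of the tail. By
  uniform convexity they converge in the p-norm, and the same combinations of the distance functions converge on
  almost every curve at every point. These limits determine the good representative of the ultralimit, whose
  values are found by completeness of the ultra-completion.

  The boundary measure satisfies the same estimates on the balls of the covers as the measure of the domain, up to
  the factor 2^(m theta), which the gain in the Poincare inequality absorbs since theta < p. Hence the level
  values also approximate the traces, and the trace of the ultralimit can be read off from them.\<close>

section \<open>The power function on extended nonnegative reals\<close>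

text \<open>An ultralimit of measurable functions need not be measurable, and Fatou's lemma fails
  along an ultrafilter. So every limit that enters an integral has to be an ordinary one; the
  ultrafilter merely supplies a complete space in which the limit values exist. Since Y need not be
  locally compact, the maps themselves need not have a convergent subsequence, and only real
  distances are accessible to Bolzano-Weierstrass.

  A second obstacle is that information valid at almost every point says nothing about the end
  points of a given curve, while an upper gradient inequality concerns all of them. The class
  [(u k z)] is therefore changed on a null set.

  To be summed over balls of bounded overlap, the right-hand side of the Poincare inequality must be
  additive in the energy. Since r * a^(1/p) = r^\<alpha> * (r^\<theta> * a)^(1/p) with \<alpha> = (p
  - \<theta>) / p, the inequality x \<le> 1 + x^p replaces the root by the density 1 + r^\<theta> *
  g^p. The power \<alpha> > 0 makes sums over levels geometric, and r^\<theta> offsets the factor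
  r^(-\<theta>) in the bound for the boundary measure.\<close>

lemma enn_powr_top [simp]: "enn_powr top p = top"
  by (simp add: enn_powr_def)

lemma enn_powr_0 [simp]: "enn_powr 0 p = 0"
  by (simp add: enn_powr_def)

lemma enn_powr_ennreal: "0 \<le> x \<Longrightarrow> enn_powr (ennreal x) p = ennreal (x powr p)"
  by (simp add: enn_powr_def)

lemma enn_powr_eq_top_iff [simp]: "enn_powr x p = top \<longleftrightarrow> x = top"
  by (simp add: enn_powr_def)

lemma enn_powr_mono:
  assumes "0 < p" "x \<le> y" shows "enn_powr x p \<le> enn_powr y p"
proof (cases "y = top")
  case False
  then have "x \<noteq> top" using assms(2) by (auto simp: top_unique)
  with False show ?thesis
    using assms by (cases x; cases y) (auto simp: enn_powr_ennreal intro!: ennreal_leI powr_mono2)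
qed simp

lemma enn_powr_le_cancel:
  assumes "0 < p" "enn_powr x p \<le> enn_powr y p" shows "x \<le> y"
proof (rule ccontr)
  assume "\<not> x \<le> y"
  then have "y < x" by simp
  then obtain y' where y': "y = ennreal y'" "0 \<le> y'" by (cases y) auto
  show False
  proof (cases x)
    case (real x')
    have "x' powr p > y' powr p"
      using \<open>y < x\<close> y' real assms(1) by (intro powr_less_mono2) (auto simp: ennreal_less_iff)
    with assms(2) y' real show False
      by (auto simp: enn_powr_ennreal ennreal_le_iff)
  next
    case top
    with assms(2) y' show False
      by (auto simp: enn_powr_ennreal top_unique)
  qed
qed

lemma enn_powr_cmult:
  assumes "0 < c"
  shows "enn_powr (ennreal c * x) p = ennreal (c powr p) * enn_powr x p"
proof (cases x)
  case (real r)
  then show ?thesis using assms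
    by (simp add: enn_powr_ennreal powr_mult flip: ennreal_mult)
next
  case top
  then show ?thesis using assms by (simp add: ennreal_mult_top)
qed

lemma enn_powr_powr_inverse:
  assumes "0 < p" shows "enn_powr (enn_powr x (1 / p)) p = x"
  using assms by (cases x) (auto simp: enn_powr_ennreal powr_powr)

lemma enn_powr_measurable [measurable]: "(\<lambda>x. enn_powr x p) \<in> borel_measurable borel"
  unfolding enn_powr_def[abs_def] by measurable

lemma enn_powr_max: "0 < p \<Longrightarrow> enn_powr (max x y) p \<le> enn_powr x p + enn_powr y p"
  by (simp add: max_def)

text \<open>Bounding a supremum by the sum of the powers makes p-masses countably subadditive under
  suprema. This replaces Minkowski's inequality wherever countably many functions are merged into
  one.\<close>

lemma enn_powr_SUP_le:
  fixes f :: "nat \<Rightarrow> ennreal"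
  assumes "0 < p"
  shows "enn_powr (SUP n. f n) p \<le> (\<Sum>n. enn_powr (f n) p)"
proof -
  have "(SUP n. f n) \<le> enn_powr (\<Sum>n. enn_powr (f n) p) (1/p)"
  proof (rule SUP_least)
    fix n
    have "enn_powr (f n) p \<le> (\<Sum>n. enn_powr (f n) p)"
      using sum_le_suminf[of "\<lambda>n. enn_powr (f n) p" "{n}"] by simp
    then have "enn_powr (enn_powr (f n) p) (1/p) \<le> enn_powr (\<Sum>n. enn_powr (f n) p) (1/p)"
      using assms by (intro enn_powr_mono) auto
    moreover have "enn_powr (enn_powr (f n) p) (1/p) = f n"
      using enn_powr_powr_inverse[of "1/p" "f n"] assms by simp
    ultimately show "f n \<le> enn_powr (\<Sum>n. enn_powr (f n) p) (1/p)" by simp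
  qed
  then show ?thesis
    using enn_powr_mono[OF assms] enn_powr_powr_inverse[OF assms] by metis
qed

lemma enn_powr_SUP:
  fixes f :: "nat \<Rightarrow> ennreal"
  assumes "0 < p"
  shows "enn_powr (SUP n. f n) p = (SUP n. enn_powr (f n) p)"
proof (rule antisym)
  have "f n \<le> enn_powr (SUP n. enn_powr (f n) p) (1/p)" for n
  proof -
    have "enn_powr (enn_powr (f n) p) (1/p) \<le> enn_powr (SUP n. enn_powr (f n) p) (1/p)"
      using assms by (intro enn_powr_mono SUP_upper) auto
    then show ?thesis using enn_powr_powr_inverse[of "1/p" "f n"] assms by simp
  qed
  then show "enn_powr (SUP n. f n) p \<le> (SUP n. enn_powr (f n) p)"
    using enn_powr_mono[OF assms] enn_powr_powr_inverse[OF assms] by (metis SUP_least)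
  show "(SUP n. enn_powr (f n) p) \<le> enn_powr (SUP n. f n) p"
    using assms by (intro SUP_least enn_powr_mono SUP_upper) auto
qed

lemma enn_powr_liminf:
  fixes f :: "nat \<Rightarrow> ennreal"
  assumes "0 < p"
  shows "enn_powr (liminf f) p \<le> liminf (\<lambda>n. enn_powr (f n) p)"
proof -
  have "enn_powr (liminf f) p = (SUP n. enn_powr (INF m\<in>{n..}. f m) p)"
    unfolding liminf_SUP_INF by (rule enn_powr_SUP[OF assms])
  also have "\<dots> \<le> liminf (\<lambda>n. enn_powr (f n) p)"
    unfolding liminf_SUP_INF
    by (intro SUP_mono' INF_greatest enn_powr_mono[OF assms] INF_lower)
  finally show ?thesis .
qed

text \<open>Away from 1 the tangent line at 1 lies strictly below x^p (\<open>bern\<close>). It is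
  applied at 1/m and t/m, with m the midpoint of 1 and t: the linear terms cancel because 1/m + t/m
  = 2.\<close>

lemma powr_midpoint_less:
  fixes t p :: real
  assumes "1 < p" "0 \<le> t" "t < 1"
  shows "((1 + t) / 2) powr p < (1 + t powr p) / 2"
proof -
  have bern: "1 + p * (x - 1) < x powr p" if "0 \<le> x" "x \<noteq> 1" for x :: real
  proof (cases "x = 0")
    case False
    with that have x: "x > 0" by simp
    define f where "f = (\<lambda>x. x powr p - p * x)"
    have der: "(f has_real_derivative (p * (y powr (p - 1) - 1))) (at y)" if "y > 0" for y
      unfolding f_def using that by (auto intro!: derivative_eq_intros simp: algebra_simps)
    have "f 1 < f x"
    proof (cases "x < 1")
      case True
      obtain z where z: "x < z" "z < 1" "f 1 - f x = (1 - x) * (p * (z powr (p - 1) - 1))"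
        using MVT2[OF True, of f "\<lambda>y. p * (y powr (p - 1) - 1)"] der x by force
      have "z powr (p - 1) < 1" using z x assms powr_less_mono2[of "p - 1" z 1] by simp
      then have "(1 - x) * (p * (z powr (p - 1) - 1)) < 0"
        using True assms by (intro mult_pos_neg) auto
      with z show ?thesis by simp
    next
      case False
      with that have True: "1 < x" by simp
      obtain z where z: "1 < z" "z < x" "f x - f 1 = (x - 1) * (p * (z powr (p - 1) - 1))"
        using MVT2[OF True, of f "\<lambda>y. p * (y powr (p - 1) - 1)"] der x by force
      have "z powr (p - 1) > 1" using z x assms powr_less_mono2[of "p - 1" 1 z] by simp
      then have "(x - 1) * (p * (z powr (p - 1) - 1)) > 0"
        using True assms by (intro mult_pos_pos) auto
      with z show ?thesis by simp
    qed
    then show ?thesis by (simp add: f_def algebra_simps)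
  qed (use assms in auto)
  define m where "m = (1 + t) / 2"
  have m: "m > 0" "m \<noteq> 1" using assms by (auto simp: m_def)
  have "1 + p * (1 / m - 1) < (1/m) powr p" "1 + p * (t / m - 1) < (t/m) powr p"
  proof -
    have "t / m \<noteq> 1" using m assms by (auto simp: m_def)
    then show "1 + p * (1 / m - 1) < (1/m) powr p" "1 + p * (t / m - 1) < (t/m) powr p"
      using m assms bern[of "1/m"] bern[of "t/m"] by auto
  qed
  then have "2 + p * (1 / m + t / m - 2) < (1/m) powr p + (t/m) powr p"
    by (simp add: algebra_simps)
  moreover have "1 / m + t / m - 2 = 0"
  proof -
    have "1 / m + t / m = 2 * m / m" by (simp add: m_def add_divide_distrib)
    then show ?thesis using m by simp
  qed
  ultimately have "2 < (1/m) powr p + (t/m) powr p" by (metis add.right_neutral mult_zero_right)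
  also have "\<dots> = (1 + t powr p) / m powr p"
    using m assms by (simp add: powr_divide add_divide_distrib)
  finally show ?thesis using m by (simp add: m_def field_simps)
qed

text \<open>Away from t = 1 the midpoint defect is bounded below by compactness, so a large multiple
  of it dominates (1 - t)^p. Near t = 1 that power is itself at most \<epsilon>.\<close>

lemma powr_convexity_defect:
  fixes p \<epsilon> :: real
  assumes "1 < p" "0 < \<epsilon>"
  obtains K where "K > 0"
    "\<And>t. 0 \<le> t \<Longrightarrow> t \<le> 1 \<Longrightarrow> (1 - t) powr p + K * ((1 + t) / 2) powr p
        \<le> \<epsilon> + K * ((1 + t powr p) / 2)"
proof -
  define D where "D = (\<lambda>t::real. (1 + t powr p) / 2 - ((1 + t) / 2) powr p)"
  \<comment> \<open>Beyond this threshold (1 - t)^p is at most \<epsilon>. For \<epsilon> > 1 it is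
    negative, and the compact interval below is empty.\<close>
  define s where "s = 1 - \<epsilon> powr (1/p)"
  have s1: "s < 1" using assms by (simp add: s_def)
  have cont: "continuous_on {0..s} D"
    unfolding D_def using assms by (intro continuous_intros continuous_on_powr') auto
  have Dpos: "D t > 0" if "t \<in> {0..s}" for t
    using powr_midpoint_less[OF assms(1), of t] that s1 by (auto simp: D_def)
  have "\<exists>c>0. \<forall>t\<in>{0..s}. c \<le> D t"
  proof (cases "{0..s} = {}")
    case False
    then obtain t0 where "t0 \<in> {0..s}" "\<forall>t\<in>{0..s}. D t0 \<le> D t"
      using continuous_attains_inf[OF compact_Icc False cont] by blast
    with Dpos show ?thesis by blast
  qed (auto intro: exI[of _ 1])
  then obtain c where c: "c > 0" "\<And>t. t \<in> {0..s} \<Longrightarrow> c \<le> D t" by blast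
  show thesis
  proof (rule that[of "1/c"])
    fix t :: real assume t: "0 \<le> t" "t \<le> 1"
    have D0: "D t \<ge> 0" using powr_midpoint_less[OF assms(1), of t] t by (cases "t = 1") (auto simp: D_def)
    have "(1 - t) powr p \<le> \<epsilon> + 1/c * D t"
    proof (cases "t \<le> s")
      case True
      then have "(1 - t) powr p \<le> 1" using t assms powr_mono2[of p "1-t" 1] by simp
      also have "1 \<le> 1/c * D t" using c(2)[of t] True t c(1) by (simp add: field_simps)
      finally show ?thesis using assms by linarith
    next
      case False
      then have "(1 - t) powr p \<le> (\<epsilon> powr (1/p)) powr p"
        using t assms by (intro powr_mono2) (auto simp: s_def)
      also have "\<dots> = \<epsilon>" using assms by (simp add: powr_powr)
      finally show ?thesis using c(1) D0 by (simp add: add_increasing2)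
    qed
    then show "(1 - t) powr p + 1/c * ((1 + t) / 2) powr p \<le> \<epsilon> + 1/c * ((1 + t powr p) / 2)"
      by (simp add: D_def right_diff_distrib)
  qed (use c in auto)
qed

text \<open>Truncated subtraction of extended reals gives the one-sided difference, and all terms have been
  moved so that no subtraction of energies occurs.\<close>
lemma enn_powr_uniform_convexity:
  fixes p \<epsilon> :: real
  assumes "1 < p" "0 < \<epsilon>"
  obtains K where "K > 0"
    "\<And>a b. enn_powr (a - b) p + ennreal K * enn_powr ((a + b) / 2) p
        \<le> ennreal \<epsilon> * (enn_powr a p + enn_powr b p) + ennreal (K/2) * (enn_powr a p + enn_powr b p)"
proof -
  obtain K where K: "K > 0"
    "\<And>t. 0 \<le> t \<Longrightarrow> t \<le> 1 \<Longrightarrow> (1 - t) powr p + K * ((1 + t) / 2) powr p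
        \<le> \<epsilon> + K * ((1 + t powr p) / 2)"
    using powr_convexity_defect[OF assms] by metis
  \<comment> \<open>Homogeneity reduces the case b \<le> a to t = b/a. The extra term \<epsilon> *
    b^p makes the bound symmetric, so that the other case follows by exchanging a and b.\<close>
  have ord: "(a - b) powr p + K * ((a + b) / 2) powr p
     \<le> \<epsilon> * (a powr p + b powr p) + K/2 * (a powr p + b powr p)" if "0 \<le> b" "b \<le> a" "0 < a" for a b
  proof -
    have "(1 - b/a) powr p + K * ((1 + b/a) / 2) powr p \<le> \<epsilon> + K * ((1 + (b/a) powr p) / 2)"
      using that by (intro K(2)) auto
    then have "a powr p * ((1 - b/a) powr p + K * ((1 + b/a) / 2) powr p) 
        \<le> a powr p * (\<epsilon> + K * ((1 + (b/a) powr p) / 2))"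
      by (intro mult_left_mono) auto
    moreover have "a powr p * (1 - b/a) powr p = (a - b) powr p"
    proof -
      have "a * (1 - b/a) = a - b" using that by (simp add: right_diff_distrib)
      then show ?thesis using that by (simp flip: powr_mult)
    qed
    moreover have "a powr p * ((1 + b/a) / 2) powr p = ((a + b)/2) powr p"
    proof -
      have "a * ((1 + b/a) / 2) = (a + b)/2" using that by (simp add: distrib_left)
      then show ?thesis using that by (simp flip: powr_mult)
    qed
    moreover have "a powr p * (b/a) powr p = b powr p"
      using that by (simp flip: powr_mult)
    moreover have "\<epsilon> * b powr p \<ge> 0" using assms by simp
    ultimately show ?thesis by (simp add: algebra_simps add_divide_distrib)
  qed
  have main: "enn_powr (ennreal a - ennreal b) p + ennreal K * enn_powr ((ennreal a + ennreal b) / 2) p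
        \<le> ennreal \<epsilon> * (enn_powr (ennreal a) p + enn_powr (ennreal b) p) 
          + ennreal (K/2) * (enn_powr (ennreal a) p + enn_powr (ennreal b) p)"
    if ab: "0 \<le> a" "0 \<le> b" for a b
  proof -
    define m where "m = max 0 (a - b)"
    have e: "ennreal a - ennreal b = ennreal m"
      using ab by (auto simp: m_def ennreal_minus ennreal_eq_0_iff max_def)
    have h: "(ennreal a + ennreal b) / 2 = ennreal ((a + b) / 2)"
      using ab by (simp add: divide_ennreal[symmetric] flip: ennreal_plus)
    have "m powr p + K * ((a + b) / 2) powr p
     \<le> \<epsilon> * (a powr p + b powr p) + K/2 * (a powr p + b powr p)"
    proof (cases "a = 0 \<and> b = 0")
      case False
      show ?thesis
      proof (cases "b \<le> a")
        case True
        then show ?thesis using ord[of b a] False ab by (simp add: m_def)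
      next
        case F2: False
        then have "(b - a) powr p + K * ((b + a) / 2) powr p
           \<le> \<epsilon> * (b powr p + a powr p) + K/2 * (b powr p + a powr p)"
          using ord[of a b] ab by simp
        moreover have "m powr p \<le> (b - a) powr p" using F2 by (simp add: m_def)
        ultimately show ?thesis by (simp add: add.commute)
      qed
    qed (simp add: m_def)
    moreover define L where "L = K/2"
    ultimately have "ennreal (m powr p + K * ((a + b) / 2) powr p)
      \<le> ennreal (\<epsilon> * (a powr p + b powr p) + L * (a powr p + b powr p))"
      by (intro ennreal_leI) (simp only:)
    moreover have "0 < L" using K(1) by (simp add: L_def)
    ultimately show ?thesis
      unfolding e h L_def[symmetric] using ab K(1) assms
      by (simp add: enn_powr_ennreal m_def ennreal_plus ennreal_mult del: ennreal_plus[symmetric])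
  qed
  show thesis
  proof (rule that[OF K(1)])
    fix a b :: ennreal
    show "enn_powr (a - b) p + ennreal K * enn_powr ((a + b) / 2) p
        \<le> ennreal \<epsilon> * (enn_powr a p + enn_powr b p) + ennreal (K/2) * (enn_powr a p + enn_powr b p)"
    proof (cases "a = top \<or> b = top")
      case True
      then show ?thesis using K(1) by (auto simp: ennreal_mult_top)
    next
      case False
      then obtain a' b' where "a = ennreal a'" "b = ennreal b'" "0 \<le> a'" "0 \<le> b'"
        by (metis ennreal_cases)
      then show ?thesis using main[of a' b'] by simp
    qed
  qed
qed

section \<open>Curves, modulus and weak upper gradients\<close>

lemma ennreal_eq_0_epsilon:
  fixes x :: ennreal
  assumes "\<And>e. 0 < e \<Longrightarrow> x \<le> ennreal e" shows "x = 0"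
proof -
  have "x \<le> 0" by (rule ennreal_le_epsilon) (use assms in auto)
  then show ?thesis by simp
qed

lemma ennreal_powr_scale:
  fixes I :: ennreal
  assumes "0 < p" "0 < e" "I < top"
  obtains c where "0 < c" "ennreal (c powr p) * I \<le> ennreal e"
proof -
  obtain R where R: "I = ennreal R" "0 \<le> R" using assms(3) by (cases I) auto
  \<comment> \<open>The summand 1 keeps \<open>c\<close> positive when R = 0.\<close>
  define c where "c = (e / (R + 1)) powr (1/p)"
  have "c powr p * R = e * (R / (R + 1))"
    using assms R by (simp add: c_def powr_powr)
  also have "\<dots> \<le> e * 1"
    using assms R by (intro mult_left_mono) (auto simp: field_simps)
  finally have "ennreal (c powr p) * I \<le> ennreal e"
    using R by (simp flip: ennreal_mult add: ennreal_leI)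
  moreover have "0 < c" using assms R by (simp add: c_def)
  ultimately show thesis using that by blast
qed

abbreviation p_mass :: "'a measure \<Rightarrow> 'a set \<Rightarrow> real \<Rightarrow> ('a \<Rightarrow> ennreal) \<Rightarrow> ennreal" where
  "p_mass \<mu> \<Omega> p f \<equiv> \<integral>\<^sup>+ x \<in> \<Omega>. enn_powr (f x) p \<partial>\<mu>"

abbreviation arc_integral :: "('a \<Rightarrow> ennreal) \<Rightarrow> (real \<Rightarrow> 'a) \<Rightarrow> real \<Rightarrow> real \<Rightarrow> ennreal" where
  "arc_integral g \<gamma> s t \<equiv> \<integral>\<^sup>+ \<tau> \<in> {s..t}. g (\<gamma> \<tau>) \<partial>lborel"

lemma p_mass_mono: "0 < p \<Longrightarrow> (\<And>x. x \<in> \<Omega> \<Longrightarrow> f x \<le> g x) \<Longrightarrow> p_mass \<mu> \<Omega> p f \<le> p_mass \<mu> \<Omega> p g"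
  by (intro nn_integral_mono) (auto split: split_indicator intro: enn_powr_mono)

lemma p_mass_cmult:
  assumes "sets \<mu> = sets borel" "\<Omega> \<in> sets borel" "f \<in> borel_measurable borel" "0 < c"
  shows "p_mass \<mu> \<Omega> p (\<lambda>x. ennreal c * f x) = ennreal (c powr p) * p_mass \<mu> \<Omega> p f"
proof -
  note [measurable_cong] = assms(1) and [measurable] = assms(2,3)
  show ?thesis
    by (simp add: enn_powr_cmult[OF assms(4)] mult.assoc nn_integral_cmult)
qed

lemma p_mass_max:
  assumes "sets \<mu> = sets borel" "\<Omega> \<in> sets borel" "f \<in> borel_measurable borel" "g \<in> borel_measurable borel" "0 < p"
  shows "p_mass \<mu> \<Omega> p (\<lambda>x. max (f x) (g x)) \<le> p_mass \<mu> \<Omega> p f + p_mass \<mu> \<Omega> p g"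
proof -
  note [measurable_cong] = assms(1) and [measurable] = assms(2-4)
  have "p_mass \<mu> \<Omega> p (\<lambda>x. max (f x) (g x)) \<le> 
    (\<integral>\<^sup>+x. enn_powr (f x) p * indicator \<Omega> x + enn_powr (g x) p * indicator \<Omega> x \<partial>\<mu>)"
    by (intro nn_integral_mono) (auto split: split_indicator intro: enn_powr_max[OF assms(5)])
  then show ?thesis by (subst (asm) nn_integral_add) auto
qed

lemma p_mass_SUP:
  fixes f :: "nat \<Rightarrow> 'a::topological_space \<Rightarrow> ennreal"
  assumes "sets \<mu> = sets borel" "\<Omega> \<in> sets borel" "\<And>n. f n \<in> borel_measurable borel" "0 < p"
  shows "p_mass \<mu> \<Omega> p (\<lambda>x. SUP n. f n x) \<le> (\<Sum>n. p_mass \<mu> \<Omega> p (f n))"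
proof -
  note [measurable_cong] = assms(1) and [measurable] = assms(2,3)
  have "p_mass \<mu> \<Omega> p (\<lambda>x. SUP n. f n x) \<le> 
    (\<integral>\<^sup>+x. (\<Sum>n. enn_powr (f n x) p * indicator \<Omega> x) \<partial>\<mu>)"
    by (intro nn_integral_mono) (auto split: split_indicator intro: enn_powr_SUP_le[OF assms(4)])
  then show ?thesis by (subst (asm) nn_integral_suminf) auto
qed

lemma curve_length_shift:
  "curve_length (\<lambda>\<tau>. \<gamma> (s + \<tau>)) a b = curve_length \<gamma> (s + a) (s + b)"
proof (rule antisym)
  show "curve_length (\<lambda>\<tau>. \<gamma> (s + \<tau>)) a b \<le> curve_length \<gamma> (s + a) (s + b)"
    unfolding curve_length_def
  proof (rule SUP_mono)
    fix ts assume ts: "ts \<in> {ts. sorted ts \<and> set ts \<subseteq> {a..b}}"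
    then show "\<exists>us\<in>{ts. sorted ts \<and> set ts \<subseteq> {s + a..s + b}}.
       ereal (\<Sum>i<length ts - 1. dist (\<gamma> (s + ts ! i)) (\<gamma> (s + ts ! Suc i)))
         \<le> ereal (\<Sum>i<length us - 1. dist (\<gamma> (us ! i)) (\<gamma> (us ! Suc i)))"
      by (intro bexI[of _ "map ((+) s) ts"]) (auto simp: sorted_iff_nth_mono)
  qed
  show "curve_length \<gamma> (s + a) (s + b) \<le> curve_length (\<lambda>\<tau>. \<gamma> (s + \<tau>)) a b"
    unfolding curve_length_def
  proof (rule SUP_mono)
    fix ts assume ts: "ts \<in> {ts. sorted ts \<and> set ts \<subseteq> {s + a..s + b}}"
    then show "\<exists>us\<in>{ts. sorted ts \<and> set ts \<subseteq> {a..b}}.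
       ereal (\<Sum>i<length ts - 1. dist (\<gamma> (ts ! i)) (\<gamma> (ts ! Suc i)))
         \<le> ereal (\<Sum>i<length us - 1. dist (\<gamma> (s + us ! i)) (\<gamma> (s + us ! Suc i)))"
      by (intro bexI[of _ "map (\<lambda>x. x - s) ts"]) (force simp: sorted_iff_nth_mono)+
  qed
qed

lemma arclength_curveD:
  assumes "arclength_curve \<Omega> (\<gamma>, L)"
  shows "0 \<le> L" "\<gamma> ` {0..L} \<subseteq> \<Omega>" "continuous_on {0..L} \<gamma>"
  using assms by (auto simp: arclength_curve_def)

lemma arclength_curve_subcurve:
  assumes "arclength_curve \<Omega> (\<gamma>, L)" "0 \<le> s" "s \<le> t" "t \<le> L"
  shows "arclength_curve \<Omega> (\<lambda>\<tau>. \<gamma> (s + \<tau>), t - s)"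
proof -
  have "continuous_on {0..t - s} (\<gamma> \<circ> (+) s)"
    by (rule continuous_on_compose)
       (use assms in \<open>auto intro!: continuous_intros intro: continuous_on_subset[OF arclength_curveD(3)[OF assms(1)]]\<close>)
  moreover have "(\<lambda>\<tau>. \<gamma> (s + \<tau>)) ` {0..t - s} \<subseteq> \<Omega>"
    using arclength_curveD(2)[OF assms(1)] assms(2-4) by (auto simp: image_subset_iff)
  moreover have "curve_length (\<lambda>\<tau>. \<gamma> (s + \<tau>)) a b = ereal (b - a)"
    if "0 \<le> a" "a \<le> b" "b \<le> t - s" for a b
  proof -
    have "curve_length \<gamma> (s + a) (s + b) = ereal ((s + b) - (s + a))"
      using assms that unfolding arclength_curve_def by fastforce
    then show ?thesis by (simp add: curve_length_shift)
  qed
  ultimately show ?thesis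
    using assms(3) by (auto simp: arclength_curve_def o_def)
qed

lemma arc_measurable:
  fixes \<gamma> :: "real \<Rightarrow> 'a::topological_space"
  assumes "g \<in> borel_measurable borel" "continuous_on {0..L} \<gamma>" "0 \<le> s" "t \<le> L"
  shows "(\<lambda>\<tau>. g (\<gamma> \<tau>) * indicator {s..t} \<tau> :: ennreal) \<in> borel_measurable borel"
proof -
  have "continuous_on {s..t} \<gamma>" by (rule continuous_on_subset[OF assms(2)]) (use assms in auto)
  then have "\<gamma> \<in> borel_measurable (restrict_space borel {s..t})"
    by (rule borel_measurable_continuous_on_restrict)
  then have "(\<lambda>\<tau>. g (\<gamma> \<tau>)) \<in> borel_measurable (restrict_space borel {s..t})"
    using assms(1) by measurable
  then show ?thesis by (subst (asm) borel_measurable_restrict_space_iff_ennreal) auto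
qed

lemma line_integral_eq_arc_integral: "line_integral g (\<gamma>, L) = arc_integral g \<gamma> 0 L"
  by (simp add: line_integral_def)

lemma line_integral_subcurve:
  assumes "g \<in> borel_measurable borel" "continuous_on {0..L} \<gamma>" "0 \<le> s" "t \<le> L"
  shows "line_integral g (\<lambda>\<tau>. \<gamma> (s + \<tau>), t - s) = arc_integral g \<gamma> s t"
proof -
  have "arc_integral g \<gamma> s t = (\<integral>\<^sup>+\<tau>. g (\<gamma> (s + \<tau>)) * indicator {s..t} (s + \<tau>) \<partial>lborel)"
    using nn_integral_real_affine[of "\<lambda>\<tau>. g (\<gamma> \<tau>) * indicator {s..t} \<tau>" 1 s] arc_measurable[OF assms]
    by simp
  also have "\<dots> = line_integral g (\<lambda>\<tau>. \<gamma> (s + \<tau>), t - s)"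
    unfolding line_integral_def by (intro nn_integral_cong) (auto split: split_indicator)
  finally show ?thesis by simp
qed

lemma arc_integral_split:
  assumes "g \<in> borel_measurable borel" "continuous_on {0..L} \<gamma>" "0 \<le> s" "s \<le> r" "r \<le> t" "t \<le> L"
  shows "arc_integral g \<gamma> s t = arc_integral g \<gamma> s r + arc_integral g \<gamma> r t"
proof -
  have "arc_integral g \<gamma> s t = 
    (\<integral>\<^sup>+\<tau>. g (\<gamma> \<tau>) * indicator {s..r} \<tau> + g (\<gamma> \<tau>) * indicator {r..t} \<tau> \<partial>lborel)"
  proof (rule nn_integral_cong_AE)
    have "AE \<tau> in lborel. \<tau> \<noteq> r" by (rule AE_lborel_singleton)
    then show "AE x in lborel. g (\<gamma> x) * indicator {s..t} x =
            g (\<gamma> x) * indicator {s..r} x + g (\<gamma> x) * indicator {r..t} x"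
      by eventually_elim (use assms in \<open>auto split: split_indicator\<close>)
  qed
  also have "\<dots> = arc_integral g \<gamma> s r + arc_integral g \<gamma> r t"
    using arc_measurable[OF assms(1,2,3), of r] arc_measurable[OF assms(1,2) _ assms(6), of r] assms
    by (intro nn_integral_add) simp_all
  finally show ?thesis .
qed

lemma arc_integral_mono: "(\<And>x. g x \<le> h x) \<Longrightarrow> arc_integral g \<gamma> s t \<le> arc_integral h \<gamma> s t"
  by (intro nn_integral_mono) (auto split: split_indicator)

lemma arc_integral_subset: "0 \<le> s \<Longrightarrow> t \<le> L \<Longrightarrow> arc_integral g \<gamma> s t \<le> arc_integral g \<gamma> 0 L"
  by (intro nn_integral_mono) (auto split: split_indicator)

lemma arc_integral_add:
  assumes "g \<in> borel_measurable borel" "h \<in> borel_measurable borel" "continuous_on {0..L} \<gamma>" "0 \<le> s" "t \<le> L"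
  shows "arc_integral (\<lambda>x. g x + h x) \<gamma> s t = arc_integral g \<gamma> s t + arc_integral h \<gamma> s t"
  unfolding distrib_right
  using arc_measurable[OF assms(1,3-5)] arc_measurable[OF assms(2,3-5)]
  by (intro nn_integral_add) simp_all

lemma arc_integral_cmult:
  assumes "g \<in> borel_measurable borel" "continuous_on {0..L} \<gamma>" "0 \<le> s" "t \<le> L"
  shows "arc_integral (\<lambda>x. c * g x) \<gamma> s t = c * arc_integral g \<gamma> s t"
  unfolding mult.assoc
  using arc_measurable[OF assms] by (intro nn_integral_cmult) simp

text \<open>Every positive multiple of \<rho> still has infinite integral along the curves of the
  family, while its p-mass can be made arbitrarily small.\<close>

lemma p_modulus_eq_0I:
  assumes "sets \<mu> = sets borel" "\<Omega> \<in> sets borel" "0 < p"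
    and \<rho>: "\<rho> \<in> borel_measurable borel" "p_mass \<mu> \<Omega> p \<rho> < top"
    and \<Gamma>: "\<And>\<gamma> L. (\<gamma>, L) \<in> \<Gamma> \<Longrightarrow> arclength_curve \<Omega> (\<gamma>, L) \<and> arc_integral \<rho> \<gamma> 0 L = top"
  shows "p_modulus \<mu> \<Omega> p \<Gamma> = 0"
proof (rule ennreal_eq_0_epsilon)
  fix e :: real assume "0 < e"
  then obtain c where c: "0 < c" "ennreal (c powr p) * p_mass \<mu> \<Omega> p \<rho> \<le> ennreal e"
    using ennreal_powr_scale[OF assms(3) _ \<rho>(2)] by blast
  have "1 \<le> line_integral (\<lambda>x. ennreal c * \<rho> x) cu" if "cu \<in> \<Gamma>" for cu
  proof -
    obtain \<gamma> L where cu: "cu = (\<gamma>, L)" by (cases cu)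
    with \<Gamma> that have "arclength_curve \<Omega> (\<gamma>, L)" "arc_integral \<rho> \<gamma> 0 L = top" by auto
    then show ?thesis
      using c(1) arclength_curveD[of \<Omega> \<gamma> L] unfolding cu line_integral_eq_arc_integral
      by (subst arc_integral_cmult[where L=L]) (auto simp: \<rho> ennreal_mult_top)
  qed
  then have "p_modulus \<mu> \<Omega> p \<Gamma> \<le> p_mass \<mu> \<Omega> p (\<lambda>x. ennreal c * \<rho> x)"
    unfolding p_modulus_def using \<rho> by (intro INF_lower) auto
  also have "\<dots> \<le> ennreal e" using c p_mass_cmult[OF assms(1,2) \<rho>(1) c(1)] by simp
  finally show "p_modulus \<mu> \<Omega> p \<Gamma> \<le> ennreal e" .
qed

text \<open>Competitors of rapidly decreasing p-mass are merged with the weights 2^n. Along a curve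
  of the family the integral of their supremum exceeds every 2^n.\<close>

lemma p_modulus_eq_0D:
  assumes "sets \<mu> = sets borel" "\<Omega> \<in> sets borel" "0 < p" "p_modulus \<mu> \<Omega> p \<Gamma> = 0"
    and \<Gamma>: "\<And>\<gamma> L. (\<gamma>, L) \<in> \<Gamma> \<Longrightarrow> arclength_curve \<Omega> (\<gamma>, L)"
  obtains \<rho> where "\<rho> \<in> borel_measurable borel" "p_mass \<mu> \<Omega> p \<rho> < top"
    "\<And>\<gamma> L. (\<gamma>, L) \<in> \<Gamma> \<Longrightarrow> arc_integral \<rho> \<gamma> 0 L = top"
proof -
  \<comment> \<open>The second factor pays for the weight 2^n inside the p-th power, the first one
    makes the masses summable.\<close>
  define e where "e = (\<lambda>n::nat. (1/2)^n * (2^n) powr (-p) :: real)"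
  have e: "e n > 0" for n by (simp add: e_def)
  have "\<exists>\<rho>\<in>borel_measurable borel. (\<forall>c\<in>\<Gamma>. 1 \<le> line_integral \<rho> c) \<and> p_mass \<mu> \<Omega> p \<rho> < ennreal (e n)" for n
  proof -
    have "p_modulus \<mu> \<Omega> p \<Gamma> < ennreal (e n)" using assms(4) e by simp
    then show ?thesis unfolding p_modulus_def INF_less_iff by auto
  qed
  then obtain \<rho> where \<rho>: "\<And>n. \<rho> n \<in> borel_measurable borel" 
      "\<And>n c. c \<in> \<Gamma> \<Longrightarrow> 1 \<le> line_integral (\<rho> n) c" "\<And>n. p_mass \<mu> \<Omega> p (\<rho> n) < ennreal (e n)"
    by metis
  note [measurable] = \<rho>(1)
  define P where "P = (\<lambda>x. SUP n. ennreal (2^n) * \<rho> n x)"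
  have P [measurable]: "P \<in> borel_measurable borel" unfolding P_def by measurable
  have "p_mass \<mu> \<Omega> p P \<le> (\<Sum>n. p_mass \<mu> \<Omega> p (\<lambda>x. ennreal (2^n) * \<rho> n x))"
    unfolding P_def by (rule p_mass_SUP[OF assms(1,2) _ assms(3)]) measurable
  also have "\<dots> = (\<Sum>n. ennreal ((2^n) powr p) * p_mass \<mu> \<Omega> p (\<rho> n))"
    by (subst p_mass_cmult[OF assms(1,2)]) (use \<rho>(1) in auto)
  also have "\<dots> \<le> (\<Sum>n. ennreal ((1/2)^n))"
  proof (intro suminf_le allI)
    fix n
    have "ennreal ((2^n) powr p) * p_mass \<mu> \<Omega> p (\<rho> n) \<le> ennreal ((2^n) powr p) * ennreal (e n)"
      using \<rho>(3)[of n] by (intro mult_left_mono) auto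
    also have "\<dots> = ennreal ((1/2)^n)"
      using e[of n] by (simp add: e_def powr_minus flip: ennreal_mult)
    finally show "ennreal ((2^n) powr p) * p_mass \<mu> \<Omega> p (\<rho> n) \<le> ennreal ((1/2)^n)" .
  qed auto
  also have "\<dots> = ennreal 2"
    by (subst suminf_ennreal2) (simp_all add: summable_geometric suminf_geometric)
  finally have fin: "p_mass \<mu> \<Omega> p P < top" by (simp add: le_less_trans)
  have "arc_integral P \<gamma> 0 L = top" if "(\<gamma>, L) \<in> \<Gamma>" for \<gamma> L
  proof -
    note cu = arclength_curveD[OF \<Gamma>[OF that]]
    have "ennreal (2^n) \<le> arc_integral P \<gamma> 0 L" for n
    proof -
      have "ennreal (2^n) \<le> ennreal (2^n) * arc_integral (\<rho> n) \<gamma> 0 L"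
        using \<rho>(2)[OF that, of n] mult_left_mono[of 1 "arc_integral (\<rho> n) \<gamma> 0 L" "ennreal (2^n)"]
        by (simp add: line_integral_eq_arc_integral)
      also have "\<dots> = arc_integral (\<lambda>x. ennreal (2^n) * \<rho> n x) \<gamma> 0 L"
        by (subst arc_integral_cmult[where L=L]) (use cu \<rho> in auto)
      also have "\<dots> \<le> arc_integral P \<gamma> 0 L"
        by (intro arc_integral_mono) (auto simp: P_def intro: SUP_upper)
      finally show ?thesis .
    qed
    note pow = this
    show ?thesis
    proof (rule ccontr)
      assume "arc_integral P \<gamma> 0 L \<noteq> top"
      then obtain r where "arc_integral P \<gamma> 0 L = ennreal r" "0 \<le> r" by (metis ennreal_cases)
      with pow have "2^n \<le> r" for n by (metis ennreal_le_iff)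
      moreover obtain n where "r < 2^n" using real_arch_pow[of 2 r] by auto
      ultimately show False by (meson not_le)
    qed
  qed
  with that[OF P fin] show thesis by blast
qed

text \<open>An exceptional family of curves is encoded by one p-integrable function whose line integral is
  infinite on it. Finiteness of a line integral passes to subcurves, so the upper gradient inequality
  comes for all subcurves at once.\<close>
lemma p_weak_upper_gradient_iff:
  assumes "sets \<mu> = sets borel" "\<Omega> \<in> sets borel" "0 < p"
  shows "p_weak_upper_gradient \<mu> \<Omega> p d u g \<longleftrightarrow> g \<in> borel_measurable borel \<and>
    (\<exists>\<rho>\<in>borel_measurable borel. p_mass \<mu> \<Omega> p \<rho> < top \<and>
      (\<forall>\<gamma> L. arclength_curve \<Omega> (\<gamma>, L) \<longrightarrow> arc_integral \<rho> \<gamma> 0 L < top \<longrightarrow>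
        (\<forall>s t. 0 \<le> s \<longrightarrow> s \<le> t \<longrightarrow> t \<le> L \<longrightarrow> ennreal (d (u (\<gamma> t)) (u (\<gamma> s))) \<le> arc_integral g \<gamma> s t)))"
    (is "?L \<longleftrightarrow> ?R")
proof
  define \<Gamma> where "\<Gamma> = {c. arclength_curve \<Omega> c \<and>
        \<not> ennreal (d (u (fst c (snd c))) (u (fst c 0))) \<le> line_integral g c}"
  {
    assume ?L
    then have g: "g \<in> borel_measurable borel" and "p_modulus \<mu> \<Omega> p \<Gamma> = 0"
      by (auto simp: p_weak_upper_gradient_def \<Gamma>_def)
    then obtain \<rho> where \<rho>: "\<rho> \<in> borel_measurable borel" "p_mass \<mu> \<Omega> p \<rho> < top"
        "\<And>\<gamma> L. (\<gamma>, L) \<in> \<Gamma> \<Longrightarrow> arc_integral \<rho> \<gamma> 0 L = top"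
      using p_modulus_eq_0D[OF assms, of \<Gamma>] by (auto simp: \<Gamma>_def)
    have "ennreal (d (u (\<gamma> t)) (u (\<gamma> s))) \<le> arc_integral g \<gamma> s t"
      if c: "arclength_curve \<Omega> (\<gamma>, L)" "arc_integral \<rho> \<gamma> 0 L < top" "0 \<le> s" "s \<le> t" "t \<le> L" for \<gamma> L s t
    proof -
      let ?c = "(\<lambda>\<tau>. \<gamma> (s + \<tau>), t - s)"
      note cont = arclength_curveD(3)[OF c(1)]
      have "line_integral \<rho> ?c \<le> arc_integral \<rho> \<gamma> 0 L"
        using line_integral_subcurve[OF \<rho>(1) cont c(3,5)] arc_integral_subset[OF c(3,5)] by simp
      then have "?c \<notin> \<Gamma>" using \<rho>(3) c(2) by (auto simp: line_integral_eq_arc_integral)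
      then show ?thesis
        using arclength_curve_subcurve[OF c(1,3,4,5)] line_integral_subcurve[OF g cont c(3,5)]
        by (simp add: \<Gamma>_def)
    qed
    with g \<rho> show ?R by blast
  next
    assume ?R
    then obtain \<rho> where g: "g \<in> borel_measurable borel" and \<rho>: "\<rho> \<in> borel_measurable borel" "p_mass \<mu> \<Omega> p \<rho> < top"
      "\<And>\<gamma> L s t. arclength_curve \<Omega> (\<gamma>, L) \<Longrightarrow> arc_integral \<rho> \<gamma> 0 L < top \<Longrightarrow> 0 \<le> s \<Longrightarrow> s \<le> t \<Longrightarrow> t \<le> L
        \<Longrightarrow> ennreal (d (u (\<gamma> t)) (u (\<gamma> s))) \<le> arc_integral g \<gamma> s t"
      by blast
    have "p_modulus \<mu> \<Omega> p \<Gamma> = 0"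
    proof (rule p_modulus_eq_0I[OF assms \<rho>(1,2)])
      fix \<gamma> L assume "(\<gamma>, L) \<in> \<Gamma>"
      then have "arclength_curve \<Omega> (\<gamma>, L)" "\<not> ennreal (d (u (\<gamma> L)) (u (\<gamma> 0))) \<le> arc_integral g \<gamma> 0 L"
        by (auto simp: \<Gamma>_def line_integral_eq_arc_integral)
      moreover from this have "0 \<le> L" by (simp add: arclength_curveD)
      ultimately show "arclength_curve \<Omega> (\<gamma>, L) \<and> arc_integral \<rho> \<gamma> 0 L = top"
        using \<rho>(3)[of \<gamma> L 0 L] by (auto simp: less_top[symmetric])
    qed
    with g show ?L by (simp add: p_weak_upper_gradient_def \<Gamma>_def)
  }
qed

lemma upper_gradientD:
  assumes "upper_gradient \<Omega> d u g" "arclength_curve \<Omega> (\<gamma>, L)" "0 \<le> s" "s \<le> t" "t \<le> L"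
  shows "ennreal (d (u (\<gamma> t)) (u (\<gamma> s))) \<le> arc_integral g \<gamma> s t"
proof -
  have g: "g \<in> borel_measurable borel" using assms(1) by (simp add: upper_gradient_def)
  have "ennreal (d (u (\<gamma> (s + (t - s)))) (u (\<gamma> (s + 0)))) \<le> line_integral g (\<lambda>\<tau>. \<gamma> (s + \<tau>), t - s)"
    using arclength_curve_subcurve[OF assms(2-5)] assms(1) unfolding upper_gradient_def by fastforce
  then show ?thesis
    using line_integral_subcurve[OF g arclength_curveD(3)[OF assms(2)] assms(3,5)] by simp
qed

text \<open>On the exceptional curves a small multiple of \<rho> already has infinite integral, so
  raising g to it repairs the inequality there. The conversion matters because admissibility
  provides the Poincare inequality for genuine upper gradients.\<close>

lemma p_weak_upper_gradient_approx:
  assumes "sets \<mu> = sets borel" "\<Omega> \<in> sets borel" "0 < p" "p_weak_upper_gradient \<mu> \<Omega> p d u g" "0 < e"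
  obtains g' where "upper_gradient \<Omega> d u g'" "p_mass \<mu> \<Omega> p g' \<le> p_mass \<mu> \<Omega> p g + ennreal e"
proof -
  obtain \<rho> where g: "g \<in> borel_measurable borel" and \<rho>: "\<rho> \<in> borel_measurable borel" "p_mass \<mu> \<Omega> p \<rho> < top"
      "\<And>\<gamma> L s t. arclength_curve \<Omega> (\<gamma>, L) \<Longrightarrow> arc_integral \<rho> \<gamma> 0 L < top \<Longrightarrow> 0 \<le> s \<Longrightarrow> s \<le> t \<Longrightarrow> t \<le> L
        \<Longrightarrow> ennreal (d (u (\<gamma> t)) (u (\<gamma> s))) \<le> arc_integral g \<gamma> s t"
    using assms(4) unfolding p_weak_upper_gradient_iff[OF assms(1-3)] by blast
  obtain c where c: "0 < c" "ennreal (c powr p) * p_mass \<mu> \<Omega> p \<rho> \<le> ennreal e"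
    using ennreal_powr_scale[OF assms(3,5) \<rho>(2)] by blast
  define g' where "g' = (\<lambda>x. max (g x) (ennreal c * \<rho> x))"
  have m: "g' \<in> borel_measurable borel" using g \<rho>(1) unfolding g'_def by measurable
  have "p_mass \<mu> \<Omega> p g' \<le> p_mass \<mu> \<Omega> p g + p_mass \<mu> \<Omega> p (\<lambda>x. ennreal c * \<rho> x)"
    unfolding g'_def using g \<rho>(1) by (intro p_mass_max assms(1-3)) (simp_all add: borel_measurable_times)
  also have "\<dots> \<le> p_mass \<mu> \<Omega> p g + ennreal e"
    using c p_mass_cmult[OF assms(1,2) \<rho>(1) c(1), of p] by (intro add_left_mono) simp
  finally have mass: "p_mass \<mu> \<Omega> p g' \<le> p_mass \<mu> \<Omega> p g + ennreal e" .
  have "upper_gradient \<Omega> d u g'"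
    unfolding upper_gradient_def
  proof (intro conjI m allI impI)
    fix cu assume cu: "arclength_curve \<Omega> cu"
    obtain \<gamma> L where [simp]: "cu = (\<gamma>, L)" by (cases cu)
    note cD = arclength_curveD[OF cu[simplified]]
    have "ennreal (d (u (\<gamma> L)) (u (\<gamma> 0))) \<le> arc_integral g' \<gamma> 0 L"
    proof (cases "arc_integral \<rho> \<gamma> 0 L < top")
      case True
      have "ennreal (d (u (\<gamma> L)) (u (\<gamma> 0))) \<le> arc_integral g \<gamma> 0 L"
        using \<rho>(3)[of \<gamma> L 0 L] cu True cD by simp
      also have "\<dots> \<le> arc_integral g' \<gamma> 0 L" by (rule arc_integral_mono) (simp add: g'_def)
      finally show ?thesis .
    next
      case False
      have "top = arc_integral (\<lambda>x. ennreal c * \<rho> x) \<gamma> 0 L"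
        using False c(1) arc_integral_cmult[OF \<rho>(1) cD(3), of 0 L "ennreal c"]
        by (simp add: less_top[symmetric] ennreal_mult_top)
      also have "\<dots> \<le> arc_integral g' \<gamma> 0 L" by (rule arc_integral_mono) (simp add: g'_def)
      finally show ?thesis by (simp add: top_unique)
    qed
    then show "ennreal (d (u (fst cu (snd cu))) (u (fst cu 0))) \<le> line_integral g' cu"
      by (simp add: line_integral_eq_arc_integral)
  qed
  with mass that show thesis by blast
qed

section \<open>Minimal weak upper gradients\<close>

text \<open>Scaling the n-th density to p-mass at most 2^(-n) lets one supremum P absorb them all.
  Exceptional families, null sets and requirements of finite line integrals are merged in this
  way.\<close>

lemma p_mass_dominating_countable:
  fixes \<rho> :: "nat \<Rightarrow> 'a::metric_space \<Rightarrow> ennreal"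
  assumes "sets \<mu> = sets borel" "\<Omega> \<in> sets borel" "0 < p"
    and \<rho>: "\<And>n. \<rho> n \<in> borel_measurable borel" "\<And>n. p_mass \<mu> \<Omega> p (\<rho> n) < top"
  obtains P where "P \<in> borel_measurable borel" "p_mass \<mu> \<Omega> p P < top"
    "\<And>n \<gamma> L. arclength_curve \<Omega> (\<gamma>, L) \<Longrightarrow> arc_integral P \<gamma> 0 L < top \<Longrightarrow> arc_integral (\<rho> n) \<gamma> 0 L < top"
proof -
  have "\<exists>c>0. ennreal (c powr p) * p_mass \<mu> \<Omega> p (\<rho> n) \<le> ennreal ((1/2)^n)" for n
    using ennreal_powr_scale[OF assms(3) _ \<rho>(2)[of n], of "(1/2)^n"] by auto
  then obtain c where c: "\<And>n. 0 < c n" 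
      "\<And>n. ennreal (c n powr p) * p_mass \<mu> \<Omega> p (\<rho> n) \<le> ennreal ((1/2)^n)" by metis
  note [measurable] = \<rho>(1)
  define P where "P = (\<lambda>x. SUP n. ennreal (c n) * \<rho> n x)"
  have P [measurable]: "P \<in> borel_measurable borel" unfolding P_def by measurable
  have "p_mass \<mu> \<Omega> p P \<le> (\<Sum>n. p_mass \<mu> \<Omega> p (\<lambda>x. ennreal (c n) * \<rho> n x))"
    unfolding P_def by (rule p_mass_SUP[OF assms(1,2) _ assms(3)]) measurable
  also have "\<dots> = (\<Sum>n. ennreal (c n powr p) * p_mass \<mu> \<Omega> p (\<rho> n))"
    by (subst p_mass_cmult[OF assms(1,2)]) (use \<rho>(1) c in auto)
  also have "\<dots> \<le> (\<Sum>n. ennreal ((1/2)^n))"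
    by (intro suminf_le c) auto
  also have "\<dots> = ennreal 2"
    by (subst suminf_ennreal2) (simp_all add: summable_geometric suminf_geometric)
  finally have fin: "p_mass \<mu> \<Omega> p P < top" by (simp add: le_less_trans)
  have "arc_integral (\<rho> n) \<gamma> 0 L < top"
    if cu: "arclength_curve \<Omega> (\<gamma>, L)" "arc_integral P \<gamma> 0 L < top" for n \<gamma> L
  proof -
    have "ennreal (c n) * arc_integral (\<rho> n) \<gamma> 0 L = arc_integral (\<lambda>x. ennreal (c n) * \<rho> n x) \<gamma> 0 L"
      using arc_integral_cmult[OF \<rho>(1) arclength_curveD(3)[OF cu(1)], of 0 L "ennreal (c n)" n] by simp
    also have "\<dots> \<le> arc_integral P \<gamma> 0 L"
      by (rule arc_integral_mono) (auto simp: P_def intro: SUP_upper)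
    finally have "ennreal (c n) * arc_integral (\<rho> n) \<gamma> 0 L < top" using cu(2) by (simp add: le_less_trans)
    then show ?thesis using c(1)[of n] by (auto simp: ennreal_mult_less_top)
  qed
  with that[OF P fin] show thesis by blast
qed

text \<open>Along one curve, \<delta> s t is the distance between the values at the times s and t,
  and a, b are two densities bounding it. That their minimum bounds it as well is the lattice
  property of weak upper gradients. It is reached by switching between a and b on larger and larger
  classes of sets, without differentiating along the curve.\<close>

locale two_bounds =
  fixes \<delta> :: "real \<Rightarrow> real \<Rightarrow> ennreal" and a b :: "real \<Rightarrow> ennreal" and L :: real
  assumes meas [measurable]: "a \<in> borel_measurable borel" "b \<in> borel_measurable borel"
    and tri: "\<And>s r t. 0 \<le> s \<Longrightarrow> s \<le> r \<Longrightarrow> r \<le> t \<Longrightarrow> t \<le> L \<Longrightarrow> \<delta> s t \<le> \<delta> s r + \<delta> r t"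
    and bounds: "\<And>s t. 0 \<le> s \<Longrightarrow> s \<le> t \<Longrightarrow> t \<le> L \<Longrightarrow> \<delta> s t \<le> (\<integral>\<^sup>+\<tau>\<in>{s..t}. a \<tau> \<partial>lborel)"
      "\<And>s t. 0 \<le> s \<Longrightarrow> s \<le> t \<Longrightarrow> t \<le> L \<Longrightarrow> \<delta> s t \<le> (\<integral>\<^sup>+\<tau>\<in>{s..t}. b \<tau> \<partial>lborel)"
    and fin: "(\<integral>\<^sup>+\<tau>\<in>{0..L}. a \<tau> \<partial>lborel) < top" "(\<integral>\<^sup>+\<tau>\<in>{0..L}. b \<tau> \<partial>lborel) < top"
begin

definition bounded_via :: "real set \<Rightarrow> bool" where
  "bounded_via A \<longleftrightarrow> A \<in> sets borel \<and> (\<forall>s t. 0 \<le> s \<longrightarrow> s \<le> t \<longrightarrow> t \<le> L \<longrightarrow>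
     \<delta> s t \<le> (\<integral>\<^sup>+\<tau>\<in>{s..t}. (if \<tau> \<in> A then a \<tau> else b \<tau>) \<partial>lborel))"

text \<open>The triangle inequality splits [s, t] at the ends of the interval: inside, the bound by
  a applies; outside, the switching set is still A.\<close>

lemma bounded_via_insert_interval:
  assumes A: "bounded_via A"
  shows "bounded_via ({c<..<d} \<union> A)"
proof (cases "c < d")
  case cd: True
  let ?f = "\<lambda>\<tau>. if \<tau> \<in> {c<..<d} \<union> A then a \<tau> else b \<tau>"
  have A_sets [measurable]: "A \<in> sets borel" using A by (simp add: bounded_via_def)
  have f [measurable]: "?f \<in> borel_measurable borel" by measurable
  show ?thesis
    unfolding bounded_via_def
  proof (intro conjI allI impI)
    fix s t :: real assume st: "0 \<le> s" "s \<le> t" "t \<le> L"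
    \<comment> \<open>Clamping both ends to [s, t] treats all relative positions at once. The
      one-point pieces that arise are null sets.\<close>
    define c' where "c' = max s (min t c)"
    define d' where "d' = max s (min t d)"
    have cd': "s \<le> c'" "c' \<le> d'" "d' \<le> t" using cd st by (auto simp: c'_def d'_def)
    have "\<delta> s t \<le> \<delta> s c' + \<delta> c' t" using cd' st by (intro tri) auto
    also have "\<dots> \<le> \<delta> s c' + (\<delta> c' d' + \<delta> d' t)" using cd' st by (intro add_left_mono tri) auto
    also have "\<dots> \<le> (\<integral>\<^sup>+\<tau>\<in>{s..c'}. ?f \<tau> \<partial>lborel)
       + ((\<integral>\<^sup>+\<tau>\<in>{c'..d'}. ?f \<tau> \<partial>lborel) + (\<integral>\<^sup>+\<tau>\<in>{d'..t}. ?f \<tau> \<partial>lborel))"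
    proof (intro add_mono)
      have "\<delta> s c' \<le> (\<integral>\<^sup>+\<tau>\<in>{s..c'}. (if \<tau> \<in> A then a \<tau> else b \<tau>) \<partial>lborel)"
        using A cd' st unfolding bounded_via_def by (meson order_trans)
      also have "\<dots> = (\<integral>\<^sup>+\<tau>\<in>{s..c'}. ?f \<tau> \<partial>lborel)"
      proof (rule nn_integral_cong_AE)
        show "AE \<tau> in lborel. (if \<tau> \<in> A then a \<tau> else b \<tau>) * indicator {s..c'} \<tau> = ?f \<tau> * indicator {s..c'} \<tau>"
          using AE_lborel_singleton[of s]
          by eventually_elim (auto simp: c'_def split: split_indicator)
      qed
      finally show "\<delta> s c' \<le> (\<integral>\<^sup>+\<tau>\<in>{s..c'}. ?f \<tau> \<partial>lborel)" .
      have "\<delta> d' t \<le> (\<integral>\<^sup>+\<tau>\<in>{d'..t}. (if \<tau> \<in> A then a \<tau> else b \<tau>) \<partial>lborel)"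
        using A cd' st unfolding bounded_via_def by (meson order_trans)
      also have "\<dots> = (\<integral>\<^sup>+\<tau>\<in>{d'..t}. ?f \<tau> \<partial>lborel)"
      proof (rule nn_integral_cong_AE)
        show "AE \<tau> in lborel. (if \<tau> \<in> A then a \<tau> else b \<tau>) * indicator {d'..t} \<tau> = ?f \<tau> * indicator {d'..t} \<tau>"
          using AE_lborel_singleton[of t]
          by eventually_elim (auto simp: d'_def split: split_indicator)
      qed
      finally show "\<delta> d' t \<le> (\<integral>\<^sup>+\<tau>\<in>{d'..t}. ?f \<tau> \<partial>lborel)" .
      have "\<delta> c' d' \<le> (\<integral>\<^sup>+\<tau>\<in>{c'..d'}. a \<tau> \<partial>lborel)"
        using cd' st by (intro bounds) auto
      also have "\<dots> = (\<integral>\<^sup>+\<tau>\<in>{c'..d'}. ?f \<tau> \<partial>lborel)"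
      proof (rule nn_integral_cong_AE)
        show "AE \<tau> in lborel. a \<tau> * indicator {c'..d'} \<tau> = ?f \<tau> * indicator {c'..d'} \<tau>"
          using AE_lborel_singleton[of c'] AE_lborel_singleton[of d']
        proof eventually_elim
          case (elim \<tau>)
          show ?case
          proof (cases "\<tau> \<in> {c'..d'}")
            case True
            then have "c' < \<tau>" "\<tau> < d'" using elim by auto
            moreover have "s < \<tau>" "\<tau> < t" using cd' calculation by linarith+
            ultimately have "c < \<tau>" "\<tau> < d" unfolding c'_def d'_def by linarith+
            then show ?thesis by simp
          qed simp
        qed
      qed
      finally show "\<delta> c' d' \<le> (\<integral>\<^sup>+\<tau>\<in>{c'..d'}. ?f \<tau> \<partial>lborel)" .
    qed
    also have "\<dots> = (\<integral>\<^sup>+\<tau>\<in>{s..t}. ?f \<tau> \<partial>lborel)"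
      using arc_integral_split[OF f continuous_on_id, of s c' t t] 
        arc_integral_split[OF f continuous_on_id, of c' d' t t] cd' st by simp
    finally show "\<delta> s t \<le> (\<integral>\<^sup>+\<tau>\<in>{s..t}. ?f \<tau> \<partial>lborel)" .
  qed simp
qed (use assms in simp)

text \<open>Dominated convergence with majorant a + b; this is where finiteness of both integrals
  enters.\<close>

lemma bounded_via_limit:
  fixes A :: "nat \<Rightarrow> real set"
  assumes A: "\<And>n. bounded_via (A n)" and B: "B \<in> sets borel"
    and lim: "\<And>\<tau>. eventually (\<lambda>n. \<tau> \<in> A n \<longleftrightarrow> \<tau> \<in> B) sequentially"
  shows "bounded_via B"
  unfolding bounded_via_def
proof (intro conjI allI impI)
  fix s t :: real assume st: "0 \<le> s" "s \<le> t" "t \<le> L"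
  have [measurable]: "A n \<in> sets borel" for n using A by (simp add: bounded_via_def)
  note [measurable] = B
  have "(\<lambda>n. \<integral>\<^sup>+\<tau>\<in>{s..t}. (if \<tau> \<in> A n then a \<tau> else b \<tau>) \<partial>lborel)
     \<longlonglongrightarrow> (\<integral>\<^sup>+\<tau>\<in>{s..t}. (if \<tau> \<in> B then a \<tau> else b \<tau>) \<partial>lborel)"
  proof (rule nn_integral_dominated_convergence[where w="\<lambda>\<tau>. a \<tau> * indicator {0..L} \<tau> + b \<tau> * indicator {0..L} \<tau>"])
    show "(\<integral>\<^sup>+ \<tau>. a \<tau> * indicator {0..L} \<tau> + b \<tau> * indicator {0..L} \<tau> \<partial>lborel) < \<infinity>"
      using fin by (subst nn_integral_add) (auto simp: less_top)
    show "AE \<tau> in lborel. (\<lambda>n. (if \<tau> \<in> A n then a \<tau> else b \<tau>) * indicator {s..t} \<tau>)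
       \<longlonglongrightarrow> (if \<tau> \<in> B then a \<tau> else b \<tau>) * indicator {s..t} \<tau>"
    proof (rule AE_I2)
      fix \<tau> show "(\<lambda>n. (if \<tau> \<in> A n then a \<tau> else b \<tau>) * indicator {s..t} \<tau>)
       \<longlonglongrightarrow> (if \<tau> \<in> B then a \<tau> else b \<tau>) * indicator {s..t} \<tau>"
        by (rule tendsto_eventually, use lim[of \<tau>] in eventually_elim) auto
    qed
  qed (use st in \<open>auto split: split_indicator\<close>)
  moreover have "\<delta> s t \<le> (\<integral>\<^sup>+\<tau>\<in>{s..t}. (if \<tau> \<in> A n then a \<tau> else b \<tau>) \<partial>lborel)" for n
    using A[of n] st unfolding bounded_via_def by blast
  ultimately show "\<delta> s t \<le> (\<integral>\<^sup>+\<tau>\<in>{s..t}. (if \<tau> \<in> B then a \<tau> else b \<tau>) \<partial>lborel)"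
    by (intro LIMSEQ_le_const) auto
qed (rule B)

text \<open>An open set is an increasing limit of finite unions of intervals, and these are inserted
  one at a time, starting from the empty set, where b alone is used.\<close>

lemma bounded_via_open:
  assumes "open U" shows "bounded_via U"
proof -
  obtain D where D: "countable D" "D \<subseteq> Pow U" "\<And>X. X \<in> D \<Longrightarrow> \<exists>c d. X = box c d" "\<Union>D = U"
    using open_countable_Union_open_box[OF assms] by metis
  have empty: "bounded_via {}" using bounds(2) by (auto simp: bounded_via_def)
  show ?thesis
  proof (cases "D = {}")
    case True with D(4) empty show ?thesis by simp
  next
    case False
    define A where "A = (\<lambda>n. \<Union>i<n. from_nat_into D i)"
    have "bounded_via (A n)" for n
    proof (induction n)
      case 0 then show ?case using empty by (simp add: A_def)
    next
      case (Suc n)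
      obtain c d where cd: "from_nat_into D n = {c<..<d}"
        using D(3)[OF from_nat_into[OF False]] box_real(1) by metis
      have "A (Suc n) = {c<..<d} \<union> A n" by (simp add: A_def lessThan_Suc cd)
      then show ?case using bounded_via_insert_interval[OF Suc] by simp
    qed
    then show ?thesis
    proof (rule bounded_via_limit)
      show "U \<in> sets borel" using assms by simp
      fix \<tau>
      show "eventually (\<lambda>n. \<tau> \<in> A n \<longleftrightarrow> \<tau> \<in> U) sequentially"
      proof (cases "\<tau> \<in> U")
        case True
        then obtain i where i: "\<tau> \<in> from_nat_into D i"
          using D(4) from_nat_into_surj[OF D(1)] by (metis UnionE)
        have "\<tau> \<in> A n" if "n \<ge> Suc i" for n using that i unfolding A_def by force
        with True show ?thesis unfolding eventually_sequentially by blast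
      next
        case F: False
        then have "\<tau> \<notin> A n" for n
          using D(4) from_nat_into[OF False] by (auto simp: A_def)
        with F show ?thesis by simp
      qed
    qed
  qed
qed

text \<open>The ideal switching set {a \<le> b} is approximated from outside by open sets, whose
  intersection V differs from it by a null set.\<close>

lemma bounded_by_min:
  assumes st: "0 \<le> s" "s \<le> t" "t \<le> L"
  shows "\<delta> s t \<le> (\<integral>\<^sup>+\<tau>\<in>{s..t}. min (a \<tau>) (b \<tau>) \<partial>lborel)"
proof -
  define S where "S = {\<tau>. a \<tau> \<le> b \<tau>}"
  have S [measurable]: "S \<in> sets borel" unfolding S_def by measurable
  have "\<exists>U. open U \<and> S \<subseteq> U \<and> emeasure lborel (U - S) < ennreal ((1/2)^n)" for n
    using outer_regular_lborel[OF S, of "(1/2)^n"] by (metis zero_less_divide_1_iff zero_less_numeral zero_less_power)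
  then obtain U where U: "\<And>n. open (U n)" "\<And>n. S \<subseteq> U n" "\<And>n. emeasure lborel (U n - S) < ennreal ((1/2)^n)"
    by metis
  \<comment> \<open>Finite intersections stay open and decrease, so membership in them eventually
    agrees with membership in V.\<close>
  define W where "W = (\<lambda>n. \<Inter>i\<le>n. U i)"
  define V where "V = (\<Inter>i. U i)"
  have [measurable]: "U n \<in> sets borel" for n using U(1) by simp
  have V [measurable]: "V \<in> sets borel" unfolding V_def by measurable
  have "bounded_via V"
  proof (rule bounded_via_limit)
    show "bounded_via (W n)" for n
      unfolding W_def by (intro bounded_via_open open_INT) (use U(1) in auto)
    fix \<tau>
    show "eventually (\<lambda>n. \<tau> \<in> W n \<longleftrightarrow> \<tau> \<in> V) sequentially"
    proof (cases "\<tau> \<in> V")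
      case False
      then obtain i where "\<tau> \<notin> U i" by (auto simp: V_def)
      then have "\<tau> \<notin> W n" if "n \<ge> i" for n using that by (auto simp: W_def)
      with False show ?thesis unfolding eventually_sequentially by blast
    qed (auto simp: V_def W_def)
  qed (rule V)
  then have "\<delta> s t \<le> (\<integral>\<^sup>+\<tau>\<in>{s..t}. (if \<tau> \<in> V then a \<tau> else b \<tau>) \<partial>lborel)"
    using st by (auto simp: bounded_via_def)
  also have "\<dots> = (\<integral>\<^sup>+\<tau>\<in>{s..t}. min (a \<tau>) (b \<tau>) \<partial>lborel)"
  proof (rule nn_integral_cong_AE)
    have "emeasure lborel (V - S) = 0"
    proof (rule ennreal_eq_0_epsilon)
      fix e :: real assume "0 < e"
      then obtain n where n: "(1/2)^n < e" using real_arch_pow_inv[of e "1/2"] by auto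
      have "emeasure lborel (V - S) \<le> emeasure lborel (U n - S)"
        by (intro emeasure_mono) (auto simp: V_def)
      also have "\<dots> \<le> ennreal e" using U(3)[of n] n by (meson ennreal_leI less_imp_le order_trans)
      finally show "emeasure lborel (V - S) \<le> ennreal e" .
    qed
    then have "AE \<tau> in lborel. \<tau> \<notin> V - S" by (intro AE_not_in) (auto simp: null_sets_def)
    then show "AE \<tau> in lborel. (if \<tau> \<in> V then a \<tau> else b \<tau>) * indicator {s..t} \<tau> = min (a \<tau>) (b \<tau>) * indicator {s..t} \<tau>"
    proof eventually_elim
      case (elim \<tau>)
      have "S \<subseteq> V" using U(2) by (auto simp: V_def)
      with elim show ?case by (auto simp: S_def min_def split: split_indicator)
    qed
  qed
  finally show ?thesis .
qed

end

lemma p_weak_upper_gradient_min: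
  assumes "sets \<mu> = sets borel" "\<Omega> \<in> sets borel" "0 < p"
    and tri: "\<And>x y z. x \<in> \<Omega> \<Longrightarrow> y \<in> \<Omega> \<Longrightarrow> z \<in> \<Omega> \<Longrightarrow> d (u x) (u z) \<le> d (u x) (u y) + d (u y) (u z)"
    and nonneg: "\<And>x y. x \<in> \<Omega> \<Longrightarrow> y \<in> \<Omega> \<Longrightarrow> 0 \<le> d (u x) (u y)"
    and g: "p_weak_upper_gradient \<mu> \<Omega> p d u g" "p_mass \<mu> \<Omega> p g < top"
    and h: "p_weak_upper_gradient \<mu> \<Omega> p d u h" "p_mass \<mu> \<Omega> p h < top"
  shows "p_weak_upper_gradient \<mu> \<Omega> p d u (\<lambda>x. min (g x) (h x))"
proof -
  note iff = p_weak_upper_gradient_iff[OF assms(1-3)]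
  have gh [measurable]: "g \<in> borel_measurable borel" "h \<in> borel_measurable borel"
    using g(1) h(1) by (auto simp: iff)
  obtain \<rho>1 where \<rho>1: "\<rho>1 \<in> borel_measurable borel" "p_mass \<mu> \<Omega> p \<rho>1 < top"
    "\<And>\<gamma> L s t. arclength_curve \<Omega> (\<gamma>, L) \<Longrightarrow> arc_integral \<rho>1 \<gamma> 0 L < top \<Longrightarrow> 0 \<le> s \<Longrightarrow> s \<le> t \<Longrightarrow> t \<le> L
      \<Longrightarrow> ennreal (d (u (\<gamma> t)) (u (\<gamma> s))) \<le> arc_integral g \<gamma> s t"
    using g(1) unfolding iff by blast
  obtain \<rho>2 where \<rho>2: "\<rho>2 \<in> borel_measurable borel" "p_mass \<mu> \<Omega> p \<rho>2 < top"
    "\<And>\<gamma> L s t. arclength_curve \<Omega> (\<gamma>, L) \<Longrightarrow> arc_integral \<rho>2 \<gamma> 0 L < top \<Longrightarrow> 0 \<le> s \<Longrightarrow> s \<le> t \<Longrightarrow> t \<le> L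
      \<Longrightarrow> ennreal (d (u (\<gamma> t)) (u (\<gamma> s))) \<le> arc_integral h \<gamma> s t"
    using h(1) unfolding iff by blast
  \<comment> \<open>Besides the two exceptional densities, g and h themselves are included, because
    \<open>two_bounds\<close> demands finite integrals of both along the curve.\<close>
  define R where "R = (\<lambda>n::nat. if n = 0 then \<rho>1 else if n = 1 then \<rho>2 else if n = 2 then g else h)"
  obtain P where P: "P \<in> borel_measurable borel" "p_mass \<mu> \<Omega> p P < top"
    "\<And>n \<gamma> L. arclength_curve \<Omega> (\<gamma>, L) \<Longrightarrow> arc_integral P \<gamma> 0 L < top \<Longrightarrow> arc_integral (R n) \<gamma> 0 L < top"
  proof (rule p_mass_dominating_countable[OF assms(1-3), of R])
    show "R n \<in> borel_measurable borel" "p_mass \<mu> \<Omega> p (R n) < top" for n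
      using \<rho>1 \<rho>2 g h gh by (auto simp: R_def)
  qed blast
  have "ennreal (d (u (\<gamma> t)) (u (\<gamma> s))) \<le> arc_integral (\<lambda>x. min (g x) (h x)) \<gamma> s t"
    if c: "arclength_curve \<Omega> (\<gamma>, L)" "arc_integral P \<gamma> 0 L < top" "0 \<le> s" "s \<le> t" "t \<le> L" for \<gamma> L s t
  proof -
    have fin: "arc_integral \<rho>1 \<gamma> 0 L < top" "arc_integral \<rho>2 \<gamma> 0 L < top" 
      "arc_integral g \<gamma> 0 L < top" "arc_integral h \<gamma> 0 L < top"
      using P(3)[OF c(1,2), of 0] P(3)[OF c(1,2), of 1] P(3)[OF c(1,2), of 2] P(3)[OF c(1,2), of 3]
      by (auto simp: R_def)
    note cD = arclength_curveD[OF c(1)]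
    \<comment> \<open>Cutting off outside [0, L] makes the densities measurable on the whole line,
      where nothing is known about the curve.\<close>
    let ?a = "\<lambda>\<tau>. g (\<gamma> \<tau>) * indicator {0..L} \<tau>" and ?b = "\<lambda>\<tau>. h (\<gamma> \<tau>) * indicator {0..L} \<tau>"
    have restr: "(\<integral>\<^sup>+\<tau>\<in>{s..t}. (f (\<gamma> \<tau>) * indicator {0..L} \<tau>) \<partial>lborel) = arc_integral f \<gamma> s t" 
      if "0 \<le> s" "t \<le> L" for s t and f :: "'a \<Rightarrow> ennreal"
      by (intro nn_integral_cong) (use that in \<open>auto split: split_indicator\<close>)
    interpret two_bounds "\<lambda>s t. ennreal (d (u (\<gamma> t)) (u (\<gamma> s)))" ?a ?b L
    proof
      show "?a \<in> borel_measurable borel" "?b \<in> borel_measurable borel"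
        using arc_measurable[OF gh(1) cD(3), of 0 L] arc_measurable[OF gh(2) cD(3), of 0 L] by auto
      fix s r t assume st: "0 \<le> s" "s \<le> r" "r \<le> t" "t \<le> L"
      then have "\<gamma> s \<in> \<Omega>" "\<gamma> r \<in> \<Omega>" "\<gamma> t \<in> \<Omega>" using cD(2) by (auto simp: image_subset_iff)
      then have "ennreal (d (u (\<gamma> t)) (u (\<gamma> s))) \<le> ennreal (d (u (\<gamma> t)) (u (\<gamma> r)) + d (u (\<gamma> r)) (u (\<gamma> s)))"
        by (intro ennreal_leI tri)
      also have "\<dots> = ennreal (d (u (\<gamma> t)) (u (\<gamma> r))) + ennreal (d (u (\<gamma> r)) (u (\<gamma> s)))"
        using \<open>\<gamma> s \<in> \<Omega>\<close> \<open>\<gamma> r \<in> \<Omega>\<close> \<open>\<gamma> t \<in> \<Omega>\<close> by (intro ennreal_plus nonneg)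
      finally show "ennreal (d (u (\<gamma> t)) (u (\<gamma> s))) \<le> ennreal (d (u (\<gamma> r)) (u (\<gamma> s))) + ennreal (d (u (\<gamma> t)) (u (\<gamma> r)))"
        by (simp add: add.commute)
    next
      fix s t assume st: "0 \<le> s" "s \<le> t" "t \<le> L"
      show "ennreal (d (u (\<gamma> t)) (u (\<gamma> s))) \<le> (\<integral>\<^sup>+\<tau>\<in>{s..t}. ?a \<tau> \<partial>lborel)"
        unfolding restr[OF st(1,3)] by (rule \<rho>1(3)[OF c(1) fin(1) st])
      show "ennreal (d (u (\<gamma> t)) (u (\<gamma> s))) \<le> (\<integral>\<^sup>+\<tau>\<in>{s..t}. ?b \<tau> \<partial>lborel)"
        unfolding restr[OF st(1,3)] by (rule \<rho>2(3)[OF c(1) fin(2) st])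
    next
      show "(\<integral>\<^sup>+\<tau>\<in>{0..L}. ?a \<tau> \<partial>lborel) < top" "(\<integral>\<^sup>+\<tau>\<in>{0..L}. ?b \<tau> \<partial>lborel) < top"
        using fin by (simp_all add: restr)
    qed
    have "ennreal (d (u (\<gamma> t)) (u (\<gamma> s))) \<le> (\<integral>\<^sup>+\<tau>\<in>{s..t}. min (?a \<tau>) (?b \<tau>) \<partial>lborel)"
      by (rule bounded_by_min[OF c(3-5)])
    also have "\<dots> = arc_integral (\<lambda>x. min (g x) (h x)) \<gamma> s t"
      by (intro nn_integral_cong) (use c in \<open>auto split: split_indicator\<close>)
    finally show ?thesis .
  qed
  with P show ?thesis unfolding iff by (intro conjI bexI[of _ P]) auto
qed

text \<open>Minima turn a sequence minimising the p-mass into a decreasing one, and its limit h is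
  again a weak upper gradient by monotone convergence along curves. For a competitor h' the minimum
  of h and h' cannot have smaller p-mass than h, so it equals h almost everywhere.\<close>

lemma minimal_p_weak_upper_gradient_exists:
  assumes "sets \<mu> = sets borel" "\<Omega> \<in> sets borel" "0 < p"
    and tri: "\<And>x y z. x \<in> \<Omega> \<Longrightarrow> y \<in> \<Omega> \<Longrightarrow> z \<in> \<Omega> \<Longrightarrow> d (u x) (u z) \<le> d (u x) (u y) + d (u y) (u z)"
    and nonneg: "\<And>x y. x \<in> \<Omega> \<Longrightarrow> y \<in> \<Omega> \<Longrightarrow> 0 \<le> d (u x) (u y)"
    and g0: "p_weak_upper_gradient \<mu> \<Omega> p d u g0" "p_mass \<mu> \<Omega> p g0 < top"
  shows "\<exists>g. minimal_p_weak_upper_gradient \<mu> \<Omega> p d u g"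
proof -
  note iff = p_weak_upper_gradient_iff[OF assms(1-3)]
  note [measurable_cong] = assms(1) and [measurable] = assms(2)
  define \<U> where "\<U> = {g. p_weak_upper_gradient \<mu> \<Omega> p d u g \<and> p_mass \<mu> \<Omega> p g < top}"
  have meas: "g \<in> borel_measurable borel" if "g \<in> \<U>" for g using that by (auto simp: \<U>_def iff)
  have min_in: "(\<lambda>x. min (g x) (h x)) \<in> \<U>" if "g \<in> \<U>" "h \<in> \<U>" for g h
  proof -
    have "p_mass \<mu> \<Omega> p (\<lambda>x. min (g x) (h x)) \<le> p_mass \<mu> \<Omega> p g" by (rule p_mass_mono[OF assms(3)]) simp
    moreover have "p_weak_upper_gradient \<mu> \<Omega> p d u (\<lambda>x. min (g x) (h x))"
      by (rule p_weak_upper_gradient_min[OF assms(1-3)]) (use that tri nonneg in \<open>auto simp: \<U>_def\<close>)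
    ultimately show ?thesis using that by (auto simp: \<U>_def intro: le_less_trans)
  qed
  define m where "m = (INF g\<in>\<U>. p_mass \<mu> \<Omega> p g)"
  have m_fin: "m < top" using g0 by (auto simp: m_def \<U>_def INF_less_iff)
  have "\<exists>g\<in>\<U>. p_mass \<mu> \<Omega> p g < m + ennreal ((1/2)^n)" for n
  proof -
    have "m < m + ennreal ((1/2)^n)" using m_fin by (cases m) (auto simp flip: ennreal_plus simp: ennreal_less_iff)
    then show ?thesis unfolding m_def INF_less_iff by blast
  qed
  then obtain f where f: "\<And>n. f n \<in> \<U>" "\<And>n. p_mass \<mu> \<Omega> p (f n) < m + ennreal ((1/2)^n)" by metis
  define G where "G = rec_nat (f 0) (\<lambda>n G x. min (G x) (f (Suc n) x))"
  have G_simps: "G 0 = f 0" "G (Suc n) = (\<lambda>x. min (G n x) (f (Suc n) x))" for n by (simp_all add: G_def)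
  have G_in: "G n \<in> \<U>" for n by (induction n) (auto simp: G_simps intro: f min_in)
  have G_le: "G n x \<le> f n x" for n x by (cases n) (auto simp: G_simps)
  have G_dec: "decseq (\<lambda>n. G n x)" for x by (rule decseq_SucI) (simp add: G_simps)
  note [measurable] = meas[OF G_in]
  define h where "h = (\<lambda>x. INF n. G n x)"
  have h [measurable]: "h \<in> borel_measurable borel" unfolding h_def by measurable
  have h_mass: "p_mass \<mu> \<Omega> p h \<le> m"
  proof (rule ennreal_le_epsilon)
    fix e :: real assume "0 < e"
    then obtain n where n: "(1/2)^n < e" using real_arch_pow_inv[of e "1/2"] by auto
    have "p_mass \<mu> \<Omega> p h \<le> p_mass \<mu> \<Omega> p (f n)"
      by (rule p_mass_mono[OF assms(3)]) (metis INF_lower UNIV_I h_def G_le order_trans)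
    also have "\<dots> \<le> m + ennreal ((1/2)^n)" using f(2)[of n] by simp
    also have "\<dots> \<le> m + ennreal e" using n by (intro add_left_mono ennreal_leI) simp
    finally show "p_mass \<mu> \<Omega> p h \<le> m + ennreal e" .
  qed
  define Q where "Q = (\<lambda>n \<rho>. \<rho> \<in> borel_measurable borel \<and> p_mass \<mu> \<Omega> p \<rho> < top \<and>
      (\<forall>\<gamma> L. arclength_curve \<Omega> (\<gamma>, L) \<longrightarrow> arc_integral \<rho> \<gamma> 0 L < top \<longrightarrow>
        (\<forall>s t. 0 \<le> s \<longrightarrow> s \<le> t \<longrightarrow> t \<le> L \<longrightarrow> ennreal (d (u (\<gamma> t)) (u (\<gamma> s))) \<le> arc_integral (G n) \<gamma> s t)))"
  have "\<exists>\<rho>. Q n \<rho>" for n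
    using G_in[of n] unfolding \<U>_def iff Q_def by blast
  then obtain \<rho> where "\<And>n. Q n (\<rho> n)" by metis
  then have \<rho>: "\<And>n. \<rho> n \<in> borel_measurable borel" "\<And>n. p_mass \<mu> \<Omega> p (\<rho> n) < top"
    "\<And>n \<gamma> L s t. arclength_curve \<Omega> (\<gamma>, L) \<Longrightarrow> arc_integral (\<rho> n) \<gamma> 0 L < top \<Longrightarrow> 0 \<le> s \<Longrightarrow> s \<le> t \<Longrightarrow> t \<le> L
      \<Longrightarrow> ennreal (d (u (\<gamma> t)) (u (\<gamma> s))) \<le> arc_integral (G n) \<gamma> s t" unfolding Q_def by blast+
  \<comment> \<open>The shift by one makes room for \<open>G 0\<close>, whose finite line integrals
    permit monotone convergence of the decreasing sequence.\<close>
  define R where "R = case_nat (G 0) \<rho>"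
  obtain P where P: "P \<in> borel_measurable borel" "p_mass \<mu> \<Omega> p P < top"
    "\<And>n \<gamma> L. arclength_curve \<Omega> (\<gamma>, L) \<Longrightarrow> arc_integral P \<gamma> 0 L < top \<Longrightarrow> arc_integral (R n) \<gamma> 0 L < top"
  proof (rule p_mass_dominating_countable[OF assms(1-3), of R])
    show "R n \<in> borel_measurable borel" "p_mass \<mu> \<Omega> p (R n) < top" for n
      using \<rho>(1,2) G_in[of 0] meas[OF G_in[of 0]] by (cases n; simp add: R_def \<U>_def)+
  qed blast
  have "ennreal (d (u (\<gamma> t)) (u (\<gamma> s))) \<le> arc_integral h \<gamma> s t"
    if c: "arclength_curve \<Omega> (\<gamma>, L)" "arc_integral P \<gamma> 0 L < top" "0 \<le> s" "s \<le> t" "t \<le> L" for \<gamma> L s t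
  proof -
    note cD = arclength_curveD[OF c(1)]
    have G0: "arc_integral (G 0) \<gamma> s t < top"
      using P(3)[OF c(1,2), of 0] arc_integral_subset[OF c(3,5), of "G 0" \<gamma>] by (simp add: R_def)
    have "arc_integral h \<gamma> s t = (\<integral>\<^sup>+\<tau>. (INF n. G n (\<gamma> \<tau>) * indicator {s..t} \<tau>) \<partial>lborel)"
      by (intro nn_integral_cong) (auto simp: h_def split: split_indicator)
    also have "\<dots> = (INF n. arc_integral (G n) \<gamma> s t)"
    proof (rule nn_integral_monotone_convergence_INF_decseq)
      show "decseq (\<lambda>n \<tau>. G n (\<gamma> \<tau>) * indicator {s..t} \<tau>)"
        by (rule decseq_SucI) (auto simp: le_fun_def G_simps split: split_indicator)
      show "(\<lambda>\<tau>. G n (\<gamma> \<tau>) * indicator {s..t} \<tau>) \<in> borel_measurable lborel" for n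
        using arc_measurable[OF meas[OF G_in[of n]] cD(3) c(3,5)] by simp
      show "arc_integral (G 0) \<gamma> s t < \<infinity>" using G0 by simp
    qed
    finally show ?thesis
      using \<rho>(3)[OF c(1) _ c(3-5)] P(3)[OF c(1,2), of "Suc n" for n]
      by (auto simp: R_def intro!: INF_greatest)
  qed
  with P h have h_in: "p_weak_upper_gradient \<mu> \<Omega> p d u h"
    unfolding iff by (intro conjI bexI[of _ P]) auto
  have h_fin: "p_mass \<mu> \<Omega> p h < top" using h_mass m_fin by simp
  have "AE x in \<mu>. x \<in> \<Omega> \<longrightarrow> h x \<le> h' x" if "h' \<in> \<U>" for h'
  proof -
    note [measurable] = meas[OF that]
    let ?f = "\<lambda>x. enn_powr (min (h x) (h' x)) p * indicator \<Omega> x" and ?g = "\<lambda>x. enn_powr (h x) p * indicator \<Omega> x"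
    have le: "?f x \<le> ?g x" for x by (auto split: split_indicator intro!: enn_powr_mono[OF assms(3)])
    have "(\<lambda>x. min (h x) (h' x)) \<in> \<U>" using h_in h_fin that by (intro min_in) (auto simp: \<U>_def)
    then have "m \<le> nn_integral \<mu> ?f" unfolding m_def by (rule INF_lower)
    with h_mass have ge: "nn_integral \<mu> ?g \<le> nn_integral \<mu> ?f" by (rule order_trans)
    have "(\<integral>\<^sup>+x. (?g x - ?f x) \<partial>\<mu>) = nn_integral \<mu> ?g - nn_integral \<mu> ?f"
    proof (rule nn_integral_diff)
      have "nn_integral \<mu> ?f \<le> nn_integral \<mu> ?g" by (intro nn_integral_mono le)
      with h_fin show "nn_integral \<mu> ?f \<noteq> \<infinity>" by auto
    qed (use le in \<open>auto intro!: AE_I2\<close>)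
    also have "\<dots> = 0" using ge h_fin by (simp add: diff_eq_0_iff_ennreal)
    finally have "AE x in \<mu>. ?g x - ?f x = 0"
      by (subst (asm) nn_integral_0_iff_AE) auto
    then show ?thesis
    proof eventually_elim
      case (elim x)
      show ?case
      proof
        assume x: "x \<in> \<Omega>"
        then have "enn_powr (h x) p \<le> enn_powr (min (h x) (h' x)) p"
          using elim by (auto simp: diff_eq_0_iff_ennreal)
        then have "h x \<le> min (h x) (h' x)" by (rule enn_powr_le_cancel[OF assms(3)])
        then show "h x \<le> h' x" by simp
      qed
    qed
  qed
  with h_in h_fin show ?thesis
    by (intro exI[of _ h]) (auto simp: minimal_p_weak_upper_gradient_def \<U>_def)
qed

text \<open>Whichever minimal gradient the choice operator in the energy picks, it lies below h
  almost everywhere.\<close>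

lemma p_energy_le:
  assumes "\<exists>g. minimal_p_weak_upper_gradient \<mu> \<Omega> p d u g" "0 < p"
    and "p_weak_upper_gradient \<mu> \<Omega> p d u h" "p_mass \<mu> \<Omega> p h < top"
  shows "p_energy \<mu> \<Omega> p d u \<le> p_mass \<mu> \<Omega> p h"
proof -
  define g where "g = (SOME g. minimal_p_weak_upper_gradient \<mu> \<Omega> p d u g)"
  have "minimal_p_weak_upper_gradient \<mu> \<Omega> p d u g" unfolding g_def by (rule someI_ex[OF assms(1)])
  then have "AE x in \<mu>. x \<in> \<Omega> \<longrightarrow> g x \<le> h x"
    using assms(3,4) by (auto simp: minimal_p_weak_upper_gradient_def)
  then have "p_mass \<mu> \<Omega> p g \<le> p_mass \<mu> \<Omega> p h"
    by (intro nn_integral_mono_AE, eventually_elim) (auto split: split_indicator intro: enn_powr_mono[OF assms(2)])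
  then show ?thesis using assms(1) by (simp add: p_energy_def g_def)
qed

section \<open>The ultra-completion\<close>

locale ultrafilter =
  fixes F :: "nat filter"
  assumes nonprincipal: "nonprincipal_ultrafilter F"
begin

lemma ne_bot [simp]: "F \<noteq> bot"
  using nonprincipal by (simp add: nonprincipal_ultrafilter_def)

lemma ultra: "eventually (\<lambda>n. n \<in> A) F \<or> eventually (\<lambda>n. n \<notin> A) F"
  using nonprincipal unfolding nonprincipal_ultrafilter_def by blast

lemma le_sequentially: "F \<le> sequentially"
proof (rule filter_leI)
  fix P assume "eventually P sequentially"
  then obtain N where N: "\<And>n. n \<ge> N \<Longrightarrow> P n" by (auto simp: eventually_sequentially)
  have "eventually (\<lambda>n. n \<notin> {..<N}) F"
    using nonprincipal unfolding nonprincipal_ultrafilter_def by blast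
  then show "eventually P F" by eventually_elim (use N in auto)
qed

lemma tendsto_sequentially: "(f \<longlongrightarrow> l) sequentially \<Longrightarrow> (f \<longlongrightarrow> l) F"
  using le_sequentially by (rule tendsto_mono)

text \<open>The limit is the supremum of all levels that are eventually below f. For a level above
  it, the ultrafilter property turns the failure of this into the opposite inequality holding
  eventually.\<close>

lemma bounded_convergent:
  fixes f :: "nat \<Rightarrow> real"
  assumes "\<And>n. \<bar>f n\<bar> \<le> B"
  shows "\<exists>l. (f \<longlongrightarrow> l) F"
proof -
  define S where "S = {x. eventually (\<lambda>n. x \<le> f n) F}"
  have lb: "-B \<in> S" unfolding S_def using assms by (auto intro!: always_eventually simp: abs_le_iff minus_le_iff)
  have ub: "x \<le> B" if "x \<in> S" for x
  proof -
    have "eventually (\<lambda>n. x \<le> f n) F" using that by (simp add: S_def)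
    then have "eventually (\<lambda>n. x \<le> B) F"
      by (rule eventually_mono) (meson abs_le_D1 assms order_trans)
    then show ?thesis using eventually_happens'[OF ne_bot] by blast
  qed
  have bdd: "bdd_above S" using ub by (rule bdd_aboveI)
  have "(f \<longlongrightarrow> Sup S) F"
  proof (rule tendstoI)
    fix e :: real assume e: "0 < e"
    obtain x where x: "x \<in> S" "Sup S - e < x"
      using less_cSup_iff[of S "Sup S - e"] lb bdd e by auto
    have "Sup S + e/2 \<notin> S" using cSup_upper[OF _ bdd, of "Sup S + e/2"] e by auto
    then have "\<not> eventually (\<lambda>n. Sup S + e/2 \<le> f n) F" by (simp add: S_def)
    then have "eventually (\<lambda>n. n \<notin> {n. Sup S + e/2 \<le> f n}) F"
      using ultra[of "{n. Sup S + e/2 \<le> f n}"] by simp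
    moreover have "eventually (\<lambda>n. x \<le> f n) F" using x by (simp add: S_def)
    ultimately show "eventually (\<lambda>n. dist (f n) (Sup S) < e) F"
      by eventually_elim (use x e in \<open>auto simp: dist_real_def abs_less_iff\<close>)
  qed
  then show ?thesis ..
qed

lemma dist_tendsto_ultra_dist:
  assumes "a \<in> ultra_carrier" "b \<in> ultra_carrier"
  shows "((\<lambda>m. dist (a m) (b m)) \<longlongrightarrow> ultra_dist F a b) F"
proof -
  obtain B x C y where "\<And>m. dist x (a m) \<le> B" "\<And>m. dist y (b m) \<le> C"
    using assms by (auto simp: ultra_carrier_def bounded_def)
  then have "dist (a m) (b m) \<le> B + dist x y + C" for m
    using dist_triangle[of "a m" "b m" x] dist_triangle[of x "b m" y] by (smt (verit) dist_commute)
  then obtain l where "((\<lambda>m. dist (a m) (b m)) \<longlongrightarrow> l) F"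
    using bounded_convergent[of "\<lambda>m. dist (a m) (b m)"] by auto
  then show ?thesis unfolding ultra_dist_def by (simp add: tendsto_Lim)
qed

lemma ultra_dist_eqI: "((\<lambda>m. dist (a m) (b m)) \<longlongrightarrow> l) F \<Longrightarrow> ultra_dist F a b = l"
  unfolding ultra_dist_def by (simp add: tendsto_Lim)

lemma ultra_dist_nonneg: "a \<in> ultra_carrier \<Longrightarrow> b \<in> ultra_carrier \<Longrightarrow> 0 \<le> ultra_dist F a b"
  by (rule tendsto_lowerbound[OF dist_tendsto_ultra_dist]) auto

lemma ultra_dist_refl [simp]: "ultra_dist F a a = 0"
  by (rule ultra_dist_eqI) simp

lemma ultra_dist_commute: "ultra_dist F a b = ultra_dist F b a"
  by (simp add: ultra_dist_def dist_commute)

lemma ultra_dist_triangle: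
  assumes "a \<in> ultra_carrier" "b \<in> ultra_carrier" "c \<in> ultra_carrier"
  shows "ultra_dist F a c \<le> ultra_dist F a b + ultra_dist F b c"
  using assms
  by (intro tendsto_le[OF ne_bot tendsto_add[OF dist_tendsto_ultra_dist dist_tendsto_ultra_dist] dist_tendsto_ultra_dist])
     (auto intro!: always_eventually dist_triangle)

lemma ultra_dist_triangle_abs:
  assumes "a \<in> ultra_carrier" "b \<in> ultra_carrier" "c \<in> ultra_carrier"
  shows "\<bar>ultra_dist F a c - ultra_dist F b c\<bar> \<le> ultra_dist F a b"
  using ultra_dist_triangle[OF assms(1,2,3)] ultra_dist_triangle[OF assms(2,1,3)] ultra_dist_commute[of a b]
  by linarith

lemma ultra_dist_le:
  assumes "a \<in> ultra_carrier" "b \<in> ultra_carrier" "eventually (\<lambda>k. dist (a k) (b k) \<le> e) F"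
  shows "ultra_dist F a b \<le> e"
  by (rule tendsto_upperbound[OF dist_tendsto_ultra_dist[OF assms(1,2)] assms(3)]) simp

lemma ultra_embed_carrier [simp]: "ultra_embed y \<in> ultra_carrier"
  by (simp add: ultra_embed_def ultra_carrier_def)

text \<open>Countable saturation: at index k, the limit follows the latest member of the sequence for which
  all earlier ultra-estimates hold at k.\<close>
lemma ultra_complete:
  fixes Y :: "nat \<Rightarrow> nat \<Rightarrow> 'y::metric_space"
  assumes Y: "\<And>m. Y m \<in> ultra_carrier" "\<And>m. ultra_dist F (Y m) (Y (Suc m)) < (1/2)^m"
  shows "\<exists>y\<in>ultra_carrier. \<forall>m. ultra_dist F y (Y m) \<le> 2 * (1/2)^m"
proof -
  \<comment> \<open>The condition m \<le> k bounds the admissible m, so that a greatest one exists;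
    it holds eventually because F contains the cofinite sets.\<close>
  define P where "P = (\<lambda>m k. m \<le> k \<and> (\<forall>l<m. dist (Y l k) (Y (Suc l) k) < (1/2)^l))"
  define mm where "mm = (\<lambda>k. GREATEST m. P m k)"
  have P0: "P 0 k" for k by (simp add: P_def)
  have Pmm: "P (mm k) k" for k
    unfolding mm_def by (rule GreatestI_nat[of "\<lambda>m. P m k" 0 k]) (auto simp: P_def)
  have mm_ge: "m \<le> mm k" if "P m k" for m k
    unfolding mm_def by (rule Greatest_le_nat[of "\<lambda>m. P m k" m k]) (use that in \<open>auto simp: P_def\<close>)
  define y where "y = (\<lambda>k. Y (mm k) k)"
  have near: "dist (y k) (Y m k) \<le> 2 * (1/2)^m" if "P m k" for m k
  proof -
    have "dist (Y n k) (Y m k) \<le> 2 * (1/2)^m - 2 * (1/2)^n" if "m \<le> n" "n \<le> mm k" for n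
      using that
    proof (induction n rule: dec_induct)
      case (step n)
      have "dist (Y n k) (Y (Suc n) k) < (1/2)^n" using Pmm[of k] step by (simp add: P_def)
      with step show ?case
        using dist_triangle[of "Y (Suc n) k" "Y m k" "Y n k"] by (simp add: dist_commute)
    qed simp
    from this[of "mm k"] mm_ge[OF that]
    have "dist (y k) (Y m k) \<le> 2 * (1/2)^m - 2 * (1/2)^mm k" by (simp add: y_def)
    moreover have "0 \<le> (1/2::real)^mm k" by simp
    ultimately show ?thesis by linarith
  qed
  have y: "y \<in> ultra_carrier"
  proof -
    obtain x B where B: "\<And>k. dist x (Y 0 k) \<le> B" using Y(1)[of 0] by (auto simp: ultra_carrier_def bounded_def)
    have "dist x (y k) \<le> B + 2" for k
      using near[OF P0[of k]] B[of k] dist_triangle[of x "y k" "Y 0 k"] by (simp add: dist_commute)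
    then show ?thesis by (auto simp: ultra_carrier_def bounded_def)
  qed
  have ev: "eventually (P m) F" for m
  proof -
    have "eventually (\<lambda>k. dist (Y l k) (Y (Suc l) k) < (1/2)^l) F" for l
      using order_tendstoD(2)[OF dist_tendsto_ultra_dist[OF Y(1) Y(1)] Y(2)] .
    then have "eventually (\<lambda>k. \<forall>l\<in>{..<m}. dist (Y l k) (Y (Suc l) k) < (1/2)^l) F"
      by (intro eventually_ball_finite) auto
    moreover have "eventually (\<lambda>k. m \<le> k) F"
      using le_sequentially eventually_ge_at_top by (rule filter_leD)
    ultimately show ?thesis by eventually_elim (auto simp: P_def)
  qed
  have "ultra_dist F y (Y m) \<le> 2 * (1/2)^m" for m
    by (rule ultra_dist_le[OF y Y(1)]) (use ev[of m] near in \<open>auto elim: eventually_mono\<close>)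
  with y show ?thesis by blast
qed

text \<open>The profile a is uniformly close to the distance functions of members of Q. These
  members form a Cauchy sequence, and completeness provides the point. In this way a value of the
  limit map is recovered where only limits of distances are known.\<close>

lemma ultra_point_of_distances:
  fixes q :: "'i \<Rightarrow> nat \<Rightarrow> 'y::metric_space" and a :: "'i \<Rightarrow> real"
  assumes q: "\<And>i. i \<in> Q \<Longrightarrow> q i \<in> ultra_carrier"
    and a: "\<And>e. 0 < e \<Longrightarrow> \<exists>j\<in>Q. \<forall>i\<in>Q. \<bar>a i - ultra_dist F (q j) (q i)\<bar> \<le> e"
  shows "\<exists>y\<in>ultra_carrier. (\<forall>i\<in>Q. ultra_dist F y (q i) = a i) \<and> (\<forall>e>0. \<exists>j\<in>Q. ultra_dist F y (q j) < e)"
proof -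
  have "\<exists>j\<in>Q. \<forall>i\<in>Q. \<bar>a i - ultra_dist F (q j) (q i)\<bar> \<le> (1/2)^m / 4" for m
    using a[of "(1/2)^m / 4"] by simp
  then obtain j where j: "\<And>m. j m \<in> Q" "\<And>m i. i \<in> Q \<Longrightarrow> \<bar>a i - ultra_dist F (q (j m)) (q i)\<bar> \<le> (1/2)^m / 4"
    by metis
  have "ultra_dist F (q (j m)) (q (j (Suc m))) < (1/2)^m" for m
  proof -
    \<comment> \<open>The profile at \<open>j (Suc m)\<close> is close to the distance of that point
      from itself, hence almost 0.\<close>
    have "\<bar>a (j (Suc m))\<bar> \<le> (1/2)^Suc m / 4" using j(2)[OF j(1), of "Suc m" "Suc m"] by simp
    moreover have "\<bar>a (j (Suc m)) - ultra_dist F (q (j m)) (q (j (Suc m)))\<bar> \<le> (1/2)^m / 4"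
      using j(2)[OF j(1)] .
    moreover have "(1/2::real)^m > 0" by simp
    ultimately show ?thesis unfolding power_Suc by linarith
  qed
  then obtain y where y: "y \<in> ultra_carrier" "\<And>m. ultra_dist F y (q (j m)) \<le> 2 * (1/2)^m"
    using ultra_complete[of "\<lambda>m. q (j m)"] q j(1) by blast
  have "ultra_dist F y (q i) = a i" if "i \<in> Q" for i
  proof -
    have "\<bar>ultra_dist F y (q i) - a i\<bar> \<le> 3 * (1/2)^m" for m
    proof -
      have "\<bar>ultra_dist F y (q i) - ultra_dist F (q (j m)) (q i)\<bar> \<le> 2 * (1/2)^m"
        using ultra_dist_triangle_abs[OF y(1) q[OF j(1)] q[OF that], of m] y(2)[of m] by linarith
      moreover have "\<bar>a i - ultra_dist F (q (j m)) (q i)\<bar> \<le> (1/2)^m / 4" using j(2)[OF that] .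
      moreover have "(1/2::real)^m > 0" by simp
      ultimately show ?thesis by linarith
    qed
    moreover have lim: "(\<lambda>m. 3 * (1/2::real)^m) \<longlonglongrightarrow> 3 * 0"
      by (intro tendsto_mult tendsto_const LIMSEQ_power_zero) simp
    ultimately have "\<bar>ultra_dist F y (q i) - a i\<bar> \<le> 3 * 0"
      using LIMSEQ_le_const[OF lim, of "\<bar>ultra_dist F y (q i) - a i\<bar>"] by blast
    then show ?thesis by simp
  qed
  moreover have "\<exists>j\<in>Q. ultra_dist F y (q j) < e" if e: "e > 0" for e
  proof -
    obtain m where "(1/2)^m < e/2" using real_arch_pow_inv[of "e/2" "1/2"] e by auto
    then show ?thesis using y(2)[of m] j(1)[of m] by (intro bexI[of _ "j m"]) auto
  qed
  ultimately show ?thesis using y(1) by blast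
qed

end

section \<open>Doubling spaces and nets\<close>

text \<open>Among finitely many centres the choice is made in a fixed order, by preferring the last
  one inserted. This is measurable into the discrete space, so arbitrary data attached to the
  centres can be composed with it.\<close>

lemma nearest_selection:
  fixes X :: "'x::metric_space set"
  assumes "finite X"
  shows "\<exists>\<kappa>\<in>measurable borel (count_space UNIV). \<forall>x. (\<exists>c\<in>X. dist x c \<le> r) \<longrightarrow> \<kappa> x \<in> X \<and> dist x (\<kappa> x) \<le> r"
  using assms
proof (induction X)
  case empty
  show ?case by (rule bexI[of _ "\<lambda>_. undefined"]) auto
next
  case (insert a X)
  then obtain \<kappa> where [measurable]: "\<kappa> \<in> measurable borel (count_space UNIV)"
    and \<kappa>: "\<And>x. (\<exists>c\<in>X. dist x c \<le> r) \<Longrightarrow> \<kappa> x \<in> X \<and> dist x (\<kappa> x) \<le> r" by blast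
  have [measurable]: "{x. dist x a \<le> r} \<in> sets borel"
    by (intro borel_closed closed_Collect_le continuous_intros)
  have "(\<lambda>x. if x \<in> {x. dist x a \<le> r} then a else \<kappa> x) \<in> measurable borel (count_space UNIV)" by measurable
  then show ?case
    by (rule bexI[rotated]) (use \<kappa> in auto)
qed

text \<open>\<nu> stands for the measure restricted to \<Omega>. The centres range over the closure,
  since traces are about averages around boundary points.\<close>

locale doubling_space =
  fixes \<nu> :: "'x::metric_space measure" and \<Omega> :: "'x set" and Cd :: real
  assumes space_\<nu>: "space \<nu> = \<Omega>" and sets_\<nu>: "sets \<nu> = sets (restrict_space borel \<Omega>)"
    and \<Omega>_ne: "\<Omega> \<noteq> {}" and \<Omega>_bounded: "bounded \<Omega>" and finite_\<nu>: "finite_measure \<nu>"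
    and ball_pos: "\<And>x r. x \<in> closure \<Omega> \<Longrightarrow> 0 < r \<Longrightarrow> 0 < measure \<nu> (ball x r \<inter> \<Omega>)"
    and doubling: "\<And>x r. x \<in> closure \<Omega> \<Longrightarrow> 0 < r \<Longrightarrow>
      measure \<nu> (ball x (2 * r) \<inter> \<Omega>) \<le> Cd * measure \<nu> (ball x r \<inter> \<Omega>)"
begin

sublocale finite_measure \<nu> by (rule finite_\<nu>)

abbreviation vol :: "'x \<Rightarrow> real \<Rightarrow> real" where "vol x r \<equiv> measure \<nu> (ball x r \<inter> \<Omega>)"

lemma borel_Int_sets [measurable]: "A \<in> sets borel \<Longrightarrow> A \<inter> \<Omega> \<in> sets \<nu>"
  unfolding sets_\<nu> sets_restrict_space by auto

lemma ball_sets [simp]: "ball x r \<inter> \<Omega> \<in> sets \<nu>"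
  by (simp add: borel_Int_sets)

lemma indicator_measurable [measurable]:
  "A \<in> sets borel \<Longrightarrow> (indicator A :: 'x \<Rightarrow> ennreal) \<in> borel_measurable \<nu>"
  using borel_Int_sets[of A] by (simp add: borel_measurable_indicator_iff space_\<nu>)

lemma nn_integral_indicator_vol: "(\<integral>\<^sup>+y. indicator (ball x r) y \<partial>\<nu>) = ennreal (vol x r)"
proof -
  have "(\<integral>\<^sup>+y. indicator (ball x r) y \<partial>\<nu>) = (\<integral>\<^sup>+y. indicator (ball x r \<inter> \<Omega>) y \<partial>\<nu>)"
    by (intro nn_integral_cong) (auto simp: space_\<nu> split: split_indicator)
  then show ?thesis by (simp add: emeasure_eq_measure)
qed

lemma Cd_ge_1: "1 \<le> Cd"
proof -
  obtain x where x: "x \<in> \<Omega>" using \<Omega>_ne by auto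
  then have x': "x \<in> closure \<Omega>" using closure_subset by auto
  have "1 * vol x 1 \<le> vol x 2" using finite_measure_mono[of "ball x 1 \<inter> \<Omega>" "ball x 2 \<inter> \<Omega>"] subset_ball[of 1 2 x] by auto
  also have "\<dots> \<le> Cd * vol x 1" using doubling[OF x', of 1] by simp
  finally show ?thesis using ball_pos[OF x', of 1] by (simp del: mult_1)
qed

text \<open>Constant for comparing the volumes of balls whose radii have ratio at most K. The
  exponent is generous: it rests on K \<le> 2^n for
  \<open>n = nat \<lceil>K\<rceil>\<close>.\<close>

definition dbl :: "real \<Rightarrow> real" where "dbl K = Cd ^ nat \<lceil>K\<rceil>"

lemma dbl_ge_1: "1 \<le> dbl K"
  unfolding dbl_def by (rule one_le_power[OF Cd_ge_1])

lemma vol_compare: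
  assumes "y \<in> closure \<Omega>" "0 < r" "dist x y + s \<le> K * r"
  shows "vol x s \<le> dbl K * vol y r"
proof -
  have pow: "vol y (2^n * r) \<le> Cd^n * vol y r" for n
  proof (induction n)
    case (Suc n)
    have "vol y (2 ^ Suc n * r) \<le> Cd * vol y (2^n * r)"
      using doubling[OF assms(1), of "2^n * r"] assms(2) by (simp add: mult.assoc)
    also have "\<dots> \<le> Cd * (Cd^n * vol y r)" using Suc Cd_ge_1 by (intro mult_left_mono) auto
    finally show ?case by (simp add: mult.assoc)
  qed simp
  define n where "n = nat \<lceil>K\<rceil>"
  have "K \<le> real n" unfolding n_def by linarith
  also have "\<dots> \<le> 2^n" by (metis less_imp_le of_nat_less_two_power)
  finally have "K * r \<le> 2^n * r" using assms(2) by simp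
  then have "dist x y + s \<le> 2^n * r" using assms(3) by simp
  have "ball x s \<subseteq> ball y (2^n * r)"
  proof
    fix z assume "z \<in> ball x s"
    then show "z \<in> ball y (2^n * r)"
      using dist_triangle[of y z x] \<open>dist x y + s \<le> 2^n * r\<close> by (simp add: dist_commute)
  qed
  then have "vol x s \<le> vol y (2^n * r)" by (intro finite_measure_mono) auto
  with pow[of n] show ?thesis by (simp add: dbl_def n_def)
qed

definition separated :: "real \<Rightarrow> 'x set \<Rightarrow> bool" where
  "separated r S \<longleftrightarrow> finite S \<and> S \<subseteq> \<Omega> \<and> (\<forall>x\<in>S. \<forall>y\<in>S. x \<noteq> y \<longrightarrow> r \<le> dist x y)"

lemma separated_subset: "separated r S \<Longrightarrow> S' \<subseteq> S \<Longrightarrow> separated r S'"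
  unfolding separated_def by (auto intro: finite_subset)

text \<open>The argument is 2 * (\<Lambda> + (\<Lambda> + 1)): the packing estimate compares a ball
  of radius (\<Lambda> + 1) * r with balls of radius r/2 whose centres are at distance at most
  \<Lambda> * r.\<close>

definition overlap :: "real \<Rightarrow> real" where "overlap \<Lambda> = dbl (4 * \<Lambda> + 2)"

lemma overlap_ge_1: "1 \<le> overlap \<Lambda>"
  by (simp add: overlap_def dbl_ge_1)

text \<open>Packing: the disjoint balls of radius r/2 around S lie in one ball around z, and by
  doubling each of them carries a fixed proportion of its volume.\<close>

lemma separated_card:
  assumes S: "separated r S" and r: "0 < r" and \<Lambda>: "0 \<le> \<Lambda>" and z: "z \<in> \<Omega>" "\<And>x. x \<in> S \<Longrightarrow> dist z x \<le> \<Lambda> * r"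
  shows "real (card S) \<le> overlap \<Lambda>"
proof -
  let ?V = "vol z ((\<Lambda> + 1) * r)"
  have S': "finite S" "S \<subseteq> \<Omega>" using S by (auto simp: separated_def)
  have disj: "disjoint_family_on (\<lambda>x. ball x (r/2) \<inter> \<Omega>) S"
    unfolding disjoint_family_on_def
  proof (intro ballI impI)
    fix x y assume "x \<in> S" "y \<in> S" "x \<noteq> y"
    then have "r \<le> dist x y" using S by (auto simp: separated_def)
    then have "ball x (r/2) \<inter> ball y (r/2) = {}"
      using dist_triangle_half_l[of x _ r y] by (fastforce simp: disjoint_iff)
    then show "ball x (r/2) \<inter> \<Omega> \<inter> (ball y (r/2) \<inter> \<Omega>) = {}" by blast
  qed
  have "real (card S) * ?V = (\<Sum>x\<in>S. ?V)" by simp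
  also have "\<dots> \<le> (\<Sum>x\<in>S. overlap \<Lambda> * vol x (r/2))"
  proof (rule sum_mono)
    fix x assume x: "x \<in> S"
    then have "x \<in> closure \<Omega>" using S' closure_subset by blast
    moreover have "dist z x + (\<Lambda> + 1) * r \<le> (4 * \<Lambda> + 2) * (r/2)"
      using z(2)[OF x] by (simp add: algebra_simps)
    ultimately show "?V \<le> overlap \<Lambda> * vol x (r/2)"
      unfolding overlap_def using r by (intro vol_compare) auto
  qed
  also have "\<dots> = overlap \<Lambda> * measure \<nu> (\<Union>x\<in>S. ball x (r/2) \<inter> \<Omega>)"
    unfolding sum_distrib_left[symmetric]
    by (subst finite_measure_finite_Union) (use S' disj in auto)
  also have "\<dots> \<le> overlap \<Lambda> * ?V"
  proof (intro mult_left_mono finite_measure_mono)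
    have "ball x (r/2) \<subseteq> ball z ((\<Lambda> + 1) * r)" if "x \<in> S" for x
    proof
      fix w assume "w \<in> ball x (r/2)"
      then have "dist z w < \<Lambda> * r + r/2" using dist_triangle[of z w x] z(2)[OF that] by simp
      then show "w \<in> ball z ((\<Lambda> + 1) * r)" using r by (simp add: algebra_simps)
    qed
    then show "(\<Union>x\<in>S. ball x (r/2) \<inter> \<Omega>) \<subseteq> ball z ((\<Lambda> + 1) * r) \<inter> \<Omega>" by blast
  qed (use overlap_ge_1[of \<Lambda>] in auto)
  finally have "real (card S) * ?V \<le> overlap \<Lambda> * ?V" .
  moreover have "z \<in> closure \<Omega>" using z(1) closure_subset by blast
  then have "0 < ?V" using r \<Lambda> by (intro ball_pos) auto
  ultimately show ?thesis by (rule mult_right_le_imp_le)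
qed

definition net :: "real \<Rightarrow> 'x set \<Rightarrow> bool" where
  "net r X \<longleftrightarrow> separated r X \<and> (\<forall>z\<in>closure \<Omega>. \<exists>x\<in>X. dist z x \<le> r)"

text \<open>A separated set of largest cardinality is a net; a largest one exists since the bounded
  set \<Omega> lies within fixed distance of one of its points. A finite union of closed balls that
  covers \<Omega> also covers its closure.\<close>

lemma net_exists:
  assumes "0 < r" shows "\<exists>X. net r X"
proof -
  obtain z where z: "z \<in> \<Omega>" using \<Omega>_ne by auto
  obtain R where R: "\<And>x. x \<in> \<Omega> \<Longrightarrow> dist z x \<le> R" using \<Omega>_bounded bounded_any_center[of \<Omega> z] by auto
  have R0: "0 \<le> R" using R[OF z] by simp
  have bd: "card S \<le> nat \<lfloor>overlap (R / r)\<rfloor>" if "separated r S" for S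
  proof -
    have "real (card S) \<le> overlap (R / r)"
      by (rule separated_card[OF that assms _ z]) (use that R R0 assms in \<open>auto simp: separated_def\<close>)
    then show ?thesis by linarith
  qed
  have "separated r {}" by (simp add: separated_def)
  then obtain X where X: "separated r X" "\<And>S. separated r S \<Longrightarrow> card S \<le> card X"
    using ex_has_greatest_nat[of "separated r" "{}" card "Suc (nat \<lfloor>overlap (R / r)\<rfloor>)"] bd by (metis le_imp_less_Suc)
  have "\<exists>x\<in>X. dist z x \<le> r" if "z \<in> \<Omega>" for z
  proof (rule ccontr)
    assume "\<not> (\<exists>x\<in>X. dist z x \<le> r)"
    then have far: "\<And>x. x \<in> X \<Longrightarrow> r < dist z x" by (auto simp: not_le)
    then have "z \<notin> X" using assms by force
    have "separated r (insert z X)"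
      using X(1) far that by (auto simp: separated_def dist_commute less_imp_le)
    from X(2)[OF this] show False using X(1) \<open>z \<notin> X\<close> by (simp add: separated_def)
  qed
  then have "\<Omega> \<subseteq> (\<Union>x\<in>X. cball x r)" by (force simp: dist_commute)
  moreover have "closed (\<Union>x\<in>X. cball x r)" using X(1) by (intro closed_UN) (auto simp: separated_def)
  ultimately have "closure \<Omega> \<subseteq> (\<Union>x\<in>X. cball x r)" by (rule closure_minimal)
  then show ?thesis using X(1) by (force simp: net_def dist_commute)
qed

text \<open>By the packing bound every point lies in at most \<open>overlap \<Lambda>\<close> of the
  enlarged balls.\<close>

lemma sum_ball_integrals_le:
  assumes X: "separated r X" and r: "0 < r" and \<Lambda>: "0 \<le> \<Lambda>" and h [measurable]: "h \<in> borel_measurable \<nu>"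
    and A [measurable]: "A \<in> sets borel" and sub: "\<And>x. x \<in> X \<Longrightarrow> ball x (\<Lambda> * r) \<subseteq> A"
  shows "(\<Sum>x\<in>X. \<integral>\<^sup>+y\<in>ball x (\<Lambda> * r). h y \<partial>\<nu>) \<le> ennreal (overlap \<Lambda>) * (\<integral>\<^sup>+y\<in>A. h y \<partial>\<nu>)"
proof -
  have finX: "finite X" using X by (simp add: separated_def)
  have "(\<Sum>x\<in>X. \<integral>\<^sup>+y\<in>ball x (\<Lambda> * r). h y \<partial>\<nu>) = (\<integral>\<^sup>+y. (\<Sum>x\<in>X. h y * indicator (ball x (\<Lambda> * r)) y) \<partial>\<nu>)"
    by (rule nn_integral_sum[symmetric]) measurable
  also have "\<dots> \<le> (\<integral>\<^sup>+y. ennreal (overlap \<Lambda>) * (h y * indicator A y) \<partial>\<nu>)"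
  proof (rule nn_integral_mono)
    fix y assume "y \<in> space \<nu>"
    then have y: "y \<in> \<Omega>" by (simp add: space_\<nu>)
    let ?S = "{x\<in>X. y \<in> ball x (\<Lambda> * r)}"
    have sum_eq: "(\<Sum>x\<in>X. h y * indicator (ball x (\<Lambda> * r)) y) = (\<Sum>x\<in>?S. h y)"
      using finX by (intro sum.mono_neutral_cong_right) auto
    show "(\<Sum>x\<in>X. h y * indicator (ball x (\<Lambda> * r)) y) \<le> ennreal (overlap \<Lambda>) * (h y * indicator A y)"
    proof (cases "?S = {}")
      case False
      then have "y \<in> A" using sub by blast
      have "real (card ?S) \<le> overlap \<Lambda>"
        by (rule separated_card[OF separated_subset[OF X] r \<Lambda> y]) (auto simp: dist_commute)
      then have "of_nat (card ?S) \<le> ennreal (overlap \<Lambda>)"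
        by (metis ennreal_leI ennreal_of_nat_eq_real_of_nat)
      then show ?thesis unfolding sum_eq using \<open>y \<in> A\<close> by (simp add: mult_right_mono)
    qed (simp add: sum_eq)
  qed
  also have "\<dots> = ennreal (overlap \<Lambda>) * (\<integral>\<^sup>+y\<in>A. h y \<partial>\<nu>)"
    by (rule nn_integral_cmult) measurable
  finally show ?thesis .
qed

lemma levels_exist:
  "\<exists>X \<kappa>. \<forall>m. net ((1/2)^m) (X m) \<and> \<kappa> m \<in> measurable borel (count_space UNIV) \<and>
     (\<forall>x\<in>closure \<Omega>. \<kappa> m x \<in> X m \<and> dist x (\<kappa> m x) \<le> (1/2)^m)"
proof -
  have "\<exists>X \<kappa>. net ((1/2)^m) X \<and> \<kappa> \<in> measurable borel (count_space UNIV) \<and>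
     (\<forall>x\<in>closure \<Omega>. \<kappa> x \<in> X \<and> dist x (\<kappa> x) \<le> (1/2)^m)" for m :: nat
  proof -
    obtain X where X: "net ((1/2)^m) X" using net_exists[of "(1/2)^m"] by auto
    then have "finite X" by (simp add: net_def separated_def)
    from nearest_selection[OF this, of "(1/2)^m"] X show ?thesis unfolding net_def by blast
  qed
  then show ?thesis by metis
qed

end

text \<open>By monotone convergence the series has finite integral, hence is finite almost
  everywhere. The almost everywhere limits along the levels all come from here.\<close>

lemma AE_tendsto_0_if_integrals_summable:
  fixes f :: "nat \<Rightarrow> 'a \<Rightarrow> ennreal"
  assumes "\<And>n. f n \<in> borel_measurable M" "\<And>n. (\<integral>\<^sup>+x. f n x \<partial>M) \<le> ennreal (b n)" "summable b" "\<And>n. 0 \<le> b n"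
  shows "AE x in M. (\<Sum>n. f n x) < top" "AE x in M. (\<lambda>n. f n x) \<longlonglongrightarrow> 0"
proof -
  note [measurable] = assms(1)
  have "(\<integral>\<^sup>+x. (\<Sum>n. f n x) \<partial>M) = (\<Sum>n. \<integral>\<^sup>+x. f n x \<partial>M)" by (rule nn_integral_suminf) measurable
  also have "\<dots> \<le> (\<Sum>n. ennreal (b n))" by (intro suminf_le assms) auto
  also have "\<dots> = ennreal (\<Sum>n. b n)" by (rule suminf_ennreal2) (use assms in auto)
  finally have "(\<integral>\<^sup>+x. (\<Sum>n. f n x) \<partial>M) < top" by (simp add: le_less_trans)
  then show *: "AE x in M. (\<Sum>n. f n x) < top"
    using nn_integral_PInf_AE[of "\<lambda>x. \<Sum>n. f n x" M] by (simp add: less_top)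
  show "AE x in M. (\<lambda>n. f n x) \<longlonglongrightarrow> 0"
    using *
  proof eventually_elim
    case (elim x)
    have fin: "f n x < top" for n
      using sum_le_suminf[of "\<lambda>n. f n x" "{n}"] elim by (auto intro: le_less_trans)
    have eq: "f n x = ennreal (enn2real (f n x))" for n using fin[of n] by simp
    have "summable (\<lambda>n. enn2real (f n x))"
      by (rule summable_suminf_not_top) (use elim eq in \<open>auto simp: less_top[symmetric]\<close>)
    then have "(\<lambda>n. enn2real (f n x)) \<longlonglongrightarrow> 0" by (rule summable_LIMSEQ_zero)
    then have "(\<lambda>n. ennreal (enn2real (f n x))) \<longlonglongrightarrow> ennreal 0" by (rule tendsto_ennrealI)
    then show ?case using eq by simp
  qed
qed

lemma powr_half_power: "((1/2)^n) powr a = ((1/2) powr a)^n" for a :: real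
  by (simp add: powr_realpow[symmetric] powr_powr mult.commute)

lemma half_powr_less_1: "0 < a \<Longrightarrow> (1/2) powr a < (1::real)"
  using powr_less_mono2[of a "1/2" 1] by simp

section \<open>Measurable selection from nets of radius 2^(-m)\<close>

locale doubling_levels = doubling_space \<nu> \<Omega> Cd
  for \<nu> :: "'x::metric_space measure" and \<Omega> :: "'x set" and Cd :: real +
  fixes X :: "nat \<Rightarrow> 'x set" and \<kappa> :: "nat \<Rightarrow> 'x \<Rightarrow> 'x"
  assumes net_X: "\<And>m. net ((1/2)^m) (X m)"
    and \<kappa>_measurable: "\<And>m. \<kappa> m \<in> measurable borel (count_space UNIV)"
    and \<kappa>: "\<And>m x. x \<in> closure \<Omega> \<Longrightarrow> \<kappa> m x \<in> X m" "\<And>m x. x \<in> closure \<Omega> \<Longrightarrow> dist x (\<kappa> m x) \<le> (1/2)^m"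
begin

abbreviation rad :: "nat \<Rightarrow> real" where "rad m \<equiv> (1/2)^m"

lemma rad_pos: "0 < rad m" and rad_Suc: "rad (Suc m) = rad m / 2"
  by simp_all

lemma X_finite: "finite (X m)" and X_sub: "c \<in> X m \<Longrightarrow> c \<in> \<Omega>" and X_separated: "separated (rad m) (X m)"
  using net_X[of m] by (auto simp: net_def separated_def)

lemma \<Omega>_closure: "x \<in> \<Omega> \<Longrightarrow> x \<in> closure \<Omega>"
  using closure_subset by blast

text \<open>\<tau> will be the measure on \<Omega> or the one on its boundary, so it is only
  supposed to live on a subset of the closure.\<close>

lemma \<kappa>_count_space:
  assumes "space \<tau> \<subseteq> closure \<Omega>" "sets \<tau> = sets (restrict_space borel (space \<tau>))"
  shows "\<kappa> m \<in> measurable \<tau> (count_space (X m))"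
proof (subst measurable_count_space_eq2[OF X_finite], intro conjI ballI)
  show "\<kappa> m \<in> space \<tau> \<rightarrow> X m" using assms(1) \<kappa>(1) by auto
  fix a
  have "\<kappa> m -` {a} \<in> sets borel" using measurable_sets[OF \<kappa>_measurable, of "{a}" m] by simp
  then show "\<kappa> m -` {a} \<inter> space \<tau> \<in> sets \<tau>"
    by (subst assms(2)) (auto simp: sets_restrict_space)
qed

lemma selection_measurable:
  assumes "space \<tau> \<subseteq> closure \<Omega>" "sets \<tau> = sets (restrict_space borel (space \<tau>))"
    and "\<And>c. c \<in> X m \<Longrightarrow> g c \<in> measurable \<tau> N"
  shows "(\<lambda>z. g (\<kappa> m z) z) \<in> measurable \<tau> N"
  using assms(3) \<kappa>_count_space[OF assms(1,2)]
  by (rule measurable_compose_countable') (auto intro: countable_finite X_finite)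

lemma \<nu>_space: "space \<nu> \<subseteq> closure \<Omega>" "sets \<nu> = sets (restrict_space borel (space \<nu>))"
  using space_\<nu> sets_\<nu> closure_subset by auto

text \<open>The integral over A is distributed over the balls selected by its points. The radius s
  exceeds rad m strictly because the balls are open, while a selected centre may be at distance
  exactly rad m.\<close>

lemma selection_nn_integral_le:
  assumes "\<And>c. c \<in> X m \<Longrightarrow> g c \<in> borel_measurable \<nu>" and A [measurable]: "A \<in> sets borel" and "rad m < s"
  shows "(\<integral>\<^sup>+z\<in>A. g (\<kappa> m z) z \<partial>\<nu>) \<le> (\<Sum>c\<in>{c\<in>X m. \<exists>z\<in>A. dist z c \<le> rad m}. \<integral>\<^sup>+z\<in>ball c s. g c z \<partial>\<nu>)"
proof -
  let ?Y = "{c\<in>X m. \<exists>z\<in>A. dist z c \<le> rad m}"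
  have "(\<integral>\<^sup>+z\<in>A. g (\<kappa> m z) z \<partial>\<nu>) \<le> (\<integral>\<^sup>+z. (\<Sum>c\<in>?Y. g c z * indicator (ball c s) z) \<partial>\<nu>)"
  proof (rule nn_integral_mono)
    fix z assume "z \<in> space \<nu>"
    then have z: "z \<in> closure \<Omega>" using \<nu>_space(1) by blast
    show "g (\<kappa> m z) z * indicator A z \<le> (\<Sum>c\<in>?Y. g c z * indicator (ball c s) z)"
    proof (cases "z \<in> A")
      case True
      then have *: "\<kappa> m z \<in> ?Y" "z \<in> ball (\<kappa> m z) s" using \<kappa>[OF z, of m] assms(3) by (auto simp: dist_commute)
      have "g (\<kappa> m z) z * indicator A z = g (\<kappa> m z) z * indicator (ball (\<kappa> m z) s) z"
        using * True by simp
      also have "\<dots> \<le> (\<Sum>c\<in>?Y. g c z * indicator (ball c s) z)"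
        using * X_finite by (intro member_le_sum[where f="\<lambda>c. g c z * indicator (ball c s) z"]) auto
      finally show ?thesis .
    qed simp
  qed
  also have "\<dots> = (\<Sum>c\<in>?Y. \<integral>\<^sup>+z\<in>ball c s. g c z \<partial>\<nu>)"
  proof (rule nn_integral_sum)
    fix c assume "c \<in> ?Y"
    then have [measurable]: "g c \<in> borel_measurable \<nu>" using assms(1) by simp
    show "(\<lambda>z. g c z * indicator (ball c s) z) \<in> borel_measurable \<nu>" by measurable
  qed
  finally show ?thesis .
qed

definition avg :: "('x \<Rightarrow> real) \<Rightarrow> 'x \<Rightarrow> real \<Rightarrow> real" where
  "avg f x r = (LINT y:ball x r|\<nu>. f y) / vol x r"

lemma vol_avg_diff_le:
  assumes f: "integrable \<nu> f" and x: "x \<in> closure \<Omega>" "0 < r"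
  shows "ennreal (vol x r) * ennreal \<bar>avg f x r - a\<bar> \<le> (\<integral>\<^sup>+z\<in>ball x r. ennreal \<bar>f z - a\<bar> \<partial>\<nu>)"
proof -
  have v: "0 < vol x r" using ball_pos[OF x] .
  have [measurable]: "f \<in> borel_measurable \<nu>" using f by simp

  have ind: "integrable \<nu> (\<lambda>z. indicator (ball x r) z * g z)" if "integrable \<nu> g" for g :: "'x \<Rightarrow> real"
  proof -
    have "integrable \<nu> (\<lambda>z. indicator (ball x r \<inter> \<Omega>) z *\<^sub>R g z)"
      by (rule integrable_mult_indicator[OF ball_sets that])
    moreover have "integrable \<nu> (\<lambda>z. indicator (ball x r \<inter> \<Omega>) z *\<^sub>R g z) \<longleftrightarrow> integrable \<nu> (\<lambda>z. indicator (ball x r) z * g z)"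
      by (rule Bochner_Integration.integrable_cong) (auto simp: space_\<nu> indicator_def)
    ultimately show ?thesis by simp
  qed
  note int = ind[OF f] and int1 = ind[OF integrable_const[of a]]
  have vol_eq: "(\<integral>z. indicator (ball x r) z \<partial>\<nu>) = vol x r"
    by (simp add: space_\<nu> Int_commute)
  have "vol x r * (avg f x r - a) = (\<integral>z. indicator (ball x r) z * f z \<partial>\<nu>) - (\<integral>z. indicator (ball x r) z * a \<partial>\<nu>)"
    using v by (simp add: avg_def set_lebesgue_integral_def right_diff_distrib vol_eq del: Bochner_Integration.integral_indicator)
  also have "\<dots> = (\<integral>z. indicator (ball x r) z * (f z - a) \<partial>\<nu>)"
    using int int1 by (simp add: right_diff_distrib del: integral_mult_left integral_mult_right)
  finally have eq: "vol x r * (avg f x r - a) = (\<integral>z. indicator (ball x r) z * (f z - a) \<partial>\<nu>)" .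
  have "ennreal (vol x r) * ennreal \<bar>avg f x r - a\<bar> = ennreal (norm (vol x r * (avg f x r - a)))"
    using v by (simp add: abs_mult ennreal_mult)
  also have "\<dots> = ennreal (norm (\<integral>z. indicator (ball x r) z * (f z - a) \<partial>\<nu>))" by (simp only: eq)
  also have "\<dots> \<le> (\<integral>\<^sup>+z. ennreal (norm (indicator (ball x r) z * (f z - a))) \<partial>\<nu>)"
    by (rule integral_norm_bound_ennreal)
       (use int int1 in \<open>simp add: right_diff_distrib del: integral_mult_left integral_mult_right\<close>)
  also have "\<dots> = (\<integral>\<^sup>+z\<in>ball x r. ennreal \<bar>f z - a\<bar> \<partial>\<nu>)"
    by (intro nn_integral_cong) (auto split: split_indicator)
  finally show ?thesis .
qed

end

section \<open>Chaining along the levels\<close>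

text \<open>h plays the role of g^p for an upper gradient g of u. The Poincare inequality is assumed
  in its additive form, which can be summed over balls, and with constants that do not depend on the
  test point y.\<close>

locale poincare_chain = doubling_levels \<nu> \<Omega> Cd X \<kappa>
  for \<nu> :: "'x::metric_space measure" and \<Omega> :: "'x set" and Cd :: real and X \<kappa> +
  fixes u :: "'x \<Rightarrow> 'y::metric_space" and h :: "'x \<Rightarrow> ennreal" and C lam \<alpha> \<theta> :: real
  assumes const: "0 < C" "1 \<le> lam" "0 < \<alpha>" "0 \<le> \<theta>"
    and h [measurable]: "h \<in> borel_measurable \<nu>" and h_fin: "(\<integral>\<^sup>+z. h z \<partial>\<nu>) < top"
    and dist_integrable: "\<And>y. integrable \<nu> (\<lambda>z. dist (u z) y)"
    and essentially_separable: "\<exists>D. countable D \<and> (AE z in \<nu>. \<forall>e>0. \<exists>y\<in>D. dist (u z) y < e)"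
    and poincare: "\<And>y x r. x \<in> \<Omega> \<Longrightarrow> 0 < r \<Longrightarrow>
      (\<integral>\<^sup>+z\<in>ball x r. ennreal \<bar>dist (u z) y - avg (\<lambda>z. dist (u z) y) x r\<bar> \<partial>\<nu>)
        \<le> ennreal (C * r powr \<alpha>) * (\<integral>\<^sup>+z\<in>ball x (lam * r). 1 + ennreal (r powr \<theta>) * h z \<partial>\<nu>)"
begin

text \<open>A centre of the chain at level l is within 4 * rad l of z, the next one within rad (Suc
  l). Since 4 + 1/2 + 8 \<le> 16, the ball of radius R (Suc l) around the latter is contained in the
  ball of radius R l around the former.\<close>

abbreviation R :: "nat \<Rightarrow> real" where "R m \<equiv> 16 * rad m"

definition Hs :: "real \<Rightarrow> 'x \<Rightarrow> ennreal" where "Hs s z = 1 + ennreal (s powr \<theta>) * h z"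

definition a :: "'y \<Rightarrow> nat \<Rightarrow> 'x \<Rightarrow> real" where "a y m c = avg (\<lambda>z. dist (u z) y) c (R m)"

text \<open>Right-hand side of the Poincare inequality divided by the volume: it bounds the mean
  oscillation of \<open>dist (u z) y\<close> on the ball for every y at once.\<close>

definition osc :: "nat \<Rightarrow> 'x \<Rightarrow> ennreal" where
  "osc m c = ennreal (C * R m powr \<alpha>) * (\<integral>\<^sup>+z\<in>ball c (lam * R m). Hs (R m) z \<partial>\<nu>) / ennreal (vol c (R m))"

definition \<Phi> :: "nat \<Rightarrow> 'x \<Rightarrow> 'x \<Rightarrow> ennreal" where
  "\<Phi> m c z = osc m c + (\<Sum>j. osc (m + 1 + j) (\<kappa> (m + 1 + j) z))"

lemma Hs_measurable [measurable]: "Hs s \<in> borel_measurable \<nu>"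
  unfolding Hs_def[abs_def] by measurable

lemma dist_measurable [measurable]: "(\<lambda>z. dist (u z) y) \<in> borel_measurable \<nu>"
  using dist_integrable by blast

lemma R_pos [simp]: "0 < R m" by simp

lemma vol_osc:
  assumes "c \<in> \<Omega>"
  shows "ennreal (vol c (R m)) * osc m c = ennreal (C * R m powr \<alpha>) * (\<integral>\<^sup>+z\<in>ball c (lam * R m). Hs (R m) z \<partial>\<nu>)"
proof -
  have "0 < vol c (R m)" using ball_pos[OF \<Omega>_closure[OF assms]] by simp
  then show ?thesis
    unfolding osc_def
    by (subst ennreal_times_divide, subst mult.commute[of "ennreal (vol c (R m))"], intro mult_divide_eq_ennreal) auto
qed

lemma oscillation_le:
  assumes "c \<in> \<Omega>"
  shows "(\<integral>\<^sup>+z\<in>ball c (R m). ennreal \<bar>dist (u z) y - a y m c\<bar> \<partial>\<nu>) \<le> ennreal (vol c (R m)) * osc m c"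
  using poincare[OF assms R_pos[of m], of y] unfolding vol_osc[OF assms] a_def Hs_def .

lemma consecutive_averages:
  assumes "c \<in> \<Omega>" "c' \<in> \<Omega>" "dist c c' + R (Suc m) \<le> R m"
  shows "ennreal \<bar>a y (Suc m) c' - a y m c\<bar> \<le> ennreal (dbl 4) * osc m c"
proof -
  let ?v = "vol c' (R (Suc m))"
  have v: "0 < ?v" using ball_pos[OF \<Omega>_closure[OF assms(2)]] by simp
  have "ennreal ?v * ennreal \<bar>a y (Suc m) c' - a y m c\<bar>
    \<le> (\<integral>\<^sup>+z\<in>ball c' (R (Suc m)). ennreal \<bar>dist (u z) y - a y m c\<bar> \<partial>\<nu>)"
    unfolding a_def[of y "Suc m" c'] using \<Omega>_closure[OF assms(2)] 
    by (intro vol_avg_diff_le dist_integrable) auto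
  also have "\<dots> \<le> (\<integral>\<^sup>+z\<in>ball c (R m). ennreal \<bar>dist (u z) y - a y m c\<bar> \<partial>\<nu>)"
  proof (rule nn_integral_mono)
    fix z
    have "z \<in> ball c (R m)" if "z \<in> ball c' (R (Suc m))"
      using that assms(3) dist_triangle[of c z c'] by simp
    then show "ennreal \<bar>dist (u z) y - a y m c\<bar> * indicator (ball c' (R (Suc m))) z
       \<le> ennreal \<bar>dist (u z) y - a y m c\<bar> * indicator (ball c (R m)) z"
      by (auto split: split_indicator)
  qed
  also have "\<dots> \<le> ennreal (vol c (R m)) * osc m c" by (rule oscillation_le[OF assms(1)])
  \<comment> \<open>By assumption dist c c' + R m is at most 3/2 * R m, which is below 4 * R (Suc
    m).\<close>
  also have "\<dots> \<le> ennreal (dbl 4 * ?v) * osc m c"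
  proof (intro mult_right_mono ennreal_leI vol_compare)
    show "c' \<in> closure \<Omega>" using \<Omega>_closure[OF assms(2)] .
    show "dist c c' + R m \<le> 4 * R (Suc m)" using assms(3) rad_pos[of m] unfolding rad_Suc by linarith
  qed auto
  also have "\<dots> = ennreal ?v * (ennreal (dbl 4) * osc m c)"
    using dbl_ge_1[of 4] v by (simp add: ennreal_mult mult.assoc mult.left_commute)
  finally show ?thesis
    using v by (subst (asm) ennreal_mult_le_mult_iff) auto
qed

lemma chain_bound:
  assumes "c \<in> X m" "z \<in> \<Omega>" "dist c z < 4 * rad m" "m < n"
  shows "ennreal \<bar>a y n (\<kappa> n z) - a y m c\<bar> \<le> ennreal (dbl 4) * \<Phi> m c z"
proof -
  \<comment> \<open>The chain starts at the given c instead of \<kappa> m z, so that one average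
    serves all z near c.\<close>
  define cc where "cc = (\<lambda>l. if l = m then c else \<kappa> l z)"
  have cc_X: "cc l \<in> X l" for l using assms \<kappa>(1)[OF \<Omega>_closure] by (auto simp: cc_def)
  then have cc: "cc l \<in> \<Omega>" for l using X_sub by blast
  have d1: "dist (cc l) z \<le> 4 * rad l" for l
    using assms(3) \<kappa>(2)[OF \<Omega>_closure[OF assms(2)], of l] rad_pos[of l]
    unfolding cc_def by (smt (verit) dist_commute)
  have d2: "dist z (cc (Suc l)) \<le> rad (Suc l)" if "m \<le> l" for l
    using \<kappa>(2)[OF \<Omega>_closure[OF assms(2)], of "Suc l"] that by (simp add: cc_def)
  have st: "dist (cc l) (cc (Suc l)) + R (Suc l) \<le> R l" if "m \<le> l" for l
    using d1[of l] d2[OF that] dist_triangle[of "cc l" "cc (Suc l)" z] rad_pos[of l]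
    unfolding rad_Suc by linarith
  have "ennreal \<bar>a y (m + j) (cc (m + j)) - a y m c\<bar> \<le> (\<Sum>i<j. ennreal (dbl 4) * osc (m + i) (cc (m + i)))" for j
  proof (induction j)
    case (Suc j)
    have "ennreal \<bar>a y (m + Suc j) (cc (m + Suc j)) - a y m c\<bar>
      \<le> ennreal (\<bar>a y (m + j) (cc (m + j)) - a y m c\<bar> + \<bar>a y (Suc (m + j)) (cc (Suc (m + j))) - a y (m + j) (cc (m + j))\<bar>)"
      by (intro ennreal_leI) simp
    also have "\<dots> = ennreal \<bar>a y (m + j) (cc (m + j)) - a y m c\<bar> + ennreal \<bar>a y (Suc (m + j)) (cc (Suc (m + j))) - a y (m + j) (cc (m + j))\<bar>"
      by (rule ennreal_plus) auto
    also have "\<dots> \<le> (\<Sum>i<j. ennreal (dbl 4) * osc (m + i) (cc (m + i))) + ennreal (dbl 4) * osc (m + j) (cc (m + j))"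
      by (intro add_mono Suc consecutive_averages cc st) simp
    finally show ?case by simp
  qed (simp add: cc_def)
  from this[of "n - m"] have "ennreal \<bar>a y n (\<kappa> n z) - a y m c\<bar> \<le> ennreal (dbl 4) * (\<Sum>i<n - m. osc (m + i) (cc (m + i)))"
    using assms(4) by (simp add: cc_def sum_distrib_left)
  also have "(\<Sum>i<n - m. osc (m + i) (cc (m + i))) \<le> \<Phi> m c z"
  proof -
    obtain k where k: "n - m = Suc k" using assms(4) by (cases "n - m") auto
    have "(\<Sum>i<n - m. osc (m + i) (cc (m + i))) = osc m c + (\<Sum>j<k. osc (m + 1 + j) (\<kappa> (m + 1 + j) z))"
      unfolding k by (subst sum.lessThan_Suc_shift) (simp add: cc_def)
    also have "\<dots> \<le> \<Phi> m c z"
      unfolding \<Phi>_def by (intro add_left_mono sum_le_suminf) auto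
    finally show ?thesis .
  qed
  finally show ?thesis by (simp add: mult_left_mono)
qed

lemma Hs_mono:
  assumes "m \<le> l" shows "Hs (R l) z \<le> ennreal (16 powr \<theta>) * Hs (rad m) z"
proof -
  have "R l \<le> 16 * rad m" using assms by (simp add: power_decreasing)
  then have "R l powr \<theta> \<le> (16 * rad m) powr \<theta>" using const by (intro powr_mono2) auto
  also have "\<dots> = 16 powr \<theta> * rad m powr \<theta>" by (simp add: powr_mult)
  finally have "ennreal (R l powr \<theta>) * h z \<le> ennreal (16 powr \<theta> * rad m powr \<theta>) * h z"
    by (intro mult_right_mono ennreal_leI) auto
  moreover have "(1::ennreal) \<le> ennreal (16 powr \<theta>)"
    using ge_one_powr_ge_zero[of 16 \<theta>] const by (metis ennreal_1 ennreal_leI one_le_numeral)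
  ultimately show ?thesis unfolding Hs_def distrib_left
    by (intro add_mono) (simp_all add: ennreal_mult mult.assoc)
qed

text \<open>Weighted with volumes, the oscillation bounds of one level add up by bounded overlap and
  keep the gain rad l powr \<alpha>. The density on the right is that of the coarser level m, so
  that sums over all l \<ge> m share one integral.\<close>

lemma selected_oscillation_sum:
  assumes "m \<le> l" and A: "A \<in> sets borel" and Y: "Y \<subseteq> X l" "\<And>c. c \<in> Y \<Longrightarrow> ball c (lam * R l) \<subseteq> A"
  shows "(\<Sum>c\<in>Y. ennreal (vol c (R l)) * osc l c)
     \<le> ennreal (C * overlap (16 * lam) * 16 powr (\<alpha> + \<theta>) * rad l powr \<alpha>) * (\<integral>\<^sup>+z\<in>A. Hs (rad m) z \<partial>\<nu>)"
proof -
  note [measurable] = A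
  have "(\<Sum>c\<in>Y. ennreal (vol c (R l)) * osc l c) 
     = ennreal (C * R l powr \<alpha>) * (\<Sum>c\<in>Y. \<integral>\<^sup>+z\<in>ball c ((16 * lam) * rad l). Hs (R l) z \<partial>\<nu>)"
    unfolding sum_distrib_left using Y(1) X_sub
    by (intro sum.cong) (auto simp: vol_osc subset_iff mult.assoc mult.left_commute)
  also have "\<dots> \<le> ennreal (C * R l powr \<alpha>) * (ennreal (overlap (16 * lam)) * (\<integral>\<^sup>+z\<in>A. Hs (R l) z \<partial>\<nu>))"
  proof (intro mult_left_mono sum_ball_integrals_le)
    show "separated (rad l) Y" by (rule separated_subset[OF X_separated Y(1)])
    show "ball c (16 * lam * rad l) \<subseteq> A" if "c \<in> Y" for c
      using Y(2)[OF that] by (simp add: mult.assoc mult.left_commute)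
  qed (use const in auto)
  also have "\<dots> \<le> ennreal (C * R l powr \<alpha>) * (ennreal (overlap (16 * lam)) * (\<integral>\<^sup>+z\<in>A. ennreal (16 powr \<theta>) * Hs (rad m) z \<partial>\<nu>))"
    by (intro mult_left_mono nn_integral_mono mult_right_mono Hs_mono assms) auto
  also have "\<dots> = ennreal (C * R l powr \<alpha>) * (ennreal (overlap (16 * lam)) * (ennreal (16 powr \<theta>) * (\<integral>\<^sup>+z\<in>A. Hs (rad m) z \<partial>\<nu>)))"
    by (subst nn_integral_cmult[symmetric]) (auto simp: mult.assoc)
  also have "\<dots> = ennreal (C * overlap (16 * lam) * 16 powr (\<alpha> + \<theta>) * rad l powr \<alpha>) * (\<integral>\<^sup>+z\<in>A. Hs (rad m) z \<partial>\<nu>)"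
  proof -
    have eq: "C * overlap (16 * lam) * 16 powr (\<alpha> + \<theta>) * rad l powr \<alpha>
      = (C * R l powr \<alpha>) * (overlap (16 * lam) * 16 powr \<theta>)"
      by (simp add: powr_mult powr_add)
    show ?thesis
      unfolding eq using const overlap_ge_1[of "16 * lam"] by (simp add: ennreal_mult mult.assoc)
  qed
  finally show ?thesis .
qed

definition K0 :: real where "K0 = C * overlap (16 * lam) * 16 powr (\<alpha> + \<theta>)"

lemma K0_pos: "0 < K0"
  using const overlap_ge_1[of "16 * lam"] by (simp add: K0_def)

lemma Hs_integral_fin: "(\<integral>\<^sup>+z\<in>A. Hs s z \<partial>\<nu>) < top"
proof -
  have "(\<integral>\<^sup>+z\<in>A. Hs s z \<partial>\<nu>) \<le> (\<integral>\<^sup>+z. 1 + ennreal (s powr \<theta>) * h z \<partial>\<nu>)"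
    by (intro nn_integral_mono) (auto simp: Hs_def split: split_indicator)
  also have "\<dots> = emeasure \<nu> (space \<nu>) + ennreal (s powr \<theta>) * (\<integral>\<^sup>+z. h z \<partial>\<nu>)"
    by (simp add: nn_integral_add nn_integral_cmult)
  also have "\<dots> < top"
    using h_fin by (simp add: ennreal_mult_less_top emeasure_eq_measure)
  finally show ?thesis .
qed

text \<open>The gain in \<alpha> takes the place of Lebesgue differentiation: the integrals of the
  errors are summable over the levels.\<close>

lemma averages_converge:
  "AE z in \<nu>. (\<lambda>l. a y l (\<kappa> l z)) \<longlonglongrightarrow> dist (u z) y"
proof -
  let ?f = "\<lambda>l z. ennreal \<bar>dist (u z) y - a y l (\<kappa> l z)\<bar>"
  obtain I where I: "(\<integral>\<^sup>+z\<in>UNIV. Hs (rad 0) z \<partial>\<nu>) = ennreal I" "0 \<le> I"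
    using Hs_integral_fin[of "rad 0" UNIV] by (cases "\<integral>\<^sup>+z\<in>UNIV. Hs (rad 0) z \<partial>\<nu>") auto
  have meas: "?f l \<in> borel_measurable \<nu>" for l
    by (rule selection_measurable[OF \<nu>_space, of l "\<lambda>c z. ennreal \<bar>dist (u z) y - a y l c\<bar>"]) measurable
  have bd: "(\<integral>\<^sup>+z. ?f l z \<partial>\<nu>) \<le> ennreal (K0 * I * ((1/2) powr \<alpha>)^l)" for l
  proof -
    have "(\<integral>\<^sup>+z\<in>UNIV. ?f l z \<partial>\<nu>) \<le> (\<Sum>c\<in>{c\<in>X l. \<exists>z\<in>UNIV. dist z c \<le> rad l}. 
        \<integral>\<^sup>+z\<in>ball c (R l). ennreal \<bar>dist (u z) y - a y l c\<bar> \<partial>\<nu>)"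
      by (rule selection_nn_integral_le[where g="\<lambda>c z. ennreal \<bar>dist (u z) y - a y l c\<bar>"]) auto
    also have "\<dots> \<le> (\<Sum>c\<in>X l. ennreal (vol c (R l)) * osc l c)"
      using X_finite X_sub
      by (intro order_trans[OF sum_mono2 sum_mono] oscillation_le) auto
    also have "\<dots> \<le> ennreal (K0 * rad l powr \<alpha>) * (\<integral>\<^sup>+z\<in>UNIV. Hs (rad 0) z \<partial>\<nu>)"
      unfolding K0_def by (rule selected_oscillation_sum) auto
    also have "\<dots> = ennreal (K0 * I * ((1/2) powr \<alpha>)^l)"
      using I K0_pos by (simp add: ennreal_mult[symmetric] powr_half_power mult_ac)
    finally show ?thesis by simp
  qed
  have "AE z in \<nu>. (\<lambda>l. ?f l z) \<longlonglongrightarrow> 0"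
    by (rule AE_tendsto_0_if_integrals_summable(2)[OF meas bd])
       (use K0_pos I half_powr_less_1[OF const(3)] in \<open>auto intro!: summable_mult\<close>)
  then show ?thesis
  proof eventually_elim
    case (elim z)
    then have "(\<lambda>l. ennreal \<bar>dist (u z) y - a y l (\<kappa> l z)\<bar>) \<longlonglongrightarrow> ennreal 0" by (simp only: ennreal_0)
    then have "(\<lambda>l. \<bar>dist (u z) y - a y l (\<kappa> l z)\<bar>) \<longlonglongrightarrow> 0"
      by (rule tendsto_ennreal_iff[THEN iffD1, rotated 2]) simp_all
    then have "(\<lambda>l. dist (u z) y - a y l (\<kappa> l z)) \<longlonglongrightarrow> 0" by (simp add: tendsto_rabs_zero_iff)
    from tendsto_minus[OF this] have "(\<lambda>l. a y l (\<kappa> l z) - dist (u z) y) \<longlonglongrightarrow> 0" by simp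
    then show ?case by (rule LIM_zero_cancel)
  qed
qed

text \<open>The function Phi does not depend on the test point y, so one may take the supremum over
  a countable essentially dense set of test points.\<close>
lemma pairwise_bound:
  obtains G where "AE z in \<nu>. z \<in> G"
    "\<And>m c z w. c \<in> X m \<Longrightarrow> z \<in> G \<Longrightarrow> w \<in> G \<Longrightarrow> dist c z < 4 * rad m \<Longrightarrow> dist c w < 4 * rad m \<Longrightarrow>
      ennreal (dist (u z) (u w)) \<le> ennreal (dbl 4) * (\<Phi> m c z + \<Phi> m c w)"
proof -
  obtain D where D: "countable D" "AE z in \<nu>. \<forall>e>0. \<exists>y\<in>D. dist (u z) y < e"
    using essentially_separable by blast
  define G where "G = {z\<in>\<Omega>. (\<forall>e>0. \<exists>y\<in>D. dist (u z) y < e) \<and> (\<forall>y\<in>D. (\<lambda>l. a y l (\<kappa> l z)) \<longlonglongrightarrow> dist (u z) y)}"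
  have "AE z in \<nu>. \<forall>y\<in>D. (\<lambda>l. a y l (\<kappa> l z)) \<longlonglongrightarrow> dist (u z) y"
    using D(1) averages_converge by (subst AE_ball_countable) auto
  then have "AE z in \<nu>. z \<in> G"
    using D(2) AE_space by eventually_elim (auto simp: G_def space_\<nu>)
  moreover have "ennreal (dist (u z) (u w)) \<le> ennreal (dbl 4) * (\<Phi> m c z + \<Phi> m c w)"
    if c: "c \<in> X m" and zw: "z \<in> G" "w \<in> G" "dist c z < 4 * rad m" "dist c w < 4 * rad m" for m c z w
  proof -
    have one: "ennreal \<bar>dist (u z) y - a y m c\<bar> \<le> ennreal (dbl 4) * \<Phi> m c z"
      if "z \<in> G" "dist c z < 4 * rad m" "y \<in> D" for z y
    proof (rule tendsto_upperbound)
      have "(\<lambda>l. a y l (\<kappa> l z)) \<longlonglongrightarrow> dist (u z) y" using that by (auto simp: G_def)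
      then show "(\<lambda>l. ennreal \<bar>a y l (\<kappa> l z) - a y m c\<bar>) \<longlonglongrightarrow> ennreal \<bar>dist (u z) y - a y m c\<bar>"
        by (intro tendsto_ennrealI tendsto_intros)
      show "eventually (\<lambda>l. ennreal \<bar>a y l (\<kappa> l z) - a y m c\<bar> \<le> ennreal (dbl 4) * \<Phi> m c z) sequentially"
        using eventually_gt_at_top[of m]
        by eventually_elim (use that c in \<open>auto simp: G_def intro: chain_bound\<close>)
    qed simp
    show ?thesis
    proof (rule ennreal_le_epsilon)
      fix e :: real assume "0 < e"
      then obtain y where y: "y \<in> D" "dist (u z) y < e/2" using zw(1) unfolding G_def by (auto dest: spec[of _ "e/2"])
      \<comment> \<open>The average at c cancels: through it, \<open>u z\<close> and
        \<open>u w\<close> have almost the same distance to y, and y is close to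
        \<open>u z\<close>.\<close>
      have "dist (u z) (u w) \<le> \<bar>dist (u z) y - a y m c\<bar> + \<bar>dist (u w) y - a y m c\<bar> + e"
        using dist_triangle2[of "u z" "u w" y] y(2) by linarith
      then have "ennreal (dist (u z) (u w)) \<le> ennreal \<bar>dist (u z) y - a y m c\<bar> + ennreal \<bar>dist (u w) y - a y m c\<bar> + ennreal e"
        using \<open>0 < e\<close> by (simp flip: ennreal_plus add: ennreal_leI)
      also have "\<dots> \<le> ennreal (dbl 4) * \<Phi> m c z + ennreal (dbl 4) * \<Phi> m c w + ennreal e"
        using one zw y(1) by (intro add_mono) auto
      finally show "ennreal (dist (u z) (u w)) \<le> ennreal (dbl 4) * (\<Phi> m c z + \<Phi> m c w) + ennreal e"
        by (simp add: distrib_left)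
    qed
  qed
  ultimately show thesis using that by blast
qed

lemma \<Phi>_measurable [measurable]: "\<Phi> m c \<in> borel_measurable \<nu>"
proof -
  have [measurable]: "(\<lambda>z. osc l (\<kappa> l z)) \<in> borel_measurable \<nu>" for l
    by (rule selection_measurable[OF \<nu>_space, of l "\<lambda>c z. osc l c"]) simp
  show ?thesis unfolding \<Phi>_def[abs_def] by measurable
qed

text \<open>Finer centres selected for points within 4 * rad m of c are within 5 * rad m of c, and
  the enlarged balls around them have radius at most 16 * lam * rad m.\<close>

definition \<Lambda> :: real where "\<Lambda> = 5 + 16 * lam"

definition K1 :: real where "K1 = K0 / (1 - (1/2) powr \<alpha>)"

lemma K1_pos: "0 < K1"
  using K0_pos half_powr_less_1[OF const(3)] by (simp add: K1_def)

lemma \<Phi>_integral_le: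
  assumes c: "c \<in> X m"
  shows "(\<integral>\<^sup>+z\<in>ball c (4 * rad m). \<Phi> m c z \<partial>\<nu>) 
    \<le> ennreal (K1 * rad m powr \<alpha>) * (\<integral>\<^sup>+z\<in>ball c (\<Lambda> * rad m). Hs (rad m) z \<partial>\<nu>)"
proof -
  let ?B = "ball c (4 * rad m)" and ?A = "ball c (\<Lambda> * rad m)"
  let ?I = "\<integral>\<^sup>+z\<in>?A. Hs (rad m) z \<partial>\<nu>"
  have meas [measurable]: "(\<lambda>z. osc l (\<kappa> l z)) \<in> borel_measurable \<nu>" for l
    by (rule selection_measurable[OF \<nu>_space, of l "\<lambda>c z. osc l c"]) simp
  have split: "(\<integral>\<^sup>+z\<in>?B. \<Phi> m c z \<partial>\<nu>) = (\<integral>\<^sup>+z\<in>?B. osc m c \<partial>\<nu>) 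
     + (\<Sum>j. \<integral>\<^sup>+z\<in>?B. osc (m + 1 + j) (\<kappa> (m + 1 + j) z) \<partial>\<nu>)"
    unfolding \<Phi>_def by (subst nn_integral_suminf[symmetric], measurable)
      (subst nn_integral_add[symmetric], auto simp: distrib_right ennreal_suminf_multc)
  have "(\<integral>\<^sup>+z\<in>?B. osc m c \<partial>\<nu>) = ennreal (vol c (4 * rad m)) * osc m c"
    by (subst nn_integral_cmult) (auto simp: nn_integral_indicator_vol mult.commute)
  also have "\<dots> \<le> ennreal (vol c (R m)) * osc m c"
    by (intro mult_right_mono ennreal_leI finite_measure_mono Int_mono subset_ball) auto
  also have "\<dots> \<le> ennreal (K0 * rad m powr \<alpha>) * ?I"
  proof -
    have "lam * R m \<le> \<Lambda> * rad m" using rad_pos[of m] by (simp add: \<Lambda>_def distrib_right)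
    then show ?thesis
      using selected_oscillation_sum[of m m ?A "{c}"] c unfolding K0_def by (simp add: subset_ball)
  qed
  finally have first: "(\<integral>\<^sup>+z\<in>?B. osc m c \<partial>\<nu>) \<le> ennreal (K0 * rad m powr \<alpha>) * ?I" .
  have rest: "(\<integral>\<^sup>+z\<in>?B. osc l (\<kappa> l z) \<partial>\<nu>) \<le> ennreal (K0 * rad l powr \<alpha>) * ?I" if "m \<le> l" for l
  proof -
    let ?Y = "{c'\<in>X l. \<exists>z\<in>?B. dist z c' \<le> rad l}"
    have "(\<integral>\<^sup>+z\<in>?B. osc l (\<kappa> l z) \<partial>\<nu>) \<le> (\<Sum>c'\<in>?Y. \<integral>\<^sup>+z\<in>ball c' (R l). osc l c' \<partial>\<nu>)"
      by (rule selection_nn_integral_le[where g="\<lambda>c z. osc l c"]) auto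
    also have "\<dots> = (\<Sum>c'\<in>?Y. ennreal (vol c' (R l)) * osc l c')"
      by (subst nn_integral_cmult) (auto simp: nn_integral_indicator_vol mult.commute)
    also have "\<dots> \<le> ennreal (K0 * rad l powr \<alpha>) * ?I"
      unfolding K0_def
    proof (rule selected_oscillation_sum[OF that])
      fix c' assume "c' \<in> ?Y"
      then obtain z where z: "dist c z < 4 * rad m" "dist z c' \<le> rad l" by auto
      have rl: "rad l \<le> rad m" using that by (simp add: power_decreasing)
      have d: "dist c c' \<le> 5 * rad m" using z rl dist_triangle[of c c' z] by linarith
      have "lam * R l \<le> 16 * lam * rad m" using rl const by simp
      show "ball c' (lam * R l) \<subseteq> ?A"
      proof
        fix w assume "w \<in> ball c' (lam * R l)"
        then have "dist c' w < 16 * lam * rad m" using \<open>lam * R l \<le> 16 * lam * rad m\<close> by simp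
        then show "w \<in> ?A" using d dist_triangle[of c w c'] by (simp add: \<Lambda>_def distrib_right)
      qed
    qed auto
    finally show ?thesis .
  qed
  have geo: "(\<Sum>j. ennreal (K0 * rad (m + j) powr \<alpha>)) = ennreal (K1 * rad m powr \<alpha>)"
  proof -
    let ?q = "(1/2) powr \<alpha> :: real"
    have q: "0 \<le> ?q" "?q < 1" using half_powr_less_1[OF const(3)] by auto
    have eq: "K0 * rad (m + j) powr \<alpha> = K0 * rad m powr \<alpha> * ?q^j" for j
      unfolding powr_half_power by (simp add: power_add)
    have "(\<lambda>j. K0 * rad m powr \<alpha> * ?q^j) sums (K0 * rad m powr \<alpha> * (1 / (1 - ?q)))"
      by (intro sums_mult geometric_sums) (use q in auto)
    then have "(\<lambda>j. K0 * rad (m + j) powr \<alpha>) sums (K1 * rad m powr \<alpha>)"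
      unfolding eq by (simp add: K1_def mult_ac)
    then show ?thesis
      using K0_pos by (subst suminf_ennreal2) (auto simp: sums_iff)
  qed
  have "(\<integral>\<^sup>+z\<in>?B. \<Phi> m c z \<partial>\<nu>) \<le> ennreal (K0 * rad m powr \<alpha>) * ?I 
     + (\<Sum>j. ennreal (K0 * rad (m + 1 + j) powr \<alpha>) * ?I)"
    unfolding split by (intro add_mono first suminf_le rest) auto
  also have "\<dots> = (\<Sum>j. ennreal (K0 * rad (m + j) powr \<alpha>) * ?I)"
    by (subst suminf_offset[of "\<lambda>j. ennreal (K0 * rad (m + j) powr \<alpha>) * ?I" 1]) (auto simp: ac_simps)
  also have "\<dots> = (\<Sum>j. ennreal (K0 * rad (m + j) powr \<alpha>)) * ?I"
    by (rule ennreal_suminf_multc)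
  finally show ?thesis unfolding geo .
qed

text \<open>The factor 3 is 1 + 2: the bound for the mean of \<Phi> on the ball, plus the value of
  \<Phi> at the chosen point, which is at most twice that bound.\<close>

definition poincare_const :: real where "poincare_const = 3 * dbl 4 * K1"

text \<open>By Chebyshev's inequality some w in the ball has \<Phi> at most twice the bound for its
  mean, and y = u w serves. An actual value of u thus replaces the average of u, which has no
  meaning in a metric space.\<close>

lemma value_exists:
  assumes c: "c \<in> X m"
  shows "\<exists>y. (\<integral>\<^sup>+z\<in>ball c (4 * rad m). ennreal (dist (u z) y) \<partial>\<nu>)
    \<le> ennreal (poincare_const * rad m powr \<alpha>) * (\<integral>\<^sup>+z\<in>ball c (\<Lambda> * rad m). 1 + ennreal (rad m powr \<theta>) * h z \<partial>\<nu>)"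
proof -
  let ?B = "ball c (4 * rad m)"
  define v where "v = vol c (4 * rad m)"
  have v: "0 < v" unfolding v_def using ball_pos[OF \<Omega>_closure[OF X_sub[OF c]]] by simp
  obtain G where G: "AE z in \<nu>. z \<in> G"
    "\<And>z w. z \<in> G \<Longrightarrow> w \<in> G \<Longrightarrow> dist c z < 4 * rad m \<Longrightarrow> dist c w < 4 * rad m \<Longrightarrow>
      ennreal (dist (u z) (u w)) \<le> ennreal (dbl 4) * (\<Phi> m c z + \<Phi> m c w)"
    using pairwise_bound c by metis
  define Bd where "Bd = ennreal (K1 * rad m powr \<alpha>) * (\<integral>\<^sup>+z\<in>ball c (\<Lambda> * rad m). Hs (rad m) z \<partial>\<nu>)"
  have Bd_fin: "Bd < top" using Hs_integral_fin by (simp add: Bd_def ennreal_mult_less_top)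
  \<comment> \<open>The summand 1 in \<open>Hs\<close> makes the bound positive; Chebyshev's
    argument by contradiction needs twice the bound to be strictly larger than the bound.\<close>
  have Bd_pos: "0 < Bd"
  proof -
    have "4 * rad m \<le> \<Lambda> * rad m" using const by (intro mult_right_mono) (auto simp: \<Lambda>_def)
    then have "ennreal v \<le> (\<integral>\<^sup>+z\<in>ball c (\<Lambda> * rad m). Hs (rad m) z \<partial>\<nu>)"
        unfolding v_def nn_integral_indicator_vol[symmetric]
    proof (intro nn_integral_mono)
      fix x
      have "ball c (4 * rad m) \<subseteq> ball c (\<Lambda> * rad m)" using \<open>4 * rad m \<le> \<Lambda> * rad m\<close> by (rule subset_ball)
      then show "indicator (ball c (4 * rad m)) x \<le> Hs (rad m) x * indicator (ball c (\<Lambda> * rad m)) x"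
        by (auto simp: Hs_def split: split_indicator)
    qed
    then have "0 < (\<integral>\<^sup>+z\<in>ball c (\<Lambda> * rad m). Hs (rad m) z \<partial>\<nu>)" using v by (metis ennreal_less_zero_iff less_le_trans)
    then show ?thesis using K1_pos by (simp add: Bd_def ennreal_zero_less_mult_iff)
  qed
  obtain b where b: "Bd = ennreal b" "0 < b" using Bd_fin Bd_pos by (cases Bd) auto
  have "\<exists>w\<in>G. w \<in> ?B \<and> \<Phi> m c w \<le> ennreal (2 * b / v)"
  proof (rule ccontr)
    assume "\<not> ?thesis"
    then have no: "\<And>w. w \<in> G \<Longrightarrow> w \<in> ?B \<Longrightarrow> ennreal (2 * b / v) \<le> \<Phi> m c w" by (meson le_cases)
    have "ennreal (2 * b) = ennreal (2 * b / v) * ennreal v"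
      using v b by (simp add: ennreal_mult[symmetric])
    also have "\<dots> = (\<integral>\<^sup>+z\<in>?B. ennreal (2 * b / v) \<partial>\<nu>)"
      by (subst nn_integral_cmult) (auto simp: nn_integral_indicator_vol v_def)
    also have "\<dots> \<le> (\<integral>\<^sup>+z\<in>?B. \<Phi> m c z \<partial>\<nu>)"
      using G(1) by (intro nn_integral_mono_AE, eventually_elim) (auto split: split_indicator intro: no)
    also have "\<dots> \<le> ennreal b" using \<Phi>_integral_le[OF c] b(1) by (simp add: Bd_def)
    finally show False using b(2) by (simp add: ennreal_le_iff)
  qed
  then obtain w where w: "w \<in> G" "w \<in> ?B" "\<Phi> m c w \<le> ennreal (2 * b / v)" by blast
  have "(\<integral>\<^sup>+z\<in>?B. ennreal (dist (u z) (u w)) \<partial>\<nu>) \<le> (\<integral>\<^sup>+z. ennreal (dbl 4) * (\<Phi> m c z * indicator ?B z + ennreal (2 * b / v) * indicator ?B z) \<partial>\<nu>)"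
  proof (rule nn_integral_mono_AE)
    show "AE z in \<nu>. ennreal (dist (u z) (u w)) * indicator ?B z
      \<le> ennreal (dbl 4) * (\<Phi> m c z * indicator ?B z + ennreal (2 * b / v) * indicator ?B z)"
      using G(1)
    proof eventually_elim
      case (elim z)
      show ?case
      proof (cases "z \<in> ?B")
        case True
        then have "ennreal (dist (u z) (u w)) \<le> ennreal (dbl 4) * (\<Phi> m c z + \<Phi> m c w)"
          using G(2)[OF elim w(1)] w(2) by simp
        also have "\<dots> \<le> ennreal (dbl 4) * (\<Phi> m c z + ennreal (2 * b / v))"
          by (intro mult_left_mono add_left_mono w) simp
        finally show ?thesis using True by simp
      qed simp
    qed
  qed
  also have "\<dots> = ennreal (dbl 4) * ((\<integral>\<^sup>+z\<in>?B. \<Phi> m c z \<partial>\<nu>) + ennreal (2 * b / v) * ennreal v)"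
    by (simp add: nn_integral_cmult nn_integral_add nn_integral_indicator_vol v_def del: nn_integral_indicator)
  also have "\<dots> \<le> ennreal (dbl 4) * (ennreal b + ennreal (2 * b))"
    using v b \<Phi>_integral_le[OF c] by (intro mult_left_mono add_mono) (auto simp: Bd_def ennreal_mult[symmetric])
  also have "\<dots> = ennreal (3 * dbl 4) * Bd"
    using b dbl_ge_1[of 4] by (simp add: ennreal_mult[symmetric] flip: ennreal_plus)
  also have "\<dots> = ennreal (poincare_const * rad m powr \<alpha>) * (\<integral>\<^sup>+z\<in>ball c (\<Lambda> * rad m). Hs (rad m) z \<partial>\<nu>)"
    using K1_pos dbl_ge_1[of 4] unfolding Bd_def poincare_const_def
    by (simp add: mult.assoc[symmetric] ennreal_mult[symmetric])
  finally show ?thesis unfolding Hs_def by blast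
qed

end

section \<open>Subsequences\<close>

lemma diagonal_convergent_subsequence:
  fixes f :: "nat \<Rightarrow> 'i \<Rightarrow> real"
  assumes "countable Q" "\<And>i. i \<in> Q \<Longrightarrow> \<exists>B. \<forall>k. \<bar>f k i\<bar> \<le> B"
  obtains r :: "nat \<Rightarrow> nat" where "strict_mono r" "\<And>i. i \<in> Q \<Longrightarrow> convergent (\<lambda>k. f (r k) i)"
proof (cases "Q = {}")
  case True
  then show thesis using that[of id] by (auto simp: strict_mono_id)
next
  case False
  define P where "P = (\<lambda>n s. convergent (\<lambda>k. f (s k) (from_nat_into Q n)))"
  interpret subseqs P
  proof
    fix n and s :: "nat \<Rightarrow> nat" assume "strict_mono s"
    obtain B where "\<And>k. \<bar>f k (from_nat_into Q n)\<bar> \<le> B"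
      using assms(2)[OF from_nat_into[OF False]] by metis
    then have "bounded (range (\<lambda>k. f (s k) (from_nat_into Q n)))" by (auto simp: bounded_iff)
    then obtain l r where "strict_mono r" "((\<lambda>k. f (s k) (from_nat_into Q n)) \<circ> r) \<longlonglongrightarrow> l"
      using bounded_imp_convergent_subsequence by blast
    then show "\<exists>r'. strict_mono r' \<and> P n (s \<circ> r')"
      by (auto simp: P_def o_def convergent_def)
  qed
  have "convergent (\<lambda>k. f (diagseq k) i)" if i: "i \<in> Q" for i
  proof -
    obtain n where n: "i = from_nat_into Q n" using from_nat_into_surj[OF assms(1) i] by metis
    have "P n (diagseq \<circ> ((+) (Suc n)))"
    proof (rule diagseq_holds)
      fix r s :: "nat \<Rightarrow> nat" and n assume "strict_mono r" "P n s"
      then show "P n (s \<circ> r)"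
        using LIMSEQ_subseq_LIMSEQ[of "\<lambda>k. f (s k) (from_nat_into Q n)" _ r]
        by (auto simp: P_def o_def convergent_def)
    qed
    then have "convergent (\<lambda>k. f (diagseq (k + Suc n)) i)"
      by (simp add: P_def o_def n add.commute)
    then show ?thesis by (rule convergent_ignore_initial_segment[THEN iffD1])
  qed
  with subseq_diagseq that show thesis by blast
qed

text \<open>A second thinning of the diagonal subsequence: the k-th index is taken so late that the
  finitely many sequences in A k are already within \<epsilon> k of their limits.\<close>

lemma diagonal_subsequence_with_rate:
  fixes f :: "nat \<Rightarrow> 'i \<Rightarrow> real"
  assumes "countable Q" "\<And>i. i \<in> Q \<Longrightarrow> \<exists>B. \<forall>k. \<bar>f k i\<bar> \<le> B"
    and A: "\<And>k. finite (A k)" "\<And>k. A k \<subseteq> Q" and \<epsilon>: "\<And>k. 0 < \<epsilon> k"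
  obtains r :: "nat \<Rightarrow> nat" and L where "strict_mono r" "\<And>i. i \<in> Q \<Longrightarrow> (\<lambda>k. f (r k) i) \<longlonglongrightarrow> L i"
    "\<And>k i. i \<in> A k \<Longrightarrow> \<bar>f (r k) i - L i\<bar> \<le> \<epsilon> k"
proof -
  obtain s :: "nat \<Rightarrow> nat" where s: "strict_mono s" "\<And>i. i \<in> Q \<Longrightarrow> convergent (\<lambda>k. f (s k) i)"
    using assms(1,2) diagonal_convergent_subsequence[of Q f thesis] by blast
  define L where "L = (\<lambda>i. lim (\<lambda>k. f (s k) i))"
  have L: "(\<lambda>k. f (s k) i) \<longlonglongrightarrow> L i" if "i \<in> Q" for i
    using s(2)[OF that] by (simp add: L_def convergent_LIMSEQ_iff)
  have step: "\<exists>k>n. \<forall>i\<in>A m. \<bar>f (s k) i - L i\<bar> \<le> \<epsilon> m" for n m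
  proof -
    have "eventually (\<lambda>k. \<forall>i\<in>A m. \<bar>f (s k) i - L i\<bar> \<le> \<epsilon> m) sequentially"
    proof (rule eventually_ball_finite[OF A(1)], rule ballI)
      fix i assume "i \<in> A m"
      then have "eventually (\<lambda>k. dist (f (s k) i) (L i) < \<epsilon> m) sequentially"
        using A(2) by (intro tendstoD L \<epsilon>) auto
      then show "eventually (\<lambda>k. \<bar>f (s k) i - L i\<bar> \<le> \<epsilon> m) sequentially"
        by eventually_elim (simp add: dist_real_def)
    qed
    then have "eventually (\<lambda>k. n < k \<and> (\<forall>i\<in>A m. \<bar>f (s k) i - L i\<bar> \<le> \<epsilon> m)) sequentially"
      using eventually_gt_at_top[of n] by eventually_elim auto
    then show ?thesis using eventually_happens'[OF sequentially_bot] by blast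
  qed
  define nx where "nx = (\<lambda>m n. SOME k. n < k \<and> (\<forall>i\<in>A m. \<bar>f (s k) i - L i\<bar> \<le> \<epsilon> m))"
  have nx: "n < nx m n \<and> (\<forall>i\<in>A m. \<bar>f (s (nx m n)) i - L i\<bar> \<le> \<epsilon> m)" for n m
    unfolding nx_def by (rule someI_ex) (use step in blast)
  define t where "t = rec_nat (nx 0 0) (\<lambda>m n. nx (Suc m) n)"
  have t: "t 0 = nx 0 0" "t (Suc m) = nx (Suc m) (t m)" for m by (simp_all add: t_def)
  have "\<bar>f (s (t k)) i - L i\<bar> \<le> \<epsilon> k" if "i \<in> A k" for k i
    using nx that by (cases k) (auto simp: t)
  moreover have tm: "strict_mono t" using nx by (simp add: strict_mono_Suc_iff t)
  moreover have "(\<lambda>k. f (s (t k)) i) \<longlonglongrightarrow> L i" if "i \<in> Q" for i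
    using LIMSEQ_subseq_LIMSEQ[OF L[OF that] tm] by (simp add: o_def)
  ultimately show thesis
    using that[of "s \<circ> t" L] s(1) by (auto simp: strict_mono_o)
qed

section \<open>Comparison of a sequence of maps with its values on the levels\<close>

context doubling_levels
begin

text \<open>Convergence in measure of u k is not enough to control the ultralimit pointwise. Along a
  subsequence for which the finitely many distances at levels up to k are within a summable error
  of their limits, the k-th map is compared with its own approximation at level k, and the latter
  with the coarser ones through the limit distances.\<close>
lemma approximation_by_level_values:
  fixes q :: "nat \<Rightarrow> 'x \<Rightarrow> nat \<Rightarrow> 'y::metric_space" and v :: "nat \<Rightarrow> 'x \<Rightarrow> 'y"
  assumes \<tau>: "space \<tau> \<subseteq> closure \<Omega>" "sets \<tau> = sets (restrict_space borel (space \<tau>))"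
    and K: "0 \<le> K" and \<beta>: "0 \<le> \<beta>" "\<beta> < 1"
    and int: "\<And>k m. (\<integral>\<^sup>+x. ennreal (dist (q m (\<kappa> m x) k) (q (Suc m) (\<kappa> (Suc m) x) k)) \<partial>\<tau>) \<le> ennreal (K * \<beta>^m)"
    and lim: "\<And>k. AE x in \<tau>. (\<lambda>m. dist (v k x) (q m (\<kappa> m x) k)) \<longlonglongrightarrow> 0"
    and rate: "\<And>k m m' c c'. m \<le> k \<Longrightarrow> m' \<le> k \<Longrightarrow> c \<in> X m \<Longrightarrow> c' \<in> X m' \<Longrightarrow>
       \<bar>dist (q m c k) (q m' c' k) - L m c m' c'\<bar> \<le> (1/2)^k / real (Suc k)"
  shows "AE x in \<tau>. \<forall>e>0. \<exists>l0. \<forall>l\<ge>l0. \<forall>\<^sub>F k in sequentially. dist (v k x) (q l (\<kappa> l x) k) < e"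
proof -
  define D where "D = (\<lambda>k m x. dist (q m (\<kappa> m x) k) (q (Suc m) (\<kappa> (Suc m) x) k))"
  define D' where "D' = (\<lambda>m x. L m (\<kappa> m x) (Suc m) (\<kappa> (Suc m) x))"
  have D_meas [measurable]: "(\<lambda>x. D k m x) \<in> borel_measurable \<tau>" for k m
    unfolding D_def
    by (rule selection_measurable[OF \<tau>, of m "\<lambda>c x. dist (q m c k) (q (Suc m) (\<kappa> (Suc m) x) k)"],
        rule selection_measurable[OF \<tau>, of "Suc m" "\<lambda>c' x. dist (q m c k) (q (Suc m) c' k)" for c]) simp
  have near: "\<bar>D k m x - D' m x\<bar> \<le> (1/2)^k / real (Suc k)" if "x \<in> space \<tau>" "Suc m \<le> k" for k m x
    unfolding D_def D'_def using that \<tau>(1) by (intro rate \<kappa>) auto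
  have rate0: "(\<lambda>k. (1/2::real)^k / real (Suc k)) \<longlonglongrightarrow> 0"
  proof (rule Lim_null_comparison)
    show "\<forall>\<^sub>F k in sequentially. norm ((1/2::real)^k / real (Suc k)) \<le> (1/2)^k"
    proof (intro always_eventually allI)
      fix k :: nat
      have "(1/2::real)^k / real (Suc k) \<le> (1/2)^k / 1" by (intro divide_left_mono) auto
      then show "norm ((1/2::real)^k / real (Suc k)) \<le> (1/2)^k" by simp
    qed
    show "(\<lambda>k. (1/2::real)^k) \<longlonglongrightarrow> 0" by (rule LIMSEQ_power_zero) simp
  qed
  have D_lim: "(\<lambda>k. D k m x) \<longlonglongrightarrow> D' m x" if "x \<in> space \<tau>" for m x
  proof (rule LIM_zero_cancel, rule Lim_null_comparison[OF _ rate0])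
    show "\<forall>\<^sub>F k in sequentially. norm (D k m x - D' m x) \<le> (1/2)^k / real (Suc k)"
      using eventually_ge_at_top[of "Suc m"] by eventually_elim (use near[OF that] in auto)
  qed
  have D'_nonneg: "0 \<le> D' m x" if "x \<in> space \<tau>" for m x
    by (rule LIMSEQ_le_const[OF D_lim[OF that]]) (simp add: D_def)
  have D'_meas: "(\<lambda>x. D' m x) \<in> borel_measurable \<tau>" for m
    by (rule borel_measurable_LIMSEQ_real[OF D_lim D_meas])
  have "(\<integral>\<^sup>+x. ennreal (D' m x) \<partial>\<tau>) \<le> ennreal (K * \<beta>^m)" for m
  proof -
    have "(\<integral>\<^sup>+x. ennreal (D' m x) \<partial>\<tau>) = (\<integral>\<^sup>+x. liminf (\<lambda>k. ennreal (D k m x)) \<partial>\<tau>)"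
      by (intro nn_integral_cong lim_imp_Liminf[symmetric] tendsto_ennrealI D_lim) auto
    also have "\<dots> \<le> liminf (\<lambda>k. \<integral>\<^sup>+x. ennreal (D k m x) \<partial>\<tau>)" by (rule nn_integral_liminf) measurable
    also have "\<dots> \<le> liminf (\<lambda>k. ennreal (K * \<beta>^m))"
      by (rule Liminf_mono) (auto simp: D_def int)
    finally show ?thesis by (simp add: Liminf_const)
  qed
  then have ae1: "AE x in \<tau>. (\<Sum>m. ennreal (D' m x)) < top"
    using D'_meas K \<beta> by (intro AE_tendsto_0_if_integrals_summable(1)[where b="\<lambda>m. K * \<beta>^m"]) (auto intro!: summable_mult)
  \<comment> \<open>The k-th map is compared with its own value at level k. The distances beyond
    that level need not be close to their limits yet, so they are estimated by integration.\<close>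
  define E where "E = (\<lambda>k x. \<Sum>j. ennreal (D k (k + j) x))"
  have "(\<integral>\<^sup>+x. E k x \<partial>\<tau>) \<le> ennreal (K / (1 - \<beta>) * \<beta>^k)" for k
  proof -
    have "(\<integral>\<^sup>+x. E k x \<partial>\<tau>) = (\<Sum>j. \<integral>\<^sup>+x. ennreal (D k (k + j) x) \<partial>\<tau>)"
      unfolding E_def by (rule nn_integral_suminf) measurable
    also have "\<dots> \<le> (\<Sum>j. ennreal (K * \<beta>^(k + j)))"
      by (intro suminf_le) (auto simp: D_def int)
    also have "\<dots> = ennreal (\<Sum>j. K * \<beta>^k * \<beta>^j)"
      using K \<beta> by (subst suminf_ennreal2) (auto simp: power_add mult.assoc intro!: summable_mult)
    also have "(\<Sum>j. K * \<beta>^k * \<beta>^j) = K / (1 - \<beta>) * \<beta>^k"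
      using \<beta> by (subst suminf_mult) (auto simp: suminf_geometric)
    finally show ?thesis .
  qed
  then have ae2: "AE x in \<tau>. (\<lambda>k. E k x) \<longlonglongrightarrow> 0"
    using K \<beta>
    by (intro AE_tendsto_0_if_integrals_summable(2)[where b="\<lambda>k. K / (1 - \<beta>) * \<beta>^k"])
       (auto simp: E_def intro!: summable_mult)
  have ae3: "AE x in \<tau>. \<forall>k. (\<lambda>m. dist (v k x) (q m (\<kappa> m x) k)) \<longlonglongrightarrow> 0"
    using lim by (simp add: AE_all_countable)
  show ?thesis
    using ae1 ae2 ae3 AE_space
  proof eventually_elim
    case (elim x)
    have tel: "dist (q l (\<kappa> l x) k) (q (l + n) (\<kappa> (l + n) x) k) \<le> (\<Sum>j<n. D k (l + j) x)" for k l n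
    proof (induction n)
      case (Suc n)
      then show ?case
        using dist_triangle[of "q l (\<kappa> l x) k" "q (l + Suc n) (\<kappa> (l + Suc n) x) k" "q (l + n) (\<kappa> (l + n) x) k"]
        by (simp add: D_def)
    qed simp
    \<comment> \<open>Telescoping from level k upwards; for the fixed map v k the remaining distance
      at level m vanishes as m grows.\<close>
    have vq: "ennreal (dist (v k x) (q k (\<kappa> k x) k)) \<le> E k x" for k
    proof (rule ennreal_le_epsilon)
      fix e :: real assume "0 < e"
      have "eventually (\<lambda>m. dist (v k x) (q m (\<kappa> m x) k) < e) sequentially"
        using order_tendstoD(2)[OF elim(3)[rule_format, of k] \<open>0 < e\<close>] .
      then obtain m where m: "m \<ge> k" "dist (v k x) (q m (\<kappa> m x) k) < e"
        unfolding eventually_sequentially by (meson le_cases order_refl)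
      then obtain n where n: "m = k + n" by (metis le_iff_add)
      have "dist (v k x) (q k (\<kappa> k x) k) \<le> (\<Sum>j<n. D k (k + j) x) + e"
        using tel[of k k n] m(2) dist_triangle[of "v k x" "q k (\<kappa> k x) k" "q m (\<kappa> m x) k"]
        by (simp add: n dist_commute)
      then have "ennreal (dist (v k x) (q k (\<kappa> k x) k)) \<le> ennreal ((\<Sum>j<n. D k (k + j) x) + e)"
        by (rule ennreal_leI)
      also have "\<dots> = ennreal (\<Sum>j<n. D k (k + j) x) + ennreal e"
        using \<open>0 < e\<close> by (intro ennreal_plus sum_nonneg) (auto simp: D_def)
      also have "ennreal (\<Sum>j<n. D k (k + j) x) = (\<Sum>j<n. ennreal (D k (k + j) x))"
        by (rule sum_ennreal[symmetric]) (simp add: D_def)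
      also have "\<dots> \<le> E k x" unfolding E_def by (rule sum_le_suminf) auto
      finally show "ennreal (dist (v k x) (q k (\<kappa> k x) k)) \<le> E k x + ennreal e" by (simp add: add_right_mono)
    qed
    have summ: "summable (\<lambda>m. D' m x)"
      by (rule summable_suminf_not_top) (use elim(1,4) D'_nonneg in auto)
    show ?case
    proof (intro allI impI)
      fix e :: real assume e: "0 < e"
      obtain l0 where l0: "\<And>l n. l \<ge> l0 \<Longrightarrow> norm (\<Sum>m=l..<n. D' m x) < e/3"
        using summ e unfolding summable_Cauchy by (metis zero_less_divide_iff zero_less_numeral)
      have ev: "eventually (\<lambda>k. dist (v k x) (q l (\<kappa> l x) k) < e) sequentially" if l: "l \<ge> l0" for l
      proof -
        have "eventually (\<lambda>k. E k x < ennreal (e/3)) sequentially"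
          using order_tendstoD(2)[OF elim(2)] e by simp
        moreover have "(\<lambda>k. (1/2::real)^k) \<longlonglongrightarrow> 0" by (rule LIMSEQ_power_zero) simp
        then have "eventually (\<lambda>k. (1/2::real)^k < e/3) sequentially"
          using order_tendstoD(2) e by (metis zero_less_divide_iff zero_less_numeral)
        ultimately show ?thesis using eventually_ge_at_top[of l]
        proof eventually_elim
          case (elim k)
          have "ennreal (dist (v k x) (q k (\<kappa> k x) k)) < ennreal (e/3)" using vq[of k] elim(1) by (rule le_less_trans)
          then have d1: "dist (v k x) (q k (\<kappa> k x) k) < e/3" by (simp add: ennreal_less_iff)
          have "dist (q l (\<kappa> l x) k) (q k (\<kappa> k x) k) \<le> (\<Sum>j<k - l. D k (l + j) x)"
            using tel[of l k "k - l"] elim(3) by simp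
          also have "\<dots> \<le> (\<Sum>j<k - l. D' (l + j) x + (1/2)^k / real (Suc k))"
          proof (rule sum_mono)
            fix j assume "j \<in> {..<k - l}"
            then have "Suc (l + j) \<le> k" by auto
            from near[OF \<open>x \<in> space \<tau>\<close> this] show "D k (l + j) x \<le> D' (l + j) x + (1/2)^k / real (Suc k)" by linarith
          qed
          also have "\<dots> = (\<Sum>m=l..<k. D' m x) + real (k - l) * ((1/2)^k / real (Suc k))"
            using sum.shift_bounds_nat_ivl[of "\<lambda>m. D' m x" 0 l "k - l"] elim(3)
            by (simp add: sum.distrib atLeast0LessThan add.commute)
          also have "\<dots> \<le> e/3 + (1/2)^k"
          proof (rule add_mono)
            show "(\<Sum>m=l..<k. D' m x) \<le> e/3" using l0[OF l, of k] by simp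
            \<comment> \<open>Fewer than Suc k consecutive distances are replaced by their limits;
              the divisor Suc k in the rate keeps their total error below (1/2)^k.\<close>
            have "real (k - l) * ((1/2)^k / real (Suc k)) \<le> real (Suc k) * ((1/2)^k / real (Suc k))"
              by (intro mult_right_mono) auto
            then show "real (k - l) * ((1/2)^k / real (Suc k)) \<le> (1/2)^k" by simp
          qed
          finally show ?case
            using d1 elim(2) dist_triangle[of "v k x" "q l (\<kappa> l x) k" "q k (\<kappa> k x) k"]
            by (simp add: dist_commute)
        qed
      qed
      then show "\<exists>l0. \<forall>l\<ge>l0. \<forall>\<^sub>F k in sequentially. dist (v k x) (q l (\<kappa> l x) k) < e" by blast
    qed
  qed
qed

end

text \<open>All constants are uniform in k, and \<open>y m c k\<close> is the value attached to the
  centre c of level m for the k-th map.\<close>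

locale level_values = doubling_levels \<nu> \<Omega> Cd X \<kappa>
  for \<nu> :: "'x::metric_space measure" and \<Omega> :: "'x set" and Cd :: real and X \<kappa> +
  fixes u :: "nat \<Rightarrow> 'x \<Rightarrow> 'y::metric_space" and h :: "nat \<Rightarrow> 'x \<Rightarrow> ennreal" and K \<Lambda> B \<alpha> \<theta> :: real
    and y :: "nat \<Rightarrow> 'x \<Rightarrow> nat \<Rightarrow> 'y"
  assumes const: "0 < K" "1 \<le> \<Lambda>" "0 < \<alpha>" "0 \<le> \<theta>" "0 \<le> B"
    and h [measurable]: "\<And>k. h k \<in> borel_measurable \<nu>" and h_bound: "\<And>k. (\<integral>\<^sup>+z. h k z \<partial>\<nu>) \<le> ennreal B"
    and dist_measurable [measurable]: "\<And>k y. (\<lambda>z. dist (u k z) y) \<in> borel_measurable \<nu>"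
    and value_bound: "\<And>k m c. c \<in> X m \<Longrightarrow> (\<integral>\<^sup>+z\<in>ball c (4 * rad m). ennreal (dist (u k z) (y m c k)) \<partial>\<nu>)
      \<le> ennreal (K * rad m powr \<alpha>) * (\<integral>\<^sup>+z\<in>ball c (\<Lambda> * rad m). 1 + ennreal (rad m powr \<theta>) * h k z \<partial>\<nu>)"
begin

abbreviation \<beta> :: real where "\<beta> \<equiv> (1/2) powr \<alpha>"

lemma \<beta>: "0 \<le> \<beta>" "\<beta> < 1"
  using half_powr_less_1[OF const(3)] by auto

lemma vol_pos: "c \<in> \<Omega> \<Longrightarrow> 0 < r \<Longrightarrow> 0 < vol c r"
  by (rule ball_pos[OF \<Omega>_closure])

definition A :: "nat \<Rightarrow> nat \<Rightarrow> 'x \<Rightarrow> ennreal" where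
  "A k m c = (\<integral>\<^sup>+z\<in>ball c (4 * rad m). ennreal (dist (u k z) (y m c k)) \<partial>\<nu>) / ennreal (vol c (4 * rad m))"

lemma vol_A:
  assumes "c \<in> X m"
  shows "ennreal (vol c (4 * rad m)) * A k m c = (\<integral>\<^sup>+z\<in>ball c (4 * rad m). ennreal (dist (u k z) (y m c k)) \<partial>\<nu>)"
  unfolding A_def
  by (subst ennreal_times_divide, subst mult.commute[of "ennreal (vol c (4 * rad m))"], intro mult_divide_eq_ennreal)
     (use vol_pos[OF X_sub[OF assms], of "4 * rad m"] in auto)

text \<open>Both the measure on the domain and the codimension theta measure on its boundary satisfy
  the growth condition imposed on tau here.\<close>
definition growth :: "'x measure \<Rightarrow> real \<Rightarrow> bool" where
  "growth \<tau> C\<tau> \<longleftrightarrow> space \<tau> \<subseteq> closure \<Omega> \<and> sets \<tau> = sets (restrict_space borel (space \<tau>)) \<and> finite_measure \<tau> \<and> 0 \<le> C\<tau> \<and>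
     (\<forall>m. \<forall>c\<in>X m. emeasure \<tau> (cball c (rad m) \<inter> space \<tau>) \<le> ennreal (C\<tau> * rad m powr (-\<theta>) * vol c (4 * rad m)))"

text \<open>After division by the volume the summand 1 of the density contributes a constant, by
  doubling; only the energy part keeps a volume in its denominator.\<close>

lemma A_le:
  assumes c: "c \<in> X m"
  shows "A k m c \<le> ennreal (K * rad m powr \<alpha>) * (ennreal (dbl \<Lambda>) + ennreal (rad m powr \<theta> / vol c (4 * rad m)) * (\<integral>\<^sup>+z\<in>ball c (\<Lambda> * rad m). h k z \<partial>\<nu>))"
proof -
  let ?v = "vol c (4 * rad m)"
  have v: "0 < ?v" using vol_pos[OF X_sub[OF c]] by simp
  let ?I = "\<integral>\<^sup>+z\<in>ball c (\<Lambda> * rad m). h k z \<partial>\<nu>"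
  have "(\<integral>\<^sup>+z\<in>ball c (\<Lambda> * rad m). 1 + ennreal (rad m powr \<theta>) * h k z \<partial>\<nu>)
    = (\<integral>\<^sup>+z. indicator (ball c (\<Lambda> * rad m)) z + ennreal (rad m powr \<theta>) * (h k z * indicator (ball c (\<Lambda> * rad m)) z) \<partial>\<nu>)"
    by (intro nn_integral_cong) (auto simp: distrib_right mult.assoc)
  also have "\<dots> = ennreal (vol c (\<Lambda> * rad m)) + ennreal (rad m powr \<theta>) * ?I"
    by (subst nn_integral_add) (auto simp: nn_integral_cmult nn_integral_indicator_vol simp del: nn_integral_indicator)
  also have "\<dots> \<le> ennreal (dbl \<Lambda> * ?v) + ennreal (rad m powr \<theta>) * ?I"
  proof (intro add_right_mono ennreal_leI vol_compare)
    show "c \<in> closure \<Omega>" by (rule \<Omega>_closure[OF X_sub[OF c]])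
    show "dist c c + \<Lambda> * rad m \<le> \<Lambda> * (4 * rad m)" using const by simp
  qed simp
  also have "\<dots> = ennreal ?v * (ennreal (dbl \<Lambda>) + ennreal (rad m powr \<theta> / ?v) * ?I)"
    using v dbl_ge_1[of \<Lambda>] by (simp add: distrib_left mult.assoc[symmetric] ennreal_mult[symmetric] mult.commute)
  finally have "ennreal ?v * A k m c \<le> ennreal (K * rad m powr \<alpha>) * (ennreal ?v * (ennreal (dbl \<Lambda>) + ennreal (rad m powr \<theta> / ?v) * ?I))"
    unfolding vol_A[OF c] by (intro order_trans[OF value_bound[OF c]] mult_left_mono) auto
  then have "ennreal ?v * A k m c \<le> ennreal ?v * (ennreal (K * rad m powr \<alpha>) * (ennreal (dbl \<Lambda>) + ennreal (rad m powr \<theta> / ?v) * ?I))"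
    by (simp only: mult.left_commute)
  then show ?thesis using v by (subst (asm) ennreal_mult_le_mult_iff) auto
qed

text \<open>The power rad m powr (-\<theta>) from the growth of \<tau> cancels the weight rad m powr
  \<theta> in front of the energy density, the volumes cancel, and bounded overlap sums the
  energies. What remains is the gain rad m powr \<alpha> = \<beta>^m.\<close>

lemma selection_integral_A:
  assumes g: "growth \<tau> C\<tau>"
  shows "(\<integral>\<^sup>+x. A k m (\<kappa> m x) \<partial>\<tau>) \<le> ennreal (K * (dbl \<Lambda> * measure \<tau> (space \<tau>) + C\<tau> * overlap \<Lambda> * B) * \<beta>^m)"
proof -
  have sp: "space \<tau> \<subseteq> closure \<Omega>" and st: "sets \<tau> = sets (restrict_space borel (space \<tau>))" and C\<tau>: "0 \<le> C\<tau>"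
    and gr: "\<And>m c. c \<in> X m \<Longrightarrow> emeasure \<tau> (cball c (rad m) \<inter> space \<tau>) \<le> ennreal (C\<tau> * rad m powr (-\<theta>) * vol c (4 * rad m))"
    using g by (auto simp: growth_def)
  interpret \<tau>: finite_measure \<tau> using g by (simp add: growth_def)
  define W where "W = (\<lambda>c. ennreal (rad m powr \<theta> / vol c (4 * rad m)) * (\<integral>\<^sup>+z\<in>ball c (\<Lambda> * rad m). h k z \<partial>\<nu>))"
  have cb: "cball c (rad m) \<inter> space \<tau> \<in> sets \<tau>" for c
    by (subst st) (auto simp: sets_restrict_space)
  have "(\<integral>\<^sup>+x. A k m (\<kappa> m x) \<partial>\<tau>) \<le> (\<integral>\<^sup>+x. ennreal (K * rad m powr \<alpha>) * (ennreal (dbl \<Lambda>) + (\<Sum>c\<in>X m. W c * indicator (cball c (rad m) \<inter> space \<tau>) x)) \<partial>\<tau>)"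
  proof (rule nn_integral_mono)
    fix x assume x: "x \<in> space \<tau>"
    then have x': "\<kappa> m x \<in> X m" "x \<in> cball (\<kappa> m x) (rad m) \<inter> space \<tau>" using \<kappa>[of x m] sp by (auto simp: dist_commute)
    have "W (\<kappa> m x) = W (\<kappa> m x) * indicator (cball (\<kappa> m x) (rad m) \<inter> space \<tau>) x" using x' by simp
    also have "\<dots> \<le> (\<Sum>c\<in>X m. W c * indicator (cball c (rad m) \<inter> space \<tau>) x)"
      using x' X_finite by (intro member_le_sum[where f="\<lambda>c. W c * indicator (cball c (rad m) \<inter> space \<tau>) x"]) auto
    finally have W_le: "W (\<kappa> m x) \<le> (\<Sum>c\<in>X m. W c * indicator (cball c (rad m) \<inter> space \<tau>) x)" .
    have "A k m (\<kappa> m x) \<le> ennreal (K * rad m powr \<alpha>) * (ennreal (dbl \<Lambda>) + W (\<kappa> m x))"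
      unfolding W_def by (rule A_le[OF x'(1)])
    also have "\<dots> \<le> ennreal (K * rad m powr \<alpha>) * (ennreal (dbl \<Lambda>) + (\<Sum>c\<in>X m. W c * indicator (cball c (rad m) \<inter> space \<tau>) x))"
      by (intro mult_left_mono add_left_mono W_le) auto
    finally show "A k m (\<kappa> m x) \<le> ennreal (K * rad m powr \<alpha>) * (ennreal (dbl \<Lambda>) + (\<Sum>c\<in>X m. W c * indicator (cball c (rad m) \<inter> space \<tau>) x))" .
  qed
  also have "\<dots> = ennreal (K * rad m powr \<alpha>) * (ennreal (dbl \<Lambda>) * emeasure \<tau> (space \<tau>) + (\<Sum>c\<in>X m. W c * emeasure \<tau> (cball c (rad m) \<inter> space \<tau>)))"
    using cb by (simp add: nn_integral_cmult nn_integral_add nn_integral_sum nn_integral_cmult_indicator)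
  also have "(\<Sum>c\<in>X m. W c * emeasure \<tau> (cball c (rad m) \<inter> space \<tau>)) \<le> ennreal C\<tau> * (ennreal (overlap \<Lambda>) * ennreal B)"
  proof -
    have "(\<Sum>c\<in>X m. W c * emeasure \<tau> (cball c (rad m) \<inter> space \<tau>)) \<le> (\<Sum>c\<in>X m. ennreal C\<tau> * (\<integral>\<^sup>+z\<in>ball c (\<Lambda> * rad m). h k z \<partial>\<nu>))"
    proof (rule sum_mono)
      fix c assume c: "c \<in> X m"
      have v: "0 < vol c (4 * rad m)" using vol_pos[OF X_sub[OF c]] by simp
      have "W c * emeasure \<tau> (cball c (rad m) \<inter> space \<tau>) \<le> W c * ennreal (C\<tau> * rad m powr (-\<theta>) * vol c (4 * rad m))"
        by (intro mult_left_mono gr[OF c]) simp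
      also have "\<dots> = ennreal (rad m powr \<theta> / vol c (4 * rad m)) * ennreal (C\<tau> * rad m powr (-\<theta>) * vol c (4 * rad m)) * (\<integral>\<^sup>+z\<in>ball c (\<Lambda> * rad m). h k z \<partial>\<nu>)"
        unfolding W_def by (simp only: mult_ac)
      also have "ennreal (rad m powr \<theta> / vol c (4 * rad m)) * ennreal (C\<tau> * rad m powr (-\<theta>) * vol c (4 * rad m)) = ennreal C\<tau>"
        using v C\<tau> by (subst ennreal_mult[symmetric]) (auto simp: powr_minus field_simps)
      finally show "W c * emeasure \<tau> (cball c (rad m) \<inter> space \<tau>) \<le> ennreal C\<tau> * (\<integral>\<^sup>+z\<in>ball c (\<Lambda> * rad m). h k z \<partial>\<nu>)" .
    qed
    also have "\<dots> = ennreal C\<tau> * (\<Sum>c\<in>X m. \<integral>\<^sup>+z\<in>ball c (\<Lambda> * rad m). h k z \<partial>\<nu>)" by (rule sum_distrib_left[symmetric])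
    also have "\<dots> \<le> ennreal C\<tau> * (ennreal (overlap \<Lambda>) * (\<integral>\<^sup>+z\<in>UNIV. h k z \<partial>\<nu>))"
      using const by (intro mult_left_mono sum_ball_integrals_le X_separated) auto
    also have "\<dots> \<le> ennreal C\<tau> * (ennreal (overlap \<Lambda>) * ennreal B)"
      using h_bound[of k] by (intro mult_left_mono) auto
    finally show ?thesis .
  qed
  also have "ennreal (K * rad m powr \<alpha>) * (ennreal (dbl \<Lambda>) * emeasure \<tau> (space \<tau>) + ennreal C\<tau> * (ennreal (overlap \<Lambda>) * ennreal B))
     = ennreal (K * (dbl \<Lambda> * measure \<tau> (space \<tau>) + C\<tau> * overlap \<Lambda> * B) * \<beta>^m)"
  proof -
    have nn: "0 \<le> dbl \<Lambda>" "0 \<le> overlap \<Lambda>" using dbl_ge_1[of \<Lambda>] overlap_ge_1[of \<Lambda>] by auto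
    have "ennreal (dbl \<Lambda>) * emeasure \<tau> (space \<tau>) + ennreal C\<tau> * (ennreal (overlap \<Lambda>) * ennreal B)
      = ennreal (dbl \<Lambda> * measure \<tau> (space \<tau>) + C\<tau> * overlap \<Lambda> * B)"
      using nn C\<tau> const by (simp add: \<tau>.emeasure_eq_measure ennreal_mult mult.assoc ennreal_plus del: ennreal_plus[symmetric])
    moreover define Q where "Q = dbl \<Lambda> * measure \<tau> (space \<tau>) + C\<tau> * overlap \<Lambda> * B"
    moreover have "0 \<le> Q" using nn C\<tau> const by (simp add: Q_def)
    ultimately show ?thesis
      using const by (simp add: ennreal_mult[symmetric] powr_half_power mult_ac del: ennreal_plus)
  qed
  finally show ?thesis by (simp add: mult_left_mono add_left_mono)
qed

text \<open>Both values approximate u k in mean on the smaller of the two balls, which is contained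
  in the larger one and of comparable volume.\<close>

lemma consecutive_values:
  assumes x: "x \<in> closure \<Omega>"
  shows "ennreal (dist (y m (\<kappa> m x) k) (y (Suc m) (\<kappa> (Suc m) x) k)) \<le> ennreal (dbl 4) * (A k m (\<kappa> m x) + A k (Suc m) (\<kappa> (Suc m) x))"
proof -
  define c c' where "c = \<kappa> m x" and "c' = \<kappa> (Suc m) x"
  have X: "c \<in> X m" "c' \<in> X (Suc m)" using \<kappa>(1)[OF x] by (auto simp: c_def c'_def)
  have d: "dist c c' \<le> 3/2 * rad m"
    using \<kappa>(2)[OF x, of m] \<kappa>(2)[OF x, of "Suc m"] dist_triangle[of c c' x]
    unfolding c_def c'_def rad_Suc by (simp add: dist_commute)
  let ?W = "ball c' (4 * rad (Suc m))" and ?w = "vol c' (4 * rad (Suc m))"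
  have w: "0 < ?w" using vol_pos[OF X_sub[OF X(2)]] by simp
  have sub: "?W \<subseteq> ball c (4 * rad m)"
  proof
    fix z assume "z \<in> ?W"
    then have "dist c' z < 2 * rad m" unfolding rad_Suc by simp
    then have "dist c z < 4 * rad m" using d dist_triangle[of c z c'] rad_pos[of m] by linarith
    then show "z \<in> ball c (4 * rad m)" by simp
  qed
  have "ennreal ?w * ennreal (dist (y m c k) (y (Suc m) c' k)) = (\<integral>\<^sup>+z\<in>?W. ennreal (dist (y m c k) (y (Suc m) c' k)) \<partial>\<nu>)"
    by (subst nn_integral_cmult) (auto simp: nn_integral_indicator_vol mult.commute simp del: nn_integral_indicator)
  also have "\<dots> \<le> (\<integral>\<^sup>+z. ennreal (dist (u k z) (y m c k)) * indicator (ball c (4 * rad m)) z + ennreal (dist (u k z) (y (Suc m) c' k)) * indicator ?W z \<partial>\<nu>)"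
  proof (rule nn_integral_mono)
    fix z
    show "ennreal (dist (y m c k) (y (Suc m) c' k)) * indicator ?W z
      \<le> ennreal (dist (u k z) (y m c k)) * indicator (ball c (4 * rad m)) z + ennreal (dist (u k z) (y (Suc m) c' k)) * indicator ?W z"
    proof (cases "z \<in> ?W")
      case True
      then have "z \<in> ball c (4 * rad m)" using sub by blast
      moreover have "ennreal (dist (y m c k) (y (Suc m) c' k)) \<le> ennreal (dist (u k z) (y m c k) + dist (u k z) (y (Suc m) c' k))"
        by (intro ennreal_leI) (metis dist_commute dist_triangle)
      ultimately show ?thesis using True by simp
    qed simp
  qed
  also have "\<dots> = ennreal (vol c (4 * rad m)) * A k m c + ennreal ?w * A k (Suc m) c'"
    unfolding vol_A[OF X(1)] vol_A[OF X(2)] by (rule nn_integral_add) measurable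
  also have "\<dots> \<le> ennreal (dbl 4 * ?w) * A k m c + ennreal (dbl 4 * ?w) * A k (Suc m) c'"
  proof -
    have "vol c (4 * rad m) \<le> dbl 4 * ?w"
    proof (rule vol_compare)
      show "c' \<in> closure \<Omega>" by (rule \<Omega>_closure[OF X_sub[OF X(2)]])
      show "dist c c' + 4 * rad m \<le> 4 * (4 * rad (Suc m))" using d rad_pos[of m] unfolding rad_Suc by linarith
    qed simp
    moreover have "?w \<le> dbl 4 * ?w" using dbl_ge_1[of 4] w by simp
    ultimately show ?thesis by (intro add_mono mult_right_mono ennreal_leI) auto
  qed
  also have "\<dots> = ennreal ?w * (ennreal (dbl 4) * (A k m c + A k (Suc m) c'))"
    using dbl_ge_1[of 4] by (simp add: ennreal_mult distrib_left mult.left_commute mult.assoc)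
  finally show ?thesis
    using w unfolding c_def c'_def by (subst (asm) ennreal_mult_le_mult_iff) auto
qed

lemma A_measurable [measurable]: 
  assumes "growth \<tau> C\<tau>" shows "(\<lambda>x. A k m (\<kappa> m x)) \<in> borel_measurable \<tau>"
  using assms by (intro selection_measurable[of \<tau> m "\<lambda>c x. A k m c"]) (auto simp: growth_def)

definition C0 :: "'x measure \<Rightarrow> real \<Rightarrow> real" where
  "C0 \<tau> C\<tau> = K * (dbl \<Lambda> * measure \<tau> (space \<tau>) + C\<tau> * overlap \<Lambda> * B)"

lemma C0_nonneg: "growth \<tau> C\<tau> \<Longrightarrow> 0 \<le> C0 \<tau> C\<tau>"
  using const dbl_ge_1[of \<Lambda>] overlap_ge_1[of \<Lambda>] by (auto simp: C0_def growth_def)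

lemma consecutive_values_integral:
  assumes g: "growth \<tau> C\<tau>"
  shows "(\<integral>\<^sup>+x. ennreal (dist (y m (\<kappa> m x) k) (y (Suc m) (\<kappa> (Suc m) x) k)) \<partial>\<tau>) \<le> ennreal (2 * dbl 4 * C0 \<tau> C\<tau> * \<beta>^m)"
proof -
  note [measurable] = A_measurable[OF g]
  have "(\<integral>\<^sup>+x. ennreal (dist (y m (\<kappa> m x) k) (y (Suc m) (\<kappa> (Suc m) x) k)) \<partial>\<tau>)
     \<le> (\<integral>\<^sup>+x. ennreal (dbl 4) * (A k m (\<kappa> m x) + A k (Suc m) (\<kappa> (Suc m) x)) \<partial>\<tau>)"
    using g by (intro nn_integral_mono consecutive_values) (auto simp: growth_def)
  also have "\<dots> = ennreal (dbl 4) * ((\<integral>\<^sup>+x. A k m (\<kappa> m x) \<partial>\<tau>) + (\<integral>\<^sup>+x. A k (Suc m) (\<kappa> (Suc m) x) \<partial>\<tau>))"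
    by (simp add: nn_integral_cmult nn_integral_add)
  also have "\<dots> \<le> ennreal (dbl 4) * (ennreal (C0 \<tau> C\<tau> * \<beta>^m) + ennreal (C0 \<tau> C\<tau> * \<beta>^m))"
  proof (intro mult_left_mono add_mono)
    show "(\<integral>\<^sup>+x. A k m (\<kappa> m x) \<partial>\<tau>) \<le> ennreal (C0 \<tau> C\<tau> * \<beta>^m)"
      using selection_integral_A[OF g] by (simp add: C0_def)
    have "(\<integral>\<^sup>+x. A k (Suc m) (\<kappa> (Suc m) x) \<partial>\<tau>) \<le> ennreal (C0 \<tau> C\<tau> * \<beta>^Suc m)"
      using selection_integral_A[OF g, of k "Suc m"] by (simp only: C0_def)
    also have "\<dots> \<le> ennreal (C0 \<tau> C\<tau> * \<beta>^m)"
      using C0_nonneg[OF g] \<beta> by (intro ennreal_leI mult_left_mono power_decreasing) auto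
    finally show "(\<integral>\<^sup>+x. A k (Suc m) (\<kappa> (Suc m) x) \<partial>\<tau>) \<le> ennreal (C0 \<tau> C\<tau> * \<beta>^m)" .
  qed auto
  also have "\<dots> = ennreal (2 * dbl 4 * C0 \<tau> C\<tau> * \<beta>^m)"
  proof -
    have nn: "0 \<le> C0 \<tau> C\<tau> * \<beta>^m" "0 \<le> dbl 4" using C0_nonneg[OF g] dbl_ge_1[of 4] by auto
    then have "ennreal (C0 \<tau> C\<tau> * \<beta>^m) + ennreal (C0 \<tau> C\<tau> * \<beta>^m) = ennreal (2 * (C0 \<tau> C\<tau> * \<beta>^m))"
      by (subst ennreal_plus[symmetric]) auto
    then show ?thesis using nn by (simp add: ennreal_mult[symmetric] mult_ac)
  qed
  finally show ?thesis .
qed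

lemma A_tendsto_0:
  assumes g: "growth \<tau> C\<tau>" shows "AE x in \<tau>. (\<lambda>m. A k m (\<kappa> m x)) \<longlonglongrightarrow> 0"
  by (rule AE_tendsto_0_if_integrals_summable(2)[OF A_measurable[OF g] selection_integral_A[OF g, folded C0_def]])
     (use C0_nonneg[OF g] \<beta> in \<open>auto intro!: summable_mult\<close>)

text \<open>All radii are at most 1, so the factor rad m powr (-\<theta>) only weakens the
  bound.\<close>

lemma interior_growth: "growth \<nu> 1"
  unfolding growth_def
proof (intro conjI allI ballI \<nu>_space finite_\<nu>)
  fix m c assume c: "c \<in> X m"
  have "emeasure \<nu> (cball c (rad m) \<inter> space \<nu>) \<le> ennreal (vol c (4 * rad m))"
  proof -
    have "dist c z < 4 * rad m" if "dist c z \<le> rad m" for z using that rad_pos[of m] by linarith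
    then have "cball c (rad m) \<inter> \<Omega> \<subseteq> ball c (4 * rad m) \<inter> \<Omega>" by auto
    then show ?thesis unfolding emeasure_eq_measure space_\<nu> by (intro ennreal_leI finite_measure_mono) auto
  qed
  also have "\<dots> \<le> ennreal (1 * rad m powr (-\<theta>) * vol c (4 * rad m))"
  proof (intro ennreal_leI)
    have "rad m powr \<theta> \<le> 1 powr \<theta>" using const by (intro powr_mono2) (auto simp: power_le_one)
    then have "1 \<le> rad m powr (-\<theta>)" by (simp add: powr_minus one_le_inverse_iff)
    then show "vol c (4 * rad m) \<le> 1 * rad m powr (-\<theta>) * vol c (4 * rad m)"
      using mult_right_mono[of 1 "rad m powr (-\<theta>)" "vol c (4 * rad m)"] by simp
  qed
  finally show "emeasure \<nu> (cball c (rad m) \<inter> space \<nu>) \<le> ennreal (1 * rad m powr (-\<theta>) * vol c (4 * rad m))" .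
qed simp

lemma interior_lim: "AE z in \<nu>. (\<lambda>m. dist (u k z) (y m (\<kappa> m z) k)) \<longlonglongrightarrow> 0"
proof -
  let ?f = "\<lambda>m z. ennreal (dist (u k z) (y m (\<kappa> m z) k))"
  have meas: "?f m \<in> borel_measurable \<nu>" for m
    by (rule selection_measurable[OF \<nu>_space, of m "\<lambda>c z. ennreal (dist (u k z) (y m c k))"]) measurable
  define I where "I = overlap \<Lambda> * (measure \<nu> \<Omega> + B)"
  have I: "0 \<le> I" using overlap_ge_1[of \<Lambda>] const by (simp add: I_def)
  have bd: "(\<integral>\<^sup>+z. ?f m z \<partial>\<nu>) \<le> ennreal (K * I * \<beta>^m)" for m
  proof -
    have "(\<integral>\<^sup>+z\<in>UNIV. ?f m z \<partial>\<nu>) \<le> (\<Sum>c\<in>{c\<in>X m. \<exists>z\<in>UNIV. dist z c \<le> rad m}. \<integral>\<^sup>+z\<in>ball c (4 * rad m). ennreal (dist (u k z) (y m c k)) \<partial>\<nu>)"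
      by (rule selection_nn_integral_le[where g="\<lambda>c z. ennreal (dist (u k z) (y m c k))"]) auto
    also have "\<dots> \<le> (\<Sum>c\<in>X m. \<integral>\<^sup>+z\<in>ball c (4 * rad m). ennreal (dist (u k z) (y m c k)) \<partial>\<nu>)"
      using X_finite by (intro sum_mono2) auto
    also have "\<dots> \<le> (\<Sum>c\<in>X m. ennreal (K * rad m powr \<alpha>) * (\<integral>\<^sup>+z\<in>ball c (\<Lambda> * rad m). 1 + ennreal (rad m powr \<theta>) * h k z \<partial>\<nu>))"
      by (intro sum_mono value_bound)
    also have "\<dots> = ennreal (K * rad m powr \<alpha>) * (\<Sum>c\<in>X m. \<integral>\<^sup>+z\<in>ball c (\<Lambda> * rad m). 1 + ennreal (rad m powr \<theta>) * h k z \<partial>\<nu>)"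
      by (rule sum_distrib_left[symmetric])
    also have "\<dots> \<le> ennreal (K * rad m powr \<alpha>) * (ennreal (overlap \<Lambda>) * (\<integral>\<^sup>+z\<in>UNIV. 1 + ennreal (rad m powr \<theta>) * h k z \<partial>\<nu>))"
      using const by (intro mult_left_mono sum_ball_integrals_le X_separated) auto
    also have "\<dots> \<le> ennreal (K * rad m powr \<alpha>) * (ennreal (overlap \<Lambda>) * ennreal (measure \<nu> \<Omega> + B))"
    proof (intro mult_left_mono)
      have "rad m powr \<theta> \<le> 1 powr \<theta>" using const by (intro powr_mono2) (auto simp: power_le_one)
      then have r1: "ennreal (rad m powr \<theta>) \<le> 1" by simp
      have "(\<integral>\<^sup>+z\<in>UNIV. 1 + ennreal (rad m powr \<theta>) * h k z \<partial>\<nu>) \<le> (\<integral>\<^sup>+z. 1 + h k z \<partial>\<nu>)"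
        using mult_right_mono[OF r1] by (intro nn_integral_mono) (simp add: add_left_mono)
      also have "\<dots> \<le> ennreal (measure \<nu> \<Omega>) + ennreal B"
        using h_bound[of k] by (simp add: nn_integral_add emeasure_eq_measure space_\<nu>)
      finally show "(\<integral>\<^sup>+z\<in>UNIV. 1 + ennreal (rad m powr \<theta>) * h k z \<partial>\<nu>) \<le> ennreal (measure \<nu> \<Omega> + B)"
        using const by (simp add: ennreal_plus)
    qed auto
    also have "\<dots> = ennreal (K * I * \<beta>^m)"
    proof -
      have "0 \<le> overlap \<Lambda>" "0 \<le> measure \<nu> \<Omega> + B" using const overlap_ge_1[of \<Lambda>] by auto
      then have "ennreal (overlap \<Lambda>) * ennreal (measure \<nu> \<Omega> + B) = ennreal I"
        unfolding I_def by (rule ennreal_mult[symmetric])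
      then show ?thesis using const I by (simp add: ennreal_mult[symmetric] powr_half_power mult_ac)
    qed
    finally show ?thesis by simp
  qed
  have "AE z in \<nu>. (\<lambda>m. ?f m z) \<longlonglongrightarrow> 0"
    by (rule AE_tendsto_0_if_integrals_summable(2)[OF meas bd])
       (use const I \<beta> in \<open>auto intro!: summable_mult\<close>)
  then show ?thesis
  proof eventually_elim
    case (elim z)
    then have "(\<lambda>m. ?f m z) \<longlonglongrightarrow> ennreal 0" by (simp only: ennreal_0)
    then show ?case by (rule tendsto_ennreal_iff[THEN iffD1, rotated 2]) simp_all
  qed
qed

text \<open>What counts is that the bound is independent of k: the level values form bounded
  sequences, hence points of the ultra-completion, and their mutual distances have convergent
  subsequences.\<close>

lemma value_dist_le:
  assumes c: "c \<in> X m" and I: "(\<integral>\<^sup>+z. ennreal (dist (u k z) y0) \<partial>\<nu>) \<le> ennreal J" and J: "0 \<le> J"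
  shows "dist (y m c k) y0 \<le> (K * (measure \<nu> \<Omega> + B) + J) / vol c (4 * rad m)"
proof -
  let ?B = "ball c (4 * rad m)" and ?v = "vol c (4 * rad m)"
  have v: "0 < ?v" using vol_pos[OF X_sub[OF c]] by simp
  have r1: "rad m powr \<theta> \<le> 1" "rad m powr \<alpha> \<le> 1"
    using powr_mono2[of \<theta> "rad m" 1] powr_mono2[of \<alpha> "rad m" 1] const by (auto simp: power_le_one)
  have "ennreal ?v * ennreal (dist (y m c k) y0) = (\<integral>\<^sup>+z\<in>?B. ennreal (dist (y m c k) y0) \<partial>\<nu>)"
    by (subst nn_integral_cmult) (auto simp: nn_integral_indicator_vol mult.commute simp del: nn_integral_indicator)
  also have "\<dots> \<le> (\<integral>\<^sup>+z. ennreal (dist (u k z) (y m c k)) * indicator ?B z + ennreal (dist (u k z) y0) \<partial>\<nu>)"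
  proof (rule nn_integral_mono)
    fix z
    have "ennreal (dist (y m c k) y0) \<le> ennreal (dist (u k z) (y m c k) + dist (u k z) y0)"
      by (intro ennreal_leI) (metis dist_commute dist_triangle)
    then show "ennreal (dist (y m c k) y0) * indicator ?B z \<le> ennreal (dist (u k z) (y m c k)) * indicator ?B z + ennreal (dist (u k z) y0)"
      by (auto split: split_indicator)
  qed
  also have "\<dots> = (\<integral>\<^sup>+z\<in>?B. ennreal (dist (u k z) (y m c k)) \<partial>\<nu>) + (\<integral>\<^sup>+z. ennreal (dist (u k z) y0) \<partial>\<nu>)"
    by (rule nn_integral_add) measurable
  also have "\<dots> \<le> ennreal (K * (measure \<nu> \<Omega> + B)) + ennreal J"
  proof (rule add_mono[OF _ I])
    have "(\<integral>\<^sup>+z\<in>ball c (\<Lambda> * rad m). 1 + ennreal (rad m powr \<theta>) * h k z \<partial>\<nu>) \<le> (\<integral>\<^sup>+z. 1 + h k z \<partial>\<nu>)"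
    proof (rule nn_integral_mono)
      fix z have "ennreal (rad m powr \<theta>) * h k z \<le> 1 * h k z" using r1 by (intro mult_right_mono) auto
      then show "(1 + ennreal (rad m powr \<theta>) * h k z) * indicator (ball c (\<Lambda> * rad m)) z \<le> 1 + h k z"
        by (auto split: split_indicator intro: add_left_mono)
    qed
    also have "\<dots> \<le> ennreal (measure \<nu> \<Omega>) + ennreal B"
      using h_bound[of k] by (simp add: nn_integral_add emeasure_eq_measure space_\<nu>)
    also have "\<dots> = ennreal (measure \<nu> \<Omega> + B)" using const by (simp add: ennreal_plus)
    finally have "(\<integral>\<^sup>+z\<in>?B. ennreal (dist (u k z) (y m c k)) \<partial>\<nu>) \<le> ennreal (K * rad m powr \<alpha>) * ennreal (measure \<nu> \<Omega> + B)"
      using value_bound[OF c, of k] by (meson mult_left_mono order_trans zero_le)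
    also have "\<dots> \<le> ennreal K * ennreal (measure \<nu> \<Omega> + B)"
      using r1 const by (intro mult_right_mono ennreal_leI) auto
    also have "\<dots> = ennreal (K * (measure \<nu> \<Omega> + B))" using const by (simp add: ennreal_mult)
    finally show "(\<integral>\<^sup>+z\<in>?B. ennreal (dist (u k z) (y m c k)) \<partial>\<nu>) \<le> ennreal (K * (measure \<nu> \<Omega> + B))" .
  qed
  also have "\<dots> = ennreal (K * (measure \<nu> \<Omega> + B) + J)" using const J by (intro ennreal_plus[symmetric]) auto
  finally have le: "ennreal ?v * ennreal (dist (y m c k) y0) \<le> ennreal (K * (measure \<nu> \<Omega> + B) + J)" .
  have "ennreal (?v * dist (y m c k) y0) = ennreal ?v * ennreal (dist (y m c k) y0)"
    by (rule ennreal_mult) (use v in auto)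
  with le have "ennreal (?v * dist (y m c k) y0) \<le> ennreal (K * (measure \<nu> \<Omega> + B) + J)" by (simp only:)
  then have "?v * dist (y m c k) y0 \<le> K * (measure \<nu> \<Omega> + B) + J"
    by (rule ennreal_le_iff[THEN iffD1, rotated]) (use const J in auto)
  then show ?thesis using v by (simp add: field_simps)
qed

end

section \<open>Midpoint combinations of upper gradients\<close>

lemma ennreal_half: "x / 2 = inverse 2 * x" for x :: ennreal
  by (simp add: divide_ennreal_def mult.commute)

lemma ennreal_half_add: "0 \<le> a \<Longrightarrow> 0 \<le> b \<Longrightarrow> (ennreal a + ennreal b) / 2 = ennreal ((a + b) / 2)"
  by (simp add: divide_ennreal[symmetric] flip: ennreal_plus)

lemma ennreal_midpoint_self: "(b + b) / 2 = b" for b :: ennreal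
  by (cases b) (auto simp: ennreal_half_add ennreal_top_divide)

lemma powr_midpoint_le:
  fixes a b p :: real
  assumes "1 < p" "0 \<le> a" "0 \<le> b"
  shows "((a + b) / 2) powr p \<le> (a powr p + b powr p) / 2"
proof -
  have *: "((a + b) / 2) powr p \<le> (a powr p + b powr p) / 2" if "0 \<le> b" "b \<le> a" for a b :: real
  proof (cases "b = a")
    case False
    with that have a: "0 < a" "b < a" by auto
    have "((1 + b/a) / 2) powr p \<le> (1 + (b/a) powr p) / 2"
      by (rule less_imp_le[OF powr_midpoint_less]) (use a that assms in auto)
    then have "a powr p * ((1 + b/a) / 2) powr p \<le> a powr p * ((1 + (b/a) powr p) / 2)"
      by (intro mult_left_mono) auto
    moreover have "a powr p * ((1 + b/a) / 2) powr p = ((a + b)/2) powr p"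
    proof -
      have "a * ((1 + b/a) / 2) = (a + b)/2" using a by (simp add: distrib_left)
      then show ?thesis using that a by (simp flip: powr_mult)
    qed
    moreover have "a powr p * (b/a) powr p = b powr p" using that a by (simp flip: powr_mult)
    ultimately show ?thesis by (simp add: algebra_simps add_divide_distrib)
  qed simp
  show ?thesis using *[of a b] *[of b a] assms by (cases "b \<le> a") (auto simp: add.commute)
qed

lemma enn_powr_midpoint_le:
  assumes "1 < p"
  shows "enn_powr ((a + b) / 2) p \<le> (enn_powr a p + enn_powr b p) / 2"
proof (cases "a = top \<or> b = top")
  case True
  then show ?thesis by (auto simp: ennreal_top_divide)
next
  case False
  then obtain a' b' where ab: "a = ennreal a'" "b = ennreal b'" "0 \<le> a'" "0 \<le> b'" by (metis ennreal_cases)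
  show ?thesis
    using ab powr_midpoint_le[OF assms ab(3,4)] by (simp add: enn_powr_ennreal ennreal_half_add ennreal_leI)
qed

text \<open>Q indexes the sequences of level values. Their mutual distances converge in the ordinary
  sense, and \<open>approximable\<close> says that some of them stay close to \<open>u k x\<close>
  for almost every x. In the application \<open>e k\<close> is the energy of the k-th map plus an
  error tending to 0.\<close>

locale ultralimit = ultrafilter F for F :: "nat filter" +
  fixes \<mu> :: "'x::metric_space measure" and \<Omega> :: "'x set" and p e0 :: real
    and u :: "nat \<Rightarrow> 'x \<Rightarrow> 'y::metric_space" and g :: "nat \<Rightarrow> 'x \<Rightarrow> ennreal" and e :: "nat \<Rightarrow> real"
    and Q :: "'i set" and q :: "'i \<Rightarrow> nat \<Rightarrow> 'y"
  assumes sets_\<mu>: "sets \<mu> = sets borel" and \<Omega>_borel: "\<Omega> \<in> sets borel" and p: "1 < p"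
    and ug: "\<And>k. upper_gradient \<Omega> dist (u k) (g k)"
    and energy: "\<And>k. p_mass \<mu> \<Omega> p (g k) \<le> ennreal (e k)" "\<And>k. 0 \<le> e k" "e \<longlonglongrightarrow> e0"
    and dist_u_measurable: "\<And>k y. (\<lambda>x. dist (u k x) y) \<in> borel_measurable (restrict_space \<mu> \<Omega>)"
    and Q: "countable Q" "Q \<noteq> {}" and q_bounded: "\<And>i. i \<in> Q \<Longrightarrow> q i \<in> ultra_carrier"
    and q_convergent: "\<And>i j. i \<in> Q \<Longrightarrow> j \<in> Q \<Longrightarrow> convergent (\<lambda>k. dist (q i k) (q j k))"
    and approximable: "AE x in \<mu>. x \<in> \<Omega> \<longrightarrow> (\<forall>\<epsilon>>0. \<exists>j\<in>Q. \<forall>\<^sub>F k in sequentially. dist (u k x) (q j k) < \<epsilon>)"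
begin

lemma p_pos: "0 < p" using p by simp

lemma g_measurable [measurable]: "g k \<in> borel_measurable borel"
  using ug by (simp add: upper_gradient_def)

text \<open>Iterated midpoints suffice in place of general convex combinations. The gradients and the
  distance functions are combined with the same weights.\<close>
inductive comb :: "nat \<Rightarrow> ('x \<Rightarrow> ennreal) \<Rightarrow> ('i \<Rightarrow> 'x \<Rightarrow> real) \<Rightarrow> bool" where
  base: "n \<le> k \<Longrightarrow> comb n (g k) (\<lambda>i x. dist (u k x) (q i k))"
| midpoint: "comb n h f \<Longrightarrow> comb n h' f' \<Longrightarrow>
    comb n (\<lambda>x. (h x + h' x) / 2) (\<lambda>i x. (f i x + f' i x) / 2)"

lemma comb_mono: "comb l h f \<Longrightarrow> n \<le> l \<Longrightarrow> comb n h f"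
  by (induction rule: comb.induct) (auto intro: comb.intros)

lemma comb_measurable: "comb n h f \<Longrightarrow> h \<in> borel_measurable borel \<and> (\<forall>i. f i \<in> borel_measurable (restrict_space \<mu> \<Omega>))"
proof (induction rule: comb.induct)
  case (midpoint n h f h' f')
  then have [measurable]: "h \<in> borel_measurable borel" "h' \<in> borel_measurable borel"
    "\<And>i. f i \<in> borel_measurable (restrict_space \<mu> \<Omega>)" "\<And>i. f' i \<in> borel_measurable (restrict_space \<mu> \<Omega>)" by auto
  show ?case by (intro conjI allI) measurable
qed (use dist_u_measurable in simp)

lemma comb_mass:
  assumes "comb n h f" "\<And>k. n \<le> k \<Longrightarrow> p_mass \<mu> \<Omega> p (g k) \<le> b"
  shows "p_mass \<mu> \<Omega> p h \<le> b"
  using assms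
proof (induction rule: comb.induct)
  case (midpoint n h f h' f')
  note [measurable_cong] = sets_\<mu> and [measurable] = \<Omega>_borel
  have [measurable]: "h \<in> borel_measurable borel" "h' \<in> borel_measurable borel"
    using comb_measurable midpoint.hyps by blast+
  have "p_mass \<mu> \<Omega> p (\<lambda>x. (h x + h' x) / 2) 
     \<le> (\<integral>\<^sup>+x. inverse 2 * (enn_powr (h x) p * indicator \<Omega> x + enn_powr (h' x) p * indicator \<Omega> x) \<partial>\<mu>)"
    using enn_powr_midpoint_le[OF p] unfolding ennreal_half
    by (intro nn_integral_mono) (auto split: split_indicator)
  also have "\<dots> = inverse 2 * (p_mass \<mu> \<Omega> p h + p_mass \<mu> \<Omega> p h')"
    by (subst nn_integral_cmult, measurable, subst nn_integral_add) auto
  also have "\<dots> \<le> inverse 2 * (b + b)"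
    using midpoint by (intro mult_left_mono add_mono) auto
  also have "\<dots> = b"
    unfolding ennreal_half[symmetric] by (rule ennreal_midpoint_self)
  finally show ?case .
qed blast

text \<open>No exceptional curves arise, as the base gradients are genuine upper gradients; distance
  functions are 1-Lipschitz, and midpoints preserve the bound.\<close>

lemma comb_curve:
  assumes "comb n h f" and c: "arclength_curve \<Omega> (\<gamma>, L)" "0 \<le> s" "s \<le> t" "t \<le> L"
  shows "ennreal \<bar>f i (\<gamma> t) - f i (\<gamma> s)\<bar> \<le> arc_integral h \<gamma> s t"
  using assms(1)
proof (induction rule: comb.induct)
  case (base n k)
  have "\<bar>dist (u k (\<gamma> t)) (q i k) - dist (u k (\<gamma> s)) (q i k)\<bar> \<le> dist (u k (\<gamma> t)) (u k (\<gamma> s))"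
    by (metis abs_dist_diff_le dist_commute)
  then show ?case using upper_gradientD[OF ug c] by (meson ennreal_leI order_trans)
next
  case (midpoint n h f h' f')
  have hm: "h \<in> borel_measurable borel" "h' \<in> borel_measurable borel"
    using comb_measurable midpoint.hyps by blast+
  note cont = arclength_curveD(3)[OF c(1)]
  have "ennreal \<bar>(f i (\<gamma> t) + f' i (\<gamma> t)) / 2 - (f i (\<gamma> s) + f' i (\<gamma> s)) / 2\<bar>
    \<le> ennreal ((\<bar>f i (\<gamma> t) - f i (\<gamma> s)\<bar> + \<bar>f' i (\<gamma> t) - f' i (\<gamma> s)\<bar>) / 2)"
  proof (rule ennreal_leI)
    have eq: "(f i (\<gamma> t) + f' i (\<gamma> t)) / 2 - (f i (\<gamma> s) + f' i (\<gamma> s)) / 2 = ((f i (\<gamma> t) - f i (\<gamma> s)) + (f' i (\<gamma> t) - f' i (\<gamma> s))) / 2"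
      by argo
    have "\<bar>(f i (\<gamma> t) + f' i (\<gamma> t)) / 2 - (f i (\<gamma> s) + f' i (\<gamma> s)) / 2\<bar> = \<bar>(f i (\<gamma> t) - f i (\<gamma> s)) + (f' i (\<gamma> t) - f' i (\<gamma> s))\<bar> / 2"
      by (simp only: eq abs_divide abs_numeral)
    also have "\<dots> \<le> (\<bar>f i (\<gamma> t) - f i (\<gamma> s)\<bar> + \<bar>f' i (\<gamma> t) - f' i (\<gamma> s)\<bar>) / 2"
      by (intro divide_right_mono abs_triangle_ineq) simp
    finally show "\<bar>(f i (\<gamma> t) + f' i (\<gamma> t)) / 2 - (f i (\<gamma> s) + f' i (\<gamma> s)) / 2\<bar> \<le> (\<bar>f i (\<gamma> t) - f i (\<gamma> s)\<bar> + \<bar>f' i (\<gamma> t) - f' i (\<gamma> s)\<bar>) / 2" .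
  qed
  also have "\<dots> = inverse 2 * (ennreal \<bar>f i (\<gamma> t) - f i (\<gamma> s)\<bar> + ennreal \<bar>f' i (\<gamma> t) - f' i (\<gamma> s)\<bar>)"
    unfolding ennreal_half[symmetric] by (rule ennreal_half_add[symmetric]) auto
  also have "\<dots> \<le> inverse 2 * (arc_integral h \<gamma> s t + arc_integral h' \<gamma> s t)"
    using midpoint.IH by (intro mult_left_mono add_mono) auto
  also have "\<dots> = arc_integral (\<lambda>x. (h x + h' x) / 2) \<gamma> s t"
    using arc_integral_cmult[OF _ cont c(2,4), of "\<lambda>x. h x + h' x" "inverse 2"] arc_integral_add[OF hm cont c(2,4)] hm
    unfolding ennreal_half by simp
  finally show ?case .
qed

text \<open>Intervals are convex, so combinations of a tail inherit the bounds of that tail.\<close>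

lemma comb_limit:
  assumes "comb n h f" "\<And>k. n \<le> k \<Longrightarrow> \<bar>dist (u k x) (q i k) - a\<bar> \<le> \<epsilon>"
  shows "\<bar>f i x - a\<bar> \<le> \<epsilon>"
  using assms
proof (induction rule: comb.induct)
  case (midpoint n h f h' f')
  then have "\<bar>f i x - a\<bar> \<le> \<epsilon>" "\<bar>f' i x - a\<bar> \<le> \<epsilon>" by blast+
  then show ?case by (simp add: abs_le_iff) argo
qed blast

text \<open>Fuglede's lemma in pointwise form: fast convergence in the p-norm of almost minimising
  combinations dominates them, up to a geometrically small multiple of one p-integrable function, by
  their lower limit.\<close>
lemma fast_combinations:
  obtains H f h \<rho> s where "\<And>j::nat. comb (s j) (H j) (f j)" "strict_mono s"
    "h \<in> borel_measurable borel" "\<rho> \<in> borel_measurable borel" "p_mass \<mu> \<Omega> p \<rho> < top"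
    "p_mass \<mu> \<Omega> p h \<le> ennreal e0" "\<And>j x. H j x \<le> h x + ennreal (2 * (1/2)^j) * \<rho> x"
proof -
  note [measurable_cong] = sets_\<mu> and [measurable] = \<Omega>_borel
  obtain Bd where Bd: "\<And>k. e k \<le> Bd" "0 \<le> Bd"
  proof -
    obtain B where "\<forall>k. \<bar>e k\<bar> \<le> B" using convergent_imp_Bseq[of e] energy(3)
      by (auto simp: convergent_def Bseq_def)
    then show thesis using that[of "\<bar>B\<bar>"] by (metis abs_ge_self abs_ge_zero order_trans)
  qed
  \<comment> \<open>Least p-mass among combinations of the tail from n on. It increases with n and
    is bounded, so the almost minimisers of different tails have nearly equal masses.\<close>
  define m where "m = (\<lambda>n. INF hf\<in>{hf. comb n (fst hf) (snd hf)}. p_mass \<mu> \<Omega> p (fst hf))"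
  have m_le: "m n \<le> p_mass \<mu> \<Omega> p h" if "comb n h f" for n h f
    unfolding m_def using that by (intro INF_lower2[of "(h, f)"]) auto
  have comb_Bd: "p_mass \<mu> \<Omega> p h \<le> ennreal Bd" if "comb n h f" for n h f
    by (rule comb_mass[OF that order_trans[OF energy(1) ennreal_leI[OF Bd(1)]]])
  have m_Bd: "m n \<le> ennreal Bd" for n
    using m_le[OF comb.base[of n n]] comb_Bd[OF comb.base[of n n]] by (rule order_trans) simp_all
  then have m_fin: "m n < top" for n by (meson ennreal_less_top le_less_trans)
  define r where "r = (\<lambda>n. enn2real (m n))"
  have mr: "m n = ennreal (r n)" for n using m_fin[of n] by (simp add: r_def)
  have r0: "0 \<le> r n" for n by (simp add: r_def)
  have m_mono: "m n \<le> m l" if "n \<le> l" for n l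
  proof -
    have "m n \<le> (INF hf\<in>{hf. comb l (fst hf) (snd hf)}. p_mass \<mu> \<Omega> p (fst hf))"
      by (intro INF_greatest) (auto intro: m_le[OF comb_mono[OF _ that]])
    then show ?thesis unfolding m_def .
  qed
  have "incseq r" unfolding incseq_def r_def using m_mono m_fin by (auto intro!: enn2real_mono)
  moreover have "r n \<le> Bd" for n using m_Bd[of n] Bd(2) unfolding mr by (simp add: ennreal_le_iff)
  ultimately have "Cauchy r" by (intro convergent_Cauchy) (metis convergent_def incseq_convergent)
  have "\<exists>hf. comb n (fst hf) (snd hf) \<and> p_mass \<mu> \<Omega> p (fst hf) \<le> m n + ennreal ((1/2)^n)" for n
  proof -
    have "m n < m n + ennreal ((1/2)^n)" unfolding mr by (simp add: r0 ennreal_less_iff flip: ennreal_plus)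
    then show ?thesis unfolding m_def INF_less_iff by (auto intro: less_imp_le)
  qed
  then obtain hf where hf: "\<And>n. comb n (fst (hf n)) (snd (hf n))" 
    "\<And>n. p_mass \<mu> \<Omega> p (fst (hf n)) \<le> m n + ennreal ((1/2)^n)" by metis
  define I where "I = (\<lambda>n. enn2real (p_mass \<mu> \<Omega> p (fst (hf n))))"
  have Ifin: "p_mass \<mu> \<Omega> p (fst (hf n)) = ennreal (I n)" for n
    unfolding I_def
    by (rule ennreal_enn2real[symmetric]) (rule le_less_trans[OF comb_Bd[OF hf(1)[of n]] ennreal_less_top])
  have I_le: "I n \<le> r n + (1/2)^n" and I_Bd: "I n \<le> Bd" and I0: "0 \<le> I n" for n
  proof -
    show "I n \<le> r n + (1/2)^n" using hf(2)[of n] r0[of n] unfolding Ifin mr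
      by (simp add: ennreal_le_iff flip: ennreal_plus)
    show "I n \<le> Bd" using comb_Bd[OF hf(1)[of n]] Bd(2) unfolding Ifin by (simp add: ennreal_le_iff)
    show "0 \<le> I n" by (simp add: I_def)
  qed
  note [measurable] = comb_measurable[OF hf(1), THEN conjunct1]
  have cauchy: "\<exists>N. \<forall>n\<ge>N. \<forall>l\<ge>n. p_mass \<mu> \<Omega> p (\<lambda>x. fst (hf n) x - fst (hf l) x) \<le> ennreal \<epsilon>" if \<epsilon>: "0 < \<epsilon>" for \<epsilon>
  proof -
    \<comment> \<open>As I n + I l is at most 2 * (Bd + 1), the corresponding error term costs at
      most \<epsilon> / 2; the summand 1 covers Bd = 0.\<close>
    define \<epsilon>' where "\<epsilon>' = \<epsilon> / (4 * (Bd + 1))"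
    have \<epsilon>': "0 < \<epsilon>'" using \<epsilon> Bd by (simp add: \<epsilon>'_def)
    obtain K where K: "K > 0" "\<And>a b. enn_powr (a - b) p + ennreal K * enn_powr ((a + b) / 2) p
        \<le> ennreal \<epsilon>' * (enn_powr a p + enn_powr b p) + ennreal (K/2) * (enn_powr a p + enn_powr b p)"
      using enn_powr_uniform_convexity[OF p \<epsilon>'] by metis
    obtain N1 where N1: "\<And>n l. n \<ge> N1 \<Longrightarrow> l \<ge> N1 \<Longrightarrow> dist (r n) (r l) < \<epsilon> / (2 * K)"
      using metric_CauchyD[OF \<open>Cauchy r\<close>, of "\<epsilon> / (2 * K)"] \<epsilon> K(1) by auto
    obtain N2 where N2: "(1/2)^N2 < \<epsilon> / (4 * K)" using real_arch_pow_inv[of "\<epsilon> / (4 * K)" "1/2"] \<epsilon> K(1) by auto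
    show ?thesis
    proof (intro exI allI impI)
      fix n l assume nl: "max N1 N2 \<le> n" "n \<le> l"
      let ?a = "fst (hf n)" and ?b = "fst (hf l)"
      let ?J = "p_mass \<mu> \<Omega> p (\<lambda>x. ?a x - ?b x)"
      let ?M = "p_mass \<mu> \<Omega> p (\<lambda>x. (?a x + ?b x) / 2)"
      \<comment> \<open>The midpoint of two almost minimisers is again a combination of the tail
        from n on, so its mass is at least m n. Uniform convexity then makes the difference
        small.\<close>
      have "comb n (\<lambda>x. (?a x + ?b x) / 2) (\<lambda>i x. (snd (hf n) i x + snd (hf l) i x) / 2)"
        using comb_mono[OF hf(1) nl(2)] by (intro comb.midpoint hf)
      then have M: "m n \<le> ?M" by (rule m_le)
      define S where "S = (\<lambda>x. enn_powr (?a x) p * indicator \<Omega> x + enn_powr (?b x) p * indicator \<Omega> x)"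
      have S_meas [measurable]: "S \<in> borel_measurable \<mu>" unfolding S_def by measurable
      have "(\<integral>\<^sup>+x. S x \<partial>\<mu>) = ennreal (I n) + ennreal (I l)"
        unfolding S_def Ifin[symmetric] by (rule nn_integral_add) measurable
      then have S_int: "(\<integral>\<^sup>+x. S x \<partial>\<mu>) = ennreal (I n + I l)" using I0 by simp
      have "?J + ennreal K * ?M = (\<integral>\<^sup>+x. enn_powr (?a x - ?b x) p * indicator \<Omega> x + ennreal K * (enn_powr ((?a x + ?b x) / 2) p * indicator \<Omega> x) \<partial>\<mu>)"
        by (subst nn_integral_add, measurable, subst nn_integral_cmult) auto
      also have "\<dots> \<le> (\<integral>\<^sup>+x. ennreal \<epsilon>' * S x + ennreal (K/2) * S x \<partial>\<mu>)"
        unfolding S_def using K(2) by (intro nn_integral_mono) (auto split: split_indicator)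
      also have "\<dots> = (\<integral>\<^sup>+x. ennreal \<epsilon>' * S x \<partial>\<mu>) + (\<integral>\<^sup>+x. ennreal (K/2) * S x \<partial>\<mu>)"
        by (rule nn_integral_add) measurable
      also have "\<dots> = ennreal \<epsilon>' * ennreal (I n + I l) + ennreal (K/2) * ennreal (I n + I l)"
        unfolding S_int[symmetric] by (intro arg_cong2[where f="(+)"] nn_integral_cmult S_meas)
      also have "\<dots> = ennreal (\<epsilon>' * (I n + I l)) + ennreal (K/2 * (I n + I l))"
        using I0 \<epsilon>' K(1) by (intro arg_cong2[where f="(+)"] ennreal_mult[symmetric] add_nonneg_nonneg) auto
      also have "\<dots> = ennreal (\<epsilon>' * (I n + I l) + K/2 * (I n + I l))"
        using I0 \<epsilon>' K(1) by (intro ennreal_plus[symmetric] mult_nonneg_nonneg add_nonneg_nonneg) auto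
      finally have 1: "?J + ennreal K * ?M \<le> ennreal (\<epsilon>' * (I n + I l) + K/2 * (I n + I l))" .
      have 2: "ennreal (K * r n) \<le> ennreal K * ?M" using M K(1) r0 unfolding mr by (simp add: ennreal_mult mult_left_mono)
      have "?J < top"
        using le_less_trans[OF 1 ennreal_less_top] by (simp add: less_top)
      then obtain J where J: "?J = ennreal J" "0 \<le> J" by (cases ?J) auto
      have "ennreal (J + K * r n) = ennreal J + ennreal (K * r n)" using J K(1) r0 by (intro ennreal_plus) auto
      also have "\<dots> \<le> ennreal (\<epsilon>' * (I n + I l) + K/2 * (I n + I l))"
        using order_trans[OF add_left_mono[OF 2, of ?J] 1] unfolding J(1) .
      finally have "ennreal (J + K * r n) \<le> ennreal (\<epsilon>' * (I n + I l) + K/2 * (I n + I l))" .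
      moreover have "0 \<le> \<epsilon>' * (I n + I l) + K/2 * (I n + I l)" using I0 \<epsilon>' K(1) by simp
      ultimately have le: "J + K * r n \<le> \<epsilon>' * (I n + I l) + K/2 * (I n + I l)" by (simp add: ennreal_le_iff)
      have "\<epsilon>' * (I n + I l) \<le> \<epsilon>' * (2 * (Bd + 1))" using I_Bd[of n] I_Bd[of l] \<epsilon>' by (intro mult_left_mono) auto
      also have "\<dots> = \<epsilon> / 2"
      proof -
        have "\<epsilon> / (4 * b) * (2 * b) = \<epsilon> / 2" if "b \<noteq> 0" for b :: real using that by simp
        from this[of "Bd + 1"] show ?thesis using Bd(2) by (simp add: \<epsilon>'_def)
      qed
      finally have t1: "\<epsilon>' * (I n + I l) \<le> \<epsilon> / 2" .
      have "\<bar>r n - r l\<bar> < \<epsilon> / (2 * K)" using N1[of n l] nl by (simp add: dist_real_def)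
      moreover have "(1/2::real)^n \<le> (1/2)^N2" "(1/2::real)^l \<le> (1/2)^N2" using nl by (intro power_decreasing; simp)+
      ultimately have "I n + I l - 2 * r n \<le> \<epsilon> / (2 * K) + 2 * (\<epsilon> / (4 * K))"
        using I_le[of n] I_le[of l] N2 by linarith
      then have "K/2 * (I n + I l - 2 * r n) \<le> K/2 * (\<epsilon> / (2 * K) + 2 * (\<epsilon> / (4 * K)))"
        using K(1) by (intro mult_left_mono) auto
      also have "\<dots> = \<epsilon> / 2" using K(1) by (simp add: field_simps)
      finally have "K/2 * (I n + I l) - K * r n \<le> \<epsilon> / 2" by (simp add: algebra_simps)
      with le t1 have "J \<le> \<epsilon>" by linarith
      then show "?J \<le> ennreal \<epsilon>" unfolding J by (rule ennreal_leI)
    qed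
  qed
  define E where "E = (\<lambda>j::nat. (1/2)^j * (2^j) powr (-p) :: real)"
  have E: "0 < E j" for j by (simp add: E_def)
  have "\<exists>N. \<forall>n\<ge>N. \<forall>l\<ge>n. p_mass \<mu> \<Omega> p (\<lambda>x. fst (hf n) x - fst (hf l) x) \<le> ennreal (E j)" for j
    by (rule cauchy[OF E])
  then obtain N where N: "\<And>j n l. N j \<le> n \<Longrightarrow> n \<le> l \<Longrightarrow> p_mass \<mu> \<Omega> p (\<lambda>x. fst (hf n) x - fst (hf l) x) \<le> ennreal (E j)"
    by metis
  \<comment> \<open>Cumulative sums of Suc (N i) are strictly increasing and still exceed N
    j.\<close>
  define s where "s = (\<lambda>j. \<Sum>i\<le>j. Suc (N i))"
  have s: "strict_mono s" by (simp add: strict_mono_Suc_iff s_def)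
  have sN: "N j \<le> s j" for j
    using member_le_sum[of j "{..j}" "\<lambda>i. Suc (N i)"] by (simp add: s_def)
  define H where "H = (\<lambda>j. fst (hf (s j)))"
  have Hm [measurable]: "H j \<in> borel_measurable borel" for j unfolding H_def by measurable
  \<comment> \<open>Subtraction is truncated, so only decreases from one member to the next are
    controlled. This suffices, since only an upper bound of \<open>H j\<close> by its successors is
    needed.\<close>
  define \<rho> where "\<rho> = (\<lambda>x. SUP j. ennreal (2^j) * (H j x - H (Suc j) x))"
  have \<rho> [measurable]: "\<rho> \<in> borel_measurable borel" unfolding \<rho>_def by measurable
  have "p_mass \<mu> \<Omega> p \<rho> \<le> (\<Sum>j. p_mass \<mu> \<Omega> p (\<lambda>x. ennreal (2^j) * (H j x - H (Suc j) x)))"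
    unfolding \<rho>_def by (rule p_mass_SUP[OF sets_\<mu> \<Omega>_borel _ p_pos]) measurable
  also have "\<dots> = (\<Sum>j. ennreal ((2^j) powr p) * p_mass \<mu> \<Omega> p (\<lambda>x. H j x - H (Suc j) x))"
    by (subst p_mass_cmult[OF sets_\<mu> \<Omega>_borel]) auto
  also have "\<dots> \<le> (\<Sum>j. ennreal ((1/2)^j))"
  proof (intro suminf_le)
    fix j
    have "p_mass \<mu> \<Omega> p (\<lambda>x. H j x - H (Suc j) x) \<le> ennreal (E j)"
      unfolding H_def using sN[of j] s by (intro N) (auto simp: strict_mono_Suc_iff less_imp_le)
    then have "ennreal ((2^j) powr p) * p_mass \<mu> \<Omega> p (\<lambda>x. H j x - H (Suc j) x) \<le> ennreal ((2^j) powr p) * ennreal (E j)"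
      by (intro mult_left_mono) auto
    also have "\<dots> = ennreal ((1/2)^j)"
      using E[of j] by (simp add: E_def powr_minus flip: ennreal_mult)
    finally show "ennreal ((2^j) powr p) * p_mass \<mu> \<Omega> p (\<lambda>x. H j x - H (Suc j) x) \<le> ennreal ((1/2)^j)" .
  qed auto
  also have "\<dots> = ennreal 2"
    by (subst suminf_ennreal2) (simp_all add: summable_geometric suminf_geometric)
  finally have \<rho>_fin: "p_mass \<mu> \<Omega> p \<rho> < top" by (simp add: le_less_trans)
  define h where "h = (\<lambda>x. liminf (\<lambda>j. H j x))"
  have h [measurable]: "h \<in> borel_measurable borel" unfolding h_def by measurable
  have step: "H j x \<le> H (Suc j) x + ennreal ((1/2)^j) * \<rho> x" for j x
  proof -
    have "ennreal (2^j) * (H j x - H (Suc j) x) \<le> \<rho> x" unfolding \<rho>_def by (rule SUP_upper) simp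
    then have "ennreal ((1/2)^j) * (ennreal (2^j) * (H j x - H (Suc j) x)) \<le> ennreal ((1/2)^j) * \<rho> x"
      by (rule mult_left_mono) simp
    moreover have "ennreal ((1/2)^j) * (ennreal (2^j) * (H j x - H (Suc j) x)) = H j x - H (Suc j) x"
      by (simp add: mult.assoc[symmetric] ennreal_mult[symmetric] power_mult_distrib[symmetric])
    ultimately have "H j x - H (Suc j) x \<le> ennreal ((1/2)^j) * \<rho> x" by simp
    then show ?thesis by (cases "H (Suc j) x = top") (auto simp: ennreal_minus_le_iff)
  qed
  \<comment> \<open>The coefficients are the partial sums of the geometric series of one-step
    errors.\<close>
  have multi: "H j x \<le> H (j + n) x + ennreal (2 * (1/2)^j - 2 * (1/2)^(j + n)) * \<rho> x" for j n x
  proof (induction n)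
    case (Suc n)
    have nn: "0 \<le> 2 * (1/2)^j - 2 * (1/2::real)^(j + n)" by (simp add: power_decreasing)
    have "H j x \<le> H (j + n) x + ennreal (2 * (1/2)^j - 2 * (1/2)^(j + n)) * \<rho> x" by (rule Suc)
    also have "\<dots> \<le> (H (Suc (j + n)) x + ennreal ((1/2)^(j + n)) * \<rho> x) + ennreal (2 * (1/2)^j - 2 * (1/2)^(j + n)) * \<rho> x"
      by (intro add_right_mono step)
    also have "\<dots> = H (Suc (j + n)) x + ennreal ((1/2)^(j + n) + (2 * (1/2)^j - 2 * (1/2)^(j + n))) * \<rho> x"
      using nn by (simp only: add.assoc distrib_right[symmetric] ennreal_plus[symmetric, OF zero_le_power nn] zero_le_divide_1_iff zero_le_numeral)
    finally show ?case by simp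
  qed simp
  have dom: "H j x \<le> h x + ennreal (2 * (1/2)^j) * \<rho> x" for j x
  proof -
    let ?c = "ennreal (2 * (1/2)^j) * \<rho> x"
    have le: "H j x \<le> H i x + ?c" if "j \<le> i" for i
    proof -
      have "H j x \<le> H i x + ennreal (2 * (1/2)^j - 2 * (1/2)^i) * \<rho> x" using multi[of j x "i - j"] that by simp
      also have "\<dots> \<le> H i x + ?c" by (intro add_left_mono mult_right_mono ennreal_leI) auto
      finally show ?thesis .
    qed
    show ?thesis
    proof (cases "?c = top")
      case False
      have "eventually (\<lambda>i. H j x - ?c \<le> H i x) sequentially"
        using eventually_ge_at_top[of j]
      proof eventually_elim
        case (elim i)
        then show ?case using le[OF elim] False by (auto simp: ennreal_minus_le_iff add.commute)
      qed
      then have "H j x - ?c \<le> h x" unfolding h_def by (rule Liminf_bounded)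
      then show ?thesis using False by (auto simp: ennreal_minus_le_iff add.commute)
    qed simp
  qed
  have "p_mass \<mu> \<Omega> p h \<le> (\<integral>\<^sup>+x. liminf (\<lambda>j. enn_powr (H j x) p * indicator \<Omega> x) \<partial>\<mu>)"
    unfolding h_def by (intro nn_integral_mono) (auto split: split_indicator simp: enn_powr_liminf[OF p_pos])
  also have "\<dots> \<le> liminf (\<lambda>j. p_mass \<mu> \<Omega> p (H j))" by (rule nn_integral_liminf) measurable
  \<comment> \<open>By convexity a combination of a tail has p-mass at most any common bound for the
    gradients of that tail, and these bounds approach e0.\<close>
  also have "\<dots> \<le> ennreal e0"
  proof (rule ennreal_le_epsilon)
    fix \<epsilon> :: real assume "0 < \<epsilon>"
    then have "eventually (\<lambda>k. e k < e0 + \<epsilon>) sequentially" using order_tendstoD(2)[OF energy(3)] by simp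
    then obtain k0 where k0: "\<And>k. k \<ge> k0 \<Longrightarrow> e k < e0 + \<epsilon>" by (auto simp: eventually_sequentially)
    have e0: "0 \<le> e0" using energy(2,3) by (intro LIMSEQ_le_const) auto
    have "p_mass \<mu> \<Omega> p (H j) \<le> ennreal (e0 + \<epsilon>)" if "j \<ge> k0" for j
    proof -
      have "k0 \<le> s j" using that seq_suble[OF s, of j] by simp
      then show ?thesis
        unfolding H_def using k0 energy(1)
        by (intro comb_mass[OF hf(1)]) (meson ennreal_leI less_imp_le order_trans)
    qed
    then have "liminf (\<lambda>j. p_mass \<mu> \<Omega> p (H j)) \<le> liminf (\<lambda>j::nat. ennreal (e0 + \<epsilon>))"
      by (intro Liminf_mono) (auto simp: eventually_sequentially)
    then show "liminf (\<lambda>j. p_mass \<mu> \<Omega> p (H j)) \<le> ennreal e0 + ennreal \<epsilon>"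
      using e0 \<open>0 < \<epsilon>\<close> by (simp add: Liminf_const)
  qed
  finally have h_mass: "p_mass \<mu> \<Omega> p h \<le> ennreal e0" .
  show thesis
    by (rule that[of s H "\<lambda>j. snd (hf (s j))" h \<rho>]) (use hf(1) s h \<rho> \<rho>_fin h_mass dom in \<open>auto simp: H_def\<close>)
qed

end

section \<open>The ultralimit map\<close>

context ultralimit
begin

text \<open>At such an x the distances from u k x to \<open>q i\<close> are approximated, up to any
  error and for all large k, by the convergent distances from \<open>q j\<close> to
  \<open>q i\<close>; hence they are Cauchy. Ultralimits become ordinary limits here.\<close>

lemma good_points:
  assumes "\<forall>\<epsilon>>0. \<exists>j\<in>Q. \<forall>\<^sub>F k in sequentially. dist (u k x) (q j k) < \<epsilon>"
  shows "bounded (range (\<lambda>k. u k x))"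
    and "i \<in> Q \<Longrightarrow> (\<lambda>k. dist (u k x) (q i k)) \<longlonglongrightarrow> ultra_dist F (\<lambda>k. u k x) (q i)"
    and "0 < \<epsilon> \<Longrightarrow> \<exists>j\<in>Q. ultra_dist F (\<lambda>k. u k x) (q j) < \<epsilon>"
proof -
  have good: "\<exists>j\<in>Q. \<forall>\<^sub>F k in sequentially. dist (u k x) (q j k) < \<epsilon>" if "0 < \<epsilon>" for \<epsilon>
    using assms that by blast
  obtain j where j: "j \<in> Q" "\<forall>\<^sub>F k in sequentially. dist (u k x) (q j k) < 1" using good[of 1] by auto
  then obtain N where N: "\<And>k. k \<ge> N \<Longrightarrow> dist (u k x) (q j k) < 1" by (auto simp: eventually_sequentially)
  obtain y B where B: "\<And>k. dist y (q j k) \<le> B" using q_bounded[OF j(1)] by (auto simp: ultra_carrier_def bounded_def)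
  have "range (\<lambda>k. u k x) \<subseteq> (\<lambda>k. u k x) ` {..<N} \<union> cball y (B + 1)"
  proof (rule image_subsetI)
    fix k
    show "u k x \<in> (\<lambda>k. u k x) ` {..<N} \<union> cball y (B + 1)"
    proof (cases "k < N")
      case False
      then have "dist y (u k x) \<le> B + 1"
        using N[of k] B[of k] dist_triangle[of y "u k x" "q j k"] by (simp add: dist_commute)
      then show ?thesis by simp
    qed simp
  qed
  moreover have "bounded ((\<lambda>k. u k x) ` {..<N} \<union> cball y (B + 1))" by (simp add: finite_imp_bounded)
  ultimately show bdd: "bounded (range (\<lambda>k. u k x))" using bounded_subset by blast
  then have carrier: "(\<lambda>k. u k x) \<in> ultra_carrier" by (simp add: ultra_carrier_def)
  show conv: "(\<lambda>k. dist (u k x) (q i k)) \<longlonglongrightarrow> ultra_dist F (\<lambda>k. u k x) (q i)" if i: "i \<in> Q" for i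
  proof -
    have "Cauchy (\<lambda>k. dist (u k x) (q i k))"
      unfolding Cauchy_def
    proof (intro allI impI)
      fix e :: real assume e: "0 < e"
      obtain j where j: "j \<in> Q" "\<forall>\<^sub>F k in sequentially. dist (u k x) (q j k) < e/3" using good[of "e/3"] e by auto
      then obtain N1 where N1: "\<And>k. k \<ge> N1 \<Longrightarrow> dist (u k x) (q j k) < e/3" by (auto simp: eventually_sequentially)
      have "Cauchy (\<lambda>k. dist (q j k) (q i k))" using q_convergent[OF j(1) i] by (rule convergent_Cauchy)
      from metric_CauchyD[OF this, of "e/3"] obtain N2 where N2: "\<And>k l. k \<ge> N2 \<Longrightarrow> l \<ge> N2 \<Longrightarrow> dist (dist (q j k) (q i k)) (dist (q j l) (q i l)) < e/3"
        using e by auto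
      show "\<exists>M. \<forall>m\<ge>M. \<forall>n\<ge>M. dist (dist (u m x) (q i m)) (dist (u n x) (q i n)) < e"
      proof (intro exI allI impI)
        fix k l assume kl: "max N1 N2 \<le> k" "max N1 N2 \<le> l"
        have "\<bar>dist (u k x) (q i k) - dist (q j k) (q i k)\<bar> \<le> dist (u k x) (q j k)" 
          "\<bar>dist (u l x) (q i l) - dist (q j l) (q i l)\<bar> \<le> dist (u l x) (q j l)"
          by (metis abs_dist_diff_le dist_commute)+
        then show "dist (dist (u k x) (q i k)) (dist (u l x) (q i l)) < e"
          using N1[of k] N1[of l] N2[of k l] kl unfolding dist_real_def by linarith
      qed
    qed
    then obtain l where l: "(\<lambda>k. dist (u k x) (q i k)) \<longlonglongrightarrow> l" using Cauchy_convergent convergent_def by blast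
    moreover have "ultra_dist F (\<lambda>k. u k x) (q i) = l" by (rule ultra_dist_eqI[OF tendsto_sequentially[OF l]])
    ultimately show ?thesis by simp
  qed
  show "\<exists>j\<in>Q. ultra_dist F (\<lambda>k. u k x) (q j) < \<epsilon>" if pos: "0 < \<epsilon>"
  proof -
    obtain j where j: "j \<in> Q" "\<forall>\<^sub>F k in sequentially. dist (u k x) (q j k) < \<epsilon>/2" using good[of "\<epsilon>/2"] pos by auto
    have "ultra_dist F (\<lambda>k. u k x) (q j) \<le> \<epsilon>/2"
      by (rule ultra_dist_le[OF carrier q_bounded[OF j(1)]])
         (rule filter_leD[OF le_sequentially], use j(2) in \<open>auto elim: eventually_mono\<close>)
    then show ?thesis using j(1) pos by (intro bexI[of _ j]) auto
  qed
qed

text \<open>If \<open>q j\<close> is close to z, its distance to y exceeds its negligible distance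
  to z by at most b.\<close>

lemma ultra_dist_via_family:
  assumes y: "y \<in> ultra_carrier" "z \<in> ultra_carrier" and close: "\<And>\<epsilon>. 0 < \<epsilon> \<Longrightarrow> \<exists>j\<in>Q. ultra_dist F z (q j) < \<epsilon>"
    and le: "\<And>i. i \<in> Q \<Longrightarrow> \<bar>ultra_dist F y (q i) - ultra_dist F z (q i)\<bar> \<le> b"
  shows "ultra_dist F y z \<le> b"
proof (rule field_le_epsilon)
  fix e :: real assume "0 < e"
  then obtain j where j: "j \<in> Q" "ultra_dist F z (q j) < e/2" using close[of "e/2"] by auto
  then show "ultra_dist F y z \<le> b + e"
    using ultra_dist_triangle[OF y(1) q_bounded[OF j(1)] y(2)] le[OF j(1)] ultra_dist_commute[of z "q j"] by linarith
qed

text \<open>Shrinking intervals around t have integrals tending to 0. The interval found is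
  nondegenerate even at an end point of the curve, so it contains times outside any given null
  set.\<close>

lemma arc_integral_small_neighbourhood:
  assumes c: "arclength_curve \<Omega> (\<gamma>, L)" and h: "h \<in> borel_measurable borel" "arc_integral h \<gamma> 0 L < top"
    and t: "0 \<le> t" "t \<le> L" and "0 < L" and "0 < \<epsilon>"
  obtains a b where "0 \<le> a" "a \<le> t" "t \<le> b" "b \<le> L" "a < b" "arc_integral h \<gamma> a b < ennreal \<epsilon>"
proof -
  define a where "a = (\<lambda>n::nat. max 0 (t - 1 / real (Suc n)))"
  define b where "b = (\<lambda>n::nat. min L (t + 1 / real (Suc n)))"
  have ab: "0 \<le> a n" "a n \<le> t" "t \<le> b n" "b n \<le> L" "a n < b n" for n
  proof -
    have "0 < 1 / real (Suc n)" by simp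
    then show "0 \<le> a n" "a n \<le> t" "t \<le> b n" "b n \<le> L" "a n < b n"
      using t \<open>0 < L\<close> unfolding a_def b_def by linarith+
  qed
  have mono: "a m \<le> a n" "b n \<le> b m" if "m \<le> n" for m n
  proof -
    have "1 / real (Suc n) \<le> 1 / real (Suc m)" using that by (intro divide_left_mono) auto
    then show "a m \<le> a n" "b n \<le> b m" unfolding a_def b_def by linarith+
  qed

  have "(INF n. arc_integral h \<gamma> (a n) (b n)) = (\<integral>\<^sup>+\<tau>. (INF n. h (\<gamma> \<tau>) * indicator {a n..b n} \<tau>) \<partial>lborel)"
  proof (rule nn_integral_monotone_convergence_INF_decseq[symmetric])
    show "decseq (\<lambda>n \<tau>. h (\<gamma> \<tau>) * indicator {a n..b n} \<tau>)"
    proof (rule decseq_SucI, rule le_funI)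
      fix n \<tau> show "h (\<gamma> \<tau>) * indicator {a (Suc n)..b (Suc n)} \<tau> \<le> h (\<gamma> \<tau>) * indicator {a n..b n} \<tau>"
        using mono[of n "Suc n"] by (auto split: split_indicator)
    qed
    show "(\<lambda>\<tau>. h (\<gamma> \<tau>) * indicator {a n..b n} \<tau>) \<in> borel_measurable lborel" for n
      using arc_measurable[OF h(1) arclength_curveD(3)[OF c] ab(1) ab(4)] by simp
    show "arc_integral h \<gamma> (a 0) (b 0) < \<infinity>"
      using arc_integral_subset[OF ab(1) ab(4), of h \<gamma>] h(2) by (auto intro: le_less_trans)
  qed
  also have "\<dots> = (\<integral>\<^sup>+\<tau>. 0 \<partial>(lborel :: real measure))"
  proof (rule nn_integral_cong_AE)
    show "AE \<tau> in lborel. (INF n. h (\<gamma> \<tau>) * indicator {a n..b n} \<tau>) = 0"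
      using AE_lborel_singleton[of t]
    proof eventually_elim
      case (elim \<tau>)
      then have "0 < \<bar>\<tau> - t\<bar>" by simp
      then obtain n where "1 / real (Suc n) < \<bar>\<tau> - t\<bar>"
        using reals_Archimedean[of "\<bar>\<tau> - t\<bar>"] by (auto simp: inverse_eq_divide)
      then have "\<tau> \<notin> {a n..b n}" by (auto simp: a_def b_def)
      then have "(INF n. h (\<gamma> \<tau>) * indicator {a n..b n} \<tau>) \<le> 0" by (intro INF_lower2[of n]) auto
      then show ?case by simp
    qed
  qed
  finally have "(INF n. arc_integral h \<gamma> (a n) (b n)) < ennreal \<epsilon>" using \<open>0 < \<epsilon>\<close> by simp
  then obtain n where "arc_integral h \<gamma> (a n) (b n) < ennreal \<epsilon>" by (auto simp: INF_less_iff)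
  with ab that show thesis by blast
qed

text \<open>A density that is infinite on a null set N has p-mass 0, so finiteness of its line
  integral may be demanded of almost every curve. Such a curve meets N in a null set of times
  only.\<close>

lemma arc_integral_top_indicator:
  assumes c: "arclength_curve \<Omega> (\<gamma>, L)" and N: "N \<in> sets borel"
    and fin: "arc_integral (\<lambda>x. top * indicator N x) \<gamma> 0 L < top"
  shows "AE \<tau> in lborel. \<tau> \<in> {0..L} \<longrightarrow> \<gamma> \<tau> \<notin> N"
proof -
  have m: "(\<lambda>x. top * indicator N x :: ennreal) \<in> borel_measurable borel" using N by measurable
  have "AE \<tau> in lborel. top * indicator N (\<gamma> \<tau>) * indicator {0..L} \<tau> \<noteq> (\<infinity>::ennreal)"
    using fin arc_measurable[OF m arclength_curveD(3)[OF c], of 0 L] by (intro nn_integral_PInf_AE) auto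
  then show ?thesis
    by eventually_elim (auto simp: ennreal_mult_top split: split_indicator)
qed

text \<open>Values are prescribed on the set W where the combined distance functions converge to a
  profile that members of Q realise up to any error. Unlike \<open>Good\<close>, the set W contains
  every point of almost every curve, because along the curve the combinations differ little from
  those at a nearby good point.\<close>

lemma ultralimit_in_newtonian:
  "\<exists>\<phi>. (\<forall>x. \<phi> x \<in> ultra_carrier) \<and>
     (AE x in \<mu>. x \<in> \<Omega> \<longrightarrow> bounded (range (\<lambda>k. u k x)) \<and> ultra_dist F (\<phi> x) (\<lambda>k. u k x) = 0) \<and>
     (AE x in \<mu>. x \<in> \<Omega> \<longrightarrow> (\<forall>i\<in>Q. (\<lambda>k. dist (u k x) (q i k)) \<longlonglongrightarrow> ultra_dist F (\<phi> x) (q i)) \<and>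
         (\<forall>\<epsilon>>0. \<exists>j\<in>Q. ultra_dist F (\<phi> x) (q j) < \<epsilon>)) \<and>
     (\<forall>z\<in>ultra_carrier. (\<lambda>x. ultra_dist F (\<phi> x) z) \<in> borel_measurable (restrict_space \<mu> \<Omega>)) \<and>
     (\<exists>h. p_weak_upper_gradient \<mu> \<Omega> p (ultra_dist F) \<phi> h \<and> p_mass \<mu> \<Omega> p h \<le> ennreal e0)"
proof -
  obtain H f h \<rho> s where comb: "\<And>j::nat. comb (s j) (H j) (f j)" and s: "strict_mono s"
    and h [measurable]: "h \<in> borel_measurable borel" and \<rho> [measurable]: "\<rho> \<in> borel_measurable borel" and \<rho>_fin: "p_mass \<mu> \<Omega> p \<rho> < top"
    and h_mass: "p_mass \<mu> \<Omega> p h \<le> ennreal e0" and dom: "\<And>j x. H j x \<le> h x + ennreal (2 * (1/2)^j) * \<rho> x"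
    by (rule fast_combinations) (rule that)
  define Good where "Good = {x. \<forall>\<epsilon>>0. \<exists>j\<in>Q. \<forall>\<^sub>F k in sequentially. dist (u k x) (q j k) < \<epsilon>}"
  have f_meas [measurable]: "f j i \<in> borel_measurable (restrict_space \<mu> \<Omega>)" for i j using comb_measurable[OF comb] by blast
  define lf where "lf = (\<lambda>i x. lim (\<lambda>j. f j i x))"
  have f_lim: "(\<lambda>j. f j i x) \<longlonglongrightarrow> ultra_dist F (\<lambda>k. u k x) (q i)" if "x \<in> Good" "i \<in> Q" for x i
  proof (rule LIMSEQ_I)
    fix e :: real assume e: "0 < e"
    have "(\<lambda>k. dist (u k x) (q i k)) \<longlonglongrightarrow> ultra_dist F (\<lambda>k. u k x) (q i)"
      by (rule good_points(2)) (use that in \<open>auto simp: Good_def\<close>)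
    from LIMSEQ_D[OF this half_gt_zero[OF e]]
    obtain N where N: "\<And>k. k \<ge> N \<Longrightarrow> \<bar>dist (u k x) (q i k) - ultra_dist F (\<lambda>k. u k x) (q i)\<bar> < e/2"
      unfolding real_norm_def by blast
    have "\<bar>f j i x - ultra_dist F (\<lambda>k. u k x) (q i)\<bar> \<le> e/2" if "j \<ge> N" for j
    proof (rule comb_limit[OF comb[of j]])
      fix k assume "s j \<le> k"
      then have "k \<ge> N" using that seq_suble[OF s, of j] by linarith
      then show "\<bar>dist (u k x) (q i k) - ultra_dist F (\<lambda>k. u k x) (q i)\<bar> \<le> e/2" using N[of k] by simp
    qed
    then show "\<exists>no. \<forall>n\<ge>no. norm (f n i x - ultra_dist F (\<lambda>k. u k x) (q i)) < e"
      using e by (intro exI[of _ N]) fastforce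
  qed
  \<comment> \<open>Countably many conditions on measurable functions; the ultra-distances that
    occur here do not depend on x.\<close>
  define W where "W = {x\<in>\<Omega>. (\<forall>i\<in>Q. Cauchy (\<lambda>j. f j i x)) \<and> (\<forall>m::nat. \<exists>j\<in>Q. \<forall>i\<in>Q. \<bar>lf i x - ultra_dist F (q j) (q i)\<bar> \<le> (1/2)^m)}"
  have W_lim: "(\<lambda>j. f j i x) \<longlonglongrightarrow> lf i x" if "x \<in> W" "i \<in> Q" for x i
    using that Cauchy_convergent unfolding W_def lf_def by (auto simp: convergent_LIMSEQ_iff)
  define pt where "pt = (\<lambda>x y. y \<in> ultra_carrier \<and> (\<forall>i\<in>Q. ultra_dist F y (q i) = lf i x) \<and> (\<forall>\<epsilon>>0. \<exists>j\<in>Q. ultra_dist F y (q j) < \<epsilon>))"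
  have ex_pt: "\<exists>y. pt x y" if "x \<in> W" for x
  proof -
    have "\<exists>j\<in>Q. \<forall>i\<in>Q. \<bar>lf i x - ultra_dist F (q j) (q i)\<bar> \<le> e" if "0 < e" for e
    proof -
      obtain m where "(1/2)^m < e" using real_arch_pow_inv[of e "1/2"] \<open>0 < e\<close> by auto
      moreover obtain j where "j \<in> Q" "\<forall>i\<in>Q. \<bar>lf i x - ultra_dist F (q j) (q i)\<bar> \<le> (1/2)^m"
        using \<open>x \<in> W\<close> unfolding W_def by blast
      ultimately show ?thesis by (intro bexI[of _ j]) (auto intro: order_trans less_imp_le)
    qed
    from ultra_point_of_distances[of Q q "\<lambda>i. lf i x", OF q_bounded this] show ?thesis by (auto simp: pt_def)
  qed
  obtain i0 where i0: "i0 \<in> Q" using Q(2) by blast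
  \<comment> \<open>Off W one fixed carrier point is taken, which keeps \<phi> measurable.\<close>
  define \<phi> where "\<phi> = (\<lambda>x. if x \<in> W then SOME y. pt x y else q i0)"
  have \<phi>_pt: "pt x (\<phi> x)" if "x \<in> W" for x
    unfolding \<phi>_def using someI_ex[OF ex_pt[OF that]] that by simp
  have carrier: "\<phi> x \<in> ultra_carrier" for x
    using \<phi>_pt[of x] q_bounded[OF i0] by (cases "x \<in> W") (auto simp: pt_def \<phi>_def)
  have \<phi>_W: "ultra_dist F (\<phi> x) (q i) = lf i x" if "x \<in> W" "i \<in> Q" for x i
    using \<phi>_pt[OF that(1)] that(2) by (simp add: pt_def)
  have \<phi>_close: "\<exists>j\<in>Q. ultra_dist F (\<phi> x) (q j) < \<epsilon>" if "x \<in> W" "0 < \<epsilon>" for x \<epsilon>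
    using \<phi>_pt[OF that(1)] that(2) unfolding pt_def by blast
  have good_W: "x \<in> W" if "x \<in> Good" "x \<in> \<Omega>" for x
  proof -
    note gp = good_points[of x]
    have good: "\<forall>\<epsilon>>0. \<exists>j\<in>Q. \<forall>\<^sub>F k in sequentially. dist (u k x) (q j k) < \<epsilon>"
      using \<open>x \<in> Good\<close> by (simp add: Good_def)
    have car: "(\<lambda>k. u k x) \<in> ultra_carrier" using gp(1)[OF good] by (simp add: ultra_carrier_def)
    have lf_eq: "lf i x = ultra_dist F (\<lambda>k. u k x) (q i)" if "i \<in> Q" for i
      unfolding lf_def by (rule limI[OF f_lim[OF \<open>x \<in> Good\<close> that]])
    have "\<exists>j\<in>Q. \<forall>i\<in>Q. \<bar>lf i x - ultra_dist F (q j) (q i)\<bar> \<le> (1/2)^m" for m :: nat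
    proof -
      obtain j where j: "j \<in> Q" "ultra_dist F (\<lambda>k. u k x) (q j) < (1/2)^m" using gp(3)[OF good, of "(1/2)^m"] by auto
      have "\<bar>lf i x - ultra_dist F (q j) (q i)\<bar> \<le> (1/2)^m" if "i \<in> Q" for i
        using ultra_dist_triangle_abs[OF car q_bounded[OF j(1)] q_bounded[OF that]] j(2) lf_eq[OF that] by linarith
      then show ?thesis using j(1) by blast
    qed
    then show ?thesis
      using f_lim[OF \<open>x \<in> Good\<close>] \<open>x \<in> \<Omega>\<close> by (auto simp: W_def intro: LIMSEQ_imp_Cauchy)
  qed
  have good_\<phi>: "ultra_dist F (\<phi> x) (\<lambda>k. u k x) = 0" "bounded (range (\<lambda>k. u k x))" 
    "\<And>i. i \<in> Q \<Longrightarrow> (\<lambda>k. dist (u k x) (q i k)) \<longlonglongrightarrow> ultra_dist F (\<phi> x) (q i)" if "x \<in> Good" "x \<in> \<Omega>" for x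
  proof -
    have good: "\<forall>\<epsilon>>0. \<exists>j\<in>Q. \<forall>\<^sub>F k in sequentially. dist (u k x) (q j k) < \<epsilon>"
      using \<open>x \<in> Good\<close> by (simp add: Good_def)
    note gp = good_points[of x, OF good]
    show bdd: "bounded (range (\<lambda>k. u k x))" by (rule gp(1))
    then have car: "(\<lambda>k. u k x) \<in> ultra_carrier" by (simp add: ultra_carrier_def)
    have eq: "ultra_dist F (\<phi> x) (q i) = ultra_dist F (\<lambda>k. u k x) (q i)" if "i \<in> Q" for i
      using \<phi>_W[OF good_W that] f_lim[of x i] that \<open>x \<in> Good\<close> \<open>x \<in> \<Omega>\<close> by (auto simp: lf_def intro: limI)
    \<comment> \<open>Both points have the same distances to all members of Q, some of which are
      arbitrarily close to the second point.\<close>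
    have "ultra_dist F (\<phi> x) (\<lambda>k. u k x) \<le> 0"
      by (rule ultra_dist_via_family[OF carrier car]) (use gp(3) eq in auto)
    then show "ultra_dist F (\<phi> x) (\<lambda>k. u k x) = 0" using ultra_dist_nonneg[OF carrier car, of x] by simp
    show "(\<lambda>k. dist (u k x) (q i k)) \<longlonglongrightarrow> ultra_dist F (\<phi> x) (q i)" if "i \<in> Q" for i
      using gp(2)[OF that] eq[OF that] by simp
  qed
  have ae_good: "AE x in \<mu>. x \<in> \<Omega> \<longrightarrow> x \<in> Good" using approximable by (simp add: Good_def)
  have meas: "(\<lambda>x. ultra_dist F (\<phi> x) z) \<in> borel_measurable (restrict_space \<mu> \<Omega>)" if z: "z \<in> ultra_carrier" for z
  proof -
    let ?R = "restrict_space \<mu> \<Omega>"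
    have sp: "space ?R = \<Omega>" using sets_\<mu> sets_eq_imp_space_eq[OF sets_\<mu>] by (simp add: space_restrict_space)
    have [measurable]: "lf i \<in> borel_measurable ?R" for i unfolding lf_def by measurable
    have "W = (\<Inter>i\<in>Q. {x\<in>space ?R. Cauchy (\<lambda>j. f j i x)}) \<inter> (\<Inter>m. \<Union>j\<in>Q. \<Inter>i\<in>Q. {x\<in>space ?R. \<bar>lf i x - ultra_dist F (q j) (q i)\<bar> \<le> (1/2)^m})"
      using Q(2) unfolding W_def sp by auto
    also have "\<dots> \<in> sets ?R"
    proof -
      have "(\<Inter>i\<in>Q. {x\<in>space ?R. \<bar>lf i x - ultra_dist F (q j) (q i)\<bar> \<le> (1/2)^m}) \<in> sets ?R" for j m
        by (rule sets.countable_INT'[OF Q]) auto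
      then have "(\<Union>j\<in>Q. \<Inter>i\<in>Q. {x\<in>space ?R. \<bar>lf i x - ultra_dist F (q j) (q i)\<bar> \<le> (1/2)^m}) \<in> sets ?R" for m
        by (intro sets.countable_UN'[OF Q(1)]) blast
      then have "(\<Inter>m. \<Union>j\<in>Q. \<Inter>i\<in>Q. {x\<in>space ?R. \<bar>lf i x - ultra_dist F (q j) (q i)\<bar> \<le> (1/2)^m}) \<in> sets ?R"
        by (intro sets.countable_INT') auto
      moreover have "(\<Inter>i\<in>Q. {x\<in>space ?R. Cauchy (\<lambda>j. f j i x)}) \<in> sets ?R"
        by (rule sets.countable_INT'[OF Q]) auto
      ultimately show ?thesis by (rule sets.Int[rotated])
    qed
    finally have W_sets: "W \<in> sets ?R" .
    \<comment> \<open>The infimum over the dense family recovers the distance to an arbitrary z from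
      the countably many measurable functions \<open>lf i\<close>.\<close>
    define G where "G = (\<lambda>x. INF i\<in>Q. ennreal (lf i x + ultra_dist F (q i) z))"
    have [measurable]: "G \<in> borel_measurable ?R"
      unfolding G_def using Q(1) by measurable
    have "ultra_dist F (\<phi> x) z = enn2real (if x \<in> W then G x else ennreal (ultra_dist F (q i0) z))" for x
    proof (cases "x \<in> W")
      case True
      have "G x = ennreal (ultra_dist F (\<phi> x) z)"
      proof (rule antisym)
        show "ennreal (ultra_dist F (\<phi> x) z) \<le> G x"
          unfolding G_def using ultra_dist_triangle[OF carrier q_bounded z] \<phi>_W[OF True]
          by (intro INF_greatest ennreal_leI) (metis (no_types))
        show "G x \<le> ennreal (ultra_dist F (\<phi> x) z)"
        proof (rule ennreal_le_epsilon)
          fix e :: real assume e: "0 < e"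
          then obtain j where j: "j \<in> Q" "ultra_dist F (\<phi> x) (q j) < e/2" using \<phi>_close[OF True, of "e/2"] by auto
          have "G x \<le> ennreal (lf j x + ultra_dist F (q j) z)" unfolding G_def by (rule INF_lower[OF j(1)])
          also have "\<dots> \<le> ennreal (ultra_dist F (\<phi> x) z + e)"
            using ultra_dist_triangle[OF q_bounded[OF j(1)] carrier z, of x] j(2) \<phi>_W[OF True j(1)] ultra_dist_commute[of "q j" "\<phi> x"]
            by (intro ennreal_leI) linarith
          finally show "G x \<le> ennreal (ultra_dist F (\<phi> x) z) + ennreal e"
            using ultra_dist_nonneg[OF carrier z] e by simp
        qed
      qed
      then show ?thesis using True ultra_dist_nonneg[OF carrier z] by simp
    next
      case False
      then show ?thesis using ultra_dist_nonneg[OF q_bounded[OF i0] z] by (simp add: \<phi>_def)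
    qed
    moreover have "(\<lambda>x. enn2real (if x \<in> W then G x else ennreal (ultra_dist F (q i0) z))) \<in> borel_measurable ?R"
      using W_sets by measurable
    ultimately show ?thesis by (simp cong: measurable_cong)
  qed
  \<comment> \<open>A Borel null set containing the bad points, so that it can be tested against
    curves.\<close>
  obtain N where N: "{x\<in>space \<mu>. \<not> (x \<in> \<Omega> \<longrightarrow> x \<in> Good)} \<subseteq> N" "emeasure \<mu> N = 0" "N \<in> sets \<mu>"
    using AE_E[OF ae_good] by blast
  have sp: "space \<mu> = UNIV" using sets_eq_imp_space_eq[OF sets_\<mu>] by simp
  have N_good: "x \<in> Good" if "x \<in> \<Omega>" "x \<notin> N" for x using N(1) that sp by auto
  have N_borel [measurable]: "N \<in> sets borel" using N(3) sets_\<mu> by simp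
  have \<rho>N: "p_mass \<mu> \<Omega> p (\<lambda>x. top * indicator N x) < top"
  proof -
    have "AE x in \<mu>. x \<notin> N" using N by (intro AE_not_in) (auto simp: null_sets_def)
    then have "p_mass \<mu> \<Omega> p (\<lambda>x. top * indicator N x) = (\<integral>\<^sup>+x. 0 \<partial>\<mu>)"
      by (intro nn_integral_cong_AE, eventually_elim) auto
    then show ?thesis by simp
  qed
  define Rf where "Rf = (\<lambda>n::nat. if n = 0 then \<rho> else if n = 1 then h else (\<lambda>x. top * indicator N x))"
  have h_fin: "p_mass \<mu> \<Omega> p h < top" using h_mass by (rule le_less_trans) simp
  obtain P where P: "P \<in> borel_measurable borel" "p_mass \<mu> \<Omega> p P < top"
    "\<And>n \<gamma> L. arclength_curve \<Omega> (\<gamma>, L) \<Longrightarrow> arc_integral P \<gamma> 0 L < top \<Longrightarrow> arc_integral (Rf n) \<gamma> 0 L < top"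
  proof (rule p_mass_dominating_countable[OF sets_\<mu> \<Omega>_borel p_pos, of Rf])
    show "Rf n \<in> borel_measurable borel" for n by (simp add: Rf_def)
    show "p_mass \<mu> \<Omega> p (Rf n) < top" for n using \<rho>_fin h_fin \<rho>N by (simp add: Rf_def)
  qed blast
  have ug_\<phi>: "ennreal (ultra_dist F (\<phi> (\<gamma> t)) (\<phi> (\<gamma> s'))) \<le> arc_integral h \<gamma> s' t"
    if c: "arclength_curve \<Omega> (\<gamma>, L)" "arc_integral P \<gamma> 0 L < top" and st: "0 \<le> s'" "s' \<le> t" "t \<le> L" for \<gamma> L s' t
  \<comment> \<open>A constant curve is treated apart, as it has no arcs of positive length.\<close>
  proof (cases "L = 0")
    case True
    then have "s' = t" using st by simp
    then show ?thesis by simp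
  next
    case False
    then have L: "0 < L" using st by simp
    note cD = arclength_curveD[OF c(1)]
    have fin: "arc_integral \<rho> \<gamma> 0 L < top" "arc_integral h \<gamma> 0 L < top" "arc_integral (\<lambda>x. top * indicator N x) \<gamma> 0 L < top"
      using P(3)[OF c, of 0] P(3)[OF c, of 1] P(3)[OF c, of 2] by (simp_all add: Rf_def)
    have ae: "AE \<tau> in lborel. \<tau> \<in> {0..L} \<longrightarrow> \<gamma> \<tau> \<notin> N" by (rule arc_integral_top_indicator[OF c(1) N_borel fin(3)])
    obtain A where A: "arc_integral \<rho> \<gamma> 0 L = ennreal A" "0 \<le> A" using fin(1) by (cases "arc_integral \<rho> \<gamma> 0 L") auto
    \<comment> \<open>The error vanishes as j grows, uniformly in i and in the subarc.\<close>
    have bound: "ennreal \<bar>f j i (\<gamma> b) - f j i (\<gamma> a)\<bar> \<le> arc_integral h \<gamma> a b + ennreal (2 * (1/2)^j * A)"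
      if "0 \<le> a" "a \<le> b" "b \<le> L" for a b i j
    proof -
      have "ennreal \<bar>f j i (\<gamma> b) - f j i (\<gamma> a)\<bar> \<le> arc_integral (H j) \<gamma> a b"
        by (rule comb_curve[OF comb c(1) that])
      also have "\<dots> \<le> arc_integral (\<lambda>x. h x + ennreal (2 * (1/2)^j) * \<rho> x) \<gamma> a b" by (rule arc_integral_mono[OF dom])
      also have "\<dots> = arc_integral h \<gamma> a b + ennreal (2 * (1/2)^j) * arc_integral \<rho> \<gamma> a b"
        using arc_integral_add[OF h _ cD(3) that(1,3), of "\<lambda>x. ennreal (2 * (1/2)^j) * \<rho> x"]
          arc_integral_cmult[OF \<rho> cD(3) that(1,3), of "ennreal (2 * (1/2)^j)"] by simp
      also have "\<dots> \<le> arc_integral h \<gamma> a b + ennreal (2 * (1/2)^j) * ennreal A"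
        using arc_integral_subset[OF that(1,3), of \<rho> \<gamma>] A by (intro add_left_mono mult_left_mono) auto
      finally show ?thesis using A(2) by (simp add: ennreal_mult)
    qed
    have tail: "(\<lambda>j. 2 * (1/2)^j * A) \<longlonglongrightarrow> 0"
      using tendsto_mult_left[OF tendsto_mult_right[OF LIMSEQ_power_zero[of "1/2::real"]], of A 2] by (simp add: mult_ac)
    \<comment> \<open>A short arc of positive length around t contains a good point, and the bound
      on subarcs compares the combinations there with those at t. Uniformity in i transfers both the
      Cauchy property and the approximation by members of Q.\<close>
    have near: "\<exists>x'\<in>Good \<inter> \<Omega>. \<exists>j0. \<forall>j\<ge>j0. \<forall>i. \<bar>f j i (\<gamma> t) - f j i x'\<bar> \<le> \<epsilon>" if t: "0 \<le> t" "t \<le> L" and \<epsilon>: "0 < \<epsilon>" for t \<epsilon>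
    proof -
      obtain a b where ab: "0 \<le> a" "a \<le> t" "t \<le> b" "b \<le> L" "a < b" "arc_integral h \<gamma> a b < ennreal (\<epsilon>/2)"
        using arc_integral_small_neighbourhood[OF c(1) h fin(2) t L, of "\<epsilon>/2"] \<epsilon> by auto
      have "\<exists>\<tau>\<in>{a..b}. \<gamma> \<tau> \<notin> N"
      proof (rule ccontr)
        assume "\<not> ?thesis"
        then have "AE \<tau> in lborel. \<tau> \<notin> {a..b}" using ae ab(1,4) by (auto elim!: eventually_mono)
        then have "emeasure lborel {a..b} = 0" by (subst (asm) AE_iff_measurable[of "{a..b}"]) auto
        then show False using ab(5) by simp
      qed
      then obtain \<tau> where \<tau>: "a \<le> \<tau>" "\<tau> \<le> b" "\<gamma> \<tau> \<notin> N" by auto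
      have \<tau>\<Omega>: "\<gamma> \<tau> \<in> \<Omega>" using cD(2) \<tau> ab(1,4) by (auto simp: image_subset_iff)
      obtain j0 where j0: "\<And>j. j \<ge> j0 \<Longrightarrow> 2 * (1/2)^j * A < \<epsilon>/2"
        using order_tendstoD(2)[OF tail, of "\<epsilon>/2"] \<epsilon> by (auto simp: eventually_sequentially)
      have "\<bar>f j i (\<gamma> t) - f j i (\<gamma> \<tau>)\<bar> \<le> \<epsilon>" if j: "j \<ge> j0" for j i
      proof -
        have "ennreal \<bar>f j i (\<gamma> t) - f j i (\<gamma> \<tau>)\<bar> \<le> arc_integral h \<gamma> (min t \<tau>) (max t \<tau>) + ennreal (2 * (1/2)^j * A)"
        proof (cases "\<tau> \<le> t")
          case True
          then show ?thesis using bound[of \<tau> t j i] ab(1) \<tau> t by (simp add: min_def max_def)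
        next
          case False
          then show ?thesis using bound[of t \<tau> j i] ab(4) \<tau> t by (simp add: min_def max_def abs_minus_commute)
        qed
        also have "\<dots> \<le> ennreal (\<epsilon>/2) + ennreal (\<epsilon>/2)"
        proof (intro add_mono ennreal_leI)
          have "arc_integral h \<gamma> (min t \<tau>) (max t \<tau>) \<le> arc_integral h \<gamma> a b"
            using ab \<tau> by (intro nn_integral_mono) (auto split: split_indicator)
          then show "arc_integral h \<gamma> (min t \<tau>) (max t \<tau>) \<le> ennreal (\<epsilon>/2)" using ab(6) by simp
          show "2 * (1/2)^j * A \<le> \<epsilon>/2" using j0[OF j] by simp
        qed
        also have "\<dots> = ennreal \<epsilon>" using \<epsilon> by (simp flip: ennreal_plus)
        finally show ?thesis using \<epsilon> by (simp add: ennreal_le_iff)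
      qed
      then show ?thesis using N_good[OF \<tau>\<Omega> \<tau>(3)] \<tau>\<Omega> by blast
    qed
    have in_W: "\<gamma> t \<in> W" if t: "0 \<le> t" "t \<le> L" for t
    proof -
      have cau: "Cauchy (\<lambda>j. f j i (\<gamma> t))" if i: "i \<in> Q" for i
        unfolding Cauchy_def
      proof (intro allI impI)
        fix e :: real assume e: "0 < e"
        then obtain x' j0 where x': "x' \<in> Good" "\<And>j. j \<ge> j0 \<Longrightarrow> \<bar>f j i (\<gamma> t) - f j i x'\<bar> \<le> e/4"
          using near[OF t, of "e/4"] by auto
        have "Cauchy (\<lambda>j. f j i x')" using f_lim[OF x'(1) i] by (rule LIMSEQ_imp_Cauchy)
        then obtain M where M: "\<And>m n. m \<ge> M \<Longrightarrow> n \<ge> M \<Longrightarrow> dist (f m i x') (f n i x') < e/4"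
          using metric_CauchyD[of "\<lambda>j. f j i x'" "e/4"] e by auto
        show "\<exists>M. \<forall>m\<ge>M. \<forall>n\<ge>M. dist (f m i (\<gamma> t)) (f n i (\<gamma> t)) < e"
        proof (intro exI allI impI)
          fix m n assume mn: "max M j0 \<le> m" "max M j0 \<le> n"
          have "\<bar>f m i x' - f n i x'\<bar> < e/4" using M[of m n] mn by (simp add: dist_real_def)
          moreover have "\<bar>f m i (\<gamma> t) - f m i x'\<bar> \<le> e/4" "\<bar>f n i (\<gamma> t) - f n i x'\<bar> \<le> e/4"
            using mn by (intro x'(2); simp)+
          ultimately show "dist (f m i (\<gamma> t)) (f n i (\<gamma> t)) < e"
            using e unfolding dist_real_def abs_le_iff abs_less_iff by linarith
        qed
      qed
      have lf_t: "(\<lambda>j. f j i (\<gamma> t)) \<longlonglongrightarrow> lf i (\<gamma> t)" if "i \<in> Q" for i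
        using Cauchy_convergent[OF cau[OF that]] by (simp add: lf_def convergent_LIMSEQ_iff)
      have "\<exists>j\<in>Q. \<forall>i\<in>Q. \<bar>lf i (\<gamma> t) - ultra_dist F (q j) (q i)\<bar> \<le> (1/2)^m" for m :: nat
      proof -
        obtain x' j0 where x': "x' \<in> Good" "x' \<in> \<Omega>" "\<And>j i. j \<ge> j0 \<Longrightarrow> \<bar>f j i (\<gamma> t) - f j i x'\<bar> \<le> (1/2)^m / 2"
          using near[OF t, of "(1/2)^m / 2"] by auto
        have x'W: "x' \<in> W" by (rule good_W[OF x'(1,2)])
        obtain j where j: "j \<in> Q" "ultra_dist F (\<phi> x') (q j) < (1/2)^m / 2" using \<phi>_close[OF x'W, of "(1/2)^m / 2"] by auto
        have "\<bar>lf i (\<gamma> t) - ultra_dist F (q j) (q i)\<bar> \<le> (1/2)^m" if i: "i \<in> Q" for i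
        proof -
          have "(\<lambda>j. \<bar>f j i (\<gamma> t) - f j i x'\<bar>) \<longlonglongrightarrow> \<bar>lf i (\<gamma> t) - lf i x'\<bar>"
            by (intro tendsto_intros lf_t W_lim i x'W)
          then have "\<bar>lf i (\<gamma> t) - lf i x'\<bar> \<le> (1/2)^m / 2"
            by (rule LIMSEQ_le_const2) (use x'(3) in blast)
          moreover have "\<bar>lf i x' - ultra_dist F (q j) (q i)\<bar> \<le> (1/2)^m / 2"
            using ultra_dist_triangle_abs[OF carrier q_bounded[OF j(1)] q_bounded[OF i], of x'] j(2) \<phi>_W[OF x'W i] by linarith
          ultimately show ?thesis by linarith
        qed
        then show ?thesis using j(1) by blast
      qed
      then show ?thesis using cau cD(2) t by (auto simp: W_def image_subset_iff)
    qed
    have W: "\<gamma> s' \<in> W" "\<gamma> t \<in> W" using in_W st by auto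
    show ?thesis
    proof (cases "arc_integral h \<gamma> s' t")
      case (real r)
      \<comment> \<open>Both ends lie in W, so their distances to members of Q are limits of the
        combined distance functions, whose increments are at most r up to a vanishing error.\<close>
      have "ultra_dist F (\<phi> (\<gamma> t)) (\<phi> (\<gamma> s')) \<le> r"
      proof (rule ultra_dist_via_family[OF carrier carrier \<phi>_close[OF W(1)]])
        fix i assume i: "i \<in> Q"
        have l1: "(\<lambda>j. \<bar>f j i (\<gamma> t) - f j i (\<gamma> s')\<bar>) \<longlonglongrightarrow> \<bar>lf i (\<gamma> t) - lf i (\<gamma> s')\<bar>"
          by (intro tendsto_intros W_lim i W)
        have l2: "(\<lambda>j. r + 2 * (1/2)^j * A) \<longlonglongrightarrow> r + 0" by (intro tendsto_add tendsto_const tail)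
        have "\<bar>f j i (\<gamma> t) - f j i (\<gamma> s')\<bar> \<le> r + 2 * (1/2)^j * A" for j
          using bound[OF st, of j i] real A(2) by (simp add: ennreal_le_iff flip: ennreal_plus)
        then have "\<bar>lf i (\<gamma> t) - lf i (\<gamma> s')\<bar> \<le> r" using LIMSEQ_le[OF l1 l2] by simp
        then show "\<bar>ultra_dist F (\<phi> (\<gamma> t)) (q i) - ultra_dist F (\<phi> (\<gamma> s')) (q i)\<bar> \<le> r"
          using \<phi>_W i W by simp
      qed
      then show ?thesis using real by (simp add: ennreal_leI)
    qed simp
  qed
  have "p_weak_upper_gradient \<mu> \<Omega> p (ultra_dist F) \<phi> h"
    unfolding p_weak_upper_gradient_iff[OF sets_\<mu> \<Omega>_borel p_pos]
    using h P(1,2) ug_\<phi> by (intro conjI bexI[of _ P]) auto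
  moreover have "AE x in \<mu>. x \<in> \<Omega> \<longrightarrow> bounded (range (\<lambda>k. u k x)) \<and> ultra_dist F (\<phi> x) (\<lambda>k. u k x) = 0"
    using ae_good by eventually_elim (use good_\<phi> in auto)
  moreover have "AE x in \<mu>. x \<in> \<Omega> \<longrightarrow> (\<forall>i\<in>Q. (\<lambda>k. dist (u k x) (q i k)) \<longlonglongrightarrow> ultra_dist F (\<phi> x) (q i)) \<and>
         (\<forall>\<epsilon>>0. \<exists>j\<in>Q. ultra_dist F (\<phi> x) (q j) < \<epsilon>)"
    using ae_good by eventually_elim (use good_\<phi>(3) good_W \<phi>_close in auto)
  ultimately show ?thesis using carrier meas h_mass by (intro exI[of _ \<phi>]) blast
qed

end

section \<open>Traces\<close>

context level_values
begin

text \<open>The ball around x lies in the ball around the selected centre. The constant is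
  \<open>dbl 5\<close>, since that ball has radius 4 * rad m and a centre within rad m of x.\<close>

lemma vol_average_le:
  fixes f :: "'x \<Rightarrow> ennreal"
  assumes x: "x \<in> closure \<Omega>"
  shows "(\<integral>\<^sup>+z\<in>ball x (rad m). f z \<partial>\<nu>) / ennreal (vol x (rad m)) 
    \<le> ennreal (dbl 5) * ((\<integral>\<^sup>+z\<in>ball (\<kappa> m x) (4 * rad m). f z \<partial>\<nu>) / ennreal (vol (\<kappa> m x) (4 * rad m)))"
proof -
  let ?c = "\<kappa> m x"
  have c: "?c \<in> X m" "dist x ?c \<le> rad m" using \<kappa>[OF x] by auto
  have v: "0 < vol x (rad m)" "0 < vol ?c (4 * rad m)"
    using ball_pos[OF x, of "rad m"] vol_pos[OF X_sub[OF c(1)], of "4 * rad m"] by auto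
  have cmp: "vol ?c (4 * rad m) \<le> dbl 5 * vol x (rad m)"
    using c(2) by (intro vol_compare x) (auto simp: dist_commute)
  have "ball x (rad m) \<subseteq> ball ?c (4 * rad m)"
  proof
    fix z assume "z \<in> ball x (rad m)"
    then have "dist ?c z < 2 * rad m" using c(2) dist_triangle[of ?c z x] by (simp add: dist_commute)
    then have "dist ?c z < 4 * rad m" using rad_pos[of m] by linarith
    then show "z \<in> ball ?c (4 * rad m)" by simp
  qed
  then have "(\<integral>\<^sup>+z\<in>ball x (rad m). f z \<partial>\<nu>) \<le> (\<integral>\<^sup>+z\<in>ball ?c (4 * rad m). f z \<partial>\<nu>)"
    by (intro nn_integral_mono) (auto split: split_indicator)
  then have "(\<integral>\<^sup>+z\<in>ball x (rad m). f z \<partial>\<nu>) / ennreal (vol x (rad m)) \<le> (\<integral>\<^sup>+z\<in>ball ?c (4 * rad m). f z \<partial>\<nu>) / ennreal (vol x (rad m))"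
    by (rule divide_right_mono_ennreal)
  also have "\<dots> = (\<integral>\<^sup>+z\<in>ball ?c (4 * rad m). f z \<partial>\<nu>) * ennreal (1 / vol x (rad m))"
    using v by (simp add: divide_ennreal_def inverse_ennreal inverse_eq_divide)
  also have "\<dots> \<le> (\<integral>\<^sup>+z\<in>ball ?c (4 * rad m). f z \<partial>\<nu>) * ennreal (dbl 5 * (1 / vol ?c (4 * rad m)))"
    using v cmp by (intro mult_left_mono ennreal_leI) (auto simp: field_simps)
  also have "\<dots> = ennreal (dbl 5) * ((\<integral>\<^sup>+z\<in>ball ?c (4 * rad m). f z \<partial>\<nu>) / ennreal (vol ?c (4 * rad m)))"
  proof -
    have "ennreal (dbl 5 * (1 / vol ?c (4 * rad m))) = ennreal (dbl 5) * inverse (ennreal (vol ?c (4 * rad m)))"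
      using v dbl_ge_1[of 5] by (subst ennreal_mult) (auto simp: inverse_ennreal inverse_eq_divide)
    then show ?thesis by (simp add: divide_ennreal_def mult_ac)
  qed
  finally show ?thesis .
qed

lemma dist_average_le:
  assumes x: "x \<in> closure \<Omega>" and r: "0 < r" and f: "f \<in> borel_measurable \<nu>" and g: "g \<in> borel_measurable \<nu>"
    and le: "\<And>z. z \<in> \<Omega> \<Longrightarrow> a \<le> f z + (g z :: ennreal)"
  shows "a \<le> (\<integral>\<^sup>+z\<in>ball x r. f z \<partial>\<nu>) / ennreal (vol x r) + (\<integral>\<^sup>+z\<in>ball x r. g z \<partial>\<nu>) / ennreal (vol x r)"
proof -
  note [measurable] = f g
  have v: "0 < vol x r" using ball_pos[OF x r] .
  have "ennreal (vol x r) * a = (\<integral>\<^sup>+z\<in>ball x r. a \<partial>\<nu>)"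
    by (subst nn_integral_cmult) (auto simp: nn_integral_indicator_vol mult.commute simp del: nn_integral_indicator)
  also have "\<dots> \<le> (\<integral>\<^sup>+z. f z * indicator (ball x r) z + g z * indicator (ball x r) z \<partial>\<nu>)"
    using le by (intro nn_integral_mono) (auto simp: space_\<nu> split: split_indicator)
  also have "\<dots> = (\<integral>\<^sup>+z\<in>ball x r. f z \<partial>\<nu>) + (\<integral>\<^sup>+z\<in>ball x r. g z \<partial>\<nu>)"
    by (rule nn_integral_add) measurable
  finally have "ennreal (vol x r) * a / ennreal (vol x r) \<le> ((\<integral>\<^sup>+z\<in>ball x r. f z \<partial>\<nu>) + (\<integral>\<^sup>+z\<in>ball x r. g z \<partial>\<nu>)) / ennreal (vol x r)"
    by (rule divide_right_mono_ennreal)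
  moreover have "ennreal (vol x r) * a / ennreal (vol x r) = a"
    by (subst mult.commute, rule mult_divide_eq_ennreal) (use v in auto)
  ultimately show ?thesis by (simp add: divide_ennreal_def distrib_right)
qed

lemma rad_at_right: "filterlim (\<lambda>m. rad m) (at_right 0) sequentially"
proof -
  have "(\<lambda>m. rad m) \<longlonglongrightarrow> 0" by (rule LIMSEQ_power_zero) simp
  then show ?thesis by (auto simp: filterlim_at eventually_sequentially)
qed

text \<open>For fixed k, the trace value and the level value both approximate u k in mean near x, by
  definition of the trace and by \<open>A_tendsto_0\<close>.\<close>

lemma trace_lim:
  assumes g: "growth \<tau> C\<tau>"
    and tr: "AE x in \<tau>. ((\<lambda>r. (\<integral>\<^sup>+z\<in>ball x r. ennreal (dist (u k z) (T x)) \<partial>\<nu>) / ennreal (vol x r)) \<longlongrightarrow> 0) (at_right 0)"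
  shows "AE x in \<tau>. (\<lambda>m. dist (T x) (y m (\<kappa> m x) k)) \<longlonglongrightarrow> 0"
  using tr A_tendsto_0[OF g, of k] AE_space
proof eventually_elim
  case (elim x)
  have x: "x \<in> closure \<Omega>" using elim(3) g by (auto simp: growth_def)
  let ?avg = "\<lambda>r. (\<integral>\<^sup>+z\<in>ball x r. ennreal (dist (u k z) (T x)) \<partial>\<nu>) / ennreal (vol x r)"
  have le: "ennreal (dist (T x) (y m (\<kappa> m x) k)) \<le> ?avg (rad m) + ennreal (dbl 5) * A k m (\<kappa> m x)" for m
  proof -
    have "ennreal (dist (T x) (y m (\<kappa> m x) k)) \<le> ?avg (rad m) + 
       (\<integral>\<^sup>+z\<in>ball x (rad m). ennreal (dist (u k z) (y m (\<kappa> m x) k)) \<partial>\<nu>) / ennreal (vol x (rad m))"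
    proof (rule dist_average_le[OF x rad_pos])
      fix z
      have "ennreal (dist (T x) (y m (\<kappa> m x) k)) \<le> ennreal (dist (u k z) (T x) + dist (u k z) (y m (\<kappa> m x) k))"
        by (intro ennreal_leI) (metis dist_commute dist_triangle)
      then show "ennreal (dist (T x) (y m (\<kappa> m x) k)) \<le> ennreal (dist (u k z) (T x)) + ennreal (dist (u k z) (y m (\<kappa> m x) k))"
        by simp
    qed measurable
    also have "\<dots> \<le> ?avg (rad m) + ennreal (dbl 5) * A k m (\<kappa> m x)"
      unfolding A_def by (intro add_left_mono vol_average_le x)
    finally show ?thesis .
  qed
  have "(\<lambda>m. ?avg (rad m) + ennreal (dbl 5) * A k m (\<kappa> m x)) \<longlonglongrightarrow> 0 + ennreal (dbl 5) * 0"
    by (intro tendsto_add ennreal_tendsto_cmult elim(2) filterlim_compose[OF elim(1) rad_at_right]) simp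
  then have lim: "(\<lambda>m. ?avg (rad m) + ennreal (dbl 5) * A k m (\<kappa> m x)) \<longlonglongrightarrow> 0" by simp
  have "(\<lambda>m. ennreal (dist (T x) (y m (\<kappa> m x) k))) \<longlonglongrightarrow> 0"
    by (rule tendsto_sandwich[OF _ _ tendsto_const lim]) (auto intro!: always_eventually le)
  then have "(\<lambda>m. ennreal (dist (T x) (y m (\<kappa> m x) k))) \<longlonglongrightarrow> ennreal 0" by (simp only: ennreal_0)
  then show ?case by (rule tendsto_ennreal_iff[THEN iffD1, rotated 2]) simp_all
qed

text \<open>Fatou's lemma is used twice, over the ball and over \<tau>, to pass from averages for
  the k-th map, bounded uniformly in k, to averages of the limit distances.\<close>

lemma limit_averages_tendsto_0:
  fixes D :: "'x \<Rightarrow> nat \<Rightarrow> 'x \<Rightarrow> real"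
  assumes g: "growth \<tau> C\<tau>"
    and lim: "AE z in \<nu>. \<forall>m. \<forall>c\<in>X m. (\<lambda>k. dist (u k z) (y m c k)) \<longlonglongrightarrow> D z m c"
  shows "AE x in \<tau>. (\<lambda>m. (\<integral>\<^sup>+z\<in>ball (\<kappa> m x) (4 * rad m). ennreal (D z m (\<kappa> m x)) \<partial>\<nu>) / ennreal (vol (\<kappa> m x) (4 * rad m))) \<longlonglongrightarrow> 0"
proof -
  let ?f = "\<lambda>m c. (\<integral>\<^sup>+z\<in>ball c (4 * rad m). ennreal (D z m c) \<partial>\<nu>) / ennreal (vol c (4 * rad m))"
  have le: "?f m c \<le> liminf (\<lambda>k. A k m c)" if c: "c \<in> X m" for m c
  proof -
    have v: "0 < vol c (4 * rad m)" using vol_pos[OF X_sub[OF c], of "4 * rad m"] by simp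
    have "(\<integral>\<^sup>+z\<in>ball c (4 * rad m). ennreal (D z m c) \<partial>\<nu>) = (\<integral>\<^sup>+z. liminf (\<lambda>k. ennreal (dist (u k z) (y m c k)) * indicator (ball c (4 * rad m)) z) \<partial>\<nu>)"
    proof (rule nn_integral_cong_AE)
      show "AE z in \<nu>. ennreal (D z m c) * indicator (ball c (4 * rad m)) z = liminf (\<lambda>k. ennreal (dist (u k z) (y m c k)) * indicator (ball c (4 * rad m)) z)"
        using lim
      proof eventually_elim
        case (elim z)
        then have "(\<lambda>k. ennreal (dist (u k z) (y m c k))) \<longlonglongrightarrow> ennreal (D z m c)" using c by (intro tendsto_ennrealI) blast
        then have "(\<lambda>k. ennreal (dist (u k z) (y m c k)) * indicator (ball c (4 * rad m)) z) \<longlonglongrightarrow> ennreal (D z m c) * indicator (ball c (4 * rad m)) z"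
          by (auto split: split_indicator)
        then show ?case by (intro lim_imp_Liminf[symmetric]) auto
      qed
    qed
    also have "\<dots> \<le> liminf (\<lambda>k. \<integral>\<^sup>+z\<in>ball c (4 * rad m). ennreal (dist (u k z) (y m c k)) \<partial>\<nu>)"
      by (rule nn_integral_liminf) measurable
    also have "\<dots> = liminf (\<lambda>k. ennreal (vol c (4 * rad m)) * A k m c)"
      by (simp only: vol_A[OF c])
    also have "\<dots> = ennreal (vol c (4 * rad m)) * liminf (\<lambda>k. A k m c)"
      by (rule Liminf_compose_continuous_mono)
         (auto intro!: ennreal_continuous_on_cmult continuous_on_id monoI mult_left_mono)
    finally have "?f m c \<le> ennreal (vol c (4 * rad m)) * liminf (\<lambda>k. A k m c) / ennreal (vol c (4 * rad m))"
      by (rule divide_right_mono_ennreal)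
    also have "\<dots> = liminf (\<lambda>k. A k m c)"
      by (subst mult.commute, rule mult_divide_eq_ennreal) (use v in auto)
    finally show ?thesis .
  qed
  note [measurable] = A_measurable[OF g]
  have sp: "space \<tau> \<subseteq> closure \<Omega>" "sets \<tau> = sets (restrict_space borel (space \<tau>))" using g by (auto simp: growth_def)
  have "(\<integral>\<^sup>+x. ?f m (\<kappa> m x) \<partial>\<tau>) \<le> ennreal (C0 \<tau> C\<tau> * \<beta>^m)" for m
  proof -
    have "(\<integral>\<^sup>+x. ?f m (\<kappa> m x) \<partial>\<tau>) \<le> (\<integral>\<^sup>+x. liminf (\<lambda>k. A k m (\<kappa> m x)) \<partial>\<tau>)"
      using sp \<kappa>(1) by (intro nn_integral_mono le) auto
    also have "\<dots> \<le> liminf (\<lambda>k. \<integral>\<^sup>+x. A k m (\<kappa> m x) \<partial>\<tau>)" by (rule nn_integral_liminf) measurable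
    also have "\<dots> \<le> liminf (\<lambda>k::nat. ennreal (C0 \<tau> C\<tau> * \<beta>^m))"
      by (intro Liminf_mono always_eventually allI) (use selection_integral_A[OF g] in \<open>simp only: C0_def\<close>)
    finally show ?thesis by (simp add: Liminf_const)
  qed
  moreover have "(\<lambda>x. ?f m (\<kappa> m x)) \<in> borel_measurable \<tau>" for m
    by (rule selection_measurable[OF sp, of m "\<lambda>c x. ?f m c"]) simp
  ultimately show ?thesis
    by (intro AE_tendsto_0_if_integrals_summable(2)[where b="\<lambda>m. C0 \<tau> C\<tau> * \<beta>^m"])
       (use C0_nonneg[OF g] \<beta> in \<open>auto intro!: summable_mult\<close>)
qed

text \<open>At \<tau>-almost every x the level values approach the embedded limit of the traces, and
  the averages of the distance from \<phi> to the level values tend to 0. The triangle inequality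
  combines the two.\<close>

lemma ultralimit_trace:
  assumes "nonprincipal_ultrafilter F" and g: "growth \<tau> C\<tau>"
    and \<phi>: "\<And>z. \<phi> z \<in> ultra_carrier" "\<And>w. w \<in> ultra_carrier \<Longrightarrow> (\<lambda>z. ultra_dist F (\<phi> z) w) \<in> borel_measurable \<nu>"
    and y_bounded: "\<And>m c. c \<in> X m \<Longrightarrow> y m c \<in> ultra_carrier"
    and lim: "AE z in \<nu>. \<forall>m. \<forall>c\<in>X m. (\<lambda>k. dist (u k z) (y m c k)) \<longlonglongrightarrow> ultra_dist F (\<phi> z) (y m c)"
    and rate: "\<And>k m m' c c'. m \<le> k \<Longrightarrow> m' \<le> k \<Longrightarrow> c \<in> X m \<Longrightarrow> c' \<in> X m' \<Longrightarrow>
       \<bar>dist (y m c k) (y m' c' k) - L m c m' c'\<bar> \<le> (1/2)^k / real (Suc k)"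
    and tr: "\<And>k. AE x in \<tau>. ((\<lambda>r. (\<integral>\<^sup>+z\<in>ball x r. ennreal (dist (u k z) (T k x)) \<partial>\<nu>) / ennreal (vol x r)) \<longlongrightarrow> 0) (at_right 0)"
    and T: "AE x in \<tau>. (\<lambda>k. T k x) \<longlonglongrightarrow> t x"
  shows "AE x in \<tau>. ((\<lambda>r. (\<integral>\<^sup>+z\<in>ball x r. ennreal (ultra_dist F (\<phi> z) (ultra_embed (t x))) \<partial>\<nu>) / ennreal (vol x r)) \<longlongrightarrow> 0) (at_right 0)"
proof -
  interpret ultrafilter F by standard fact
  have sp: "space \<tau> \<subseteq> closure \<Omega>" "sets \<tau> = sets (restrict_space borel (space \<tau>))" using g by (auto simp: growth_def)
  have approx: "AE x in \<tau>. \<forall>e>0. \<exists>l0. \<forall>l\<ge>l0. \<forall>\<^sub>F k in sequentially. dist (T k x) (y l (\<kappa> l x) k) < e"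
  proof (rule approximation_by_level_values[OF sp _ \<beta> consecutive_values_integral[OF g] trace_lim[OF g tr] rate])
    show "0 \<le> 2 * dbl 4 * C0 \<tau> C\<tau>" using C0_nonneg[OF g] dbl_ge_1[of 4] by simp
  qed
  show ?thesis
    using approx T limit_averages_tendsto_0[OF g lim] AE_space
  proof eventually_elim
    case (elim x)
    have x: "x \<in> closure \<Omega>" using elim(4) sp by auto
    have y_car: "y l (\<kappa> l x) \<in> ultra_carrier" for l using \<kappa>(1)[OF x] by (rule y_bounded)
    let ?t = "ultra_embed (t x)"
    let ?avg = "\<lambda>r. (\<integral>\<^sup>+z\<in>ball x r. ennreal (ultra_dist F (\<phi> z) ?t) \<partial>\<nu>) / ennreal (vol x r)"
    let ?D = "\<lambda>m. (\<integral>\<^sup>+z\<in>ball (\<kappa> m x) (4 * rad m). ennreal (ultra_dist F (\<phi> z) (y m (\<kappa> m x))) \<partial>\<nu>) / ennreal (vol (\<kappa> m x) (4 * rad m))"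
    have td: "(\<lambda>l. ultra_dist F (y l (\<kappa> l x)) ?t) \<longlonglongrightarrow> 0"
    proof (rule LIMSEQ_I)
      fix e :: real assume e: "0 < e"
      then obtain l0 where l0: "\<And>l. l \<ge> l0 \<Longrightarrow> \<forall>\<^sub>F k in sequentially. dist (T k x) (y l (\<kappa> l x) k) < e/4"
        using elim(1)[rule_format, of "e/4"] by auto
      have "norm (ultra_dist F (y l (\<kappa> l x)) ?t - 0) < e" if "l \<ge> l0" for l
      proof -
        have e4: "0 < e/4" using e by simp
        have "\<forall>\<^sub>F k in sequentially. dist (y l (\<kappa> l x) k) (?t k) \<le> e/2"
          using l0[OF that] tendstoD[OF elim(2) e4]
        proof eventually_elim
          case (elim k)
          then show ?case
            using dist_triangle[of "y l (\<kappa> l x) k" "t x" "T k x"] by (simp add: ultra_embed_def dist_commute)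
        qed
        then have "ultra_dist F (y l (\<kappa> l x)) ?t \<le> e/2"
          by (intro ultra_dist_le y_car ultra_embed_carrier) (rule filter_leD[OF le_sequentially])
        then show ?thesis using e ultra_dist_nonneg[OF y_car ultra_embed_carrier, of l "t x"] by simp
      qed
      then show "\<exists>no. \<forall>l\<ge>no. norm (ultra_dist F (y l (\<kappa> l x)) ?t - 0) < e" by blast
    qed
    have level: "?avg (rad m) \<le> ennreal (dbl 5) * ?D m + ennreal (ultra_dist F (y m (\<kappa> m x)) ?t)" for m
    proof -
      have [measurable]: "(\<lambda>z. ultra_dist F (\<phi> z) (y m (\<kappa> m x))) \<in> borel_measurable \<nu>" by (rule \<phi>(2)[OF y_car])
      let ?b = "ennreal (ultra_dist F (y m (\<kappa> m x)) ?t)"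
      have v: "0 < vol x (rad m)" using ball_pos[OF x, of "rad m"] by simp
      have "(\<integral>\<^sup>+z\<in>ball x (rad m). ennreal (ultra_dist F (\<phi> z) ?t) \<partial>\<nu>) 
        \<le> (\<integral>\<^sup>+z. ennreal (ultra_dist F (\<phi> z) (y m (\<kappa> m x))) * indicator (ball x (rad m)) z + ?b * indicator (ball x (rad m)) z \<partial>\<nu>)"
      proof (rule nn_integral_mono)
        fix z
        have "ennreal (ultra_dist F (\<phi> z) ?t) \<le> ennreal (ultra_dist F (\<phi> z) (y m (\<kappa> m x)) + ultra_dist F (y m (\<kappa> m x)) ?t)"
          by (intro ennreal_leI ultra_dist_triangle \<phi> y_car ultra_embed_carrier)
        also have "\<dots> = ennreal (ultra_dist F (\<phi> z) (y m (\<kappa> m x))) + ?b"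
          by (intro ennreal_plus ultra_dist_nonneg \<phi> y_car ultra_embed_carrier)
        finally show "ennreal (ultra_dist F (\<phi> z) ?t) * indicator (ball x (rad m)) z
          \<le> ennreal (ultra_dist F (\<phi> z) (y m (\<kappa> m x))) * indicator (ball x (rad m)) z + ?b * indicator (ball x (rad m)) z"
          by (auto split: split_indicator)
      qed
      also have "\<dots> = (\<integral>\<^sup>+z\<in>ball x (rad m). ennreal (ultra_dist F (\<phi> z) (y m (\<kappa> m x))) \<partial>\<nu>) + ?b * ennreal (vol x (rad m))"
        by (subst nn_integral_add) (auto simp: nn_integral_cmult nn_integral_indicator_vol simp del: nn_integral_indicator)
      finally have "?avg (rad m) \<le> ((\<integral>\<^sup>+z\<in>ball x (rad m). ennreal (ultra_dist F (\<phi> z) (y m (\<kappa> m x))) \<partial>\<nu>) + ?b * ennreal (vol x (rad m))) / ennreal (vol x (rad m))"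
        by (rule divide_right_mono_ennreal)
      also have "\<dots> = (\<integral>\<^sup>+z\<in>ball x (rad m). ennreal (ultra_dist F (\<phi> z) (y m (\<kappa> m x))) \<partial>\<nu>) / ennreal (vol x (rad m)) + ?b * ennreal (vol x (rad m)) / ennreal (vol x (rad m))"
        by (simp add: divide_ennreal_def distrib_right)
      also have "?b * ennreal (vol x (rad m)) / ennreal (vol x (rad m)) = ?b"
        by (rule mult_divide_eq_ennreal) (use v in auto)
      finally show ?thesis using vol_average_le[OF x, of "\<lambda>z. ennreal (ultra_dist F (\<phi> z) (y m (\<kappa> m x)))" m]
        by (meson add_right_mono order_trans)
    qed
    have "(\<lambda>m. ennreal (dbl 5) * ?D m + ennreal (ultra_dist F (y m (\<kappa> m x)) ?t)) \<longlonglongrightarrow> ennreal (dbl 5) * 0 + ennreal 0"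
      by (intro tendsto_add ennreal_tendsto_cmult elim(3) tendsto_ennrealI td) simp
    then have lim_m: "(\<lambda>m. ennreal (dbl 5) * ?D m + ennreal (ultra_dist F (y m (\<kappa> m x)) ?t)) \<longlonglongrightarrow> 0" by simp
    have avg_m: "(\<lambda>m. ?avg (rad m)) \<longlonglongrightarrow> 0"
      by (rule tendsto_sandwich[OF _ _ tendsto_const lim_m]) (auto intro!: always_eventually level)
    \<comment> \<open>Arbitrary radii are placed between consecutive powers of 1/2, at the cost of
      the factor \<open>dbl 2\<close>.\<close>
    show "(?avg \<longlongrightarrow> 0) (at_right 0)"
    proof (rule order_tendstoI)
      fix e :: ennreal assume e: "0 < e"
      have "(\<lambda>m. ennreal (dbl 2) * ?avg (rad m)) \<longlonglongrightarrow> ennreal (dbl 2) * 0"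
        by (intro ennreal_tendsto_cmult avg_m) simp
      then have "(\<lambda>m. ennreal (dbl 2) * ?avg (rad m)) \<longlonglongrightarrow> 0" by simp
      from order_tendstoD(2)[OF this e] obtain l0 where l0: "\<And>l. l \<ge> l0 \<Longrightarrow> ennreal (dbl 2) * ?avg (rad l) < e"
        by (auto simp: eventually_sequentially)
      have "?avg r < e" if r: "0 < r" "r < rad l0" for r
      proof -
        \<comment> \<open>The finest level with r \<le> rad l; by maximality rad l < 2 * r.\<close>
        define l where "l = (GREATEST l. r \<le> rad l)"
        obtain n where n: "rad n < r" using real_arch_pow_inv[of r "1/2"] r by auto
        have bd: "l \<le> n" if "r \<le> rad l" for l
        proof (rule ccontr)
          assume "\<not> l \<le> n"
          then have "rad l \<le> rad n" by (intro power_decreasing) auto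
          then show False using that n by linarith
        qed
        have "r \<le> rad l0" using r by simp
        have l: "r \<le> rad l" unfolding l_def by (rule GreatestI_nat[of "\<lambda>l. r \<le> rad l", OF \<open>r \<le> rad l0\<close> bd])
        have ll0: "l0 \<le> l" unfolding l_def by (rule Greatest_le_nat[of "\<lambda>l. r \<le> rad l", OF \<open>r \<le> rad l0\<close> bd])
        have "\<not> r \<le> rad (Suc l)" using Greatest_le_nat[of "\<lambda>l. r \<le> rad l" "Suc l", OF _ bd] by (auto simp: l_def[symmetric])
        then have Suc_l: "rad l < 2 * r" by simp
        have v: "0 < vol x r" "0 < vol x (rad l)" using ball_pos[OF x] r(1) by auto
        have cmp: "vol x (rad l) \<le> dbl 2 * vol x r" by (rule vol_compare[OF x r(1)]) (use Suc_l in simp)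
        have "(\<integral>\<^sup>+z\<in>ball x r. ennreal (ultra_dist F (\<phi> z) ?t) \<partial>\<nu>) \<le> (\<integral>\<^sup>+z\<in>ball x (rad l). ennreal (ultra_dist F (\<phi> z) ?t) \<partial>\<nu>)" (is "?I1 \<le> ?I2")
          using subset_ball[OF l, of x] by (intro nn_integral_mono) (auto split: split_indicator simp del: mem_ball)
        then have "?avg r \<le> ?I2 / ennreal (vol x r)" by (rule divide_right_mono_ennreal)
        also have "\<dots> = ?I2 * ennreal (1 / vol x r)"
          using v by (simp add: divide_ennreal_def inverse_ennreal inverse_eq_divide)
        also have "\<dots> \<le> ?I2 * ennreal (dbl 2 * (1 / vol x (rad l)))"
          using v cmp by (intro mult_left_mono ennreal_leI) (auto simp: field_simps)
        also have "\<dots> = ennreal (dbl 2) * ?avg (rad l)"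
        proof -
          have "ennreal (dbl 2 * (1 / vol x (rad l))) = ennreal (dbl 2) * inverse (ennreal (vol x (rad l)))"
            using v dbl_ge_1[of 2] by (subst ennreal_mult) (auto simp: inverse_ennreal inverse_eq_divide)
          then show ?thesis by (simp add: divide_ennreal_def mult_ac)
        qed
        also have "\<dots> < e" by (rule l0[OF ll0])
        finally show ?thesis .
      qed
      then show "\<forall>\<^sub>F r in at_right 0. ?avg r < e"
        unfolding eventually_at_right_field by (intro exI[of _ "rad l0"]) simp
    qed simp
  qed
qed

end

section \<open>Admissible domains\<close>

lemma le_one_add_powr:
  fixes x p :: real
  assumes "1 \<le> p" "0 \<le> x"
  shows "x \<le> 1 + x powr p"
proof (cases "x \<le> 1")
  case False
  then have "x powr 1 \<le> x powr p" using assms by (intro powr_mono) auto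
  then show ?thesis using False by simp
qed (simp add: add_increasing2)

text \<open>Split r into r^((p - \<theta>)/p) and r^(\<theta>/p), and apply x \<le> 1 + x^p to the
  product of the second factor and the root.\<close>

lemma rescaled_young:
  fixes a :: ennreal
  assumes p: "1 < p" and r: "0 < r"
  shows "ennreal r * enn_powr a (1/p) \<le> ennreal (r powr ((p - \<theta>) / p)) * (1 + ennreal (r powr \<theta>) * a)"
proof (cases a)
  case (real t)
  define x where "x = r powr (\<theta> / p) * t powr (1/p)"
  have x: "0 \<le> x" by (simp add: x_def)
  have xp: "x powr p = r powr \<theta> * t" using p r real by (simp add: x_def powr_mult powr_powr)
  have "x \<le> 1 + x powr p" using p x by (intro le_one_add_powr) auto
  then have "r powr ((p - \<theta>) / p) * x \<le> r powr ((p - \<theta>) / p) * (1 + r powr \<theta> * t)"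
    unfolding xp by (intro mult_left_mono) auto
  moreover have "r powr ((p - \<theta>) / p) * x = r * t powr (1/p)"
  proof -
    have "(p - \<theta>) / p + \<theta> / p = 1" using p by (simp add: diff_divide_distrib)
    then have "r powr ((p - \<theta>) / p) * r powr (\<theta> / p) = r" using r by (simp flip: powr_add)
    then show ?thesis by (simp add: x_def mult.assoc[symmetric])
  qed
  ultimately have "ennreal (r * t powr (1/p)) \<le> ennreal (r powr ((p - \<theta>) / p) * (1 + r powr \<theta> * t))"
    by (simp add: ennreal_leI)
  then show ?thesis using real r by (simp add: enn_powr_ennreal ennreal_mult ennreal_plus del: ennreal_plus[symmetric])
next
  case top
  then show ?thesis using r by (simp add: ennreal_mult_top)
qed

lemma ennreal_divide_mult_cancel: "0 < v \<Longrightarrow> a / ennreal v * ennreal v = a"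
  by (simp add: ennreal_divide_times)

text \<open>The Poincare clause of \<open>admissible\<close> with its constants made
  explicit.\<close>

definition local_poincare :: "'x::metric_space measure \<Rightarrow> 'x set \<Rightarrow> real \<Rightarrow> real \<Rightarrow> real \<Rightarrow> bool" where
  "local_poincare \<mu> \<Omega> p C lam \<longleftrightarrow> (\<forall>x\<in>\<Omega>. \<forall>r>0. \<forall>u g.
        L1_loc \<mu> \<Omega> u \<and> set_integrable \<mu> (ball x r \<inter> \<Omega>) u \<and> upper_gradient \<Omega> dist u g \<longrightarrow>
        (\<integral>\<^sup>+ y \<in> ball x r \<inter> \<Omega>.
            ennreal \<bar>u y - (\<integral>z \<in> ball x r \<inter> \<Omega>. u z \<partial>\<mu>) / measure \<mu> (ball x r \<inter> \<Omega>)\<bar> \<partial>\<mu>)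
          / emeasure \<mu> (ball x r \<inter> \<Omega>)
        \<le> ennreal (C * r) *
           enn_powr ((\<integral>\<^sup>+ y \<in> ball x (lam*r) \<inter> \<Omega>. enn_powr (g y) p \<partial>\<mu>)
                      / emeasure \<mu> (ball x (lam*r) \<inter> \<Omega>)) (1/p))"

text \<open>The restricted measure is finite because the bounded set \<Omega> is its own
  intersection with one large ball.\<close>

lemma admissible_doubling_space:
  fixes \<mu> :: "'x::metric_space measure"
  assumes sets: "sets \<mu> = sets borel" and \<Omega>: "open \<Omega>" "\<Omega> \<noteq> {}" "bounded \<Omega>"
    and doubling: "\<forall>x\<in>closure \<Omega>. \<forall>r>0.
        0 < emeasure \<mu> (ball x (2*r) \<inter> \<Omega>) \<and>
        emeasure \<mu> (ball x (2*r) \<inter> \<Omega>) \<le> ennreal Cd * emeasure \<mu> (ball x r \<inter> \<Omega>) \<and>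
        emeasure \<mu> (ball x r \<inter> \<Omega>) < top"
  shows "doubling_space (restrict_space \<mu> \<Omega>) \<Omega> (max 0 Cd)"
proof -
  let ?\<nu> = "restrict_space \<mu> \<Omega>"
  have sp: "space \<mu> = UNIV" using sets_eq_imp_space_eq[OF sets] by simp
  have em: "emeasure ?\<nu> (ball x r \<inter> \<Omega>) = emeasure \<mu> (ball x r \<inter> \<Omega>)" for x r
    using \<Omega>(1) sets by (intro emeasure_restrict_space) auto
  obtain x0 where x0: "x0 \<in> \<Omega>" using \<Omega> by auto
  obtain R where R: "0 < R" "\<Omega> \<subseteq> ball x0 R" using bounded_subset_ballD[OF \<Omega>(3), of x0] by auto
  have x0c: "x0 \<in> closure \<Omega>" using x0 closure_subset by blast
  have spR: "space ?\<nu> = \<Omega>" by (simp add: space_restrict_space sp)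
  have fin: "finite_measure ?\<nu>"
  proof
    have "\<Omega> = ball x0 R \<inter> \<Omega>" using R by auto
    then show "emeasure ?\<nu> (space ?\<nu>) \<noteq> \<infinity>"
      using doubling[rule_format, OF x0c R(1)] em[of x0 R] by (simp add: spR less_top[symmetric])
  qed
  interpret finite_measure ?\<nu> by (rule fin)
  have me: "emeasure \<mu> (ball x r \<inter> \<Omega>) = ennreal (measure ?\<nu> (ball x r \<inter> \<Omega>))" for x r
    by (simp add: em[symmetric] emeasure_eq_measure)
  show ?thesis
  proof
    show "space ?\<nu> = \<Omega>" by (rule spR)
    show "sets ?\<nu> = sets (restrict_space borel \<Omega>)" using sets by (simp add: sets_restrict_space)
    \<comment> \<open>Positivity is provided for doubled radii, hence the application at
      r/2.\<close>
    show "0 < measure ?\<nu> (ball x r \<inter> \<Omega>)" if "x \<in> closure \<Omega>" "0 < r" for x r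
      using doubling[rule_format, OF that(1), of "r/2"] that(2) by (simp add: me)
    show "measure ?\<nu> (ball x (2 * r) \<inter> \<Omega>) \<le> max 0 Cd * measure ?\<nu> (ball x r \<inter> \<Omega>)" if "x \<in> closure \<Omega>" "0 < r" for x r
    proof -
      \<comment> \<open>\<open>ennreal\<close> truncates a negative constant to 0, so Cd may be
        replaced by its positive part.\<close>
      have "ennreal Cd = ennreal (max 0 Cd)" by (simp add: ennreal_neg max_def)
      then have "ennreal (measure ?\<nu> (ball x (2 * r) \<inter> \<Omega>)) \<le> ennreal (max 0 Cd * measure ?\<nu> (ball x r \<inter> \<Omega>))"
        using doubling[rule_format, OF that] by (simp add: me ennreal_mult)
      then show ?thesis by (simp add: ennreal_le_iff)
    qed
  qed (use \<Omega> fin in auto)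
qed

section \<open>Restriction of the measure to the domain\<close>

locale restricted_domain = doubling_levels "restrict_space \<mu> \<Omega>" \<Omega> Cd X \<kappa>
  for \<mu> :: "'x::metric_space measure" and \<Omega> :: "'x set" and Cd :: real and X \<kappa> +
  assumes sets_\<mu>: "sets \<mu> = sets borel" and open_\<Omega>: "open \<Omega>"
begin

abbreviation "\<nu> \<equiv> restrict_space \<mu> \<Omega>"

lemma \<Omega>_Int_sets: "\<Omega> \<inter> space \<mu> \<in> sets \<mu>"
  using open_\<Omega> sets_\<mu> sets_eq_imp_space_eq[OF sets_\<mu>] by simp

lemma nn_integral_ball: "(\<integral>\<^sup>+y\<in>ball x r \<inter> \<Omega>. f y \<partial>\<mu>) = (\<integral>\<^sup>+y\<in>ball x r. f y \<partial>\<nu>)"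
  by (simp add: nn_integral_restrict_space[OF \<Omega>_Int_sets] indicator_inter_arith mult.assoc)

lemma nn_integral_domain: "(\<integral>\<^sup>+y\<in>\<Omega>. f y \<partial>\<mu>) = (\<integral>\<^sup>+y. f y \<partial>\<nu>)"
  by (simp add: nn_integral_restrict_space[OF \<Omega>_Int_sets])

lemma emeasure_ball: "emeasure \<mu> (ball x r \<inter> \<Omega>) = ennreal (vol x r)"
proof -
  have "emeasure \<mu> (ball x r \<inter> \<Omega>) = emeasure \<nu> (ball x r \<inter> \<Omega>)"
    using \<Omega>_Int_sets by (intro emeasure_restrict_space[symmetric]) auto
  then show ?thesis by (simp add: emeasure_eq_measure)
qed

lemma AE_domain: "(AE x in \<nu>. P x) \<longleftrightarrow> (AE x in \<mu>. x \<in> \<Omega> \<longrightarrow> P x)"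
  by (rule AE_restrict_space_iff[OF \<Omega>_Int_sets])

lemma avg_eq: "avg f x r = (LINT z:ball x r \<inter> \<Omega>|\<mu>. f z) / measure \<mu> (ball x r \<inter> \<Omega>)"
proof -
  have "(LINT z:ball x r|\<nu>. f z) = (LINT z:ball x r \<inter> \<Omega>|\<mu>. f z)"
    unfolding set_lebesgue_integral_def
    by (subst integral_restrict_space[OF \<Omega>_Int_sets]) (auto intro!: Bochner_Integration.integral_cong simp: indicator_def)
  moreover have "measure \<mu> (ball x r \<inter> \<Omega>) = vol x r"
    using emeasure_ball[of x r] by (simp add: measure_def)
  ultimately show ?thesis by (simp add: avg_def)
qed

lemma set_integrable_domain:
  fixes f :: "'x \<Rightarrow> real"
  assumes "integrable \<nu> f" "A \<in> sets borel" "A \<subseteq> \<Omega>"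
  shows "set_integrable \<mu> A f"
proof -
  have "set_integrable \<mu> \<Omega> f"
    using assms(1) unfolding set_integrable_def by (subst (asm) integrable_restrict_space[OF \<Omega>_Int_sets])
  then show ?thesis by (rule set_integrable_subset) (use assms sets_\<mu> in auto)
qed

text \<open>Each real function \<open>dist (v z) y\<close> of z inherits the upper gradient g, as
  distance functions are 1-Lipschitz. So the Poincare inequality applies with constants independent
  of y and v.\<close>

lemma chain:
  fixes v :: "'x \<Rightarrow> 'y::metric_space"
  assumes p: "1 < p" "0 < \<theta>" "\<theta> < p" and C: "0 < C" "1 \<le> lam" and lp: "local_poincare \<mu> \<Omega> p C lam"
    and Lp: "Lp_map \<mu> \<Omega> p UNIV dist v" and fin: "(\<integral>\<^sup>+x\<in>\<Omega>. ennreal (dist (v x) y0 powr p) \<partial>\<mu>) < top"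
    and ug: "upper_gradient \<Omega> dist v g" and g_fin: "p_mass \<mu> \<Omega> p g < top"
  shows "poincare_chain \<nu> \<Omega> Cd X \<kappa> v (\<lambda>x. enn_powr (g x) p) C lam ((p - \<theta>) / p) \<theta>"
proof
  have [measurable]: "(\<lambda>z. dist (v z) y) \<in> borel_measurable \<nu>" for y using Lp by (auto simp: Lp_map_def)
  have [measurable]: "g \<in> borel_measurable borel" using ug by (simp add: upper_gradient_def)
  have g\<nu> [measurable]: "g \<in> borel_measurable \<nu>"
    by (rule measurable_restrict_space1) (use sets_\<mu> in \<open>simp add: measurable_cong_sets[OF sets_\<mu> refl]\<close>)
  show h: "(\<lambda>x. enn_powr (g x) p) \<in> borel_measurable \<nu>" by measurable
  show "(\<integral>\<^sup>+z. enn_powr (g z) p \<partial>\<nu>) < top" using g_fin by (simp add: nn_integral_domain)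
  show int: "integrable \<nu> (\<lambda>z. dist (v z) y)" for y
  proof (rule integrableI_bounded)
    have "(\<integral>\<^sup>+z. ennreal (norm (dist (v z) y)) \<partial>\<nu>) \<le> (\<integral>\<^sup>+z. ennreal (dist (v z) y0 powr p) + ennreal (1 + dist y0 y) \<partial>\<nu>)"
    proof (rule nn_integral_mono)
      fix z
      have "dist (v z) y0 \<le> 1 + dist (v z) y0 powr p" using p by (intro le_one_add_powr) auto
      then have "norm (dist (v z) y) \<le> dist (v z) y0 powr p + (1 + dist y0 y)"
        using dist_triangle[of "v z" y y0] by simp
      then have "ennreal (norm (dist (v z) y)) \<le> ennreal (dist (v z) y0 powr p + (1 + dist y0 y))"
        by (rule ennreal_leI)
      also have "\<dots> = ennreal (dist (v z) y0 powr p) + ennreal (1 + dist y0 y)"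
        by (rule ennreal_plus) auto
      finally show "ennreal (norm (dist (v z) y)) \<le> ennreal (dist (v z) y0 powr p) + ennreal (1 + dist y0 y)" .
    qed
    also have "\<dots> = (\<integral>\<^sup>+z. ennreal (dist (v z) y0 powr p) \<partial>\<nu>) + ennreal (1 + dist y0 y) * emeasure \<nu> (space \<nu>)"
      by (subst nn_integral_add) auto
    also have "\<dots> < \<infinity>"
      using fin by (simp add: nn_integral_domain emeasure_eq_measure ennreal_mult_less_top)
    finally show "(\<integral>\<^sup>+z. ennreal (norm (dist (v z) y)) \<partial>\<nu>) < \<infinity>" .
  qed measurable
  show "\<exists>D. countable D \<and> (AE z in \<nu>. \<forall>e>0. \<exists>y\<in>D. dist (v z) y < e)"
    using Lp unfolding Lp_map_def AE_domain by blast
  fix y x and r :: real assume x: "x \<in> \<Omega>" and r: "0 < r"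
  let ?f = "\<lambda>z. dist (v z) y"
  have "L1_loc \<mu> \<Omega> ?f"
    unfolding L1_loc_def by (auto intro!: set_integrable_domain int borel_compact)
  moreover have "set_integrable \<mu> (ball x r \<inter> \<Omega>) ?f"
    using open_\<Omega> by (intro set_integrable_domain int) auto
  moreover have "upper_gradient \<Omega> dist ?f g"
    unfolding upper_gradient_def
  proof (intro conjI allI impI)
    fix c assume "arclength_curve \<Omega> c"
    then have "ennreal (dist (v (fst c (snd c))) (v (fst c 0))) \<le> line_integral g c"
      using ug unfolding upper_gradient_def by blast
    moreover have "dist (?f (fst c (snd c))) (?f (fst c 0)) \<le> dist (v (fst c (snd c))) (v (fst c 0))"
      unfolding dist_real_def by (metis abs_dist_diff_le dist_commute)
    ultimately show "ennreal (dist (?f (fst c (snd c))) (?f (fst c 0))) \<le> line_integral g c"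
      by (meson ennreal_leI order_trans)
  qed measurable
  ultimately have "(\<integral>\<^sup>+z\<in>ball x r. ennreal \<bar>?f z - avg ?f x r\<bar> \<partial>\<nu>) / ennreal (vol x r)
     \<le> ennreal (C * r) * enn_powr ((\<integral>\<^sup>+z\<in>ball x (lam * r). enn_powr (g z) p \<partial>\<nu>) / ennreal (vol x (lam * r))) (1/p)"
    (is "?I / _ \<le> _ * enn_powr (?E / _) _")
    using lp x r unfolding local_poincare_def by (simp only: nn_integral_ball emeasure_ball avg_eq)
  also have "\<dots> \<le> ennreal C * (ennreal (r powr ((p - \<theta>) / p)) * (1 + ennreal (r powr \<theta>) * (?E / ennreal (vol x (lam * r)))))"
    using rescaled_young[OF p(1) r, of "?E / ennreal (vol x (lam * r))" \<theta>] C(1) r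
    by (simp add: ennreal_mult mult.assoc mult_left_mono)
  finally have le: "?I / ennreal (vol x r) \<le> ennreal C * (ennreal (r powr ((p - \<theta>) / p)) * (1 + ennreal (r powr \<theta>) * (?E / ennreal (vol x (lam * r)))))"
    (is "_ \<le> ?Z") .
  have v: "0 < vol x r" "0 < vol x (lam * r)" using ball_pos[OF \<Omega>_closure[OF x]] r C(2) by auto
  have vle: "vol x r \<le> vol x (lam * r)"
    using r C(2) by (intro finite_measure_mono Int_mono subset_ball) (auto simp: mult_right_mono)
  have "?I = ?I / ennreal (vol x r) * ennreal (vol x r)"
    by (rule ennreal_divide_mult_cancel[OF v(1), symmetric])
  \<comment> \<open>Passing to the larger volume turns the average of the energy into an integral
    over the larger ball, and the summand 1 into its volume.\<close>
  also have "\<dots> \<le> ?Z * ennreal (vol x (lam * r))"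
    using vle by (intro mult_mono le ennreal_leI) auto
  also have "\<dots> = ennreal C * (ennreal (r powr ((p - \<theta>) / p)) * (ennreal (vol x (lam * r)) + ennreal (r powr \<theta>) * ?E))"
  proof -
    have "?E / ennreal (vol x (lam * r)) * ennreal (vol x (lam * r)) = ?E"
      by (rule ennreal_divide_mult_cancel[OF v(2)])
    then show ?thesis by (simp add: distrib_right mult.assoc)
  qed
  also have "\<dots> = ennreal (C * r powr ((p - \<theta>) / p)) * (\<integral>\<^sup>+z\<in>ball x (lam * r). 1 + ennreal (r powr \<theta>) * enn_powr (g z) p \<partial>\<nu>)"
  proof -
    have "(\<integral>\<^sup>+z\<in>ball x (lam * r). 1 + ennreal (r powr \<theta>) * enn_powr (g z) p \<partial>\<nu>)
      = (\<integral>\<^sup>+z. indicator (ball x (lam * r)) z + ennreal (r powr \<theta>) * (enn_powr (g z) p * indicator (ball x (lam * r)) z) \<partial>\<nu>)"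
      by (intro nn_integral_cong) (auto simp: distrib_right mult.assoc)
    also have "\<dots> = ennreal (vol x (lam * r)) + ennreal (r powr \<theta>) * ?E"
      by (subst nn_integral_add) (auto simp: nn_integral_cmult nn_integral_indicator_vol simp del: nn_integral_indicator)
    finally show ?thesis using C by (simp add: ennreal_mult mult.assoc)
  qed
  finally show "?I \<le> ennreal (C * r powr ((p - \<theta>) / p)) * (\<integral>\<^sup>+z\<in>ball x (lam * r). 1 + ennreal (r powr \<theta>) * enn_powr (g z) p \<partial>\<nu>)" .
qed (use p C in auto)

text \<open>K and \<Lambda> are fixed before v and g, which makes the bounds uniform along a
  sequence of maps. K is \<open>poincare_const\<close> written out in terms of the constants of the
  domain.\<close>

lemma level_values_uniform:
  assumes p: "1 < p" "0 < \<theta>" "\<theta> < p" and C: "0 < C" "1 \<le> lam" and lp: "local_poincare \<mu> \<Omega> p C lam"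
  obtains K \<Lambda> where "0 < K" "1 \<le> \<Lambda>"
    "\<And>(v :: 'x \<Rightarrow> 'y::metric_space) g y0 m c. Lp_map \<mu> \<Omega> p UNIV dist v \<Longrightarrow> (\<integral>\<^sup>+x\<in>\<Omega>. ennreal (dist (v x) y0 powr p) \<partial>\<mu>) < top \<Longrightarrow>
      upper_gradient \<Omega> dist v g \<Longrightarrow> p_mass \<mu> \<Omega> p g < top \<Longrightarrow> c \<in> X m \<Longrightarrow>
      \<exists>y. (\<integral>\<^sup>+z\<in>ball c (4 * rad m). ennreal (dist (v z) y) \<partial>\<nu>)
        \<le> ennreal (K * rad m powr ((p - \<theta>) / p)) * (\<integral>\<^sup>+z\<in>ball c (\<Lambda> * rad m). 1 + ennreal (rad m powr \<theta>) * enn_powr (g z) p \<partial>\<nu>)"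
proof -
  let ?\<alpha> = "(p - \<theta>) / p"
  define K where "K = 3 * dbl 4 * (C * overlap (16 * lam) * 16 powr (?\<alpha> + \<theta>) / (1 - (1/2) powr ?\<alpha>))"
  have "0 < K"
    unfolding K_def using C dbl_ge_1[of 4] overlap_ge_1[of "16 * lam"] half_powr_less_1[of ?\<alpha>] p
    by (intro mult_pos_pos divide_pos_pos) auto
  moreover have "1 \<le> 5 + 16 * lam" using C by simp
  moreover have "\<exists>y. (\<integral>\<^sup>+z\<in>ball c (4 * rad m). ennreal (dist (v z) y) \<partial>\<nu>)
        \<le> ennreal (K * rad m powr ?\<alpha>) * (\<integral>\<^sup>+z\<in>ball c ((5 + 16 * lam) * rad m). 1 + ennreal (rad m powr \<theta>) * enn_powr (g z) p \<partial>\<nu>)"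
    if "Lp_map \<mu> \<Omega> p UNIV dist v" "(\<integral>\<^sup>+x\<in>\<Omega>. ennreal (dist (v x) y0 powr p) \<partial>\<mu>) < top"
      "upper_gradient \<Omega> dist v g" "p_mass \<mu> \<Omega> p g < top" "c \<in> X m" for v :: "'x \<Rightarrow> 'y" and g y0 m c
  proof -
    interpret ch: poincare_chain \<nu> \<Omega> Cd X \<kappa> v "\<lambda>x. enn_powr (g x) p" C lam ?\<alpha> \<theta>
      by (rule chain[OF p C lp that(1-4)])
    show ?thesis
      using ch.value_exists[OF that(5)]
      by (simp add: ch.poincare_const_def ch.K1_def ch.K0_def ch.\<Lambda>_def K_def)
  qed
  ultimately show thesis using that by blast
qed

end

lemma powr_add_le:
  fixes a b p :: real
  assumes "0 < p" "0 \<le> a" "0 \<le> b"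
  shows "(a + b) powr p \<le> 2 powr p * (a powr p + b powr p)"
proof -
  have "(a + b) powr p \<le> (2 * max a b) powr p" using assms by (intro powr_mono2) auto
  also have "\<dots> = 2 powr p * (max a b) powr p" using assms by (simp add: powr_mult)
  also have "\<dots> \<le> 2 powr p * (a powr p + b powr p)" by (intro mult_left_mono) (auto simp: max_def)
  finally show ?thesis .
qed

theorem theorem4p4:
  fixes mu :: "'x::complete_space measure"
    and H :: "'x measure"
    and Omega :: "'x set"
    and F :: "nat filter"
    and u :: "nat \<Rightarrow> 'x \<Rightarrow> 'y::complete_space"
    and p \<theta> :: real
  assumes "sets mu = sets borel"
    and "open Omega" and "connected Omega" and "Omega \<noteq> {}" and "bounded Omega"
    and "sets H = sets (restrict_space borel (frontier Omega))"
    and "sigma_finite_measure H"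
    and "nonprincipal_ultrafilter F"
    and "admissible mu H Omega p \<theta>"
    and "1 < p"
    and "bounded_newtonian_seq mu Omega p u"
  shows "\<exists>\<sigma> \<phi>. strict_mono \<sigma> \<and>
           (AE z in mu. z \<in> Omega \<longrightarrow>
              bounded (range (\<lambda>k. u (\<sigma> k) z)) \<and> ultra_dist F (\<phi> z) (\<lambda>k. u (\<sigma> k) z) = 0) \<and>
           newtonian mu Omega p ultra_carrier (ultra_dist F) \<phi> \<and>
           p_energy mu Omega p (ultra_dist F) \<phi> \<le> liminf (\<lambda>k. p_energy mu Omega p dist (u (\<sigma> k))) \<and>
           (\<forall>\<rho> :: 'x \<Rightarrow> 'y.
              (\<exists>T. (\<forall>k. is_trace mu H Omega UNIV dist (u (\<sigma> k)) (T k)) \<and>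
                   (AE x in H. (\<lambda>k. T k x) \<longlonglongrightarrow> \<rho> x) \<and>
                   Lp_map H (frontier Omega) p UNIV dist \<rho>)
              \<longrightarrow> is_trace mu H Omega ultra_carrier (ultra_dist F) \<phi> (\<lambda>x. ultra_embed (\<rho> x)))"
proof -

  \<comment> \<open>Constants and nets of the domain\<close>
  note sets_mu = assms(1)
  have p: "1 < p" "0 < \<theta>" "\<theta> < p" using assms(9) by (auto simp: admissible_def)
  have ex_Cd: "\<exists>Cd. \<forall>x\<in>closure Omega. \<forall>r>0.
        0 < emeasure mu (ball x (2*r) \<inter> Omega) \<and>
        emeasure mu (ball x (2*r) \<inter> Omega) \<le> ennreal Cd * emeasure mu (ball x r \<inter> Omega) \<and>
        emeasure mu (ball x r \<inter> Omega) < top"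
    and ex_CH: "\<exists>C. \<forall>x\<in>frontier Omega. \<forall>r>0.
        emeasure H (ball x r \<inter> frontier Omega) \<le> ennreal (C * r powr (-\<theta>)) * emeasure mu (ball x r \<inter> Omega)"
    and ex_C: "\<exists>C>0. \<exists>lam\<ge>1. local_poincare mu Omega p C lam"
    using assms(9) unfolding admissible_def local_poincare_def by blast+
  obtain Cd where ds: "doubling_space (restrict_space mu Omega) Omega (max 0 Cd)"
    using ex_Cd admissible_doubling_space[OF sets_mu assms(2,4,5)] by blast
  obtain X \<kappa> where X\<kappa>: "\<forall>m. doubling_space.net Omega ((1/2)^m) (X m) \<and> \<kappa> m \<in> measurable borel (count_space UNIV) \<and>
     (\<forall>x\<in>closure Omega. \<kappa> m x \<in> X m \<and> dist x (\<kappa> m x) \<le> (1/2)^m)"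
    using doubling_space.levels_exist[OF ds] by blast
  interpret restricted_domain mu Omega "max 0 Cd" X \<kappa>
    by (intro restricted_domain.intro doubling_levels.intro ds doubling_levels_axioms.intro restricted_domain_axioms.intro)
       (use X\<kappa> sets_mu assms(2) in auto)
  obtain CH where CH: "\<And>x r. x \<in> frontier Omega \<Longrightarrow> 0 < r \<Longrightarrow>
        emeasure H (ball x r \<inter> frontier Omega) \<le> ennreal (CH * r powr (-\<theta>)) * emeasure mu (ball x r \<inter> Omega)"
    using ex_CH by blast
  obtain C lam where C: "0 < C" "1 \<le> lam" "local_poincare mu Omega p C lam" using ex_C by blast
  have Om_borel: "Omega \<in> sets borel" using assms(2) by simp
  have p_pos: "0 < p" using p by simp
  define \<alpha> where "\<alpha> = (p - \<theta>) / p"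
  have \<alpha>: "0 < \<alpha>" using p by (simp add: \<alpha>_def)

  \<comment> \<open>Energies and upper gradients of the sequence\<close>
  have newt: "newtonian mu Omega p UNIV dist (u k)" for k using assms(11) by (auto simp: bounded_newtonian_seq_def)
  obtain y0 B0 where B0: "\<And>k. (\<integral>\<^sup>+ x \<in> Omega. ennreal (dist (u k x) y0 powr p) \<partial>mu) + p_energy mu Omega p dist (u k) \<le> ennreal B0"
    using assms(11) by (auto simp: bounded_newtonian_seq_def)
  define B where "B = max 0 B0"
  have B: "0 \<le> B" and BB: "ennreal B0 = ennreal B" by (auto simp: B_def max_def ennreal_neg)
  have int_B: "(\<integral>\<^sup>+ x \<in> Omega. ennreal (dist (u k x) y0 powr p) \<partial>mu) \<le> ennreal B"
    and en_B: "p_energy mu Omega p dist (u k) \<le> ennreal B" for k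
    using B0[of k] unfolding BB by (meson add_increasing add_increasing2 order_refl order_trans zero_le le_iff_add)+
  have int_fin: "(\<integral>\<^sup>+ x \<in> Omega. ennreal (dist (u k x) y0 powr p) \<partial>mu) < top" for k
    using int_B[of k] by (rule le_less_trans) simp
  define E where "E = (\<lambda>k. enn2real (p_energy mu Omega p dist (u k)))"
  have E: "p_energy mu Omega p dist (u k) = ennreal (E k)" "0 \<le> E k" "E k \<le> B" for k
  proof -
    show eq: "p_energy mu Omega p dist (u k) = ennreal (E k)"
      unfolding E_def by (rule ennreal_enn2real[symmetric]) (rule le_less_trans[OF en_B ennreal_less_top])
    show "0 \<le> E k" by (simp add: E_def)
    show "E k \<le> B" using en_B[of k] B unfolding eq by (simp add: ennreal_le_iff)
  qed
  have Lp: "Lp_map mu Omega p UNIV dist (u k)" for k using newt by (simp add: newtonian_def)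
  \<comment> \<open>The error (1/2)^k vanishes in the limit, so the limit of the energies is not
    affected.\<close>
  have "\<exists>g. upper_gradient Omega dist (u k) g \<and> p_mass mu Omega p g \<le> ennreal (E k + (1/2)^k)" for k
  proof -
    define g0 where "g0 = (SOME g. minimal_p_weak_upper_gradient mu Omega p dist (u k) g)"
    have ex: "\<exists>g. minimal_p_weak_upper_gradient mu Omega p dist (u k) g" using newt by (simp add: newtonian_def)
    have "minimal_p_weak_upper_gradient mu Omega p dist (u k) g0" unfolding g0_def by (rule someI_ex[OF ex])
    then have "p_weak_upper_gradient mu Omega p dist (u k) g0" by (simp add: minimal_p_weak_upper_gradient_def)
    from p_weak_upper_gradient_approx[OF sets_mu Om_borel p_pos this, of "(1/2)^k"]
    obtain g where g: "upper_gradient Omega dist (u k) g" "p_mass mu Omega p g \<le> p_mass mu Omega p g0 + ennreal ((1/2)^k)"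
      by auto
    have "p_mass mu Omega p g0 = ennreal (E k)" using ex E(1)[of k] by (simp add: p_energy_def g0_def)
    then show ?thesis using g E(2)[of k] by auto
  qed
  then obtain g where g: "\<And>k. upper_gradient Omega dist (u k) (g k)" "\<And>k. p_mass mu Omega p (g k) \<le> ennreal (E k + (1/2)^k)"
    by metis
  have g_fin: "p_mass mu Omega p (g k) < top" for k using g(2)[of k] by (rule le_less_trans) simp
  have g_B: "p_mass mu Omega p (g k) \<le> ennreal (B + 1)" for k
  proof (rule order_trans[OF g(2) ennreal_leI])
    have "(1/2::real)^k \<le> 1" by (simp add: power_le_one)
    then show "E k + (1/2)^k \<le> B + 1" using E(3)[of k] by linarith
  qed
  define h where "h = (\<lambda>k x. enn_powr (g k x) p)"

  \<comment> \<open>Values on the levels\<close>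
  obtain K \<Lambda> where K: "0 < K" "1 \<le> \<Lambda>" and level_vals:
    "\<And>(v :: 'x \<Rightarrow> 'y) g y0 m c. Lp_map mu Omega p UNIV dist v \<Longrightarrow> (\<integral>\<^sup>+x\<in>Omega. ennreal (dist (v x) y0 powr p) \<partial>mu) < top \<Longrightarrow>
      upper_gradient Omega dist v g \<Longrightarrow> p_mass mu Omega p g < top \<Longrightarrow> c \<in> X m \<Longrightarrow>
      \<exists>y. (\<integral>\<^sup>+z\<in>ball c (4 * rad m). ennreal (dist (v z) y) \<partial>\<nu>)
        \<le> ennreal (K * rad m powr \<alpha>) * (\<integral>\<^sup>+z\<in>ball c (\<Lambda> * rad m). 1 + ennreal (rad m powr \<theta>) * enn_powr (g z) p \<partial>\<nu>)"
    by (rule level_values_uniform[OF p C, folded \<alpha>_def]) (rule that)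
  define good where "good = (\<lambda>m c k y. (\<integral>\<^sup>+z\<in>ball c (4 * rad m). ennreal (dist (u k z) y) \<partial>\<nu>)
        \<le> ennreal (K * rad m powr \<alpha>) * (\<integral>\<^sup>+z\<in>ball c (\<Lambda> * rad m). 1 + ennreal (rad m powr \<theta>) * h k z \<partial>\<nu>))"
  define y where "y = (\<lambda>m c k. SOME y. good m c k y)"
  have y: "(\<integral>\<^sup>+z\<in>ball c (4 * rad m). ennreal (dist (u k z) (y m c k)) \<partial>\<nu>)
        \<le> ennreal (K * rad m powr \<alpha>) * (\<integral>\<^sup>+z\<in>ball c (\<Lambda> * rad m). 1 + ennreal (rad m powr \<theta>) * h k z \<partial>\<nu>)"
    if "c \<in> X m" for m c k
  proof -
    have "\<exists>y. good m c k y"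
      unfolding good_def h_def by (rule level_vals[OF Lp int_fin g(1) g_fin that])
    then have "good m c k (y m c k)" unfolding y_def by (rule someI_ex)
    then show ?thesis by (simp only: good_def)
  qed
  have dist_meas: "(\<lambda>z. dist (u k z) y) \<in> borel_measurable \<nu>" for k y using Lp[of k] by (auto simp: Lp_map_def)
  have g_meas: "g k \<in> borel_measurable \<nu>" for k
    using g(1)[of k] by (intro measurable_restrict_space1) (simp add: upper_gradient_def measurable_cong_sets[OF sets_mu refl])
  have lv: "level_values \<nu> Omega (max 0 Cd) X \<kappa> (\<lambda>k. u (s k)) (\<lambda>k. h (s k)) K \<Lambda> (B + 1) \<alpha> \<theta> (\<lambda>m c k. y m c (s k))" for s :: "nat \<Rightarrow> nat"
  proof
    show "h (s k) \<in> borel_measurable \<nu>" for k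
      unfolding h_def using g_meas by (rule measurable_compose) (rule enn_powr_measurable)
    show "(\<integral>\<^sup>+z. h (s k) z \<partial>\<nu>) \<le> ennreal (B + 1)" for k
      using g_B[of "s k"] by (simp add: h_def nn_integral_domain)
  qed (use K \<alpha> p B dist_meas y in auto)

  interpret V0: level_values \<nu> Omega "max 0 Cd" X \<kappa> u h K \<Lambda> "B + 1" \<alpha> \<theta> y
    using lv[of "\<lambda>k. k"] by simp
  have int_J: "(\<integral>\<^sup>+z. ennreal (dist (u k z) y0) \<partial>\<nu>) \<le> ennreal (B + measure \<nu> Omega)" for k
  proof -
    note [measurable] = dist_meas
    have "(\<integral>\<^sup>+z. ennreal (dist (u k z) y0) \<partial>\<nu>) \<le> (\<integral>\<^sup>+z. ennreal (dist (u k z) y0 powr p) + 1 \<partial>\<nu>)"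
    proof (rule nn_integral_mono)
      fix z
      have "dist (u k z) y0 \<le> 1 + dist (u k z) y0 powr p" using p by (intro le_one_add_powr) auto
      then have "ennreal (dist (u k z) y0) \<le> ennreal (dist (u k z) y0 powr p + 1)" by (intro ennreal_leI) simp
      then show "ennreal (dist (u k z) y0) \<le> ennreal (dist (u k z) y0 powr p) + 1" by simp
    qed
    also have "\<dots> = (\<integral>\<^sup>+z. ennreal (dist (u k z) y0 powr p) \<partial>\<nu>) + ennreal (measure \<nu> Omega)"
      by (subst nn_integral_add) (auto simp: emeasure_eq_measure space_\<nu>)
    also have "\<dots> \<le> ennreal B + ennreal (measure \<nu> Omega)"
      using int_B[of k] by (intro add_right_mono) (simp add: nn_integral_domain)
    also have "\<dots> = ennreal (B + measure \<nu> Omega)" using B by (intro ennreal_plus[symmetric]) auto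
    finally show ?thesis .
  qed
  define R where "R = (\<lambda>m c. (K * (measure \<nu> Omega + (B + 1)) + (B + measure \<nu> Omega)) / vol c (4 * rad m))"
  have y_R: "dist (y m c k) y0 \<le> R m c" if "c \<in> X m" for m c k
    unfolding R_def by (rule V0.value_dist_le[OF that int_J]) (use B in simp)

  \<comment> \<open>Choice of the subsequence\<close>
  define Q where "Q = Sigma UNIV X"
  have Q_count: "countable Q" unfolding Q_def using X_finite by (intro countable_SIGMA) (auto intro: countable_finite)
  obtain x0 where x0: "x0 \<in> Omega" using assms(4) by auto
  have Q_ne: "(0, \<kappa> 0 x0) \<in> Q" using \<kappa>(1)[OF \<Omega>_closure[OF x0]] by (simp add: Q_def)
  \<comment> \<open>The index \<open>None\<close> carries the energies, so that they converge along
    the same subsequence as the distances.\<close>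
  define f where "f = (\<lambda>k i. case i of None \<Rightarrow> E k | Some ((m, c), (m', c')) \<Rightarrow> dist (y m c k) (y m' c' k))"
  \<comment> \<open>All pairs of centres up to level k, as needed to compare the k-th map with its
    values up to level k.\<close>
  define A where "A = (\<lambda>k::nat. Some ` (Sigma {..k} X \<times> Sigma {..k} X))"
  define \<epsilon> where "\<epsilon> = (\<lambda>k. (1/2)^k / real (Suc k) :: real)"
  have f_bdd: "\<exists>B. \<forall>k. \<bar>f k i\<bar> \<le> B" if iQ: "i \<in> insert None (Some ` (Q \<times> Q))" for i
  proof (cases i)
    case None
    then show ?thesis using E by (intro exI[of _ B]) (simp add: f_def)
  next
    case (Some jj)
    then obtain m c m' c' where i: "i = Some ((m, c), (m', c'))" "c \<in> X m" "c' \<in> X m'" using iQ by (auto simp: Q_def)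
    have "\<bar>f k i\<bar> \<le> R m c + R m' c'" for k
      using y_R[OF i(2), of k] y_R[OF i(3), of k] dist_triangle2[of "y m c k" "y m' c' k" y0] by (simp add: f_def i(1))
    then show ?thesis by blast
  qed
  obtain \<sigma> L where \<sigma>: "strict_mono \<sigma>" and
    \<sigma>_lim: "\<And>i. i \<in> insert None (Some ` (Q \<times> Q)) \<Longrightarrow> (\<lambda>k. f (\<sigma> k) i) \<longlonglongrightarrow> L i" and
    \<sigma>_rate: "\<And>k i. i \<in> A k \<Longrightarrow> \<bar>f (\<sigma> k) i - L i\<bar> \<le> \<epsilon> k"
  proof (rule diagonal_subsequence_with_rate[of "insert None (Some ` (Q \<times> Q))" f A \<epsilon>])
    show "countable (insert None (Some ` (Q \<times> Q)))" using Q_count by auto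
    show "finite (A k)" for k using X_finite by (auto simp: A_def)
    show "A k \<subseteq> insert None (Some ` (Q \<times> Q))" for k by (auto simp: A_def Q_def)
    show "0 < \<epsilon> k" for k by (simp add: \<epsilon>_def)
  qed (use f_bdd in blast)+
  have E_lim: "(\<lambda>k. E (\<sigma> k)) \<longlonglongrightarrow> L None" using \<sigma>_lim[of None] by (simp add: f_def)
  define q where "q = (\<lambda>(m, c) k. y m c (\<sigma> k))"
  have q_lim: "(\<lambda>k. dist (q i k) (q j k)) \<longlonglongrightarrow> L (Some (i, j))" if "i \<in> Q" "j \<in> Q" for i j
    using \<sigma>_lim[of "Some (i, j)"] that by (simp add: f_def q_def split_beta)
  have rate: "\<bar>dist (y m c (\<sigma> k)) (y m' c' (\<sigma> k)) - L (Some ((m, c), (m', c')))\<bar> \<le> (1/2)^k / real (Suc k)"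
    if "m \<le> k" "m' \<le> k" "c \<in> X m" "c' \<in> X m'" for k m m' c c'
    using \<sigma>_rate[of "Some ((m, c), (m', c'))" k] that by (simp add: f_def A_def \<epsilon>_def)
  have q_car: "q i \<in> ultra_carrier" if i: "i \<in> Q" for i
  proof -
    obtain m c where "i = (m, c)" "c \<in> X m" using i by (auto simp: Q_def)
    then have "dist y0 (q i k) \<le> R m c" for k using y_R[of c m "\<sigma> k"] by (simp add: q_def dist_commute)
    then show ?thesis by (auto simp: ultra_carrier_def bounded_def)
  qed

  \<comment> \<open>The limit map\<close>
  interpret V: level_values \<nu> Omega "max 0 Cd" X \<kappa> "\<lambda>k. u (\<sigma> k)" "\<lambda>k. h (\<sigma> k)" K \<Lambda> "B + 1" \<alpha> \<theta> "\<lambda>m c k. y m c (\<sigma> k)"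
    by (rule lv)
  have approx: "AE x in \<nu>. \<forall>e>0. \<exists>l0. \<forall>l\<ge>l0. \<forall>\<^sub>F k in sequentially. dist (u (\<sigma> k) x) (y l (\<kappa> l x) (\<sigma> k)) < e"
  proof (rule approximation_by_level_values[OF \<nu>_space _ V.\<beta> V.consecutive_values_integral[OF V.interior_growth] V.interior_lim rate])
    show "0 \<le> 2 * dbl 4 * V.C0 \<nu> 1" using V.C0_nonneg[OF V.interior_growth] dbl_ge_1[of 4] by simp
  qed
  have approximable: "AE x in mu. x \<in> Omega \<longrightarrow> (\<forall>e>0. \<exists>j\<in>Q. \<forall>\<^sub>F k in sequentially. dist (u (\<sigma> k) x) (q j k) < e)"
    using approx unfolding AE_domain
  proof eventually_elim
    case (elim x)
    show ?case
    proof (intro impI allI)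
      fix e :: real assume "x \<in> Omega" "0 < e"
      with elim obtain l where l: "\<forall>\<^sub>F k in sequentially. dist (u (\<sigma> k) x) (y l (\<kappa> l x) (\<sigma> k)) < e" by blast
      have "(l, \<kappa> l x) \<in> Q" using \<kappa>(1)[OF \<Omega>_closure[OF \<open>x \<in> Omega\<close>]] by (simp add: Q_def)
      then show "\<exists>j\<in>Q. \<forall>\<^sub>F k in sequentially. dist (u (\<sigma> k) x) (q j k) < e"
        using l by (intro bexI[of _ "(l, \<kappa> l x)"]) (simp_all add: q_def)
    qed
  qed
  have half_lim: "(\<lambda>k. (1/2::real)^\<sigma> k) \<longlonglongrightarrow> 0"
    using LIMSEQ_subseq_LIMSEQ[OF LIMSEQ_power_zero[of "1/2::real"] \<sigma>] by (simp add: o_def)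
  interpret U: ultralimit F mu Omega p "L None" "\<lambda>k. u (\<sigma> k)" "\<lambda>k. g (\<sigma> k)" "\<lambda>k. E (\<sigma> k) + (1/2)^\<sigma> k" Q q
  proof
    show "(\<lambda>k. E (\<sigma> k) + (1/2)^\<sigma> k) \<longlonglongrightarrow> L None" using tendsto_add[OF E_lim half_lim] by simp
    show "convergent (\<lambda>k. dist (q i k) (q j k))" if "i \<in> Q" "j \<in> Q" for i j
      using q_lim[OF that] by (auto simp: convergent_def)
  qed (use assms(8) sets_mu Om_borel p g E(2) dist_meas Q_count Q_ne q_car approximable in auto)
  obtain \<phi> where \<phi>_car: "\<And>x. \<phi> x \<in> ultra_carrier"
    and \<phi>_eq: "AE x in mu. x \<in> Omega \<longrightarrow> bounded (range (\<lambda>k. u (\<sigma> k) x)) \<and> ultra_dist F (\<phi> x) (\<lambda>k. u (\<sigma> k) x) = 0"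
    and \<phi>_lim: "AE x in mu. x \<in> Omega \<longrightarrow> (\<forall>i\<in>Q. (\<lambda>k. dist (u (\<sigma> k) x) (q i k)) \<longlonglongrightarrow> ultra_dist F (\<phi> x) (q i)) \<and>
         (\<forall>\<epsilon>>0. \<exists>j\<in>Q. ultra_dist F (\<phi> x) (q j) < \<epsilon>)"
    and \<phi>_meas: "\<And>z. z \<in> ultra_carrier \<Longrightarrow> (\<lambda>x. ultra_dist F (\<phi> x) z) \<in> borel_measurable \<nu>"
    and \<phi>_ug: "\<exists>h. p_weak_upper_gradient mu Omega p (ultra_dist F) \<phi> h \<and> p_mass mu Omega p h \<le> ennreal (L None)"
    using U.ultralimit_in_newtonian by blast
  obtain h\<phi> where h\<phi>: "p_weak_upper_gradient mu Omega p (ultra_dist F) \<phi> h\<phi>" "p_mass mu Omega p h\<phi> \<le> ennreal (L None)"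
    using \<phi>_ug by blast
  have h\<phi>_fin: "p_mass mu Omega p h\<phi> < top" using h\<phi>(2) by (rule le_less_trans) simp
  have minimal: "\<exists>g. minimal_p_weak_upper_gradient mu Omega p (ultra_dist F) \<phi> g"
    by (rule minimal_p_weak_upper_gradient_exists[OF sets_mu Om_borel p_pos _ _ h\<phi>(1) h\<phi>_fin])
       (auto intro!: U.ultra_dist_triangle U.ultra_dist_nonneg \<phi>_car)

  \<comment> \<open>Integrability of the limit map\<close>
  have "Lp_map mu Omega p ultra_carrier (ultra_dist F) \<phi>"
    unfolding Lp_map_def
  proof (intro conjI ballI)
    show "\<exists>D. countable D \<and> D \<subseteq> ultra_carrier \<and> (AE x in mu. x \<in> Omega \<longrightarrow> (\<forall>e>0. \<exists>z\<in>D. ultra_dist F (\<phi> x) z < e))"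
    proof (intro exI[of _ "q ` Q"] conjI)
      show "AE x in mu. x \<in> Omega \<longrightarrow> (\<forall>e>0. \<exists>z\<in>q ` Q. ultra_dist F (\<phi> x) z < e)"
        using \<phi>_lim by eventually_elim auto
    qed (use Q_count q_car in auto)
    \<comment> \<open>A level value serves as base point, because the distances of the limit map to
      it are ordinary limits almost everywhere and Fatou's lemma applies to them.\<close>
    let ?i = "(0, \<kappa> 0 x0)"
    have i: "?i \<in> Q" by (rule Q_ne)
    show "\<exists>z\<in>ultra_carrier. (\<integral>\<^sup>+ x \<in> Omega. ennreal (ultra_dist F (\<phi> x) z powr p) \<partial>mu) < top"
    proof (intro bexI[of _ "q ?i"] q_car i)
      note [measurable] = dist_meas
      define r where "r = R 0 (\<kappa> 0 x0)"
      have qr: "dist (q ?i k) y0 \<le> r" for k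
        using y_R[of "\<kappa> 0 x0" 0 "\<sigma> k"] i by (simp add: q_def r_def Q_def)
      then have r: "0 \<le> r" by (meson order_trans zero_le_dist)
      have "(\<integral>\<^sup>+ x \<in> Omega. ennreal (ultra_dist F (\<phi> x) (q ?i) powr p) \<partial>mu) = (\<integral>\<^sup>+x. ennreal (ultra_dist F (\<phi> x) (q ?i) powr p) \<partial>\<nu>)"
        by (rule nn_integral_domain)
      also have "\<dots> = (\<integral>\<^sup>+x. liminf (\<lambda>k. ennreal (dist (u (\<sigma> k) x) (q ?i k) powr p)) \<partial>\<nu>)"
      proof (rule nn_integral_cong_AE)
        show "AE x in \<nu>. ennreal (ultra_dist F (\<phi> x) (q ?i) powr p) = liminf (\<lambda>k. ennreal (dist (u (\<sigma> k) x) (q ?i k) powr p))"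
          unfolding AE_domain using \<phi>_lim
        proof eventually_elim
          case (elim x)
          show ?case
          proof
            assume "x \<in> Omega"
            then have "(\<lambda>k. dist (u (\<sigma> k) x) (q ?i k)) \<longlonglongrightarrow> ultra_dist F (\<phi> x) (q ?i)" using elim i by blast
            then have "(\<lambda>k. dist (u (\<sigma> k) x) (q ?i k) powr p) \<longlonglongrightarrow> ultra_dist F (\<phi> x) (q ?i) powr p"
              by (rule tendsto_powr'[OF _ tendsto_const]) (use p_pos in auto)
            then show "ennreal (ultra_dist F (\<phi> x) (q ?i) powr p) = liminf (\<lambda>k. ennreal (dist (u (\<sigma> k) x) (q ?i k) powr p))"
              by (intro lim_imp_Liminf[symmetric] tendsto_ennrealI) auto
          qed
        qed
      qed
      also have "\<dots> \<le> liminf (\<lambda>k. \<integral>\<^sup>+x. ennreal (dist (u (\<sigma> k) x) (q ?i k) powr p) \<partial>\<nu>)"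
        by (rule nn_integral_liminf) measurable
      also have "\<dots> \<le> liminf (\<lambda>k::nat. ennreal (2 powr p) * (ennreal B + ennreal (r powr p) * emeasure \<nu> (space \<nu>)))"
      proof (intro Liminf_mono always_eventually allI)
        fix k
        have "(\<integral>\<^sup>+x. ennreal (dist (u (\<sigma> k) x) (q ?i k) powr p) \<partial>\<nu>) 
          \<le> (\<integral>\<^sup>+x. ennreal (2 powr p) * (ennreal (dist (u (\<sigma> k) x) y0 powr p) + ennreal (r powr p)) \<partial>\<nu>)"
        proof (rule nn_integral_mono)
          fix x
          have "dist (u (\<sigma> k) x) (q ?i k) \<le> dist (u (\<sigma> k) x) y0 + r"
            using dist_triangle[of "u (\<sigma> k) x" "q ?i k" y0] qr[of k] by (simp add: dist_commute)
          then have "dist (u (\<sigma> k) x) (q ?i k) powr p \<le> (dist (u (\<sigma> k) x) y0 + r) powr p"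
            using p_pos by (intro powr_mono2) auto
          also have "\<dots> \<le> 2 powr p * (dist (u (\<sigma> k) x) y0 powr p + r powr p)"
            using r p_pos by (intro powr_add_le) auto
          finally have "ennreal (dist (u (\<sigma> k) x) (q ?i k) powr p) \<le> ennreal (2 powr p * (dist (u (\<sigma> k) x) y0 powr p + r powr p))"
            by (rule ennreal_leI)
          then show "ennreal (dist (u (\<sigma> k) x) (q ?i k) powr p) \<le> ennreal (2 powr p) * (ennreal (dist (u (\<sigma> k) x) y0 powr p) + ennreal (r powr p))"
            by (simp add: ennreal_mult)
        qed
        also have "\<dots> = ennreal (2 powr p) * ((\<integral>\<^sup>+x. ennreal (dist (u (\<sigma> k) x) y0 powr p) \<partial>\<nu>) + ennreal (r powr p) * emeasure \<nu> (space \<nu>))"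
          by (subst nn_integral_cmult, measurable, subst nn_integral_add) auto
        also have "\<dots> \<le> ennreal (2 powr p) * (ennreal B + ennreal (r powr p) * emeasure \<nu> (space \<nu>))"
          using int_B[of "\<sigma> k"] by (intro mult_left_mono add_right_mono) (simp_all add: nn_integral_domain)
        finally show "(\<integral>\<^sup>+x. ennreal (dist (u (\<sigma> k) x) (q ?i k) powr p) \<partial>\<nu>) \<le> ennreal (2 powr p) * (ennreal B + ennreal (r powr p) * emeasure \<nu> (space \<nu>))" .
      qed
      also have "\<dots> < top" by (simp add: Liminf_const emeasure_eq_measure ennreal_mult_less_top)
      finally show "(\<integral>\<^sup>+ x \<in> Omega. ennreal (ultra_dist F (\<phi> x) (q ?i) powr p) \<partial>mu) < top" .
    qed
  qed (use \<phi>_car \<phi>_meas in auto)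
  then have newt_\<phi>: "newtonian mu Omega p ultra_carrier (ultra_dist F) \<phi>" using minimal by (simp add: newtonian_def)

  \<comment> \<open>Lower semicontinuity of the energy\<close>
  have "(\<lambda>k. p_energy mu Omega p dist (u (\<sigma> k))) \<longlonglongrightarrow> ennreal (L None)"
    unfolding E(1) by (rule tendsto_ennrealI[OF E_lim])
  then have "liminf (\<lambda>k. p_energy mu Omega p dist (u (\<sigma> k))) = ennreal (L None)" by (intro lim_imp_Liminf) auto
  then have energy: "p_energy mu Omega p (ultra_dist F) \<phi> \<le> liminf (\<lambda>k. p_energy mu Omega p dist (u (\<sigma> k)))"
    using p_energy_le[OF minimal p_pos h\<phi>(1) h\<phi>_fin] h\<phi>(2) by simp

  \<comment> \<open>Growth of the boundary measure\<close>
  have space_H: "space H = frontier Omega"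
    using sets_eq_imp_space_eq[OF assms(6)] by (simp add: space_restrict_space)
  have frontier_closure: "frontier Omega \<subseteq> closure Omega" by (auto simp: frontier_def)
  have ball_H: "emeasure H (ball x r \<inter> frontier Omega) \<le> ennreal (max 0 CH * r powr (-\<theta>) * vol x r)"
    if "x \<in> frontier Omega" "0 < r" for x r
  proof -
    have "ennreal (CH * r powr (-\<theta>)) \<le> ennreal (max 0 CH * r powr (-\<theta>))" by (intro ennreal_leI mult_right_mono) auto
    then have "emeasure H (ball x r \<inter> frontier Omega) \<le> ennreal (max 0 CH * r powr (-\<theta>)) * ennreal (vol x r)"
      using CH[OF that] unfolding emeasure_ball by (meson mult_right_mono order_trans zero_le)
    then show ?thesis by (simp add: ennreal_mult)
  qed
  have growth_H: "V.growth H (max 0 CH)"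
    unfolding V.growth_def
  proof (intro conjI allI ballI)
    show "space H \<subseteq> closure Omega" using frontier_closure by (simp add: space_H)
    show "sets H = sets (restrict_space borel (space H))" using assms(6) by (simp add: space_H)
    \<comment> \<open>The frontier lies in one ball around any of its points, and the codimension
      bound makes the measure of that ball finite.\<close>
    show "finite_measure H"
    proof
      show "emeasure H (space H) \<noteq> \<infinity>"
      proof (cases "frontier Omega = {}")
        case False
        then obtain x where x: "x \<in> frontier Omega" by blast
        have "bounded (frontier Omega)" by (rule bounded_subset[OF bounded_closure[OF assms(5)] frontier_closure])
        then obtain r where r: "0 < r" "frontier Omega \<subseteq> ball x r" using bounded_subset_ballD by blast
        then have "emeasure H (space H) \<le> ennreal (max 0 CH * r powr (-\<theta>) * vol x r)"
          using ball_H[OF x r(1)] by (simp add: space_H Int_absorb1)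
        then show ?thesis by (auto simp: top_unique)
      qed (simp add: space_H)
    qed
    fix m c assume c: "c \<in> X m"
    show "emeasure H (cball c (rad m) \<inter> space H) \<le> ennreal (max 0 CH * rad m powr (-\<theta>) * vol c (4 * rad m))"
    proof (cases "cball c (rad m) \<inter> frontier Omega = {}")
      case False
      then obtain x where x: "x \<in> frontier Omega" "dist c x \<le> rad m" by auto
      \<comment> \<open>The codimension bound concerns balls centred on the frontier. Radius 3 * rad
        m around x is large enough to cover the closed ball around c, and small enough to stay in
        the ball of radius 4 * rad m around c.\<close>
      have "cball c (rad m) \<inter> frontier Omega \<subseteq> ball x (3 * rad m) \<inter> frontier Omega"
      proof
        fix w assume w: "w \<in> cball c (rad m) \<inter> frontier Omega"
        then have "dist x w \<le> 2 * rad m" using x(2) dist_triangle[of x w c] by (simp add: dist_commute)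
        then have "dist x w < 3 * rad m" using rad_pos[of m] by linarith
        then show "w \<in> ball x (3 * rad m) \<inter> frontier Omega" using w by simp
      qed
      then have "emeasure H (cball c (rad m) \<inter> space H) \<le> emeasure H (ball x (3 * rad m) \<inter> frontier Omega)"
        unfolding space_H by (intro emeasure_mono) (auto simp: assms(6) sets_restrict_space)
      also have "\<dots> \<le> ennreal (max 0 CH * (3 * rad m) powr (-\<theta>) * vol x (3 * rad m))"
        using x by (intro ball_H) auto
      also have "\<dots> \<le> ennreal (max 0 CH * rad m powr (-\<theta>) * vol c (4 * rad m))"
      proof (intro ennreal_leI mult_mono mult_left_mono)
        show "(3 * rad m) powr (-\<theta>) \<le> rad m powr (-\<theta>)" using p by (intro powr_mono2') auto
        show "vol x (3 * rad m) \<le> vol c (4 * rad m)"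
        proof (intro finite_measure_mono Int_mono subsetI)
          fix w assume "w \<in> ball x (3 * rad m)"
          then show "w \<in> ball c (4 * rad m)" using x(2) dist_triangle[of c w x] by simp
        qed auto
      qed auto
      finally show ?thesis .
    qed (simp add: space_H)
  qed simp

  \<comment> \<open>The trace of the limit map\<close>
  have trace: "is_trace mu H Omega ultra_carrier (ultra_dist F) \<phi> (\<lambda>x. ultra_embed (\<rho> x))"
    if T: "\<forall>k. is_trace mu H Omega UNIV dist (u (\<sigma> k)) (T k)" "AE x in H. (\<lambda>k. T k x) \<longlonglongrightarrow> \<rho> x" for \<rho> :: "'x \<Rightarrow> 'y" and T
    unfolding is_trace_def
  proof (intro conjI ballI)
    have "AE x in H. ((\<lambda>r. (\<integral>\<^sup>+z\<in>ball x r. ennreal (ultra_dist F (\<phi> z) (ultra_embed (\<rho> x))) \<partial>\<nu>) / ennreal (vol x r)) \<longlongrightarrow> 0) (at_right 0)"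
    proof (rule V.ultralimit_trace[OF assms(8) growth_H \<phi>_car \<phi>_meas _ _ rate _ T(2)])
      show "(\<lambda>k. y m c (\<sigma> k)) \<in> ultra_carrier" if "c \<in> X m" for m c
        using q_car[of "(m, c)"] that by (simp add: q_def Q_def)
      show "AE z in \<nu>. \<forall>m. \<forall>c\<in>X m. (\<lambda>k. dist (u (\<sigma> k) z) (y m c (\<sigma> k))) \<longlonglongrightarrow> ultra_dist F (\<phi> z) (\<lambda>k. y m c (\<sigma> k))"
        unfolding AE_domain using \<phi>_lim by eventually_elim (auto simp: Q_def q_def)
      show "AE x in H. ((\<lambda>r. (\<integral>\<^sup>+z\<in>ball x r. ennreal (dist (u (\<sigma> k) z) (T k x)) \<partial>\<nu>) / ennreal (vol x r)) \<longlongrightarrow> 0) (at_right 0)" for k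
        using T(1) by (simp add: is_trace_def nn_integral_ball emeasure_ball)
    qed
    then show "AE x in H. ((\<lambda>r. (\<integral>\<^sup>+ y \<in> ball x r \<inter> Omega. ennreal (ultra_dist F (\<phi> y) (ultra_embed (\<rho> x))) \<partial>mu)
                        / emeasure mu (ball x r \<inter> Omega)) \<longlongrightarrow> 0) (at_right 0)"
      by (simp add: nn_integral_ball emeasure_ball)
  qed simp
  show ?thesis
    using \<sigma> \<phi>_eq newt_\<phi> energy trace by (intro exI[of _ \<sigma>] exI[of _ \<phi>] conjI) blast+
qed

end
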